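(* Let $\Omega\subset\mathbb{R}^2$ be a Jordan domain with analytic boundary and let $f^{(0)}(x,y)$ be a harmonic function in $\Omega$ that extends to a real analytic function in the closed domain $\overline\Omega$ whose Hessian is nonvanishing on $\overline\Omega$ (including on $\partial\Omega$). Then there exists a unique (up to restriction) real analytic family of functions $f(x,y,t)$ on $\overline\Omega$, where $t$ ranges over a neighborhood of $0$, such that $f(x,y,t)=f^{(0)}(x,y)$ for $(x,y)\in\partial\Omega$, $f(x,y,0)=f^{(0)}(x,y)$, and $$f_{xx}+f_{yy}=t\sqrt{(f_{xy})^2-f_{xx}f_{yy}}.$$
   Context: An analytic Jordan curve is the image of a periodic injective real analytic map $\mathbb{R}\to\mathbb{R}^2$ with nowhere vanishing derivative; a Jordan domain with analytic boundary is a domain bounded by such a curve. A function on $\overline\Omega$ is real analytic in the closed domain if it extends to a real analytic function on a neighborhood of $\overline\Omega$. A real analytic family of functions is a map $\overline\Omega\times[a;b]\to\mathbb{R}$ that extends to a real analytic function on a neighborhood of $\overline\Omega\times[a;b]$; a restriction of the family is its restriction to $\overline\Omega\times[c;d]$ with $[c;d]\subset[a;b]$. *)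

theory Defs
  imports "HOL-Analysis.Analysis"
begin

text \<open>Real analyticity at a point of a function on a Euclidean space: locally the sum of an
  (unconditionally, hence absolutely, convergent) multivariate power series, with multi-indices
  indexed by the basis vectors.\<close>
definition real_analytic_at :: "('a::euclidean_space \<Rightarrow> real) \<Rightarrow> 'a \<Rightarrow> bool" where
  "real_analytic_at f x \<longleftrightarrow>
     (\<exists>c r. r > 0 \<and>
        (\<forall>y\<in>ball x r.
           ((\<lambda>\<alpha>. c \<alpha> * (\<Prod>i\<in>Basis. ((y - x) \<bullet> i) ^ \<alpha> i)) has_sum f y)
             {\<alpha>::'a \<Rightarrow> nat. \<forall>i. i \<notin> Basis \<longrightarrow> \<alpha> i = 0}))"

definition real_analytic_on :: "('a::euclidean_space \<Rightarrow> real) \<Rightarrow> 'a set \<Rightarrow> bool" where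
  "real_analytic_on f S \<longleftrightarrow> (\<exists>U. open U \<and> S \<subseteq> U \<and> (\<forall>x\<in>U. real_analytic_at f x))"

definition analytic_jordan_curve :: "(real \<Rightarrow> real \<times> real) \<Rightarrow> real \<Rightarrow> bool" where
  "analytic_jordan_curve \<gamma> T \<longleftrightarrow>
     T > 0 \<and> (\<forall>s. \<gamma> (s + T) = \<gamma> s) \<and>
     (\<forall>s t. \<gamma> s = \<gamma> t \<longrightarrow> (\<exists>k::int. s - t = of_int k * T)) \<and>
     real_analytic_on (\<lambda>s. fst (\<gamma> s)) UNIV \<and> real_analytic_on (\<lambda>s. snd (\<gamma> s)) UNIV \<and>
     (\<forall>s. \<exists>v. v \<noteq> 0 \<and> (\<gamma> has_vector_derivative v) (at s))"

definition analytic_jordan_domain :: "(real \<times> real) set \<Rightarrow> bool" where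
  "analytic_jordan_domain \<Omega> \<longleftrightarrow> (\<exists>\<gamma> T. analytic_jordan_curve \<gamma> T \<and> \<Omega> = inside (range \<gamma>))"

definition pdx :: "(real \<times> real \<Rightarrow> real) \<Rightarrow> real \<times> real \<Rightarrow> real" where
  "pdx g p = deriv (\<lambda>s. g (s, snd p)) (fst p)"

definition pdy :: "(real \<times> real \<Rightarrow> real) \<Rightarrow> real \<times> real \<Rightarrow> real" where
  "pdy g p = deriv (\<lambda>s. g (fst p, s)) (snd p)"

definition solution_family ::
  "(real \<times> real) set \<Rightarrow> (real \<times> real \<Rightarrow> real) \<Rightarrow> (real \<times> real \<Rightarrow> real \<Rightarrow> real) \<Rightarrow> real \<Rightarrow> real \<Rightarrow> bool" where
  "solution_family \<Omega> f0 F a b \<longleftrightarrow>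
     real_analytic_on (\<lambda>(p, t). F p t) (closure \<Omega> \<times> {a..b}) \<and>
     (\<forall>p\<in>frontier \<Omega>. \<forall>t\<in>{a..b}. F p t = f0 p) \<and>
     (\<forall>p\<in>closure \<Omega>. F p 0 = f0 p) \<and>
     (\<forall>p\<in>\<Omega>. \<forall>t\<in>{a..b}.
        pdx (pdx (\<lambda>q. F q t)) p + pdy (pdy (\<lambda>q. F q t)) p =
        t * sqrt ((pdx (pdy (\<lambda>q. F q t)) p)\<^sup>2 - pdx (pdx (\<lambda>q. F q t)) p * pdy (pdy (\<lambda>q. F q t)) p))"

end

theory Submission
  imports Defs "HOL-Complex_Analysis.Complex_Analysis"
begin

text \<open>Write \<open>z = x + i y\<close>. Where the discriminant is nonnegative the equation reads \<open>f\<^sub>z\<^sub>w = \<tau> |f\<^sub>z\<^sub>z|\<close>, where \<open>w\<close> is the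
  conjugate variable and \<open>\<tau> = t / sqrt (4 + t\<^sup>2)\<close>. Because \<open>|\<tau>| < 1\<close>, the difference of two solutions
  satisfies a differential inequality to which the maximum principle applies; this gives uniqueness.

  For existence, the Riemann map of \<open>\<Omega>\<close> extends conformally past the unit circle by Schwarz reflection in the
  analytic boundary. Treating \<open>z\<close> and its conjugate as independent variables \<open>\<zeta>\<close>, \<open>\<eta>\<close> turns the problem on the
  disc into a holomorphic one: find \<open>U(\<zeta>, \<eta>, \<tau>)\<close> vanishing on \<open>\<zeta> \<eta> = 1\<close> with
  \<open>U\<^sub>\<zeta>\<^sub>\<eta> = \<tau> sqrt(F F')\<close>, where \<open>F = H + U\<^sub>\<zeta>\<^sub>\<zeta> - \<alpha> U\<^sub>\<zeta>\<close>, \<open>F'\<close> is its reflection and \<open>H\<close> is the nonvanishing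
  holomorphic second derivative of \<open>f0\<close>. Expanding in powers of \<open>\<tau>\<close> gives linear Dirichlet problems for the
  coefficients. A weighted norm in which the operators from \<open>U\<^sub>\<zeta>\<^sub>\<eta>\<close> to \<open>U\<^sub>\<zeta>\<close> and \<open>U\<^sub>\<zeta>\<^sub>\<zeta>\<close> are bounded
  yields a majorant series, so the expansion converges for small \<open>\<tau>\<close>.\<close>

section \<open>Schwarz reflection\<close>

text \<open>The nonlinearity has the order of the linear part:
  \<open>U\<^sub>\<zeta>\<^sub>\<eta>\<close> is prescribed through
  \<open>U\<^sub>\<zeta>\<^sub>\<zeta>\<close>, so the passage from the first to the second must
  lose no derivative. Cauchy estimates on shrinking bidiscs would lose one at each order. The remedy
  is a decomposition into angular modes \<open>\<zeta> ^ m * a (\<zeta> * \<eta>)\<close> and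
  \<open>\<eta> ^ m * a (\<zeta> * \<eta>)\<close>. In one mode the boundary is the single point s =
  1 of the variable s = \<zeta> \<eta>, and the Dirichlet problem is an ordinary differential
  equation in s. Each of its two integrations gains a factor of order m, which pays for the factor m
  (m - 1) of two derivatives in \<zeta>. The weight \<open>v s ^ m\<close> is shaped to support both
  gains. The square root is removed by writing F = H y^2: then sqrt(F F') is a fixed function times
  y and its reflection, and only quadratic recursions remain. This is where H must not vanish. The
  coefficient \<alpha> comes from the second derivative of the conformal map.\<close>

lemma upper_half_ball: "convex (ball 0 e \<inter> {w. 0 < Im w})" "open (ball 0 e \<inter> {w. 0 < Im w})"
  by (auto intro!: convex_Int open_Int convex_halfspace_Im_gt open_halfspace_Im_gt)

text \<open>A holomorphic function on the upper half of a disc whose modulus tends to \<open>1\<close> on the real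
  diameter extends by reflection, even though it is not known to be continuous up to the diameter:
  the primitives of both halves are Lipschitz, so they do extend continuously, and they agree there
  up to a constant because \<open>f - 1 / cnj f\<close> tends to \<open>0\<close>.\<close>
lemma reflection_principle_modulus:
  assumes "e > 0" and f: "f holomorphic_on (ball 0 e \<inter> {w. 0 < Im w})"
    and f1: "\<And>w. w \<in> ball 0 e \<Longrightarrow> 0 < Im w \<Longrightarrow> norm (f w) < 1"
    and f2: "\<And>w. w \<in> ball 0 e \<Longrightarrow> 0 < Im w \<Longrightarrow> 1/2 < norm (f w)"
    and lim: "\<And>x. \<bar>x\<bar> < e \<Longrightarrow> ((\<lambda>w. norm (f w)) \<longlongrightarrow> 1) (at (of_real x) within (ball 0 e \<inter> {w. 0 < Im w}))"
  obtains F where "F holomorphic_on ball 0 e" "\<And>w. w \<in> ball 0 e \<Longrightarrow> 0 < Im w \<Longrightarrow> F w = f w"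
    "\<And>w. w \<in> ball 0 e \<Longrightarrow> Im w < 0 \<Longrightarrow> F w = 1 / cnj (f (cnj w))"
    "\<And>w. w \<in> ball 0 e \<Longrightarrow> Im w = 0 \<Longrightarrow> norm (F w) = 1"
proof -
  let ?B = "ball (0::complex) e"
  let ?Bp = "?B \<inter> {w. 0 < Im w}"
  have fnz: "f w \<noteq> 0" if "w \<in> ?Bp" for w using f2[of w] that by auto
  obtain P where P: "\<And>w. w \<in> ?Bp \<Longrightarrow> (P has_field_derivative f w) (at w within ?Bp)"
    using holomorphic_convex_primitive'[OF upper_half_ball f] by blast
  have "(\<lambda>w. 1 / f w) holomorphic_on ?Bp" using f fnz by (intro holomorphic_intros) auto
  then obtain P2 where P2: "\<And>w. w \<in> ?Bp \<Longrightarrow> (P2 has_field_derivative 1 / f w) (at w within ?Bp)"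
    using holomorphic_convex_primitive'[OF upper_half_ball] by blast
  \<comment> \<open>The constant 2 serves both primitives: |f| < 1, and |f| > 1/2 gives |1/f| <
    2.\<close>
  have uc: "uniformly_continuous_on ?Bp Z" if "\<And>w. w \<in> ?Bp \<Longrightarrow> (Z has_field_derivative z w) (at w within ?Bp)"
    "\<And>w. w \<in> ?Bp \<Longrightarrow> norm (z w) \<le> 2" for Z z
  proof (rule lipschitz_on_uniformly_continuous)
    show "2-lipschitz_on ?Bp Z"
    proof (rule lipschitz_onI)
      fix x y assume "x \<in> ?Bp" "y \<in> ?Bp"
      then show "dist (Z x) (Z y) \<le> 2 * dist x y"
        unfolding dist_norm by (intro field_differentiable_bound[OF upper_half_ball(1) that]) auto
    qed simp
  qed
  have ucP: "uniformly_continuous_on ?Bp P" 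
  proof (rule uc[OF P])
    show "norm (f w) \<le> 2" if "w \<in> ?Bp" for w using f1[of w] that by simp
  qed
  have ucP2: "uniformly_continuous_on ?Bp P2"
  proof (rule uc[OF P2])
    fix w assume w: "w \<in> ?Bp"
    then have "1/2 < norm (f w)" using f2 by auto
    then have "inverse (norm (f w)) \<le> inverse (1/2)" by (intro le_imp_inverse_le) auto
    then show "norm (1 / f w) \<le> 2" by (simp add: norm_divide inverse_eq_divide)
  qed
  obtain P' where P': "uniformly_continuous_on (closure ?Bp) P'" "\<And>x. x \<in> ?Bp \<Longrightarrow> P x = P' x"
    using uniformly_continuous_on_extension_on_closure[OF ucP] by metis
  obtain P2' where P2': "uniformly_continuous_on (closure ?Bp) P2'" "\<And>x. x \<in> ?Bp \<Longrightarrow> P2 x = P2' x"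
    using uniformly_continuous_on_extension_on_closure[OF ucP2] by metis
  have up: "w + \<i> * of_real d \<in> ?Bp" if "norm w + d < e" "0 \<le> Im w" "0 < d" for w d
    using that norm_triangle_ineq[of w "\<i> * of_real d"] by (auto simp: norm_mult)
  have clos: "w \<in> closure ?Bp" if w: "w \<in> ?B" "0 \<le> Im w" for w
  proof -
    have "(\<lambda>n. w + \<i> * of_real ((e - norm w) / 2 / real (Suc n))) \<longlonglongrightarrow> w + \<i> * of_real 0"
      by (intro tendsto_intros LIMSEQ_Suc[OF lim_const_over_n])
    moreover have "w + \<i> * of_real ((e - norm w) / 2 / real (Suc n)) \<in> ?Bp" for n
    proof (rule up)
      have "(e - norm w) / 2 / real (Suc n) \<le> (e - norm w) / 2 / 1" using w by (intro divide_left_mono) auto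
      also have "\<dots> < e - norm w" using w by simp
      finally show "norm w + (e - norm w) / 2 / real (Suc n) < e" by (simp only: less_diff_eq add.commute)
    qed (use w in auto)
    ultimately show ?thesis unfolding closure_sequential by (intro exI conjI allI) (auto simp: )
  qed
  \<comment> \<open>Along a horizontal line both terms are differentiated in the same real
    parameter, so \<open>D\<close> has derivative \<open>f - 1 / cnj f\<close> there, which is small
    near the diameter. \<open>D\<close> is not holomorphic; only its constancy on the diameter is
    wanted.\<close>
  define D where "D w = P' w - cnj (P2' w)" for w
  have cD: "continuous_on (closure ?Bp) D"
    unfolding D_def using P'(1) P2'(1) by (intro continuous_intros uniformly_continuous_imp_continuous)
  \<comment> \<open>Pointwise limits of the modulus give no uniformity along a horizontal segment.
    With the value 1 on the diameter the modulus is continuous on the closed half disc, hence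
    uniformly continuous on compact rectangles.\<close>
  define m where "m w = (if 0 < Im w then norm (f w) else 1)" for w
  have cm: "continuous_on (?B \<inter> {w. 0 \<le> Im w}) m"
  proof (rule continuous_on_eq_continuous_within[THEN iffD2], rule ballI)
    fix w assume w: "w \<in> ?B \<inter> {w. 0 \<le> Im w}"
    show "continuous (at w within ?B \<inter> {w. 0 \<le> Im w}) m"
    proof (cases "0 < Im w")
      case True
      then have wB: "w \<in> ?Bp" using w by auto
      have "continuous_on ?Bp (\<lambda>w. norm (f w))" using f by (intro continuous_intros holomorphic_on_imp_continuous_on)
      then have "isCont (\<lambda>w. norm (f w)) w" using wB upper_half_ball(2) continuous_on_eq_continuous_at by blast
      then have "isCont m w"
      proof (rule isCont_cong[THEN iffD1, rotated])
        have "\<forall>\<^sub>F x in nhds w. x \<in> ?Bp" using wB upper_half_ball(2) eventually_nhds by blast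
        then show "\<forall>\<^sub>F x in nhds w. norm (f x) = m x" by eventually_elim (auto simp: m_def)
      qed
      then show ?thesis by (rule continuous_at_imp_continuous_at_within)
    next
      case False
      then have w0: "w = of_real (Re w)" "m w = 1" using w by (auto simp: complex_eq_iff m_def)
      have wre: "\<bar>Re w\<bar> < e" using w w0(1) by (metis IntD1 mem_ball_0 norm_of_real)
      have "(m \<longlongrightarrow> 1) (at w within ?Bp)"
        using lim[OF wre] unfolding w0(1)[symmetric]
        by (rule Lim_transform_eventually) (auto simp: eventually_at_filter m_def)
      moreover have "(m \<longlongrightarrow> 1) (at w within {w. Im w = 0})"
        by (rule Lim_transform_eventually[OF tendsto_const]) (auto simp: eventually_at_filter m_def)
      ultimately have "(m \<longlongrightarrow> 1) (at w within (?Bp \<union> {w. Im w = 0}))"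
        by (simp add: Lim_within_Un)
      then have "(m \<longlongrightarrow> 1) (at w within (?B \<inter> {w. 0 \<le> Im w}))"
        by (rule tendsto_within_subset) auto
      then show ?thesis using w0 by (simp add: continuous_within)
    qed
  qed
  have Dconst: "D (of_real x) = D 0" if x: "\<bar>x\<bar> < e" for x
  proof -
    define d0 where "d0 = (e - \<bar>x\<bar>) / 2"
    have d0: "d0 > 0" using x by (simp add: d0_def)
    let ?R = "cbox (Complex (- \<bar>x\<bar>) 0) (Complex \<bar>x\<bar> d0)"
    have RB: "?R \<subseteq> ?B \<inter> {w. 0 \<le> Im w}"
    proof
      fix w assume "w \<in> ?R"
      then have "\<bar>Re w\<bar> \<le> \<bar>x\<bar>" "0 \<le> Im w" "Im w \<le> d0" by (auto simp: in_cbox_complex_iff)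
      moreover have "norm w \<le> \<bar>Re w\<bar> + \<bar>Im w\<bar>" by (rule cmod_le)
      ultimately show "w \<in> ?B \<inter> {w. 0 \<le> Im w}" using x d0 by (auto simp: d0_def)
    qed
    have "uniformly_continuous_on ?R m"
      by (rule compact_uniformly_continuous[OF continuous_on_subset[OF cm RB] compact_cbox])
    note um = this[unfolded uniformly_continuous_on_def, rule_format]
    have "dist (D (of_real x)) (D 0) \<le> 0"
    proof (rule field_le_epsilon)
      fix \<epsilon> :: real assume "\<epsilon> > 0"
      \<comment> \<open>At height d the derivative of \<open>D\<close> is at most 4 \<mu>, and the
        segment from 0 to x is shorter than e, so the increment stays below \<epsilon>.\<close>
      define \<mu> where "\<mu> = min 1 (\<epsilon> / (8 * (e + 1)))"
      have "\<mu> > 0" using \<open>\<epsilon> > 0\<close> \<open>e > 0\<close> by (simp add: \<mu>_def)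
      then obtain \<delta> where \<delta>: "\<delta> > 0" "\<And>a b. a \<in> ?R \<Longrightarrow> b \<in> ?R \<Longrightarrow> dist b a < \<delta> \<Longrightarrow> dist (m b) (m a) < \<mu>"
        using um by metis
      have "\<forall>\<^sub>F d in at_right 0. d < min \<delta> d0 \<and> 0 < d"
        using \<delta>(1) d0 by (auto simp: eventually_at_right_field intro!: exI[of _ "min \<delta> d0"])
      then have ev: "\<forall>\<^sub>F d in at_right 0. dist (D (of_real x + \<i> * of_real d)) (D (0 + \<i> * of_real d)) \<le> \<epsilon>"
      proof eventually_elim
        case (elim d)
        have der: "((\<lambda>s. D (of_real s + \<i> * of_real d)) has_vector_derivative f (of_real s + \<i> * of_real d) - cnj (1 / f (of_real s + \<i> * of_real d))) (at s)"
          and small: "norm (f (of_real s + \<i> * of_real d) - cnj (1 / f (of_real s + \<i> * of_real d))) \<le> 4 * \<mu>"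
          if s: "\<bar>s\<bar> \<le> \<bar>x\<bar>" for s
        proof -
          let ?w = "of_real s + \<i> * of_real d"
          have wR: "?w \<in> ?R" using s elim by (auto simp: in_cbox_complex_iff)
          have wB: "?w \<in> ?Bp" using RB wR elim by auto
          have at: "at ?w within ?Bp = at ?w" by (rule at_within_open[OF wB upper_half_ball(2)])
          have d1: "(P' has_field_derivative f ?w) (at ?w)"
            by (rule has_field_derivative_transform_within_open[OF _ upper_half_ball(2) wB P'(2)]) (use P[OF wB] at in auto)
          have d2: "(P2' has_field_derivative 1 / f ?w) (at ?w)"
            by (rule has_field_derivative_transform_within_open[OF _ upper_half_ball(2) wB P2'(2)]) (use P2[OF wB] at in auto)
          have line: "((\<lambda>s. of_real s + \<i> * of_real d) has_vector_derivative 1) (at s)"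
            by (auto intro!: derivative_eq_intros)
          have "((\<lambda>s. P' (of_real s + \<i> * of_real d)) has_vector_derivative 1 * f ?w) (at s)"
            using field_vector_diff_chain_at[OF line d1] by (simp add: o_def)
          moreover have "((\<lambda>s. P2' (of_real s + \<i> * of_real d)) has_vector_derivative 1 * (1 / f ?w)) (at s)"
            using field_vector_diff_chain_at[OF line d2] by (simp add: o_def)
          ultimately show "((\<lambda>s. D (of_real s + \<i> * of_real d)) has_vector_derivative f ?w - cnj (1 / f ?w)) (at s)"
            unfolding D_def by (intro has_vector_derivative_diff has_vector_derivative_cnj) simp_all
          have "dist (m ?w) (m (of_real s)) < \<mu>"
            by (rule \<delta>(2)) (use s d0 elim wR in \<open>auto simp: in_cbox_complex_iff dist_norm norm_mult\<close>)
          then have "\<bar>norm (f ?w) - 1\<bar> < \<mu>" using elim by (simp add: m_def dist_real_def)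
          moreover have half: "1/2 < norm (f ?w)" "norm (f ?w) < 1" using f1 f2 wB by auto
          moreover have "f ?w - cnj (1 / f ?w) = (of_real ((norm (f ?w))\<^sup>2 - 1)) / cnj (f ?w)"
            using fnz[OF wB] unfolding of_real_diff complex_norm_square by (simp add: field_simps)
          moreover have "norm (of_real ((norm (f ?w))\<^sup>2 - 1) / cnj (f ?w) :: complex) = \<bar>(norm (f ?w))\<^sup>2 - 1\<bar> / norm (f ?w)"
            by (simp only: norm_divide norm_of_real complex_mod_cnj)
          moreover have "\<bar>(norm (f ?w))\<^sup>2 - 1\<bar> / norm (f ?w) \<le> 4 * \<mu>"
          proof -
            have "\<bar>(norm (f ?w))\<^sup>2 - 1\<bar> = \<bar>norm (f ?w) - 1\<bar> * (norm (f ?w) + 1)"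
              using abs_mult[of "norm (f ?w) - 1" "norm (f ?w) + 1"] by (simp add: power2_eq_square algebra_simps)
            also have "\<dots> \<le> \<mu> * 2" using half \<open>\<bar>norm (f ?w) - 1\<bar> < \<mu>\<close> by (intro mult_mono) auto
            finally have "\<bar>(norm (f ?w))\<^sup>2 - 1\<bar> \<le> \<mu> * 2" .
            also have "\<dots> \<le> 4 * \<mu> * norm (f ?w)" using mult_left_mono[of "1/2" "norm (f ?w)" "4 * \<mu>"] half \<open>\<mu> > 0\<close> by simp
            finally have "\<bar>(norm (f ?w))\<^sup>2 - 1\<bar> \<le> 4 * \<mu> * norm (f ?w)" .
            moreover have "0 < norm (f ?w)" using half by linarith
            ultimately show ?thesis by (subst pos_divide_le_eq)
          qed
          ultimately show "norm (f ?w - cnj (1 / f ?w)) \<le> 4 * \<mu>" by simp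
        qed
        have "norm (D (of_real x + \<i> * of_real d) - D (of_real 0 + \<i> * of_real d)) \<le> 4 * \<mu> * norm (x - 0)"
        proof (rule differentiable_bound[where S = "{- \<bar>x\<bar>..\<bar>x\<bar>}" and f = "\<lambda>s. D (of_real s + \<i> * of_real d)"
              and f' = "\<lambda>s h. h *\<^sub>R (f (of_real s + \<i> * of_real d) - cnj (1 / f (of_real s + \<i> * of_real d)))"])
          fix s assume "s \<in> {- \<bar>x\<bar>..\<bar>x\<bar>}"
          then have s: "\<bar>s\<bar> \<le> \<bar>x\<bar>" by auto
          show "((\<lambda>s. D (of_real s + \<i> * of_real d)) has_derivative (\<lambda>h. h *\<^sub>R (f (of_real s + \<i> * of_real d) - cnj (1 / f (of_real s + \<i> * of_real d))))) (at s within {- \<bar>x\<bar>..\<bar>x\<bar>})"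
            using has_vector_derivative_at_within[OF der[OF s]] unfolding has_vector_derivative_def .
          show "onorm (\<lambda>h. h *\<^sub>R (f (of_real s + \<i> * of_real d) - cnj (1 / f (of_real s + \<i> * of_real d)))) \<le> 4 * \<mu>"
          proof (rule onorm_le)
            show "norm (h *\<^sub>R (f (of_real s + \<i> * of_real d) - cnj (1 / f (of_real s + \<i> * of_real d)))) \<le> 4 * \<mu> * norm h" for h
              unfolding norm_scaleR using mult_left_mono[OF small[OF s], of "\<bar>h\<bar>"] by (simp add: mult.commute)
          qed
        qed auto
        also have "\<dots> \<le> 4 * (\<epsilon> / (8 * (e + 1))) * (e + 1)"
          using x \<open>e > 0\<close> \<open>\<epsilon> > 0\<close> by (intro mult_mono) (auto simp: \<mu>_def)
        also have "\<dots> \<le> \<epsilon>" using \<open>e > 0\<close> \<open>\<epsilon> > 0\<close> by (simp add: field_simps)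
        finally show ?case by (simp add: dist_norm)
      qed
      have tend: "((\<lambda>d. D (of_real s + \<i> * of_real d)) \<longlongrightarrow> D (of_real s)) (at_right 0)" if "\<bar>s\<bar> < e" for s
      proof -
        have sc: "of_real s \<in> closure ?Bp" using that by (intro clos) auto
        have "((\<lambda>d. of_real s + \<i> * of_real d) \<longlongrightarrow> of_real s + \<i> * of_real 0) (at_right 0)"
          by (intro tendsto_intros)
        moreover have "\<forall>\<^sub>F d in at_right 0. of_real s + \<i> * of_real d \<in> closure ?Bp"
        proof -
          have "\<forall>\<^sub>F d in at_right 0. 0 < d \<and> d < e - \<bar>s\<bar>"
            using that by (auto simp: eventually_at_right_field intro!: exI[of _ "e - \<bar>s\<bar>"])
          then show ?thesis by eventually_elim (use up closure_subset in \<open>force\<close>)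
        qed
        ultimately show ?thesis using cD sc
          by (intro continuous_on_tendsto_compose[OF cD]) auto
      qed
      have "((\<lambda>d. dist (D (of_real x + \<i> * of_real d)) (D (0 + \<i> * of_real d))) \<longlongrightarrow> dist (D (of_real x)) (D 0)) (at_right 0)"
        using tend[OF x] tend[of 0] \<open>e > 0\<close> by (intro tendsto_dist) auto
      then show "dist (D (of_real x)) (D 0) \<le> 0 + \<epsilon>"
        using tendsto_upperbound[OF _ ev] by (simp add: trivial_limit_at_right_real)
    qed
    then show ?thesis by simp
  qed
  \<comment> \<open>The constant \<open>D 0\<close> is the jump between the two primitives on the
    diameter; adding it makes the pasted function continuous.\<close>
  define h where "h w = (if 0 \<le> Im w then P' w else cnj (P2' (cnj w)) + D 0)" for w
  have ch: "continuous_on ?B h"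
  proof -
    have "continuous_on ((?B \<inter> {w. 0 \<le> Im w}) \<union> (?B \<inter> {w. Im w \<le> 0})) h"
      unfolding h_def
    proof (rule continuous_on_cases_local)
      show "closedin (top_of_set (?B \<inter> {w. 0 \<le> Im w} \<union> ?B \<inter> {w. Im w \<le> 0})) (?B \<inter> {w. 0 \<le> Im w})"
        unfolding closedin_closed by (rule exI[of _ "{w. 0 \<le> Im w}"]) (auto intro: closed_halfspace_Im_ge)
      show "closedin (top_of_set (?B \<inter> {w. 0 \<le> Im w} \<union> ?B \<inter> {w. Im w \<le> 0})) (?B \<inter> {w. Im w \<le> 0})"
        unfolding closedin_closed by (rule exI[of _ "{w. Im w \<le> 0}"]) (auto intro: closed_halfspace_Im_le)
      show "continuous_on (?B \<inter> {w. 0 \<le> Im w}) P'"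
        by (rule continuous_on_subset[OF uniformly_continuous_imp_continuous[OF P'(1)]]) (use clos in auto)
      show "continuous_on (?B \<inter> {w. Im w \<le> 0}) (\<lambda>w. cnj (P2' (cnj w)) + D 0)"
        by (intro continuous_intros continuous_on_compose2[OF uniformly_continuous_imp_continuous[OF P2'(1)]]) (use clos in auto)
      fix w assume "w \<in> ?B \<inter> {w. 0 \<le> Im w} \<and> \<not> 0 \<le> Im w \<or> w \<in> ?B \<inter> {w. Im w \<le> 0} \<and> 0 \<le> Im w"
      then have w: "w = of_real (Re w)" "w \<in> ?B" by (auto simp: complex_eq_iff)
      have "\<bar>Re w\<bar> < e" using w by (metis mem_ball_0 norm_of_real)
      from Dconst[OF this] w(1) have "D w = D 0" by simp
      moreover have "cnj w = w" using w(1) by (metis complex_cnj_complex_of_real)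
      moreover have "P' w = cnj (P2' w) + D w" by (simp add: D_def)
      ultimately show "P' w = cnj (P2' (cnj w)) + D 0" by simp
    qed
    moreover have "(?B \<inter> {w. 0 \<le> Im w}) \<union> (?B \<inter> {w. Im w \<le> 0}) = ?B" by auto
    ultimately show ?thesis by simp
  qed
  have dup: "(h has_field_derivative f w) (at w)" if w: "w \<in> ?Bp" for w
  proof -
    have "(P has_field_derivative f w) (at w)" using P[OF w] at_within_open[OF w upper_half_ball(2)] by simp
    then show ?thesis
      by (rule has_field_derivative_transform_within_open[OF _ upper_half_ball(2) w]) (use P'(2) in \<open>auto simp: h_def\<close>)
  qed
  let ?Bm = "?B \<inter> {w. Im w < 0}"
  have oBm: "open ?Bm" by (auto intro!: open_Int open_halfspace_Im_lt)
  have dlo: "(h has_field_derivative 1 / cnj (f (cnj w))) (at w)" if w: "w \<in> ?Bm" for w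
  proof -
    have cw: "cnj w \<in> ?Bp" using w by auto
    have "(P2 has_field_derivative 1 / f (cnj w)) (at (cnj w))" using P2[OF cw] at_within_open[OF cw upper_half_ball(2)] by simp
    then have "((cnj \<circ> P2 \<circ> cnj) has_field_derivative cnj (1 / f (cnj w))) (at w)" by (rule has_field_derivative_cnj_cnj)
    then have "((\<lambda>w. (cnj \<circ> P2 \<circ> cnj) w + D 0) has_field_derivative cnj (1 / f (cnj w)) + 0) (at w)" by (intro DERIV_add DERIV_const)
    then have "((\<lambda>w. (cnj \<circ> P2 \<circ> cnj) w + D 0) has_field_derivative 1 / cnj (f (cnj w))) (at w)" by simp
    then show ?thesis
      by (rule has_field_derivative_transform_within_open[OF _ oBm w]) (use P2'(2) in \<open>auto simp: h_def\<close>)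
  qed
  have inn: "\<i> \<bullet> w = Im w" for w by (simp add: inner_complex_def)
  have hol: "h holomorphic_on ?B"
  proof (rule holomorphic_on_paste_across_line[of _ \<i> _ 0])
    show "h holomorphic_on ?B \<inter> {z. \<i> \<bullet> z < 0}" unfolding inn using dlo
      by (intro holomorphic_onI) (meson field_differentiable_at_within field_differentiable_def)
    show "h holomorphic_on ?B \<inter> {z. 0 < \<i> \<bullet> z}" unfolding inn using dup
      by (intro holomorphic_onI) (meson field_differentiable_at_within field_differentiable_def)
  qed (use ch in auto)
  have Fup: "deriv h w = f w" if "w \<in> ?Bp" for w using DERIV_imp_deriv[OF dup[OF that]] .
  have hd: "deriv h holomorphic_on ?B" using hol by (simp add: holomorphic_deriv)
  show thesis
  proof (rule that[OF hd])
    show "deriv h w = f w" if "w \<in> ?B" "0 < Im w" for w using Fup that by auto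
    show "deriv h w = 1 / cnj (f (cnj w))" if "w \<in> ?B" "Im w < 0" for w using DERIV_imp_deriv[OF dlo] that by auto
    fix w assume w: "w \<in> ?B" "Im w = 0"
    have w0: "w = of_real (Re w)" using w by (auto simp: complex_eq_iff)
    have wre: "\<bar>Re w\<bar> < e" using w w0 by (metis mem_ball_0 norm_of_real)
    have ne: "at w within ?Bp \<noteq> bot"
    proof -
      have "w \<in> closure ?Bp" using clos w by simp
      moreover have "w \<notin> ?Bp" using w by simp
      ultimately have "w islimpt ?Bp" unfolding closure_def by blast
      then show ?thesis by (simp add: trivial_limit_within)
    qed
    have "continuous_on ?B (\<lambda>w. norm (deriv h w))" using hd by (intro continuous_intros holomorphic_on_imp_continuous_on)
    then have "isCont (\<lambda>w. norm (deriv h w)) w" using w by (simp add: continuous_on_eq_continuous_at)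
    then have "((\<lambda>w. norm (deriv h w)) \<longlongrightarrow> norm (deriv h w)) (at w within ?Bp)"
      using continuous_at_imp_continuous_at_within continuous_within by blast
    moreover have "((\<lambda>w. norm (deriv h w)) \<longlongrightarrow> 1) (at w within ?Bp)"
      using lim[OF wre] unfolding w0[symmetric]
      by (rule Lim_transform_eventually) (auto simp: eventually_at_filter Fup)
    ultimately show "norm (deriv h w) = 1" using tendsto_unique[OF ne] by blast
  qed
qed

section \<open>Extension of the inverse Riemann map past the circle\<close>

lemma compact_subset_ball_extend:
  fixes W :: "complex set"
  assumes "open W" "cball 0 1 \<subseteq> W" obtains R where "1 < R" "ball 0 R \<subseteq> W"
proof -
  have "\<exists>d>0. \<forall>x\<in>cball 0 1. ball x d \<subseteq> W"
    using compact_subset_open_imp_ball_epsilon_subset[OF compact_cball assms] by (metis UN_subset_iff)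
  then obtain d where d: "d > 0" "\<And>x. x \<in> cball 0 1 \<Longrightarrow> ball x d \<subseteq> W" by blast
  have "ball 0 (1 + d) \<subseteq> W"
  proof
    fix z :: complex assume z: "z \<in> ball 0 (1 + d)"
    show "z \<in> W"
    proof (cases "norm z \<le> 1")
      case False
      let ?y = "z / of_real (norm z)"
      have nz: "z \<noteq> 0" using False by auto
      then have "norm ?y = 1" by (simp add: norm_divide)
      moreover have "dist ?y z < d"
      proof -
        have "?y * of_real (norm z) = z" using nz by simp
        then have "?y - z = ?y * of_real (1 - norm z)" by (simp add: right_diff_distrib)
        then have "norm (?y - z) = norm ?y * \<bar>1 - norm z\<bar>" by (metis norm_mult norm_of_real)
        then show ?thesis using \<open>norm ?y = 1\<close> z False by (simp add: dist_norm)
      qed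
      ultimately show ?thesis using d(2)[of ?y] by auto
    qed (use assms in auto)
  qed
  then show thesis using that[of "1 + d"] d(1) by simp
qed

text \<open>Compactness: pairs of distinct points with equal images in discs shrinking to the closed
  unit disc cluster at x and y with f x = f y. Injectivity on the closed disc gives x = y, and then
  local injectivity at x is violated by the pairs near x.\<close>

lemma injective_near_compact:
  fixes f :: "complex \<Rightarrow> complex"
  assumes f: "continuous_on (ball 0 R) f" and "1 < R" and inj: "inj_on f (cball 0 1)"
    and loc: "\<And>z. z \<in> cball 0 1 \<Longrightarrow> \<exists>d>0. inj_on f (ball z d)"
  obtains R' where "1 < R'" "R' \<le> R" "inj_on f (ball 0 R')"
proof (rule ccontr)
  assume neg: "\<not> thesis"
  define \<delta> where "\<delta> n = (R - 1) / real (Suc n) / 2" for n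
  have \<delta>: "0 < \<delta> n" "1 + \<delta> n \<le> (1 + R) / 2" for n
  proof -
    show "0 < \<delta> n" using \<open>1 < R\<close> by (simp add: \<delta>_def)
    have "(R - 1) / real (Suc n) \<le> (R - 1) / 1" using \<open>1 < R\<close> by (intro divide_left_mono) auto
    then show "1 + \<delta> n \<le> (1 + R) / 2" by (simp add: \<delta>_def field_simps)
  qed
  have "\<exists>a b. a \<in> ball 0 (1 + \<delta> n) \<and> b \<in> ball 0 (1 + \<delta> n) \<and> a \<noteq> b \<and> f a = f b" for n
  proof -
    have "\<not> inj_on f (ball 0 (1 + \<delta> n))" using that[of "1 + \<delta> n"] neg \<delta>[of n] \<open>1 < R\<close> by auto
    then show ?thesis unfolding inj_on_def by blast
  qed
  then obtain a b where ab: "\<And>n. a n \<in> ball 0 (1 + \<delta> n)" "\<And>n. b n \<in> ball 0 (1 + \<delta> n)" "\<And>n. a n \<noteq> b n" "\<And>n. f (a n) = f (b n)" by metis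
  let ?K = "cball (0::complex) ((1 + R) / 2)"
  have K: "a n \<in> ?K" "b n \<in> ?K" for n using ab(1,2)[of n] \<delta>[of n] by (auto simp: less_imp_le)
  have "compact (?K \<times> ?K)" by (intro compact_Times compact_cball)
  then obtain l s where ls: "l \<in> ?K \<times> ?K" "strict_mono (s::nat \<Rightarrow> nat)" "((\<lambda>n. (a n, b n)) \<circ> s) \<longlonglongrightarrow> l"
    unfolding compact_def by (elim allE[of _ "\<lambda>n. (a n, b n)"]) (use K in blast)
  obtain x y where l: "l = (x, y)" by (cases l)
  have ax: "(\<lambda>n. a (s n)) \<longlonglongrightarrow> x" and by': "(\<lambda>n. b (s n)) \<longlonglongrightarrow> y"
    using tendsto_fst[OF ls(3)] tendsto_snd[OF ls(3)] by (auto simp: o_def l)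
  have d0: "(\<lambda>n. 1 + \<delta> (s n)) \<longlonglongrightarrow> 1"
  proof -
    have "\<delta> \<longlonglongrightarrow> 0" using tendsto_divide[OF LIMSEQ_Suc[OF lim_const_over_n[of "R - 1"]] tendsto_const[of 2]] by (simp add: \<delta>_def[abs_def])
    from LIMSEQ_subseq_LIMSEQ[OF this ls(2)] have "(\<lambda>n. \<delta> (s n)) \<longlonglongrightarrow> 0" by (simp add: o_def)
    from tendsto_add[OF tendsto_const[of 1] this] show ?thesis by simp
  qed
  have xy: "x \<in> cball 0 1" "y \<in> cball 0 1"
  proof -
    have "norm x \<le> 1" by (rule LIMSEQ_le[OF tendsto_norm[OF ax] d0]) (use ab(1) in \<open>auto intro!: exI less_imp_le\<close>)
    moreover have "norm y \<le> 1" by (rule LIMSEQ_le[OF tendsto_norm[OF by'] d0]) (use ab(2) in \<open>auto intro!: exI less_imp_le\<close>)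
    ultimately show "x \<in> cball 0 1" "y \<in> cball 0 1" by auto
  qed
  have cont: "isCont f z" if "z \<in> cball 0 1" for z
    using f that \<open>1 < R\<close> by (intro continuous_on_interior[of "ball 0 R"]) auto
  have "(\<lambda>n. f (a (s n))) \<longlonglongrightarrow> f x" "(\<lambda>n. f (b (s n))) \<longlonglongrightarrow> f y"
    using isCont_tendsto_compose[OF cont] xy ax by' by auto
  then have "f x = f y" using ab(4) LIMSEQ_unique by auto
  then have "x = y" using inj xy by (auto simp: inj_on_def)
  obtain d where d: "d > 0" "inj_on f (ball x d)" using loc[OF xy(1)] by blast
  have "\<forall>\<^sub>F n in sequentially. a (s n) \<in> ball x d \<and> b (s n) \<in> ball x d"
    using tendstoD[OF ax d(1)] tendstoD[OF by' d(1)] \<open>x = y\<close> by (auto simp: dist_commute elim: eventually_elim2)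
  then obtain n where "a (s n) \<in> ball x d" "b (s n) \<in> ball x d" using eventually_happens'[OF sequentially_bot] by blast
  then show False using d(2) ab(3,4) by (meson inj_on_eq_iff)
qed

text \<open>Two balls centred on the circle which meet do so along a convex set that meets the disc, so local extensions agree.\<close>
lemma glue_boundary_extensions:
  assumes \<psi>: "\<psi> holomorphic_on ball 0 1"
    and ext: "\<And>\<xi>. \<xi> \<in> sphere 0 1 \<Longrightarrow> \<exists>d g. d > 0 \<and> g holomorphic_on ball \<xi> d \<and> inj_on g (ball \<xi> d) \<and>
      (\<forall>z\<in>ball \<xi> d. norm z < 1 \<longrightarrow> g z = \<psi> z) \<and> (\<forall>z\<in>ball \<xi> d. norm z = 1 \<longrightarrow> g z \<in> Fr)"
  obtains \<Psi> R where "1 < R" "\<Psi> holomorphic_on ball 0 R" "\<And>z. z \<in> ball 0 1 \<Longrightarrow> \<Psi> z = \<psi> z"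
    "\<And>z. z \<in> sphere 0 1 \<Longrightarrow> \<Psi> z \<in> Fr" "\<And>z. z \<in> sphere 0 1 \<Longrightarrow> \<exists>d>0. inj_on \<Psi> (ball z d)"
proof -
  define X where "X \<xi> d g \<longleftrightarrow> d > 0 \<and> g holomorphic_on ball \<xi> d \<and> inj_on g (ball \<xi> d) \<and>
      (\<forall>z\<in>ball \<xi> d. norm z < 1 \<longrightarrow> g z = \<psi> z) \<and> (\<forall>z\<in>ball \<xi> d. norm z = 1 \<longrightarrow> g z \<in> Fr)" for \<xi> :: complex and d g
  have "\<forall>\<xi>\<in>sphere 0 1. \<exists>d g. X \<xi> d g" using ext unfolding X_def by blast
  then obtain d g where "\<And>\<xi>. \<xi> \<in> sphere 0 1 \<Longrightarrow> X \<xi> (d \<xi>) (g \<xi>)" by metis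
  note dg = this[unfolded X_def]
  have agree: "g \<xi> z = g \<xi>' z" if x: "\<xi> \<in> sphere 0 1" "\<xi>' \<in> sphere 0 1" and z: "z \<in> ball \<xi> (d \<xi>)" "z \<in> ball \<xi>' (d \<xi>')" for \<xi> \<xi>' z
  proof -
    let ?I = "ball \<xi> (d \<xi>) \<inter> ball \<xi>' (d \<xi>')"
    have dp: "d \<xi> > 0" "d \<xi>' > 0" using dg x by auto
    \<comment> \<open>A common point of both balls inside the disc starts the continuation. For
      equal centres it lies on the radius; otherwise it divides the segment of centres in the ratio
      of the radii, and strict convexity of the disc puts it inside.\<close>
    have "\<exists>w\<in>?I. norm w < 1"
    proof (cases "\<xi> = \<xi>'")
      case True
      define e where "e = min (d \<xi>) 1 / 2"
      have e: "0 < e" "e < d \<xi>" "e < 1" using dp by (auto simp: e_def)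
      have "\<xi> * of_real (1 - e) \<in> ?I" using True e x by (auto simp: dist_norm norm_mult algebra_simps norm_minus_commute)
      moreover have "norm (\<xi> * of_real (1 - e)) < 1" using e x by (simp add: norm_mult del: of_real_diff)
      ultimately show ?thesis by blast
    next
      case False
      have dd: "dist \<xi> \<xi>' < d \<xi> + d \<xi>'" using z dist_triangle[of \<xi> \<xi>' z] by (auto simp: dist_commute)
      define t where "t = d \<xi> / (d \<xi> + d \<xi>')"
      have t: "0 < t" "t < 1" "1 - t = d \<xi>' / (d \<xi> + d \<xi>')" using dp by (auto simp: t_def field_simps)
      define w where "w = (1 - t) *\<^sub>R \<xi> + t *\<^sub>R \<xi>'"
      have "dist \<xi> w = t * dist \<xi> \<xi>'"
      proof -
        have "\<xi> - w = t *\<^sub>R (\<xi> - \<xi>')" by (simp add: w_def algebra_simps)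
        then show ?thesis using t by (simp add: dist_norm)
      qed
      also have "\<dots> < t * (d \<xi> + d \<xi>')" using dd t by (intro mult_strict_left_mono)
      also have "\<dots> = d \<xi>" using dp by (simp add: t_def)
      finally have 1: "w \<in> ball \<xi> (d \<xi>)" by simp
      have "dist \<xi>' w = (1 - t) * dist \<xi> \<xi>'"
      proof -
        have "\<xi>' - w = (1 - t) *\<^sub>R (\<xi>' - \<xi>)" by (simp add: w_def algebra_simps)
        then show ?thesis using t(1,2) by (simp add: dist_norm norm_minus_commute)
      qed
      also have "\<dots> < (1 - t) * (d \<xi> + d \<xi>')" using dd t by (intro mult_strict_left_mono) auto
      also have "\<dots> = d \<xi>'" using dp unfolding t(3) by simp
      finally have 2: "w \<in> ball \<xi>' (d \<xi>')" by simp
      have "w \<in> open_segment \<xi> \<xi>'" using False t by (auto simp: in_segment w_def)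
      then have "norm w < 1"
        using dist_decreases_open_segment[of w \<xi> \<xi>' 0] x by (auto simp: dist_norm)
      then show ?thesis using 1 2 by blast
    qed
    then obtain w where w: "w \<in> ?I" "norm w < 1" by blast
    show ?thesis
    proof (rule analytic_continuation_open[of "?I \<inter> ball 0 1" ?I "g \<xi>" "g \<xi>'"])
      show "g \<xi> holomorphic_on ?I" "g \<xi>' holomorphic_on ?I"
        using dg[OF x(1)] dg[OF x(2)] by (meson holomorphic_on_subset Int_lower1 Int_lower2)+
      show "connected ?I" by (intro convex_connected convex_Int convex_ball)
      show "?I \<inter> ball 0 1 \<noteq> {}" using w by auto
      show "g \<xi> y = g \<xi>' y" if "y \<in> ?I \<inter> ball 0 1" for y using dg[OF x(1)] dg[OF x(2)] that by auto
    qed (use z in auto)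
  qed
  define \<Psi> where "\<Psi> z = (if norm z < 1 then \<psi> z else g (SOME \<xi>. \<xi> \<in> sphere 0 1 \<and> z \<in> ball \<xi> (d \<xi>)) z)" for z
  have \<Psi>g: "\<Psi> z = g \<xi> z" if "\<xi> \<in> sphere 0 1" "z \<in> ball \<xi> (d \<xi>)" for \<xi> z
  proof (cases "norm z < 1")
    case True
    then show ?thesis using dg[OF that(1)] that(2) by (simp add: \<Psi>_def)
  next
    case False
    let ?x = "SOME \<xi>. \<xi> \<in> sphere 0 1 \<and> z \<in> ball \<xi> (d \<xi>)"
    have "?x \<in> sphere 0 1 \<and> z \<in> ball ?x (d ?x)" by (rule someI[of _ \<xi>]) (use that in blast)
    then show ?thesis using agree[of ?x \<xi> z] that False by (auto simp: \<Psi>_def)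
  qed
  let ?W = "ball 0 1 \<union> (\<Union>\<xi>\<in>sphere 0 1. ball \<xi> (d \<xi>))"
  have oW: "open ?W" by auto
  have hol: "\<Psi> holomorphic_on ?W"
  proof (rule holomorphic_on_Un)
    show "\<Psi> holomorphic_on ball 0 1" by (rule holomorphic_transform[OF \<psi>]) (simp add: \<Psi>_def)
    show "\<Psi> holomorphic_on (\<Union>\<xi>\<in>sphere 0 1. ball \<xi> (d \<xi>))"
    proof (rule holomorphic_on_UN_open)
      show "\<Psi> holomorphic_on ball \<xi> (d \<xi>)" if "\<xi> \<in> sphere 0 1" for \<xi>
        using dg[OF that] \<Psi>g[OF that] by (metis holomorphic_transform)
    qed auto
  qed auto
  have "cball 0 1 \<subseteq> ?W"
  proof
    fix z :: complex assume "z \<in> cball 0 1"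
    then consider "z \<in> ball 0 1" | "z \<in> sphere 0 1" by fastforce
    then show "z \<in> ?W"
    proof cases
      case 2
      then have "z \<in> ball z (d z)" using dg[OF 2] by simp
      then show ?thesis using 2 by blast
    qed auto
  qed
  then obtain R where R: "1 < R" "ball 0 R \<subseteq> ?W" using compact_subset_ball_extend[OF oW] by blast
  show thesis
  proof (rule that[OF R(1) holomorphic_on_subset[OF hol R(2)]])
    show "\<Psi> z = \<psi> z" if "z \<in> ball 0 1" for z using that by (simp add: \<Psi>_def)
    fix z :: complex assume z: "z \<in> sphere 0 1"
    have zz: "z \<in> ball z (d z)" using dg[OF z] by simp
    then show "\<Psi> z \<in> Fr" using dg[OF z] \<Psi>g[OF z zz] z by auto
    have "inj_on \<Psi> (ball z (d z))" using dg[OF z] \<Psi>g[OF z] by (metis inj_on_cong)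
    then show "\<exists>d>0. inj_on \<Psi> (ball z d)" using dg[OF z] by blast
  qed
qed

text \<open>\<open>X\<close> is the extension of the inverse Riemann map across the boundary point \<open>p\<close>.\<close>
definition bdry_chart :: "complex set \<Rightarrow> (complex \<Rightarrow> complex) \<Rightarrow> complex \<Rightarrow> complex set \<Rightarrow> (complex \<Rightarrow> complex) \<Rightarrow> bool" where
  "bdry_chart \<Omega> \<phi> p N X \<longleftrightarrow> open N \<and> p \<in> N \<and> X holomorphic_on N \<and> inj_on X N \<and>
     (\<forall>z\<in>N. (z \<in> \<Omega> \<longrightarrow> X z = \<phi> z) \<and> (norm (X z) < 1 \<longrightarrow> z \<in> \<Omega>) \<and> (norm (X z) = 1 \<longrightarrow> z \<in> frontier \<Omega>))"

text \<open>A chart at p inverts to an extension of \<psi> near the point of the circle that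
  \<open>X\<close> assigns to p. Every \<xi> on the circle is reached: along the radius to \<xi> the
  values of \<psi> cluster at some frontier point p, because \<Omega> is bounded, and continuity of
  the chart forces X p = \<xi>.\<close>

lemma conformal_extension:
  assumes \<Omega>: "open \<Omega>" "bounded \<Omega>" and \<phi>: "\<phi> holomorphic_on \<Omega>" and \<psi>: "\<psi> holomorphic_on ball 0 1"
    and \<phi>\<psi>: "\<And>z. z \<in> \<Omega> \<Longrightarrow> \<phi> z \<in> ball 0 1 \<and> \<psi> (\<phi> z) = z" and \<psi>\<phi>: "\<And>z. z \<in> ball 0 1 \<Longrightarrow> \<psi> z \<in> \<Omega> \<and> \<phi> (\<psi> z) = z"
    and chart: "\<And>p. p \<in> frontier \<Omega> \<Longrightarrow> \<exists>N X. bdry_chart \<Omega> \<phi> p N X"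
    and V: "open V" "closure \<Omega> \<subseteq> V"
  obtains \<Psi> R where "1 < R" "\<Psi> holomorphic_on ball 0 R" "inj_on \<Psi> (ball 0 R)" "\<Psi> ` ball 0 1 = \<Omega>"
    "\<Psi> ` sphere 0 1 = frontier \<Omega>" "\<Psi> ` ball 0 R \<subseteq> V"
proof -
  have ext: "\<exists>d g. d > 0 \<and> g holomorphic_on ball \<xi> d \<and> inj_on g (ball \<xi> d) \<and>
      (\<forall>z\<in>ball \<xi> d. norm z < 1 \<longrightarrow> g z = \<psi> z) \<and> (\<forall>z\<in>ball \<xi> d. norm z = 1 \<longrightarrow> g z \<in> frontier \<Omega>)" if \<xi>: "\<xi> \<in> sphere 0 1" for \<xi>
  proof -
    define a where "a n = \<xi> * of_real (1 - 1 / real (Suc n))" for n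
    have a1: "a n \<in> ball 0 1" for n using \<xi> by (simp add: a_def norm_mult del: of_real_diff) 
    have "(\<lambda>n. 1 - 1 / real (Suc n)) \<longlonglongrightarrow> 1 - 0" by (intro tendsto_intros LIMSEQ_Suc[OF lim_const_over_n])
    then have al: "a \<longlonglongrightarrow> \<xi>" unfolding a_def[abs_def] using tendsto_mult[OF tendsto_const[of \<xi>] tendsto_of_real[of _ "1 - 0" sequentially, where 'a = complex]] by fastforce
    have "compact (closure \<Omega>)" using \<Omega> by simp
    moreover have "\<forall>n. \<psi> (a n) \<in> closure \<Omega>" using \<psi>\<phi> a1 closure_subset by blast
    ultimately obtain p s where p: "p \<in> closure \<Omega>" "strict_mono (s :: nat \<Rightarrow> nat)" "((\<lambda>n. \<psi> (a n)) \<circ> s) \<longlonglongrightarrow> p"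
      unfolding compact_def by (elim allE[of _ "\<lambda>n. \<psi> (a n)"]) blast
    have as: "(\<lambda>n. a (s n)) \<longlonglongrightarrow> \<xi>" using LIMSEQ_subseq_LIMSEQ[OF al p(2)] by (simp add: o_def)
    have "p \<notin> \<Omega>"
    proof
      assume "p \<in> \<Omega>"
      then have "isCont \<phi> p" using holomorphic_on_imp_continuous_on[OF \<phi>] \<Omega>(1) by (simp add: continuous_on_eq_continuous_at)
      from isCont_tendsto_compose[OF this p(3)] have "(\<lambda>n. a (s n)) \<longlonglongrightarrow> \<phi> p" using \<psi>\<phi> a1 by (simp add: o_def)
      then have "\<phi> p = \<xi>" using as LIMSEQ_unique by blast
      then show False using \<phi>\<psi>[OF \<open>p \<in> \<Omega>\<close>] \<xi> by auto
    qed
    then have "p \<in> frontier \<Omega>" using p(1) \<Omega>(1) by (simp add: frontier_def interior_open)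
    then obtain N X where c: "bdry_chart \<Omega> \<phi> p N X" using chart by blast
    have c0: "open N" "p \<in> N" "X holomorphic_on N" "inj_on X N" using c unfolding bdry_chart_def by blast+
    have cX: "\<And>z. z \<in> N \<Longrightarrow> z \<in> \<Omega> \<Longrightarrow> X z = \<phi> z" and cO: "\<And>z. z \<in> N \<Longrightarrow> norm (X z) < 1 \<Longrightarrow> z \<in> \<Omega>"
      and cF: "\<And>z. z \<in> N \<Longrightarrow> norm (X z) = 1 \<Longrightarrow> z \<in> frontier \<Omega>" using c unfolding bdry_chart_def by blast+
    have "isCont X p" using holomorphic_on_imp_continuous_on[OF c0(3)] c0(1,2) continuous_on_eq_continuous_at by blast
    from isCont_tendsto_compose[OF this p(3)] have "(\<lambda>n. X (\<psi> (a (s n)))) \<longlonglongrightarrow> X p" by (simp add: o_def)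
    moreover have "\<forall>\<^sub>F n in sequentially. X (\<psi> (a (s n))) = a (s n)"
    proof -
      have "\<forall>\<^sub>F n in sequentially. \<psi> (a (s n)) \<in> N" using topological_tendstoD[OF p(3) c0(1,2)] by (simp add: o_def)
      then show ?thesis
      proof eventually_elim
        case (elim n)
        then show ?case using cX[OF elim] \<psi>\<phi>[OF a1[of "s n"]] by simp
      qed
    qed
    ultimately have "(\<lambda>n. a (s n)) \<longlonglongrightarrow> X p" by (rule Lim_transform_eventually)
    then have Xp: "X p = \<xi>" using as LIMSEQ_unique by blast
    obtain g where g: "g holomorphic_on (X ` N)" "\<And>z. z \<in> N \<Longrightarrow> g (X z) = z"
      using holomorphic_has_inverse[OF c0(3,1,4)] by metis
    have "open (X ` N)" by (rule open_mapping_thm3[OF c0(3,1,4)])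
    moreover have "\<xi> \<in> X ` N" using Xp c0(2) by blast
    ultimately obtain d where d: "d > 0" "ball \<xi> d \<subseteq> X ` N" by (meson open_contains_ball)
    show ?thesis
    proof (intro exI[of _ d] exI[of _ g] conjI ballI impI)
      show "d > 0" by fact
      show "g holomorphic_on ball \<xi> d" using g(1) d(2) holomorphic_on_subset by blast
      show "inj_on g (ball \<xi> d)"
      proof (rule inj_onI)
        fix u w assume uw: "u \<in> ball \<xi> d" "w \<in> ball \<xi> d" "g u = g w"
        obtain u' w' where "u = X u'" "u' \<in> N" "w = X w'" "w' \<in> N" using uw d(2) by blast
        then show "u = w" using g(2) uw(3) by auto
      qed
      fix z assume z: "z \<in> ball \<xi> d"
      obtain z' where z': "z = X z'" "z' \<in> N" using z d(2) by blast
      show "g z = \<psi> z" if "norm z < 1"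
      proof -
        have zO: "z' \<in> \<Omega>" using cO[OF z'(2)] z'(1) that by simp
        have "\<phi> z' = z" using cX[OF z'(2) zO] z'(1) by simp
        then show ?thesis using g(2)[OF z'(2)] z'(1) \<phi>\<psi>[OF zO] by metis
      qed
      show "g z \<in> frontier \<Omega>" if "norm z = 1"
        using g(2)[OF z'(2)] z'(1) cF[OF z'(2)] that by simp
    qed
  qed
  obtain \<Psi> R where \<Psi>: "1 < R" "\<Psi> holomorphic_on ball 0 R" "\<And>z. z \<in> ball 0 1 \<Longrightarrow> \<Psi> z = \<psi> z"
    "\<And>z. z \<in> sphere 0 1 \<Longrightarrow> \<Psi> z \<in> frontier \<Omega>" "\<And>z. z \<in> sphere 0 1 \<Longrightarrow> \<exists>d>0. inj_on \<Psi> (ball z d)"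
    by (rule glue_boundary_extensions[OF \<psi> ext]) (assumption | rule that)+
  have cont: "continuous_on (ball 0 R) \<Psi>" using \<Psi>(2) by (rule holomorphic_on_imp_continuous_on)
  have im1: "\<Psi> ` ball 0 1 = \<Omega>"
  proof
    show "\<Psi> ` ball 0 1 \<subseteq> \<Omega>" using \<Psi>(3) \<psi>\<phi> by auto
    show "\<Omega> \<subseteq> \<Psi> ` ball 0 1"
    proof
      fix z assume z: "z \<in> \<Omega>"
      then have "z = \<Psi> (\<phi> z)" using \<phi>\<psi>[OF z] \<Psi>(3)[of "\<phi> z"] by simp
      then show "z \<in> \<Psi> ` ball 0 1" using \<phi>\<psi>[OF z] by blast
    qed
  qed
  have disj: "\<Omega> \<inter> frontier \<Omega> = {}" using \<Omega>(1) by (auto simp: frontier_def interior_open)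
  have split: "z \<in> ball 0 1 \<or> z \<in> sphere 0 1" if "z \<in> cball (0::complex) 1" for z using that by fastforce
  have cc: "continuous_on (cball 0 1) \<Psi>" using cont \<Psi>(1) by (intro continuous_on_subset[OF cont]) auto
  have imc: "closure \<Omega> \<subseteq> \<Psi> ` cball 0 1"
  proof (rule closure_minimal)
    show "\<Omega> \<subseteq> \<Psi> ` cball 0 1" using im1 by force
    show "closed (\<Psi> ` cball 0 1)" using compact_continuous_image[OF cc compact_cball] compact_imp_closed by blast
  qed
  have im2: "\<Psi> ` sphere 0 1 = frontier \<Omega>"
  proof
    show "\<Psi> ` sphere 0 1 \<subseteq> frontier \<Omega>" using \<Psi>(4) by blast
    show "frontier \<Omega> \<subseteq> \<Psi> ` sphere 0 1"
    proof
      fix p assume p: "p \<in> frontier \<Omega>"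
      then have "p \<in> closure \<Omega>" by (simp add: frontier_def)
      then obtain z where z: "z \<in> cball 0 1" "p = \<Psi> z" using imc by blast
      have "z \<notin> ball 0 1" using im1 disj p z(2) by blast
      then show "p \<in> \<Psi> ` sphere 0 1" using split[OF z(1)] z(2) by blast
    qed
  qed
  \<comment> \<open>The chart reads the boundary parameter back off the value of \<Psi>. Two
    parameters with the same image share a chart, so \<Psi> is injective on the circle.\<close>
  have lim: "X p = z" if z: "z \<in> sphere 0 1" and p: "p = \<Psi> z" and c: "bdry_chart \<Omega> \<phi> p N X" for z p N X
  proof -
    have c0: "open N" "p \<in> N" "X holomorphic_on N" "inj_on X N" using c unfolding bdry_chart_def by blast+
    have cX: "\<And>z. z \<in> N \<Longrightarrow> z \<in> \<Omega> \<Longrightarrow> X z = \<phi> z" and cO: "\<And>z. z \<in> N \<Longrightarrow> norm (X z) < 1 \<Longrightarrow> z \<in> \<Omega>"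
      and cF: "\<And>z. z \<in> N \<Longrightarrow> norm (X z) = 1 \<Longrightarrow> z \<in> frontier \<Omega>" using c unfolding bdry_chart_def by blast+
    define a where "a n = z * of_real (1 - 1 / real (Suc n))" for n
    have a1: "a n \<in> ball 0 1" for n using z by (simp add: a_def norm_mult del: of_real_diff) 
    have "(\<lambda>n. 1 - 1 / real (Suc n)) \<longlonglongrightarrow> 1 - 0" by (intro tendsto_intros LIMSEQ_Suc[OF lim_const_over_n])
    then have al: "a \<longlonglongrightarrow> z" unfolding a_def[abs_def] using tendsto_mult[OF tendsto_const[of z] tendsto_of_real[of _ "1 - 0" sequentially, where 'a = complex]] by fastforce
    have "isCont \<Psi> z" using cont z \<Psi>(1) by (auto simp: continuous_on_eq_continuous_at)
    from isCont_tendsto_compose[OF this al] have l1: "(\<lambda>n. \<Psi> (a n)) \<longlonglongrightarrow> p" using p by simp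
    have "isCont X p" using holomorphic_on_imp_continuous_on[OF c0(3)] c0(1,2) continuous_on_eq_continuous_at by blast
    from isCont_tendsto_compose[OF this l1] have "(\<lambda>n. X (\<Psi> (a n))) \<longlonglongrightarrow> X p" .
    moreover have "\<forall>\<^sub>F n in sequentially. X (\<Psi> (a n)) = a n"
    proof -
      have "\<forall>\<^sub>F n in sequentially. \<Psi> (a n) \<in> N" using topological_tendstoD[OF l1 c0(1,2)] .
      then show ?thesis
      proof eventually_elim
        case (elim n)
        then show ?case using cX[OF elim] \<psi>\<phi>[OF a1[of n]] \<Psi>(3)[OF a1[of n]] by simp
      qed
    qed
    ultimately have "a \<longlonglongrightarrow> X p" by (rule Lim_transform_eventually)
    then show ?thesis using al LIMSEQ_unique by blast
  qed
  have inj: "inj_on \<Psi> (cball 0 1)"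
  proof (rule inj_onI)
    fix u w assume uw: "u \<in> cball 0 1" "w \<in> cball 0 1" "\<Psi> u = \<Psi> w"
    have D: "\<Psi> x \<in> \<Omega>" "\<phi> (\<Psi> x) = x" if "x \<in> ball 0 1" for x using that \<Psi>(3) \<psi>\<phi> by auto
    consider "u \<in> ball 0 1" "w \<in> ball 0 1" | "u \<in> ball 0 1" "w \<in> sphere 0 1" | "u \<in> sphere 0 1" "w \<in> ball 0 1" | "u \<in> sphere 0 1" "w \<in> sphere 0 1"
      using split uw by blast
    then show "u = w"
    proof cases
      case 1 then show ?thesis using D uw(3) by metis
    next
      case 2 then show ?thesis using D \<Psi>(4) disj uw(3) by (metis IntI empty_iff)
    next
      case 3 then show ?thesis using D \<Psi>(4) disj uw(3) by (metis IntI empty_iff)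
    next
      case 4
      obtain N X where c: "bdry_chart \<Omega> \<phi> (\<Psi> u) N X" using chart \<Psi>(4)[OF 4(1)] by blast
      show ?thesis using lim[OF 4(1) refl c] lim[OF 4(2) uw(3) c] by simp
    qed
  qed
  have loc: "\<exists>d>0. inj_on \<Psi> (ball z d)" if z: "z \<in> cball 0 1" for z
  proof -
    from split[OF z] show ?thesis
    proof
      assume "z \<in> ball 0 1"
      then obtain d where "d > 0" "ball z d \<subseteq> ball 0 1" by (meson open_ball open_contains_ball)
      then show ?thesis using inj by (meson ball_subset_cball inj_on_subset)
    qed (rule \<Psi>(5))
  qed
  obtain R1 where R1: "1 < R1" "R1 \<le> R" "inj_on \<Psi> (ball 0 R1)" using injective_near_compact[OF cont \<Psi>(1) inj loc] by metis
  have oV: "open (ball 0 R1 \<inter> \<Psi> -` V)"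
    by (intro continuous_open_preimage continuous_on_subset[OF cont] subset_ball R1(2) open_ball V(1))
  have "cball 0 1 \<subseteq> ball 0 R1 \<inter> \<Psi> -` V"
  proof
    fix z :: complex assume z: "z \<in> cball 0 1"
    have "\<Psi> z \<in> closure \<Omega>" using split[OF z] im1 im2 by (auto simp: frontier_def closure_def)
    then show "z \<in> ball 0 R1 \<inter> \<Psi> -` V" using V(2) R1(1) z by auto
  qed
  then obtain R2 where R2: "1 < R2" "ball 0 R2 \<subseteq> ball 0 R1 \<inter> \<Psi> -` V" using compact_subset_ball_extend[OF oV] by blast
  show thesis
  proof (rule that[OF R2(1) _ _ im1 im2])
    have s: "ball (0::complex) R2 \<subseteq> ball 0 R1" using R2 by blast
    show "\<Psi> holomorphic_on ball 0 R2" using \<Psi>(2) s R1(2) by (meson holomorphic_on_subset order_trans subset_ball)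
    show "inj_on \<Psi> (ball 0 R2)" using R1(3) s by (rule inj_on_subset)
    show "\<Psi> ` ball 0 R2 \<subseteq> V" using R2(2) by blast
  qed
qed

section \<open>Conformal parametrization of analytic Jordan domains\<close>

text \<open>Properness: the points of \<Omega> with |\<phi>| <= s < 1 lie in the compact subset
  \<open>\<psi>\<close> of \<open>cball 0 s\<close> of \<Omega>, and a frontier point has a
  neighbourhood that avoids it.\<close>

lemma riemann_map_norm_tendsto:
  assumes "open \<Omega>" "continuous_on (ball 0 1) \<psi>" "\<And>z. z \<in> \<Omega> \<Longrightarrow> \<phi> z \<in> ball 0 1 \<and> \<psi> (\<phi> z) = z"
    "\<And>z. z \<in> ball 0 1 \<Longrightarrow> \<psi> z \<in> \<Omega>" "p \<in> frontier \<Omega>"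
  shows "((\<lambda>z. norm (\<phi> z :: complex)) \<longlongrightarrow> 1) (at (p::complex) within \<Omega>)"
proof (rule tendstoI)
  fix \<epsilon> :: real assume "\<epsilon> > 0"
  define s where "s = max 0 (1 - \<epsilon>)"
  have s: "0 \<le> s" "s < 1" "1 - \<epsilon> \<le> s" using \<open>\<epsilon> > 0\<close> by (auto simp: s_def)
  let ?K = "\<psi> ` cball 0 s"
  have "compact ?K" using s by (intro compact_continuous_image continuous_on_subset[OF assms(2)]) auto
  then have "open (- ?K)" by (simp add: compact_imp_closed open_Compl)
  moreover have "p \<notin> ?K"
  proof
    assume "p \<in> ?K"
    then have "p \<in> \<Omega>" using assms(4) s by auto
    then show False using assms(1,5) by (simp add: frontier_def interior_open)
  qed
  ultimately have "\<forall>\<^sub>F z in at p within \<Omega>. z \<in> - ?K \<and> z \<in> \<Omega>"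
    by (intro eventually_conj) (auto simp: eventually_at_filter eventually_nhds intro!: exI[of _ "- ?K"] )
  then show "\<forall>\<^sub>F z in at p within \<Omega>. dist (norm (\<phi> z)) 1 < \<epsilon>"
  proof eventually_elim
    case (elim z)
    then have "\<not> norm (\<phi> z) \<le> s" using assms(3)[of z] by (metis ComplD image_eqI mem_cball_0)
    then show ?case using assms(3)[of z] elim s by (auto simp: dist_real_def)
  qed
qed

definition flattening :: "complex set \<Rightarrow> complex \<Rightarrow> real \<Rightarrow> (complex \<Rightarrow> complex) \<Rightarrow> bool" where
  "flattening \<Omega> p e G \<longleftrightarrow> e > 0 \<and> G holomorphic_on ball 0 e \<and> inj_on G (ball 0 e) \<and> G 0 = p \<and>
     (\<forall>w\<in>ball 0 e. (0 < Im w \<longrightarrow> G w \<in> \<Omega>) \<and> (Im w = 0 \<longrightarrow> G w \<in> frontier \<Omega>) \<and> (Im w < 0 \<longrightarrow> G w \<notin> closure \<Omega>))"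

text \<open>In the straightened coordinate the Riemann map has modulus tending to 1 at the diameter,
  so it extends by reflection; undoing the straightening gives the chart. Reflected values have
  modulus above 1, so the modulus alone tells on which side of the boundary a point lies.\<close>

lemma flattening_imp_chart:
  assumes \<Omega>: "open \<Omega>" and \<phi>: "\<phi> holomorphic_on \<Omega>" and \<psi>: "\<psi> holomorphic_on ball 0 1"
    and \<phi>\<psi>: "\<And>z. z \<in> \<Omega> \<Longrightarrow> \<phi> z \<in> ball 0 1 \<and> \<psi> (\<phi> z) = z" and \<psi>\<phi>: "\<And>z. z \<in> ball 0 1 \<Longrightarrow> \<psi> z \<in> \<Omega> \<and> \<phi> (\<psi> z) = z"
    and G: "flattening \<Omega> p e G"
  shows "\<exists>N X. bdry_chart \<Omega> \<phi> p N X"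
proof -
  note G' = G[unfolded flattening_def]
  have disj: "x \<notin> \<Omega>" if "x \<in> frontier \<Omega>" for x using that \<Omega> by (simp add: frontier_def interior_open)
  define f where "f w = \<phi> (G w)" for w
  let ?Bp = "\<lambda>e. ball (0::complex) e \<inter> {w. 0 < Im w}"
  have inO: "G w \<in> \<Omega>" if "w \<in> ?Bp e" for w using G' that by auto
  have holf: "f holomorphic_on ?Bp e"
  proof -
    have "G holomorphic_on ?Bp e" using G' by (meson holomorphic_on_subset Int_lower1)
    then have "(\<phi> \<circ> G) holomorphic_on ?Bp e" by (rule holomorphic_on_compose_gen[OF _ \<phi>]) (use inO in auto)
    then show ?thesis by (simp add: f_def[abs_def] o_def)
  qed
  have lim: "((\<lambda>w. norm (f w)) \<longlongrightarrow> 1) (at (of_real x) within ?Bp e)" if x: "\<bar>x\<bar> < e" for x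
  proof -
    have xb: "of_real x \<in> ball (0::complex) e" using x by simp
    have l: "((\<lambda>z. norm (\<phi> z)) \<longlongrightarrow> 1) (at (G (of_real x)) within \<Omega>)"
      by (rule riemann_map_norm_tendsto[OF \<Omega> holomorphic_on_imp_continuous_on[OF \<psi>] \<phi>\<psi>]) (use \<psi>\<phi> G' xb in auto)
    have "isCont G (of_real x)" using G' xb by (metis holomorphic_on_imp_continuous_on continuous_on_eq_continuous_at open_ball)
    then have "(G \<longlongrightarrow> G (of_real x)) (at (of_real x) within ?Bp e)"
      by (meson continuous_at_imp_continuous_at_within continuous_within)
    moreover have "\<forall>\<^sub>F w in at (of_real x) within ?Bp e. G w \<in> \<Omega> \<and> G w \<noteq> G (of_real x)"
      unfolding eventually_at_filter
    proof (intro always_eventually allI impI)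
      fix w assume w: "w \<in> ?Bp e"
      have "G (of_real x) \<in> frontier \<Omega>" using G' xb by auto
      then show "G w \<in> \<Omega> \<and> G w \<noteq> G (of_real x)" using inO[OF w] disj by metis
    qed
    ultimately have "filterlim G (at (G (of_real x)) within \<Omega>) (at (of_real x) within ?Bp e)"
      by (simp add: filterlim_at)
    from filterlim_compose[OF l this] show ?thesis by (simp add: f_def)
  qed
  have e0: "e > 0" using G' by blast
  \<comment> \<open>Reflection asks for |f| > 1/2. This holds after shrinking the half disc, since
    |f| tends to 1 at 0.\<close>
  obtain e1 where e1: "0 < e1" "e1 \<le> e" "\<And>w. w \<in> ?Bp e1 \<Longrightarrow> 1/2 < norm (f w)"
  proof -
    have "\<forall>\<^sub>F w in at 0 within ?Bp e. 1/2 < norm (f w)"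
      using order_tendstoD(1)[OF lim[of 0], of "1/2"] e0 by simp
    then obtain d where "d > 0" "\<forall>w\<in>?Bp e. w \<noteq> 0 \<and> dist w 0 < d \<longrightarrow> 1/2 < norm (f w)"
      unfolding eventually_at by blast
    then show thesis using e0 by (intro that[of "min d e"]) (auto simp: complex_eq_iff)
  qed
  have sub: "?Bp e1 \<subseteq> ?Bp e" using e1(2) by auto
  obtain F where F: "F holomorphic_on ball 0 e1" "\<And>w. w \<in> ball 0 e1 \<Longrightarrow> 0 < Im w \<Longrightarrow> F w = f w"
    "\<And>w. w \<in> ball 0 e1 \<Longrightarrow> Im w < 0 \<Longrightarrow> F w = 1 / cnj (f (cnj w))"
    "\<And>w. w \<in> ball 0 e1 \<Longrightarrow> Im w = 0 \<Longrightarrow> norm (F w) = 1"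
  proof (rule reflection_principle_modulus[OF e1(1) holomorphic_on_subset[OF holf sub]])
    show "norm (f w) < 1" if "w \<in> ball 0 e1" "0 < Im w" for w
      using \<phi>\<psi>[OF inO[of w]] that e1(2) by (auto simp: f_def)
    show "1/2 < norm (f w)" if "w \<in> ball 0 e1" "0 < Im w" for w using e1(3) that by auto
    show "((\<lambda>w. norm (f w)) \<longlongrightarrow> 1) (at (of_real x) within ?Bp e1)" if "\<bar>x\<bar> < e1" for x
      by (rule tendsto_within_subset[OF lim sub]) (use that e1(2) in auto)
  qed blast
  let ?B = "ball (0::complex) e1"
  have up: "norm (F w) < 1" if "w \<in> ?B" "0 < Im w" for w using F(2)[OF that] \<phi>\<psi>[OF inO[of w]] that e1(2) by (auto simp: f_def)
  have lo: "norm (F w) > 1" if "w \<in> ?B" "Im w < 0" for w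
  proof -
    have c: "cnj w \<in> ?Bp e1" using that by auto
    then have "norm (f (cnj w)) < 1" using up[of "cnj w"] F(2)[of "cnj w"] by auto
    moreover have "1/2 < norm (f (cnj w))" using e1(3)[OF c] .
    ultimately have "1 < 1 / norm (f (cnj w))" using less_divide_eq_1_pos[of "norm (f (cnj w))" 1] by linarith
    then show ?thesis using F(3)[OF that] by (simp add: norm_divide)
  qed
  have sgn: "0 < Im w \<longleftrightarrow> norm (F w) < 1" "Im w = 0 \<longleftrightarrow> norm (F w) = 1" "Im w < 0 \<longleftrightarrow> norm (F w) > 1" if "w \<in> ?B" for w
    using up[OF that] lo[OF that] F(4)[OF that] by (smt (verit))+
  have injf: "w = w'" if "w \<in> ?Bp e1" "w' \<in> ?Bp e1" "f w = f w'" for w w'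
  proof -
    have "G w = G w'" using \<phi>\<psi> inO that sub unfolding f_def by (metis subsetD)
    then show ?thesis using G' that sub by (metis IntD1 inj_on_eq_iff subsetD)
  qed
  have injF: "inj_on F ?B"
  proof (rule inj_onI)
    fix w w' assume w: "w \<in> ?B" "w' \<in> ?B" "F w = F w'"
    consider "0 < Im w" | "Im w < 0" | "Im w = 0" by linarith
    then show "w = w'"
    proof cases
      case 1
      then have "0 < Im w'" using sgn w by auto
      then show ?thesis using injf[of w w'] F(2) w 1 by auto
    next
      case 2
      then have "Im w' < 0" using sgn w by auto
      then have "f (cnj w) = f (cnj w')" using F(3) w 2 by (metis complex_cnj_cnj divide_divide_eq_right div_by_1 mult.right_neutral divide_self_if div_by_0 mult_1)
      then have "cnj w = cnj w'" using injf[of "cnj w" "cnj w'"] w 2 \<open>Im w' < 0\<close> by auto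
      then show ?thesis by simp
    next
      case 3
      then have w'0: "Im w' = 0" using sgn w by auto
      show ?thesis
      proof (rule ccontr)
        \<comment> \<open>On the diameter the reflection formula gives nothing. By open mapping,
          disjoint neighbourhoods of both points share a value q slightly inside the circle; q is
          then attained at two points of the upper half, where f is injective.\<close>
        assume ne: "w \<noteq> w'"
        obtain d where d: "d > 0" "ball w d \<subseteq> ?B" "ball w' d \<subseteq> ?B" "ball w d \<inter> ball w' d = {}"
        proof -
          obtain d1 where "d1 > 0" "ball w d1 \<subseteq> ?B" using w by (meson open_ball open_contains_ball)
          moreover obtain d2 where "d2 > 0" "ball w' d2 \<subseteq> ?B" using w by (meson open_ball open_contains_ball)
          moreover have "ball w (min (min d1 d2) (dist w w' / 2)) \<inter> ball w' (min (min d1 d2) (dist w w' / 2)) = {}"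
            using dist_triangle_half_r by (auto simp: disjoint_iff dist_commute)
          ultimately show thesis using ne by (intro that[of "min (min d1 d2) (dist w w' / 2)"]) auto
        qed
        have nc: "\<not> F constant_on ?B"
        proof
          assume "F constant_on ?B"
          then obtain y where y: "\<And>x. x \<in> ?B \<Longrightarrow> F x = y" unfolding constant_on_def by blast
          have "F (\<i> * of_real (e1/2)) = F 0" using y[of "\<i> * of_real (e1/2)"] y[of 0] e1(1) by (simp add: norm_mult)
          then show False using up[of "\<i> * of_real (e1/2)"] F(4)[of 0] e1(1) by (auto simp: norm_mult)
        qed
        have op: "open (F ` ball w d)" "open (F ` ball w' d)"
          using open_mapping_thm[OF F(1) open_ball connected_ball open_ball _ nc] d by auto
        have "F w \<in> F ` ball w d \<inter> F ` ball w' d" using d(1) w(3) by (metis IntI centre_in_ball imageI)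
        then obtain \<delta> where \<delta>: "\<delta> > 0" "ball (F w) \<delta> \<subseteq> F ` ball w d \<inter> F ` ball w' d"
          using open_contains_ball[THEN iffD1, OF open_Int[OF op]] by blast
        define q where "q = F w * of_real (1 - min \<delta> 1 / 2)"
        have n1: "norm (F w) = 1" using F(4)[OF w(1) 3] .
        have qd: "F w - q = F w * of_real (min \<delta> 1 / 2)" by (simp add: q_def algebra_simps)
        have "dist (F w) q = \<bar>min \<delta> 1 / 2\<bar>" unfolding dist_norm qd norm_mult n1 norm_of_real by simp
        then have "dist (F w) q < \<delta>" using \<delta>(1) by simp
        then have "q \<in> ball (F w) \<delta>" by simp
        then have "q \<in> F ` ball w d" "q \<in> F ` ball w' d" using \<delta>(2) by blast+
        then obtain a b where ab: "a \<in> ball w d" "b \<in> ball w' d" "q = F a" "q = F b" by blast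
        have q1: "norm q < 1" using n1 \<delta>(1) by (simp add: q_def norm_mult del: of_real_diff)
        have "a \<in> ?B" "b \<in> ?B" using ab d by auto
        then have "0 < Im a" "0 < Im b" using sgn(1) q1 ab by auto
        then have "a = b" using injf[of a b] F(2) ab \<open>a \<in> ?B\<close> \<open>b \<in> ?B\<close> by auto
        then show False using ab d(4) by auto
      qed
    qed
  qed
  have injG: "inj_on G ?B" and holG: "G holomorphic_on ?B"
    using G' e1(2) by (meson inj_on_subset holomorphic_on_subset subset_ball)+
  obtain g where g: "g holomorphic_on (G ` ?B)" "\<And>z. z \<in> ?B \<Longrightarrow> g (G z) = z"
    using holomorphic_has_inverse[OF holG open_ball injG] by metis
  show ?thesis
  proof (intro exI, unfold bdry_chart_def, intro conjI ballI)
    show "open (G ` ?B)" by (rule open_mapping_thm3[OF holG open_ball injG])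
    show "p \<in> G ` ?B" using G' e1(1) by (metis centre_in_ball imageI)
    have "(F \<circ> g) holomorphic_on G ` ?B" by (rule holomorphic_on_compose_gen[OF g(1) F(1)]) (use g(2) in auto)
    then show "(\<lambda>z. F (g z)) holomorphic_on G ` ?B" by (simp add: o_def)
    show "inj_on (\<lambda>z. F (g z)) (G ` ?B)" using injF g(2) by (auto simp: inj_on_def)
    fix z assume "z \<in> G ` ?B"
    then obtain w where w: "w \<in> ?B" "z = G w" by blast
    have wB: "w \<in> ball 0 e" using w e1(2) by auto
    have gz: "g z = w" using g(2) w by auto
    show "z \<in> \<Omega> \<longrightarrow> F (g z) = \<phi> z"
    proof
      assume z: "z \<in> \<Omega>"
      have "0 < Im w"
      proof (rule ccontr)
        assume "\<not> 0 < Im w"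
        then consider "Im w = 0" | "Im w < 0" by linarith
        then show False
        proof cases
          case 1
          then have "G w \<in> frontier \<Omega>" using G' wB by blast
          then show False using disj w z by blast
        next
          case 2
          then have "G w \<notin> closure \<Omega>" using G' wB by blast
          then show False using closure_subset[of \<Omega>] w z by blast
        qed
      qed
      then show "F (g z) = \<phi> z" using F(2) w gz by (simp add: f_def)
    qed
    show "norm (F (g z)) < 1 \<longrightarrow> z \<in> \<Omega>" using sgn(1)[OF w(1)] G' wB w gz by auto
    show "norm (F (g z)) = 1 \<longrightarrow> z \<in> frontier \<Omega>" using sgn(2)[OF w(1)] G' wB w gz by auto
  qed
qed

text \<open>The holomorphic extension \<Gamma> of the curve is itself the straightening. A nonreal w
  close to s0 cannot land on the curve, as the rest of a period is a compact arc away from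
  \<open>\<gamma> s0\<close>; so each half disc, being connected, lies on one side. Both sides occur
  because \<open>\<gamma> s0\<close> is a frontier point of both components.\<close>

lemma flattening_exists:
  assumes fr: "frontier \<Omega> = C" and fo: "frontier Out = C" and \<Omega>: "open \<Omega>" "open Out" "\<Omega> \<inter> Out = {}" "\<Omega> \<union> Out = - C"
    and T: "T > 0" "\<And>s. \<gamma> (s + T) = \<gamma> s" "\<And>s t. \<gamma> s = \<gamma> t \<Longrightarrow> \<exists>k::int. s - t = of_int k * T" "range \<gamma> = C"
    and ct: "continuous_on UNIV \<gamma>"
    and \<Gamma>: "d > 0" "\<Gamma> holomorphic_on ball (of_real s0) d" "\<And>s. \<bar>s - s0\<bar> < d \<Longrightarrow> \<Gamma> (of_real s) = \<gamma> s" "deriv \<Gamma> (of_real s0) \<noteq> 0"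
  shows "\<exists>e G. flattening \<Omega> (\<gamma> s0) e G"
proof -
  let ?s = "complex_of_real s0"
  obtain e1 where e1: "e1 > 0" "ball ?s e1 \<subseteq> ball ?s d" "inj_on \<Gamma> (ball ?s e1)"
    using has_complex_derivative_locally_injective[OF \<Gamma>(2) _ open_ball \<Gamma>(4)] \<Gamma>(1) by auto
  have per: "\<gamma> (s + of_int k * T) = \<gamma> s" for s and k :: int
  proof -
    have pos: "\<gamma> (s + of_nat n * T) = \<gamma> s" for s n
    proof (induction n)
      case (Suc n)
      have "\<gamma> (s + of_nat (Suc n) * T) = \<gamma> ((s + of_nat n * T) + T)" by (simp add: algebra_simps)
      then show ?case using T(2) Suc by simp
    qed simp
    show ?thesis
    proof (cases "k \<ge> 0")
      case True
      then show ?thesis using pos[of s "nat k"] by simp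
    next
      case False
      then show ?thesis using pos[of "s + of_int k * T" "nat (- k)"] by simp
    qed
  qed
  have red: "\<exists>s'. \<gamma> s' = \<gamma> s \<and> \<bar>s' - s0\<bar> \<le> T/2" for s
  proof -
    define k where "k = round ((s - s0) / T)"
    have "\<bar>of_int k - (s - s0) / T\<bar> \<le> 1/2" unfolding k_def by (rule of_int_round_abs_le)
    then have "\<bar>of_int k - (s - s0) / T\<bar> * T \<le> 1/2 * T" using T(1) by (intro mult_right_mono) auto
    moreover have "\<bar>of_int k - (s - s0) / T\<bar> * T = \<bar>of_int k * T - (s - s0)\<bar>"
    proof -
      have "(of_int k - (s - s0) / T) * T = of_int k * T - (s - s0)" using T(1) by (simp add: field_simps)
      moreover have "\<bar>of_int k - (s - s0) / T\<bar> * T = \<bar>(of_int k - (s - s0) / T) * T\<bar>" using T(1) by (simp add: abs_mult)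
      ultimately show ?thesis by simp
    qed
    ultimately have "\<bar>(s + of_int (- k) * T) - s0\<bar> \<le> T/2" by (simp add: abs_minus_commute algebra_simps)
    then show ?thesis using per by blast
  qed
  \<comment> \<open>The parameters of one period around s0 that keep a distance from s0. Their image
    is compact and misses \<open>\<gamma> s0\<close>, since the curve is injective modulo T.\<close>
  define S where "S = {s0 - T/2..s0 + T/2} \<inter> {s. e1/2 \<le> \<bar>s - s0\<bar>}"
  have "compact S" unfolding S_def by (intro compact_Int_closed closed_Collect_le continuous_intros) auto
  then have cS: "closed (\<gamma> ` S)" using ct by (intro compact_imp_closed compact_continuous_image) (auto intro: continuous_on_subset)
  have "\<gamma> s0 \<notin> \<gamma> ` S"
  proof
    assume "\<gamma> s0 \<in> \<gamma> ` S"
    then obtain s where s: "s \<in> S" "\<gamma> s = \<gamma> s0" by auto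
    then obtain k :: int where k: "s - s0 = of_int k * T" using T(3) by blast
    have "\<bar>of_int k * T\<bar> \<le> T/2" using s k by (auto simp: S_def)
    then have "\<bar>real_of_int k\<bar> * T \<le> 1/2 * T" using T(1) by (simp add: abs_mult)
    then have "\<bar>real_of_int k\<bar> \<le> 1/2" using T(1) by (simp only: mult_le_cancel_right_pos)
    then have "k = 0" by linarith
    then show False using s k e1(1) by (auto simp: S_def)
  qed
  then obtain d0 where d0: "d0 > 0" "ball (\<gamma> s0) d0 \<subseteq> - (\<gamma> ` S)" using cS by (metis ComplI open_Compl open_contains_ball)
  have \<Gamma>s: "\<Gamma> ?s = \<gamma> s0" using \<Gamma>(1,3) by simp
  have "isCont \<Gamma> ?s" using \<Gamma>(1,2) by (metis centre_in_ball holomorphic_on_imp_continuous_on continuous_on_eq_continuous_at open_ball)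
  then obtain e2 where e2: "e2 > 0" "\<And>w. dist w ?s < e2 \<Longrightarrow> dist (\<Gamma> w) (\<gamma> s0) < d0"
    unfolding continuous_at_eps_delta \<Gamma>s using d0(1) by metis
  define e where "e = min e1 e2"
  have e: "e > 0" "e \<le> e1" "e \<le> d" using e1 e2 \<Gamma>(1) by (auto simp: e_def ball_subset_ball_iff)
  let ?B = "ball ?s e"
  have real: "Im w = 0" if w: "w \<in> ?B" "\<Gamma> w \<in> C" for w
  proof -
    obtain s where s: "\<Gamma> w = \<gamma> s" "\<bar>s - s0\<bar> \<le> T/2" using w(2) T(4) red by (metis rangeE)
    have "dist (\<gamma> s) (\<gamma> s0) < d0" using e2(2)[of w] w(1) s(1) by (auto simp: e_def dist_commute)
    then have "\<gamma> s \<in> ball (\<gamma> s0) d0" by (simp add: dist_commute)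
    then have "\<gamma> s \<notin> \<gamma> ` S" using d0(2) by blast
    then have "s \<notin> S" by blast
    moreover have "s \<in> {s0 - T/2..s0 + T/2}" using s(2) unfolding atLeastAtMost_iff by linarith
    ultimately have "\<bar>s - s0\<bar> < e1/2" by (auto simp: S_def)
    then have se: "of_real s \<in> ball ?s e1" "\<bar>s - s0\<bar> < d"
      using e1 by (auto simp: dist_norm ball_subset_ball_iff abs_minus_commute simp flip: of_real_diff)
    have "\<Gamma> w = \<Gamma> (of_real s)" using \<Gamma>(3) se s by simp
    moreover have "w \<in> ball ?s e1" using w e by auto
    ultimately have "w = of_real s" using e1(3) se by (auto simp: inj_on_def)
    then show ?thesis by simp
  qed
  have onC: "\<Gamma> w \<in> C" if "w \<in> ?B" "Im w = 0" for w
  proof -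
    have "w = of_real (Re w)" using that by (simp add: complex_eq_iff)
    moreover have "\<bar>Re w - s0\<bar> < d" using that e abs_Re_le_cmod[of "w - ?s"] by (auto simp: dist_norm norm_minus_commute)
    ultimately show ?thesis using \<Gamma>(3) T(4) by (metis rangeI)
  qed
  have holB: "\<Gamma> holomorphic_on ?B" and injB: "inj_on \<Gamma> ?B" using \<Gamma>(2) e1(3) e by (meson holomorphic_on_subset inj_on_subset subset_ball)+
  have opB: "open (\<Gamma> ` ?B)" by (rule open_mapping_thm3[OF holB open_ball injB])
  have pB: "\<gamma> s0 \<in> \<Gamma> ` ?B" using \<Gamma>s e(1) by (metis centre_in_ball imageI)
  have pC: "\<gamma> s0 \<in> C" using T(4) by blast
  have side: "\<Gamma> ` H \<subseteq> \<Omega> \<or> \<Gamma> ` H \<subseteq> Out" if H: "H \<subseteq> ?B" "connected H" "\<And>w. w \<in> H \<Longrightarrow> Im w \<noteq> 0" for H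
  proof -
    have "connected (\<Gamma> ` H)" using H holB by (meson connected_continuous_image continuous_on_subset holomorphic_on_imp_continuous_on)
    moreover have "\<Gamma> ` H \<subseteq> \<Omega> \<union> Out" using real H \<Omega>(4) by blast
    ultimately show ?thesis using connectedD[of "\<Gamma> ` H" \<Omega> Out] \<Omega> by blast
  qed
  let ?U = "?B \<inter> {w. 0 < Im w}" and ?L = "?B \<inter> {w. Im w < 0}"
  have sU: "\<Gamma> ` ?U \<subseteq> \<Omega> \<or> \<Gamma> ` ?U \<subseteq> Out"
    by (rule side) (auto intro!: convex_connected convex_Int convex_halfspace_Im_gt)
  have sL: "\<Gamma> ` ?L \<subseteq> \<Omega> \<or> \<Gamma> ` ?L \<subseteq> Out"
    by (rule side) (auto intro!: convex_connected convex_Int convex_halfspace_Im_lt)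
  have meets: "\<exists>w\<in>?U \<union> ?L. \<Gamma> w \<in> Y" if Y: "frontier Y = C" "Y \<inter> C = {}" for Y
  proof -
    have "\<gamma> s0 \<in> closure Y" using pC Y by (auto simp: frontier_def)
    then have "Y \<inter> \<Gamma> ` ?B \<noteq> {}" using closure_iff_nhds_not_empty opB pB by (metis order_refl)
    then obtain w where w: "w \<in> ?B" "\<Gamma> w \<in> Y" by blast
    then have "Im w \<noteq> 0" using onC Y by blast
    then show ?thesis using w by (auto simp: not_less_iff_gr_or_eq)
  qed
  have mO: "\<exists>w\<in>?U \<union> ?L. \<Gamma> w \<in> \<Omega>" by (rule meets[OF fr]) (use \<Omega> in auto)
  have mX: "\<exists>w\<in>?U \<union> ?L. \<Gamma> w \<in> Out" by (rule meets[OF fo]) (use \<Omega> in auto)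
  have ncl: "z \<notin> closure \<Omega>" if "z \<in> Out" for z
    using that \<Omega> fr by (metis Un_iff closure_Un_frontier disjoint_iff ComplD UnI2)
  have "(\<Gamma> ` ?U \<subseteq> \<Omega> \<and> \<Gamma> ` ?L \<subseteq> Out) \<or> (\<Gamma> ` ?L \<subseteq> \<Omega> \<and> \<Gamma> ` ?U \<subseteq> Out)"
    using sU sL mO mX \<Omega>(3) by blast
  \<comment> \<open>The sign \<sigma> reverses the parameter if necessary, so that the upper half
    disc goes to the inside.\<close>
  then obtain \<sigma> :: complex where \<sigma>: "\<sigma> = 1 \<or> \<sigma> = -1" and sd: "\<And>w. w \<in> ?B \<Longrightarrow> 0 < Im (\<sigma> * w) \<Longrightarrow> \<Gamma> w \<in> \<Omega>" "\<And>w. w \<in> ?B \<Longrightarrow> Im (\<sigma> * w) < 0 \<Longrightarrow> \<Gamma> w \<in> Out"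
  proof
    assume a: "\<Gamma> ` ?U \<subseteq> \<Omega> \<and> \<Gamma> ` ?L \<subseteq> Out" show thesis by (rule that[of 1]) (use a in auto)
  next
    assume a: "\<Gamma> ` ?L \<subseteq> \<Omega> \<and> \<Gamma> ` ?U \<subseteq> Out" show thesis by (rule that[of "-1"]) (use a in auto)
  qed
  define G where "G w = \<Gamma> (?s + \<sigma> * w)" for w
  have inB: "?s + \<sigma> * w \<in> ?B" "Im (\<sigma> * (?s + \<sigma> * w)) = Im w" "Im w = 0 \<longrightarrow> Im (?s + \<sigma> * w) = 0" if "w \<in> ball 0 e" for w
    using that \<sigma> by (auto simp: dist_norm norm_mult)
  have "flattening \<Omega> (\<gamma> s0) e G" unfolding flattening_def
  proof (intro conjI ballI impI)
    show "e > 0" by fact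
    have "(\<Gamma> \<circ> (\<lambda>w. ?s + \<sigma> * w)) holomorphic_on ball 0 e"
      by (rule holomorphic_on_compose_gen[OF _ holB]) (use inB(1) in \<open>auto intro!: holomorphic_intros\<close>)
    then show "G holomorphic_on ball 0 e" by (simp add: G_def[abs_def] o_def)
    show "inj_on G (ball 0 e)"
    proof (rule inj_onI)
      fix x y assume xy: "x \<in> ball 0 e" "y \<in> ball 0 e" "G x = G y"
      then have "?s + \<sigma> * x = ?s + \<sigma> * y" using injB inB(1) unfolding G_def by (meson inj_on_eq_iff)
      then show "x = y" using \<sigma> by auto
    qed
    show "G 0 = \<gamma> s0" by (simp add: G_def \<Gamma>s)
    fix w :: complex assume w: "w \<in> ball 0 e"
    show "G w \<in> \<Omega>" if "0 < Im w" using sd(1)[OF inB(1)[OF w]] inB(2)[OF w] that by (simp add: G_def)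
    show "G w \<in> frontier \<Omega>" if "Im w = 0" using onC[OF inB(1)[OF w]] inB(3)[OF w] that fr by (simp add: G_def)
    show "G w \<notin> closure \<Omega>" if "Im w < 0" using ncl[OF sd(2)[OF inB(1)[OF w]]] inB(2)[OF w] that by (simp add: G_def)
  qed
  then show ?thesis by blast
qed

text \<open>One period of the curve is a simple closed path, so the Jordan curve theorem supplies
  inside and outside and the Riemann mapping theorem a map of the inside; the local extensions
  \<Gamma> yield its boundary charts. The set V bounds how far the extended map may reach.\<close>

theorem conformal_parametrization:
  fixes \<gamma> :: "real \<Rightarrow> complex"
  assumes T: "T > 0" "\<And>s. \<gamma> (s + T) = \<gamma> s" "\<And>s t. \<gamma> s = \<gamma> t \<Longrightarrow> \<exists>k::int. s - t = of_int k * T"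
    and \<Gamma>: "\<And>s0. \<exists>d \<Gamma>. d > 0 \<and> \<Gamma> holomorphic_on ball (of_real s0) d \<and> (\<forall>s. \<bar>s - s0\<bar> < d \<longrightarrow> \<Gamma> (of_real s) = \<gamma> s) \<and> deriv \<Gamma> (of_real s0) \<noteq> 0"
    and ct: "continuous_on UNIV \<gamma>"
    and V: "open V" "closure (inside (range \<gamma>)) \<subseteq> V"
  shows "open (inside (range \<gamma>))" "bounded (inside (range \<gamma>))" "frontier (inside (range \<gamma>)) = range \<gamma>"
    "\<exists>\<Psi> R. 1 < R \<and> \<Psi> holomorphic_on ball 0 R \<and> inj_on \<Psi> (ball 0 R) \<and> \<Psi> ` ball 0 1 = inside (range \<gamma>) \<and>
      \<Psi> ` sphere 0 1 = frontier (inside (range \<gamma>)) \<and> \<Psi> ` ball 0 R \<subseteq> V"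
proof -
  define c where "c u = \<gamma> (u * T)" for u
  have pc: "path c" unfolding path_def c_def by (intro continuous_on_compose2[OF ct] continuous_intros) auto
  have sp: "simple_path c" unfolding simple_path_def loop_free_def
  proof (intro conjI pc ballI impI)
    fix x y :: real assume xy: "x \<in> {0..1}" "y \<in> {0..1}" "c x = c y"
    then obtain k :: int where "x * T - y * T = of_int k * T" using T(3) unfolding c_def by blast
    then have "(x - y) * T = of_int k * T" by (simp add: left_diff_distrib)
    then have "x - y = of_int k" using T(1) by simp
    moreover then have "\<bar>real_of_int k\<bar> \<le> 1" using xy by (auto simp: abs_le_iff)
    then have "k = 0 \<or> k = 1 \<or> k = -1" by linarith
    ultimately show "x = y \<or> x = 0 \<and> y = 1 \<or> x = 1 \<and> y = 0" using xy by auto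
  qed
  have cl: "pathfinish c = pathstart c" using T(2)[of 0] by (simp add: c_def pathfinish_def pathstart_def)
  have per: "\<gamma> (s + of_nat n * T) = \<gamma> s" for s n
  proof (induction n)
    case (Suc n)
    have "\<gamma> (s + of_nat (Suc n) * T) = \<gamma> ((s + of_nat n * T) + T)" by (simp add: algebra_simps)
    then show ?case using T(2) Suc by simp
  qed simp
  have pi: "path_image c = range \<gamma>"
  proof
    show "path_image c \<subseteq> range \<gamma>" by (auto simp: path_image_def c_def)
    show "range \<gamma> \<subseteq> path_image c"
    proof
      fix z assume "z \<in> range \<gamma>"
      then obtain s where s: "z = \<gamma> s" by blast
      define k where "k = \<lfloor>s / T\<rfloor>"
      define u where "u = s / T - of_int k"
      have u: "0 \<le> u" "u \<le> 1" unfolding u_def k_def by linarith+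
      have us: "u * T + of_int k * T = s" using T(1) by (simp add: u_def algebra_simps)
      have "\<gamma> (u * T) = \<gamma> s"
      proof (cases "k \<ge> 0")
        case True
        then show ?thesis using per[of "u * T" "nat k"] us by simp
      next
        case False
        then have "u * T = s + of_nat (nat (- k)) * T" using us by simp
        then show ?thesis using per[of s "nat (- k)"] by simp
      qed
      then show "z \<in> path_image c" using u s unfolding path_image_def c_def by force
    qed
  qed
  let ?O = "inside (range \<gamma>)" and ?X = "outside (range \<gamma>)"
  note J = Jordan_inside_outside[OF sp cl, unfolded pi]
  show oO: "open ?O" and bO: "bounded ?O" and fO: "frontier ?O = range \<gamma>" using J by auto
  have "simply_connected ?O" using simply_connected_inside_simple_path[OF sp] by (simp add: pi)
  moreover have "?O \<noteq> {}" "?O \<noteq> UNIV" using J by auto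
  ultimately obtain \<phi> \<psi> where \<phi>: "\<phi> holomorphic_on ?O" "\<psi> holomorphic_on ball 0 1"
    "\<And>z. z \<in> ?O \<Longrightarrow> \<phi> z \<in> ball 0 1 \<and> \<psi> (\<phi> z) = z" "\<And>z. z \<in> ball 0 1 \<Longrightarrow> \<psi> z \<in> ?O \<and> \<phi> (\<psi> z) = z"
    using Riemann_mapping_theorem[of ?O] oO by metis
  have chart: "\<exists>N X. bdry_chart ?O \<phi> p N X" if p: "p \<in> frontier ?O" for p
  proof -
    obtain s0 where s0: "p = \<gamma> s0" using p fO by auto
    obtain d \<Gamma> where G: "d > 0" "\<Gamma> holomorphic_on ball (of_real s0) d" "\<And>s. \<bar>s - s0\<bar> < d \<Longrightarrow> \<Gamma> (of_real s) = \<gamma> s" "deriv \<Gamma> (of_real s0) \<noteq> 0"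
      using \<Gamma>[of s0] by blast
    have "\<exists>e G. flattening ?O (\<gamma> s0) e G"
      by (rule flattening_exists[where Out = ?X, OF fO _ oO _ _ _ T refl ct G]) (use J in auto)
    then show ?thesis using flattening_imp_chart[OF oO \<phi>] s0 by blast
  qed
  show "\<exists>\<Psi> R. 1 < R \<and> \<Psi> holomorphic_on ball 0 R \<and> inj_on \<Psi> (ball 0 R) \<and> \<Psi> ` ball 0 1 = ?O \<and>
      \<Psi> ` sphere 0 1 = frontier ?O \<and> \<Psi> ` ball 0 R \<subseteq> V"
    by (rule conformal_extension[OF oO bO \<phi> chart V]) blast+
qed

section \<open>Holomorphic functions of three variables\<close>

text \<open>Frechet differentiability with a complex linear derivative. The nested pair mirrors the
  shape (point, parameter) of the family; functions of fewer variables appear with dummy arguments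
  in the remaining slots.\<close>

definition hol3 :: "((complex \<times> complex) \<times> complex \<Rightarrow> complex) \<Rightarrow> ((complex \<times> complex) \<times> complex) set \<Rightarrow> bool" where
  "hol3 f S \<longleftrightarrow> (\<forall>p\<in>S. \<exists>a b c. (f has_derivative (\<lambda>((x, y), z). a * x + b * y + c * z)) (at p))"

definition D1 :: "((complex \<times> complex) \<times> complex \<Rightarrow> complex) \<Rightarrow> (complex \<times> complex) \<times> complex \<Rightarrow> complex" where
  "D1 f p = deriv (\<lambda>z. f ((z, snd (fst p)), snd p)) (fst (fst p))"

definition D2 :: "((complex \<times> complex) \<times> complex \<Rightarrow> complex) \<Rightarrow> (complex \<times> complex) \<times> complex \<Rightarrow> complex" where
  "D2 f p = deriv (\<lambda>z. f ((fst (fst p), z), snd p)) (snd (fst p))"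

definition D3 :: "((complex \<times> complex) \<times> complex \<Rightarrow> complex) \<Rightarrow> (complex \<times> complex) \<times> complex \<Rightarrow> complex" where
  "D3 f p = deriv (\<lambda>z. f (fst p, z)) (snd p)"

lemma hol3_mono: "hol3 f S \<Longrightarrow> T \<subseteq> S \<Longrightarrow> hol3 f T"
  by (auto simp: hol3_def)

lemma hol3_has_derivatives:
  assumes "hol3 f S" "((a, b), c) \<in> S"
  shows "((\<lambda>z. f ((z, b), c)) has_field_derivative D1 f ((a, b), c)) (at a)"
    "((\<lambda>z. f ((a, z), c)) has_field_derivative D2 f ((a, b), c)) (at b)"
    "((\<lambda>z. f ((a, b), z)) has_field_derivative D3 f ((a, b), c)) (at c)"
    "(f has_derivative (\<lambda>((x, y), z). D1 f ((a, b), c) * x + D2 f ((a, b), c) * y + D3 f ((a, b), c) * z)) (at ((a, b), c))"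
proof -
  obtain u v w where d: "(f has_derivative (\<lambda>((x, y), z). u * x + v * y + w * z)) (at ((a, b), c))"
    using assms unfolding hol3_def by blast
  have 1: "((\<lambda>z. f ((z, b), c)) has_field_derivative u) (at a)"
  proof -
    have "((\<lambda>z. ((z, b), c)) has_derivative (\<lambda>x. ((x, 0), 0))) (at a)"
      by (intro has_derivative_Pair has_derivative_ident has_derivative_const)
    from has_derivative_compose[OF this d] show ?thesis by (simp add: has_field_derivative_def)
  qed
  have 2: "((\<lambda>z. f ((a, z), c)) has_field_derivative v) (at b)"
  proof -
    have "((\<lambda>z. ((a, z), c)) has_derivative (\<lambda>x. ((0, x), 0))) (at b)"
      by (intro has_derivative_Pair has_derivative_ident has_derivative_const)
    from has_derivative_compose[OF this d] show ?thesis by (simp add: has_field_derivative_def)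
  qed
  have 3: "((\<lambda>z. f ((a, b), z)) has_field_derivative w) (at c)"
  proof -
    have "((\<lambda>z. ((a, b), z)) has_derivative (\<lambda>x. ((0, 0), x))) (at c)"
      by (intro has_derivative_Pair has_derivative_ident has_derivative_const)
    from has_derivative_compose[OF this d] show ?thesis by (simp add: has_field_derivative_def)
  qed
  have e: "D1 f ((a, b), c) = u" "D2 f ((a, b), c) = v" "D3 f ((a, b), c) = w"
    using DERIV_imp_deriv[OF 1] DERIV_imp_deriv[OF 2] DERIV_imp_deriv[OF 3] by (auto simp: D1_def D2_def D3_def)
  show "((\<lambda>z. f ((z, b), c)) has_field_derivative D1 f ((a, b), c)) (at a)"
    "((\<lambda>z. f ((a, z), c)) has_field_derivative D2 f ((a, b), c)) (at b)"
    "((\<lambda>z. f ((a, b), z)) has_field_derivative D3 f ((a, b), c)) (at c)"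
    "(f has_derivative (\<lambda>((x, y), z). D1 f ((a, b), c) * x + D2 f ((a, b), c) * y + D3 f ((a, b), c) * z)) (at ((a, b), c))"
    unfolding e using 1 2 3 d by auto
qed

lemma hol3_continuous_on: "hol3 f S \<Longrightarrow> continuous_on S f"
  unfolding hol3_def by (meson continuous_at_imp_continuous_on has_derivative_continuous)

lemma hol3_compose:
  assumes f: "hol3 f T" and g: "hol3 g1 S" "hol3 g2 S" "hol3 g3 S"
    and sub: "\<And>p. p \<in> S \<Longrightarrow> ((g1 p, g2 p), g3 p) \<in> T"
  shows "hol3 (\<lambda>p. f ((g1 p, g2 p), g3 p)) S"
  unfolding hol3_def
proof
  fix p assume p: "p \<in> S"
  obtain a1 b1 c1 where d1: "(g1 has_derivative (\<lambda>((x, y), z). a1 * x + b1 * y + c1 * z)) (at p)" using g p unfolding hol3_def by blast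
  obtain a2 b2 c2 where d2: "(g2 has_derivative (\<lambda>((x, y), z). a2 * x + b2 * y + c2 * z)) (at p)" using g p unfolding hol3_def by blast
  obtain a3 b3 c3 where d3: "(g3 has_derivative (\<lambda>((x, y), z). a3 * x + b3 * y + c3 * z)) (at p)" using g p unfolding hol3_def by blast
  obtain u v w where d: "(f has_derivative (\<lambda>((x, y), z). u * x + v * y + w * z)) (at ((g1 p, g2 p), g3 p))"
    using f sub[OF p] unfolding hol3_def by blast
  have "((\<lambda>p. f ((g1 p, g2 p), g3 p)) has_derivative
     (\<lambda>h. (\<lambda>((x, y), z). u * x + v * y + w * z) (((\<lambda>((x, y), z). a1 * x + b1 * y + c1 * z) h, (\<lambda>((x, y), z). a2 * x + b2 * y + c2 * z) h), (\<lambda>((x, y), z). a3 * x + b3 * y + c3 * z) h))) (at p)"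
    by (rule has_derivative_compose[of "\<lambda>p. ((g1 p, g2 p), g3 p)" _ p UNIV f, OF has_derivative_Pair[OF has_derivative_Pair[OF d1 d2] d3] d])
  also have "(\<lambda>h. (\<lambda>((x, y), z). u * x + v * y + w * z) (((\<lambda>((x, y), z). a1 * x + b1 * y + c1 * z) h, (\<lambda>((x, y), z). a2 * x + b2 * y + c2 * z) h), (\<lambda>((x, y), z). a3 * x + b3 * y + c3 * z) h))
    = (\<lambda>((x, y), z). (u * a1 + v * a2 + w * a3) * x + (u * b1 + v * b2 + w * b3) * y + (u * c1 + v * c2 + w * c3) * z)"
    by (auto simp: fun_eq_iff algebra_simps)
  finally show "\<exists>a b c. ((\<lambda>p. f ((g1 p, g2 p), g3 p)) has_derivative (\<lambda>((x, y), z). a * x + b * y + c * z)) (at p)" by blast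
qed

lemma hol3_coords: "hol3 (\<lambda>p. fst (fst p)) S" "hol3 (\<lambda>p. snd (fst p)) S" "hol3 snd S" "hol3 (\<lambda>p. w) S"
proof -
  have e: "(\<lambda>h. fst (fst h)) = (\<lambda>((x, y), z). 1 * x + 0 * y + 0 * z :: complex)" "(\<lambda>h. snd (fst h)) = (\<lambda>((x, y), z). 0 * x + 1 * y + 0 * z :: complex)"
    "snd = (\<lambda>((x, y), z). 0 * x + 0 * y + 1 * z :: complex)" "(\<lambda>h. 0) = (\<lambda>((x, y), z). 0 * x + 0 * y + 0 * z :: complex)"
    by (auto simp: fun_eq_iff)
  have "((\<lambda>p. fst (fst p)) has_derivative (\<lambda>h. fst (fst h))) (at p)" "((\<lambda>p. snd (fst p)) has_derivative (\<lambda>h. snd (fst h))) (at p)"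
    "(snd has_derivative snd) (at p)" "((\<lambda>p. w) has_derivative (\<lambda>h. 0)) (at p)" for p :: "(complex \<times> complex) \<times> complex"
    by (auto intro!: has_derivative_fst has_derivative_snd has_derivative_ident has_derivative_const)
  then show "hol3 (\<lambda>p. fst (fst p)) S" "hol3 (\<lambda>p. snd (fst p)) S" "hol3 snd S" "hol3 (\<lambda>p. w) S"
    unfolding hol3_def e by blast+
qed

lemma hol3_holomorphic:
  assumes "h holomorphic_on T" "open T" "hol3 g S" "\<And>p. p \<in> S \<Longrightarrow> g p \<in> T"
  shows "hol3 (\<lambda>p. h (g p)) S"
proof -
  have "hol3 (\<lambda>p. h (fst (fst p))) {p. fst (fst p) \<in> T}"
    unfolding hol3_def
  proof
    fix p :: "(complex \<times> complex) \<times> complex" assume "p \<in> {p. fst (fst p) \<in> T}"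
    then have d: "(h has_derivative (*) (deriv h (fst (fst p)))) (at (fst (fst p)))"
      using holomorphic_derivI[OF assms(1,2)] by (auto simp: has_field_derivative_def)
    have "((\<lambda>p. h (fst (fst p))) has_derivative (\<lambda>q. deriv h (fst (fst p)) * fst (fst q))) (at p)"
      by (rule has_derivative_compose[of "\<lambda>p. fst (fst p)" _ p UNIV h, OF _ d]) (auto intro!: derivative_eq_intros)
    also have "(\<lambda>q. deriv h (fst (fst p)) * fst (fst q)) = (\<lambda>((x, y), z). deriv h (fst (fst p)) * x + 0 * y + 0 * z)"
      by (auto simp: fun_eq_iff)
    finally show "\<exists>a b c. ((\<lambda>p. h (fst (fst p))) has_derivative (\<lambda>((x, y), z). a * x + b * y + c * z)) (at p)" by blast
  qed
  from hol3_compose[OF this assms(3) hol3_coords(4) hol3_coords(4)] assms(4)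
  show ?thesis by simp
qed

lemma hol3_add: assumes "hol3 f S" "hol3 g S" shows "hol3 (\<lambda>p. f p + g p) S"
  unfolding hol3_def
proof
  fix p assume p: "p \<in> S"
  obtain a1 b1 c1 where d1: "(f has_derivative (\<lambda>((x, y), z). a1 * x + b1 * y + c1 * z)) (at p)" using assms p unfolding hol3_def by blast
  obtain a2 b2 c2 where d2: "(g has_derivative (\<lambda>((x, y), z). a2 * x + b2 * y + c2 * z)) (at p)" using assms p unfolding hol3_def by blast
  have e: "(\<lambda>h. (\<lambda>((x, y), z). a1 * x + b1 * y + c1 * z) h + (\<lambda>((x, y), z). a2 * x + b2 * y + c2 * z) h)
    = (\<lambda>((x, y), z). (a1 + a2) * x + (b1 + b2) * y + (c1 + c2) * z)" by (auto simp: fun_eq_iff algebra_simps)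
  have "((\<lambda>p. f p + g p) has_derivative (\<lambda>((x, y), z). (a1 + a2) * x + (b1 + b2) * y + (c1 + c2) * z)) (at p)"
    using has_derivative_add[OF d1 d2] unfolding e .
  then show "\<exists>a b c. ((\<lambda>p. f p + g p) has_derivative (\<lambda>((x, y), z). a * x + b * y + c * z)) (at p)" by blast
qed

lemma hol3_mult: assumes "hol3 f S" "hol3 g S" shows "hol3 (\<lambda>p. f p * g p) S"
proof -
  have "hol3 (\<lambda>p. fst (fst p) * snd (fst p)) UNIV"
    unfolding hol3_def
  proof
    fix p :: "(complex \<times> complex) \<times> complex"
    have "((\<lambda>p. fst (fst p) * snd (fst p)) has_derivative (\<lambda>h. fst (fst p) * snd (fst h) + fst (fst h) * snd (fst p))) (at p)"
      by (auto intro!: derivative_eq_intros)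
    also have "(\<lambda>h. fst (fst p) * snd (fst h) + fst (fst h) * snd (fst p)) = (\<lambda>((x, y), z). snd (fst p) * x + fst (fst p) * y + 0 * z)" by (auto simp: fun_eq_iff)
    finally show "\<exists>a b c. ((\<lambda>p. fst (fst p) * snd (fst p)) has_derivative (\<lambda>((x, y), z). a * x + b * y + c * z)) (at p)" by blast
  qed
  from hol3_compose[OF this assms hol3_coords(4)] show ?thesis by simp
qed

lemma hol3_diff: assumes "hol3 f S" "hol3 g S" shows "hol3 (\<lambda>p. f p - g p) S"
  using hol3_add[OF assms(1) hol3_mult[OF hol3_coords(4)[of "-1"] assms(2)]] by simp

lemma hol3_power: "hol3 f S \<Longrightarrow> hol3 (\<lambda>p. f p ^ n) S"
  by (induction n) (auto intro: hol3_mult hol3_coords)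

lemma hol3_prod: "(\<And>i. i \<in> I \<Longrightarrow> hol3 (f i) S) \<Longrightarrow> hol3 (\<lambda>p. \<Prod>i\<in>I. f i p) S"
  by (induction I rule: infinite_finite_induct) (auto intro: hol3_mult hol3_coords)

lemma hol3_sum: "(\<And>i. i \<in> I \<Longrightarrow> hol3 (f i) S) \<Longrightarrow> hol3 (\<lambda>p. \<Sum>i\<in>I. f i p) S"
  by (induction I rule: infinite_finite_induct) (auto intro: hol3_add hol3_coords)

section \<open>Separately holomorphic functions\<close>

definition sephol3 :: "((complex \<times> complex) \<times> complex \<Rightarrow> complex) \<Rightarrow> ((complex \<times> complex) \<times> complex) set \<Rightarrow> bool" where
  "sephol3 f S \<longleftrightarrow> continuous_on S f \<and> (\<forall>a b c. ((a, b), c) \<in> S \<longrightarrow>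
     (\<lambda>z. f ((z, b), c)) field_differentiable at a \<and> (\<lambda>z. f ((a, z), c)) field_differentiable at b \<and>
     (\<lambda>z. f ((a, b), z)) field_differentiable at c)"

lemma hol3_imp_sephol3: "hol3 f S \<Longrightarrow> sephol3 f S"
  unfolding sephol3_def field_differentiable_def using hol3_has_derivatives hol3_continuous_on by metis

text \<open>The difference of two slices is uniformly small on a circle, so by the Cauchy inequality its
  derivative at the centre is small.\<close>
lemma continuous_on_slice_deriv:
  fixes f :: "'p::metric_space \<Rightarrow> complex" and e :: "'p \<Rightarrow> complex \<Rightarrow> 'p"
  assumes "open S" and f: "continuous_on S f"
    and e: "continuous_on UNIV (\<lambda>x. e (fst x) (snd x))" and e0: "\<And>p. e p 0 = p"
    and hol: "\<And>p h. e p h \<in> S \<Longrightarrow> (\<lambda>z. f (e p z)) field_differentiable at h"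
  shows "continuous_on S (\<lambda>p. deriv (\<lambda>z. f (e p z)) 0)"
proof (rule continuous_at_imp_continuous_on, rule ballI)
  fix p assume p: "p \<in> S"
  define g where "g x = f (e (fst x) (snd x))" for x
  let ?V = "(\<lambda>x. e (fst x) (snd x)) -` S"
  have oV: "open ?V" using e \<open>open S\<close> by (rule open_vimage[rotated])
  have cg: "continuous_on ?V g"
    unfolding g_def by (rule continuous_on_compose2[OF f continuous_on_subset[OF e]]) auto
  have "(p, 0) \<in> ?V" using p e0 by simp
  from open_prod_elim[OF oV this]
  obtain A B where AB: "open A" "open B" "p \<in> A" "0 \<in> B" "A \<times> B \<subseteq> ?V"
    by (metis mem_Sigma_iff)
  obtain \<delta> where \<delta>: "\<delta> > 0" "cball 0 \<delta> \<subseteq> B" using AB(2,4) open_contains_cball by blast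
  have hq: "(\<lambda>z. f (e q z)) field_differentiable at h" if "q \<in> A" "h \<in> cball 0 \<delta>" for q h
  proof (rule hol)
    have "(q, h) \<in> A \<times> B" using that \<delta>(2) by auto
    then show "e q h \<in> S" using AB(5) by auto
  qed
  have "\<forall>\<epsilon>>0. \<exists>d>0. \<forall>q. dist q p < d \<longrightarrow> dist (deriv (\<lambda>z. f (e q z)) 0) (deriv (\<lambda>z. f (e p z)) 0) < \<epsilon>"
  proof (intro allI impI)
    fix \<epsilon> :: real assume "\<epsilon> > 0"
    define \<mu> where "\<mu> = \<epsilon> * \<delta> / 2"
    have "\<mu> > 0" using \<open>\<epsilon> > 0\<close> \<delta> by (simp add: \<mu>_def)
    obtain X0 where X0: "p \<in> X0" "open X0" "\<forall>x\<in>X0 \<inter> A. \<forall>t\<in>cball 0 \<delta>. dist (g (x, t)) (g (p, t)) \<le> \<mu>"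
    proof (rule continuous_on_prod_compactE[of A "cball 0 \<delta>" g p \<mu>])
      show "continuous_on (A \<times> cball 0 \<delta>) g"
        using AB(5) \<delta>(2) by (intro continuous_on_subset[OF cg]) blast
    qed (use AB \<open>\<mu> > 0\<close> in auto)
    obtain d where d: "d > 0" "ball p d \<subseteq> X0 \<inter> A" using X0 AB by (meson IntI open_Int open_contains_ball)
    show "\<exists>d>0. \<forall>q. dist q p < d \<longrightarrow> dist (deriv (\<lambda>z. f (e q z)) 0) (deriv (\<lambda>z. f (e p z)) 0) < \<epsilon>"
    proof (intro exI[of _ d] conjI allI impI d)
      fix q assume "dist q p < d"
      then have q: "q \<in> X0" "q \<in> A" using d by (auto simp: dist_commute)
      let ?k = "\<lambda>z. f (e q z) - f (e p z)"
      have dk: "?k field_differentiable at h" if "h \<in> cball 0 \<delta>" for h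
        by (intro field_differentiable_diff hq q AB that)
      have "norm ((deriv ^^ 1) ?k 0) \<le> fact 1 * \<mu> / \<delta> ^ 1"
      proof (rule Cauchy_inequality)
        show "?k holomorphic_on ball 0 \<delta>"
          by (rule holomorphic_onI, rule field_differentiable_at_within, rule dk) auto
        show "continuous_on (cball 0 \<delta>) ?k"
          using dk continuous_at_imp_continuous_on field_differentiable_imp_continuous_at by blast
        fix x :: complex assume "norm (0 - x) = \<delta>"
        then show "norm (?k x) \<le> \<mu>" using X0(3) q by (auto simp: g_def dist_norm)
      qed (use \<delta> in auto)
      moreover have "deriv ?k 0 = deriv (\<lambda>z. f (e q z)) 0 - deriv (\<lambda>z. f (e p z)) 0"
        using hq q AB \<delta> by (intro deriv_diff) auto
      ultimately have "dist (deriv (\<lambda>z. f (e q z)) 0) (deriv (\<lambda>z. f (e p z)) 0) \<le> \<mu> / \<delta>"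
        by (simp add: dist_norm)
      also have "\<dots> < \<epsilon>" using \<delta> \<open>\<epsilon> > 0\<close> by (simp add: \<mu>_def)
      finally show "dist (deriv (\<lambda>z. f (e q z)) 0) (deriv (\<lambda>z. f (e p z)) 0) < \<epsilon>" .
    qed
  qed
  then show "isCont (\<lambda>p. deriv (\<lambda>z. f (e p z)) 0) p" by (simp add: continuous_at_eps_delta)
qed

lemma deriv_shift: "deriv (\<lambda>z. g (a + z)) 0 = deriv g (a :: complex)"
proof -
  have "((\<lambda>z. g (a + z)) has_field_derivative D) (at 0) = (g has_field_derivative D) (at a)" for D
    using DERIV_shift[of g D 0 a] by (simp add: add.commute)
  then show ?thesis by (simp add: deriv_def)
qed

lemma sephol3_continuous_D:
  assumes "open S" "sephol3 f S"
  shows "continuous_on S (D1 f)" "continuous_on S (D2 f)" "continuous_on S (D3 f)"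
proof -
  have sh: "(\<lambda>z. g (a + z)) field_differentiable at h" if gd: "g field_differentiable at (a + h)" for g a and h :: complex
  proof -
    obtain D where "(g has_field_derivative D) (at (h + a))"
      using gd unfolding field_differentiable_def add.commute[of h a] by blast
    then have "((\<lambda>x. g (x + a)) has_field_derivative D) (at h)" by (simp only: DERIV_shift)
    then show ?thesis by (auto simp: field_differentiable_def add.commute)
  qed
  have f: "continuous_on S f" using assms(2) by (simp add: sephol3_def)
  have "continuous_on S (\<lambda>p. deriv (\<lambda>z. f ((fst (fst p) + z, snd (fst p)), snd p)) 0)"
  proof (rule continuous_on_slice_deriv[OF assms(1) f, of "\<lambda>p z. ((fst (fst p) + z, snd (fst p)), snd p)"])
    fix p h assume "((fst (fst p) + h, snd (fst p)), snd p) \<in> S"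
    then show "(\<lambda>z. f ((fst (fst p) + z, snd (fst p)), snd p)) field_differentiable at h"
      using assms(2) by (intro sh[of "\<lambda>z. f ((z, snd (fst p)), snd p)" "fst (fst p)" h]) (auto simp: sephol3_def)
  qed (auto intro!: continuous_intros)
  then show "continuous_on S (D1 f)" by (simp only: D1_def[abs_def] deriv_shift[of "\<lambda>z. f ((z, snd (fst p)), snd p)" "fst (fst p)" for p])
  have "continuous_on S (\<lambda>p. deriv (\<lambda>z. f ((fst (fst p), snd (fst p) + z), snd p)) 0)"
  proof (rule continuous_on_slice_deriv[OF assms(1) f, of "\<lambda>p z. ((fst (fst p), snd (fst p) + z), snd p)"])
    fix p h assume "((fst (fst p), snd (fst p) + h), snd p) \<in> S"
    then show "(\<lambda>z. f ((fst (fst p), snd (fst p) + z), snd p)) field_differentiable at h"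
      using assms(2) by (intro sh[of "\<lambda>z. f ((fst (fst p), z), snd p)" "snd (fst p)" h]) (auto simp: sephol3_def)
  qed (auto intro!: continuous_intros)
  then show "continuous_on S (D2 f)" by (simp only: D2_def[abs_def] deriv_shift[of "\<lambda>z. f ((fst (fst p), z), snd p)" "snd (fst p)" for p])
  have "continuous_on S (\<lambda>p. deriv (\<lambda>z. f (fst p, snd p + z)) 0)"
  proof (rule continuous_on_slice_deriv[OF assms(1) f, of "\<lambda>p z. (fst p, snd p + z)"])
    fix p h assume "(fst p, snd p + h) \<in> S"
    then show "(\<lambda>z. f (fst p, snd p + z)) field_differentiable at h"
      using assms(2) by (intro sh[of "\<lambda>z. f (fst p, z)" "snd p" h], cases "fst p") (auto simp: sephol3_def)
  qed (auto intro!: continuous_intros)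
  then show "continuous_on S (D3 f)" by (simp only: D3_def[abs_def] deriv_shift[of "\<lambda>z. f (fst p, z)" "snd p" for p])
qed

text \<open>Osgood's lemma. Continuity together with holomorphy in each variable makes the partial
  derivatives continuous, and continuous partial derivatives assemble to a Frechet derivative, here
  in two stages: the first pair of variables, then the third.\<close>

lemma sephol3_imp_hol3:
  assumes "open S" "sephol3 f S" shows "hol3 f S"
  unfolding hol3_def
proof
  fix p assume "p \<in> S"
  moreover obtain a b c where p: "p = ((a, b), c)" by (metis prod.collapse)
  ultimately have "((a, b), c) \<in> S" by simp
  from open_prod_elim[OF assms(1) this]
  obtain U C where UC: "open U" "open C" "(a, b) \<in> U" "c \<in> C" "U \<times> C \<subseteq> S"
    by (metis mem_Sigma_iff)
  from open_prod_elim[OF UC(1,3)]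
  obtain A B where AB: "open A" "open B" "a \<in> A" "b \<in> B" "A \<times> B \<subseteq> U"
    by (metis mem_Sigma_iff)
  obtain ea eb ec where "ea > 0" "eb > 0" "ec > 0" "ball a ea \<subseteq> A" "ball b eb \<subseteq> B" "ball c ec \<subseteq> C"
    using UC AB by (meson open_contains_ball)
  note US = UC(5) AB(5)
  define X Y Z where "X = ball a ea" and "Y = ball b eb" and "Z = ball c ec"
  have "(X \<times> Y) \<times> Z \<subseteq> S"
    using US \<open>ball a ea \<subseteq> A\<close> \<open>ball b eb \<subseteq> B\<close> \<open>ball c ec \<subseteq> C\<close>
    unfolding X_def Y_def Z_def by (meson Sigma_mono subset_trans)
  then have XYZ: "(X \<times> Y) \<times> Z \<subseteq> S" "a \<in> X" "b \<in> Y" "c \<in> Z" "open X" "open Y" "open Z" "convex Y" "convex Z"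
    using \<open>ea > 0\<close> \<open>eb > 0\<close> \<open>ec > 0\<close>
    unfolding X_def Y_def Z_def by auto
  note cD = sephol3_continuous_D[OF assms]
  have d: "((\<lambda>z. f ((z, y), w)) has_field_derivative D1 f ((x, y), w)) (at x)"
    "((\<lambda>z. f ((x, z), w)) has_field_derivative D2 f ((x, y), w)) (at y)"
    "((\<lambda>z. f ((x, y), z)) has_field_derivative D3 f ((x, y), w)) (at w)" if "x \<in> X" "y \<in> Y" "w \<in> Z" for x y w
    using assms(2) XYZ(1) that unfolding sephol3_def D1_def D2_def D3_def
    by (auto simp: DERIV_deriv_iff_field_differentiable)
  have bl: "blinfun_apply (blinfun_mult_right w) = (*) w" for w :: complex
    by (auto simp: fun_eq_iff)
  have "((\<lambda>(x, y). f ((x, y), c)) has_derivative (\<lambda>(h, k). D1 f ((a, b), c) * h + blinfun_apply (blinfun_mult_right (D2 f ((a, b), c))) k)) (at (a, b) within X \<times> Y)"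
  proof (rule has_derivative_partialsI[where fy = "\<lambda>x y. blinfun_mult_right (D2 f ((x, y), c))"])
    show "((\<lambda>x. f ((x, b), c)) has_derivative (*) (D1 f ((a, b), c))) (at a within X)"
      using d(1)[OF XYZ(2-4)] by (simp add: has_field_derivative_def has_derivative_at_withinI)
    fix x y assume "x \<in> X" "y \<in> Y"
    then show "((\<lambda>y. f ((x, y), c)) has_derivative blinfun_apply (blinfun_mult_right (D2 f ((x, y), c)))) (at y within Y)"
      using d(2)[OF _ _ XYZ(4), of x y] unfolding bl by (simp add: has_field_derivative_def has_derivative_at_withinI)
  next
    have "continuous_on (X \<times> Y) (\<lambda>p. blinfun_mult_right (D2 f ((fst p, snd p), c)))"
      by (intro continuous_intros continuous_on_compose2[OF cD(2)]) (use XYZ in auto)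
    then show "continuous (at (a, b) within X \<times> Y) (\<lambda>(x, y). blinfun_mult_right (D2 f ((x, y), c)))"
      using XYZ by (auto simp: continuous_on_eq_continuous_within case_prod_unfold)
  qed (use XYZ in auto)
  then have d12: "((\<lambda>q. f (q, c)) has_derivative (\<lambda>(h, k). D1 f ((a, b), c) * h + D2 f ((a, b), c) * k)) (at (a, b))"
  proof -
    have e: "(\<lambda>(x, y). f ((x, y), c)) = (\<lambda>q. f (q, c))" by auto
    assume "((\<lambda>(x, y). f ((x, y), c)) has_derivative (\<lambda>(h, k). D1 f ((a, b), c) * h + blinfun_apply (blinfun_mult_right (D2 f ((a, b), c))) k)) (at (a, b) within X \<times> Y)"
    moreover have "at (a, b) within X \<times> Y = at (a, b)" by (rule at_within_open) (use XYZ in \<open>auto intro: open_Times\<close>)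
    ultimately show ?thesis unfolding e bl by simp
  qed
  have "((\<lambda>(q, z). f (q, z)) has_derivative (\<lambda>(h, k). (\<lambda>(h, k). D1 f ((a, b), c) * h + D2 f ((a, b), c) * k) h + blinfun_apply (blinfun_mult_right (D3 f ((a, b), c))) k)) (at ((a, b), c) within (X \<times> Y) \<times> Z)"
  proof (rule has_derivative_partialsI[where fy = "\<lambda>q z. blinfun_mult_right (D3 f (q, z))"])
    show "((\<lambda>q. f (q, c)) has_derivative (\<lambda>(h, k). D1 f ((a, b), c) * h + D2 f ((a, b), c) * k)) (at (a, b) within X \<times> Y)"
      by (rule has_derivative_at_withinI[OF d12])
    fix q z assume "q \<in> X \<times> Y" "z \<in> Z"
    then show "((\<lambda>z. f (q, z)) has_derivative blinfun_apply (blinfun_mult_right (D3 f (q, z)))) (at z within Z)"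
      using d(3)[of "fst q" "snd q" z] unfolding bl by (auto simp: has_field_derivative_def has_derivative_at_withinI)
  next
    have "continuous_on ((X \<times> Y) \<times> Z) (\<lambda>p. blinfun_mult_right (D3 f (fst p, snd p)))"
      by (intro continuous_intros continuous_on_compose2[OF cD(3)]) (use XYZ in auto)
    then show "continuous (at ((a, b), c) within (X \<times> Y) \<times> Z) (\<lambda>(q, z). blinfun_mult_right (D3 f (q, z)))"
      using XYZ by (auto simp: continuous_on_eq_continuous_within case_prod_unfold)
  qed (use XYZ in auto)
  then have "(f has_derivative (\<lambda>((h, k), l). D1 f ((a, b), c) * h + D2 f ((a, b), c) * k + D3 f ((a, b), c) * l)) (at p)"
  proof -
    have e: "(\<lambda>(q, z). f (q, z)) = f" by auto
    have e': "(\<lambda>(h, k). (\<lambda>(h, k). D1 f ((a, b), c) * h + D2 f ((a, b), c) * k) h + D3 f ((a, b), c) * k) =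
       (\<lambda>((h, k), l). D1 f ((a, b), c) * h + D2 f ((a, b), c) * k + D3 f ((a, b), c) * l)" by auto
    assume "((\<lambda>(q, z). f (q, z)) has_derivative (\<lambda>(h, k). (\<lambda>(h, k). D1 f ((a, b), c) * h + D2 f ((a, b), c) * k) h + blinfun_apply (blinfun_mult_right (D3 f ((a, b), c))) k)) (at ((a, b), c) within (X \<times> Y) \<times> Z)"
    moreover have "at ((a, b), c) within (X \<times> Y) \<times> Z = at ((a, b), c)" by (rule at_within_open) (use XYZ in \<open>auto intro!: open_Times\<close>)
    ultimately show ?thesis unfolding e bl e' p by simp
  qed
  then show "\<exists>a b c. (f has_derivative (\<lambda>((x, y), z). a * x + b * y + c * z)) (at p)" by blast
qed

text \<open>Separate holomorphy passes to uniform limits directly: on each coordinate line it is the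
  one-variable theorem. This makes it the convenient intermediate notion for sums of series.\<close>

lemma uniform_limit_sephol3:
  assumes "open S" and f: "eventually (\<lambda>n. sephol3 (f n) S) F" and lim: "uniform_limit S f g F" and "F \<noteq> bot"
  shows "sephol3 g S"
proof -
  have line: "(\<lambda>z. g (e z)) field_differentiable at a"
    if e: "continuous_on UNIV e" "e a \<in> S" and d: "\<And>h z. sephol3 h S \<Longrightarrow> e z \<in> S \<Longrightarrow> (\<lambda>z. h (e z)) field_differentiable at z" for e a
  proof -
    have "open (e -` S)" using e \<open>open S\<close> by (simp add: open_vimage)
    then obtain \<delta> where \<delta>: "\<delta> > 0" "cball a \<delta> \<subseteq> e -` S" using e(2) by (meson open_contains_cball vimageI)
    have "eventually (\<lambda>n. continuous_on (cball a \<delta>) (\<lambda>z. f n (e z)) \<and> (\<lambda>z. f n (e z)) holomorphic_on ball a \<delta>) F"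
      using f
    proof eventually_elim
      case (elim n)
      have fd: "(\<lambda>z. f n (e z)) field_differentiable at z" if "z \<in> cball a \<delta>" for z
        by (rule d[OF elim]) (use \<delta> that in auto)
      show ?case
      proof
        show "continuous_on (cball a \<delta>) (\<lambda>z. f n (e z))"
          using fd continuous_at_imp_continuous_on field_differentiable_imp_continuous_at by blast
        show "(\<lambda>z. f n (e z)) holomorphic_on ball a \<delta>"
          by (rule holomorphic_onI, rule field_differentiable_at_within, rule fd) auto
      qed
    qed
    moreover have "uniform_limit (cball a \<delta>) (\<lambda>n z. f n (e z)) (\<lambda>z. g (e z)) F"
      by (rule uniform_limit_compose'[OF lim]) (use \<delta> in auto)
    ultimately have "(\<lambda>z. g (e z)) holomorphic_on ball a \<delta>"
      using holomorphic_uniform_limit[of a \<delta> "\<lambda>n z. f n (e z)" F "\<lambda>z. g (e z)"] \<open>F \<noteq> bot\<close> by blast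
    then show ?thesis using \<delta>(1) by (simp add: holomorphic_on_imp_differentiable_at)
  qed
  show ?thesis unfolding sephol3_def
  proof (intro conjI allI impI)
    show "continuous_on S g"
      by (rule uniform_limit_theorem[OF _ lim]) (use f assms(4) in \<open>auto simp: sephol3_def elim: eventually_mono\<close>)
    fix a b c assume p: "((a, b), c) \<in> S"
    show "(\<lambda>z. g ((z, b), c)) field_differentiable at a"
      by (rule line[of "\<lambda>z. ((z, b), c)" a]) (use p in \<open>auto simp: sephol3_def intro!: continuous_intros\<close>)
    show "(\<lambda>z. g ((a, z), c)) field_differentiable at b"
      by (rule line[of "\<lambda>z. ((a, z), c)" b]) (use p in \<open>auto simp: sephol3_def intro!: continuous_intros\<close>)
    show "(\<lambda>z. g ((a, b), z)) field_differentiable at c"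
      by (rule line[of "\<lambda>z. ((a, b), z)" c]) (use p in \<open>auto simp: sephol3_def intro!: continuous_intros\<close>)
  qed
qed

text \<open>The limit is taken along finite subsets, so unordered sums such as power series over
  multi-indices are covered without an enumeration of the index set.\<close>

lemma hol3_has_sum:
  assumes "open S" and f: "\<And>i. i \<in> I \<Longrightarrow> hol3 (f i) S" and M: "\<And>i p. i \<in> I \<Longrightarrow> p \<in> S \<Longrightarrow> norm (f i p) \<le> M i"
    and "M summable_on I" and s: "\<And>p. p \<in> S \<Longrightarrow> ((\<lambda>i. f i p) has_sum g p) I"
  shows "hol3 g S"
proof (rule sephol3_imp_hol3[OF \<open>open S\<close>], rule uniform_limit_sephol3[OF \<open>open S\<close>])
  show "uniform_limit S (\<lambda>X p. \<Sum>i\<in>X. f i p) g (finite_subsets_at_top I)"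
    using M s assms(4) by (rule Weierstrass_m_test_general')
  have "hol3 (\<lambda>p. \<Sum>i\<in>X. f i p) S" if "X \<subseteq> I" for X using f that by (intro hol3_sum) auto
  then show "\<forall>\<^sub>F X in finite_subsets_at_top I. sephol3 (\<lambda>p. \<Sum>i\<in>X. f i p) S"
    by (intro eventually_finite_subsets_at_top_weakI hol3_imp_sephol3)
qed simp

section \<open>Holomorphy and symmetry of partial derivatives\<close>

definition swap12 :: "(complex \<times> complex) \<times> complex \<Rightarrow> (complex \<times> complex) \<times> complex" where
  "swap12 p = ((snd (fst p), fst (fst p)), snd p)"

lemma hol3_swap: assumes "hol3 f S" shows "hol3 (\<lambda>p. f (swap12 p)) (swap12 -` S)"
  unfolding swap12_def by (rule hol3_compose[OF assms]) (auto intro: hol3_coords simp: swap12_def)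

lemma D1_swap: "D1 (\<lambda>p. f (swap12 p)) p = D2 f (swap12 p)" "D2 (\<lambda>p. f (swap12 p)) p = D1 f (swap12 p)"
  by (auto simp: D1_def D2_def swap12_def)

lemma swap12_swap12 [simp]: "swap12 (swap12 p) = p" by (simp add: swap12_def)

lemma open_swap: "open S \<Longrightarrow> open (swap12 -` S)"
  unfolding swap12_def by (intro open_vimage continuous_intros)

text \<open>The difference quotients in the first variable converge locally uniformly to the first partial
  derivative, so the latter is differentiable in the other variables, and the limits commute.\<close>
lemma quotient_limit_line:
  assumes "open S" and f: "hol3 f S" and e: "continuous_on UNIV e" "\<And>h. continuous_on UNIV (\<lambda>z. e' h z)"
    and ee: "\<And>h z. e' h z = ((fst (fst (e z)) + h, snd (fst (e z))), snd (e z))"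
    and d: "\<And>z h. e' h z \<in> S \<Longrightarrow> ((\<lambda>z. f (e' h z)) has_field_derivative D (e' h z)) (at z)"
    and a: "e a \<in> S"
  shows "\<exists>g'. ((\<lambda>z. D1 f (e z)) has_field_derivative g') (at a) \<and>
    (\<forall>D'. ((\<lambda>z. D ((z, snd (fst (e a))), snd (e a))) has_field_derivative D') (at (fst (fst (e a)))) \<longrightarrow> g' = D')"
proof -
  have cD1: "continuous_on S (D1 f)" using sephol3_continuous_D(1)[OF \<open>open S\<close> hol3_imp_sephol3[OF f]] .
  define E where "E x = e' (fst x) (snd x)" for x :: "complex \<times> complex"
  have E: "E x = ((fst (fst (e (snd x))) + fst x, snd (fst (e (snd x)))), snd (e (snd x)))" for x
    by (simp add: E_def ee)
  have e0: "e' 0 z = e z" for z by (simp add: ee)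
  have cE: "continuous_on UNIV E" unfolding E by (intro continuous_intros continuous_on_compose2[OF e(1)]) auto
  have "open (E -` S)" using open_vimage[OF \<open>open S\<close> cE] .
  moreover have "(0, a) \<in> E -` S" using a by (simp add: E_def e0)
  ultimately obtain A B where AB: "open A" "open B" "0 \<in> A" "a \<in> B" "A \<times> B \<subseteq> E -` S"
    using open_prod_elim[of "E -` S" "(0, a)"] by (metis mem_Sigma_iff)
  obtain \<delta>1 where \<delta>1: "\<delta>1 > 0" "cball (0::complex) \<delta>1 \<subseteq> A" using AB by (meson open_contains_cball)
  obtain \<delta>2 where \<delta>2: "\<delta>2 > 0" "cball a \<delta>2 \<subseteq> B" using AB by (meson open_contains_cball)
  have inS: "e' h z \<in> S" if "norm h \<le> \<delta>1" "z \<in> cball a \<delta>2" for h z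
  proof -
    have "(h, z) \<in> A \<times> B" using that \<delta>1 \<delta>2 by auto
    then show ?thesis using AB(5) by (auto simp: E_def)
  qed
  \<comment> \<open>A sequence of increments, because the theorem on derivatives of uniform limits
    is about sequences. All of them stay within \<delta>1, where the shifted points remain in
    S.\<close>
  define hn where "hn n = complex_of_real (\<delta>1 / real (Suc n))" for n
  have hn: "norm (hn n) \<le> \<delta>1" "hn n \<noteq> 0" for n using \<delta>1(1) by (auto simp: hn_def field_simps norm_divide simp del: of_nat_Suc)
  have hn0: "hn \<longlonglongrightarrow> 0" unfolding hn_def using tendsto_of_real[OF LIMSEQ_Suc[OF lim_const_over_n[of \<delta>1]], where 'a = complex] by (simp only: of_real_0)
  define q where "q n z = (f (e' (hn n) z) - f (e z)) / hn n" for n z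
  have dq: "(q n has_field_derivative (D (e' (hn n) z) - D (e z)) / hn n) (at z)" if "z \<in> ball a \<delta>2" for n z
  proof -
    have "e' (hn n) z \<in> S" "e' 0 z \<in> S" using inS[of "hn n" z] inS[of 0 z] hn that \<delta>1 by auto
    from d[OF this(1)] d[OF this(2)] show ?thesis unfolding q_def[abs_def] e0 by (intro DERIV_cdivide DERIV_diff)
  qed
  have ul: "uniform_limit (cball a \<delta>2) q (\<lambda>z. D1 f (e z)) sequentially"
  proof (rule uniform_limitI)
    fix \<epsilon> :: real assume "\<epsilon> > 0"
    have "compact (cball (0::complex) \<delta>1 \<times> cball a \<delta>2)" by (intro compact_Times) auto
    moreover have "continuous_on (cball (0::complex) \<delta>1 \<times> cball a \<delta>2) (\<lambda>x. D1 f (E x))"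
      by (rule continuous_on_compose2[OF cD1 continuous_on_subset[OF cE]]) (use inS in \<open>auto simp: E_def\<close>)
    ultimately have "uniformly_continuous_on (cball (0::complex) \<delta>1 \<times> cball a \<delta>2) (\<lambda>x. D1 f (E x))"
      by (rule compact_uniformly_continuous[rotated])
    then obtain \<mu> where \<mu>: "\<mu> > 0" "\<And>x y. x \<in> cball (0::complex) \<delta>1 \<times> cball a \<delta>2 \<Longrightarrow> y \<in> cball (0::complex) \<delta>1 \<times> cball a \<delta>2 \<Longrightarrow> dist y x < \<mu> \<Longrightarrow> dist (D1 f (E y)) (D1 f (E x)) < \<epsilon> / 2"
      unfolding uniformly_continuous_on_def using \<open>\<epsilon> > 0\<close> by (metis half_gt_zero)
    have "\<forall>\<^sub>F n in sequentially. norm (hn n) < \<mu>" using hn0 \<mu>(1) by (auto simp: tendsto_iff)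
    then show "\<forall>\<^sub>F n in sequentially. \<forall>z\<in>cball a \<delta>2. dist (q n z) (D1 f (e z)) < \<epsilon>"
    proof (eventually_elim, intro ballI)
      fix n z assume n: "norm (hn n) < \<mu>" and z: "z \<in> cball a \<delta>2"
      \<comment> \<open>The derivative of g in h is the change of \<open>D1 f\<close> from the
        unshifted to the shifted point, so the mean value bound for g controls the distance of the
        difference quotient from \<open>D1 f\<close>.\<close>
      define g where "g h = f (e' h z) - h * D1 f (e z)" for h
      have "norm (g (hn n) - g 0) \<le> \<epsilon> / 2 * norm (hn n - 0)"
      proof (rule field_differentiable_bound[where S = "ball 0 \<mu> \<inter> cball (0::complex) \<delta>1" and f' = "\<lambda>h. D1 f (e' h z) - D1 f (e z)"])
        show "convex (ball 0 \<mu> \<inter> cball (0::complex) \<delta>1)" by (intro convex_Int) auto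
        fix h :: complex assume h: "h \<in> ball 0 \<mu> \<inter> cball (0::complex) \<delta>1"
        have "e' h z \<in> S" using inS h z by auto
        then have "((\<lambda>x. f ((x, snd (fst (e z))), snd (e z))) has_field_derivative D1 f (e' h z)) (at (fst (fst (e z)) + h))"
          using hol3_has_derivatives(1)[OF f] by (simp add: ee)
        from DERIV_chain2[OF this DERIV_add[OF DERIV_const DERIV_ident]]
        have "((\<lambda>h. f (e' h z)) has_field_derivative D1 f (e' h z)) (at h)" by (simp add: ee)
        from DERIV_diff[OF this DERIV_cmult_right[OF DERIV_ident]]
        show "(g has_field_derivative D1 f (e' h z) - D1 f (e z)) (at h within ball 0 \<mu> \<inter> cball (0::complex) \<delta>1)"
          unfolding g_def[abs_def] by (simp add: has_field_derivative_at_within)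
        have "dist (D1 f (E (h, z))) (D1 f (E (0, z))) < \<epsilon> / 2"
          by (rule \<mu>(2)) (use h z \<delta>1 in \<open>auto simp: dist_Pair_Pair\<close>)
        then show "norm (D1 f (e' h z) - D1 f (e z)) \<le> \<epsilon> / 2" by (simp add: E_def e0 dist_norm)
      qed (use n hn \<mu> \<delta>1 in auto)
      then have "norm (q n z - D1 f (e z)) * norm (hn n) \<le> \<epsilon> / 2 * norm (hn n)"
      proof -
        have "q n z * hn n = f (e' (hn n) z) - f (e z)" using hn(2)[of n] by (simp add: q_def)
        then have "(q n z - D1 f (e z)) * hn n = g (hn n) - g 0" by (simp add: g_def e0 left_diff_distrib)
        moreover assume "norm (g (hn n) - g 0) \<le> \<epsilon> / 2 * norm (hn n - 0)"
        ultimately show ?thesis by (simp flip: norm_mult)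
      qed
      then have "norm (q n z - D1 f (e z)) \<le> \<epsilon> / 2" using hn(2)[of n] by simp
      then show "dist (q n z) (D1 f (e z)) < \<epsilon>" using \<open>\<epsilon> > 0\<close> by (simp add: dist_norm)
    qed
  qed
  have "\<exists>g'. \<forall>x\<in>ball a \<delta>2. ((\<lambda>z. D1 f (e z)) has_field_derivative g' x) (at x) \<and> (\<lambda>n. (D (e' (hn n) x) - D (e x)) / hn n) \<longlonglongrightarrow> g' x"
  proof (rule has_complex_derivative_uniform_sequence[OF open_ball dq])
    fix x assume "x \<in> ball a \<delta>2"
    then obtain d where "d > 0" "cball x d \<subseteq> ball a \<delta>2" by (meson open_ball open_contains_cball)
    moreover then have "cball x d \<subseteq> cball a \<delta>2" by auto
    ultimately show "\<exists>d>0. cball x d \<subseteq> ball a \<delta>2 \<and> uniform_limit (cball x d) q (\<lambda>z. D1 f (e z)) sequentially"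
      using uniform_limit_on_subset[OF ul] by blast
  qed auto
  then obtain g' where g': "((\<lambda>z. D1 f (e z)) has_field_derivative g') (at a)" "(\<lambda>n. (D (e' (hn n) a) - D (e a)) / hn n) \<longlonglongrightarrow> g'"
    using \<delta>2(1) by (metis centre_in_ball)
  have "(\<lambda>n. (D (e' (hn n) a) - D (e a)) / hn n) \<longlonglongrightarrow> D'"
    if DD: "((\<lambda>z. D ((z, snd (fst (e a))), snd (e a))) has_field_derivative D') (at (fst (fst (e a))))" for D'
  proof -
    have "((\<lambda>h. (D (e' h a) - D (e a)) / h) \<longlongrightarrow> D') (at 0)"
      using DD unfolding DERIV_def by (simp add: ee)
    then show ?thesis
      by (rule filterlim_compose) (use hn0 hn(2) in \<open>auto simp: filterlim_at\<close>)
  qed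
  then show ?thesis using g' LIMSEQ_unique by blast
qed

text \<open>The implication in the conclusion is the symmetry of mixed derivatives. It is
  conditional on a derivative D' because differentiability of \<open>D2 f\<close> in the first
  variable is only available later, by exchanging coordinates in the result for
  \<open>D1\<close>.\<close>

lemma D1_line2:
  assumes "open S" "hol3 f S" "((a, b), c) \<in> S"
  shows "\<exists>g'. ((\<lambda>z. D1 f ((a, z), c)) has_field_derivative g') (at b) \<and>
    (\<forall>D'. ((\<lambda>z. D2 f ((z, b), c)) has_field_derivative D') (at a) \<longrightarrow> g' = D')"
proof -
  have "\<exists>g'. ((\<lambda>z. D1 f ((a, z), c)) has_field_derivative g') (at b) \<and>
    (\<forall>D'. ((\<lambda>z. D2 f ((z, snd (fst ((a, b), c))), snd ((a, b), c))) has_field_derivative D') (at (fst (fst ((a, b), c)))) \<longrightarrow> g' = D')"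
  proof (rule quotient_limit_line[OF assms(1,2), where e = "\<lambda>z. ((a, z), c)" and e' = "\<lambda>h z. ((a + h, z), c)"])
    fix z h assume "((a + h, z), c) \<in> S"
    then show "((\<lambda>z. f ((a + h, z), c)) has_field_derivative D2 f ((a + h, z), c)) (at z)"
      by (rule hol3_has_derivatives(2)[OF assms(2)])
  qed (use assms(3) in \<open>auto intro!: continuous_intros\<close>)
  then show ?thesis by simp
qed

lemma D1_line3:
  assumes "open S" "hol3 f S" "((a, b), c) \<in> S"
  shows "\<exists>g'. ((\<lambda>z. D1 f ((a, b), z)) has_field_derivative g') (at c) \<and>
    (\<forall>D'. ((\<lambda>z. D3 f ((z, b), c)) has_field_derivative D') (at a) \<longrightarrow> g' = D')"
proof -
  have "\<exists>g'. ((\<lambda>z. D1 f ((a, b), z)) has_field_derivative g') (at c) \<and>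
    (\<forall>D'. ((\<lambda>z. D3 f ((z, snd (fst ((a, b), c))), snd ((a, b), c))) has_field_derivative D') (at (fst (fst ((a, b), c)))) \<longrightarrow> g' = D')"
  proof (rule quotient_limit_line[OF assms(1,2), where e = "\<lambda>z. ((a, b), z)" and e' = "\<lambda>h z. ((a + h, b), z)"])
    fix z h assume "((a + h, b), z) \<in> S"
    then show "((\<lambda>z. f ((a + h, b), z)) has_field_derivative D3 f ((a + h, b), z)) (at z)"
      by (rule hol3_has_derivatives(3)[OF assms(2)])
  qed (use assms(3) in \<open>auto intro!: continuous_intros\<close>)
  then show ?thesis by simp
qed

lemma hol3_D1:
  assumes "open S" "hol3 f S" shows "hol3 (D1 f) S"
proof (rule sephol3_imp_hol3[OF assms(1)], unfold sephol3_def, intro conjI allI impI)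
  show "continuous_on S (D1 f)" by (rule sephol3_continuous_D(1)[OF assms(1) hol3_imp_sephol3[OF assms(2)]])
  fix a b c assume p: "((a, b), c) \<in> S"
  show "(\<lambda>z. D1 f ((z, b), c)) field_differentiable at a"
  proof -
    let ?T = "(\<lambda>z. ((z, b), c)) -` S"
    have T: "open ?T" by (intro open_vimage assms continuous_intros)
    have "(\<lambda>z. f ((z, b), c)) holomorphic_on ?T"
    proof (rule holomorphic_onI, rule field_differentiable_at_within)
      show "(\<lambda>z. f ((z, b), c)) field_differentiable at z" if "z \<in> ?T" for z
        using hol3_has_derivatives(1)[OF assms(2), of z b c] that by (auto simp: field_differentiable_def)
    qed
    from holomorphic_deriv[OF this T] have "(\<lambda>z. D1 f ((z, b), c)) holomorphic_on ?T"
      by (simp add: D1_def)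
    then show ?thesis using T p by (simp add: holomorphic_on_imp_differentiable_at)
  qed
  show "(\<lambda>z. D1 f ((a, z), c)) field_differentiable at b"
    unfolding field_differentiable_def using D1_line2[OF assms p] by blast
  show "(\<lambda>z. D1 f ((a, b), z)) field_differentiable at c"
    unfolding field_differentiable_def using D1_line3[OF assms p] by blast
qed

lemma hol3_D2: assumes "open S" "hol3 f S" shows "hol3 (D2 f) S"
proof -
  have "hol3 (D1 (\<lambda>p. f (swap12 p))) (swap12 -` S)"
    by (intro hol3_D1 open_swap hol3_swap assms)
  from hol3_swap[OF this] show ?thesis by (simp add: D1_swap vimage_def)
qed

lemma D2_D1: assumes "open S" "hol3 f S" "p \<in> S" shows "D2 (D1 f) p = D1 (D2 f) p"
proof -
  obtain a b c where p: "p = ((a, b), c)" by (metis prod.collapse)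
  obtain g' where g': "((\<lambda>z. D1 f ((a, z), c)) has_field_derivative g') (at b)"
    "\<And>D'. ((\<lambda>z. D2 f ((z, b), c)) has_field_derivative D') (at a) \<Longrightarrow> g' = D'"
    using D1_line2[OF assms(1,2) assms(3)[unfolded p]] by blast
  have "D2 (D1 f) p = g'" using DERIV_imp_deriv[OF g'(1)] by (simp add: p D2_def)
  also have "g' = D1 (D2 f) p"
    using hol3_has_derivatives(1)[OF hol3_D2[OF assms(1,2)]] assms(3) p by (intro g'(2)) auto
  finally show ?thesis .
qed

section \<open>Power series and real analyticity\<close>

lemma holomorphic_taylor_bound:
  assumes g: "g holomorphic_on ball z0 \<epsilon>" and M: "\<And>z. z \<in> ball z0 \<epsilon> \<Longrightarrow> norm (g z) \<le> M" and \<delta>: "0 < \<delta>" "\<delta> < \<epsilon>"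
  shows "norm ((deriv ^^ n) g z0 / fact n) \<le> M / \<delta> ^ n"
    "norm (z - z0) < \<delta> \<Longrightarrow> ((\<lambda>n. (deriv ^^ n) g z0 / fact n * (z - z0) ^ n) has_sum g z) UNIV"
proof -
  have b: "norm ((deriv ^^ n) g z0 / fact n) \<le> M / \<delta> ^ n" for n
  proof -
    have "norm ((deriv ^^ n) g z0) \<le> fact n * M / \<delta> ^ n"
    proof (rule Cauchy_inequality)
      show "g holomorphic_on ball z0 \<delta>" using \<delta> by (intro holomorphic_on_subset[OF g]) auto
      show "continuous_on (cball z0 \<delta>) g"
        using \<delta> by (intro continuous_on_subset[OF holomorphic_on_imp_continuous_on[OF g]]) auto
    qed (use \<delta> M in \<open>auto simp: dist_norm\<close>)
    then show ?thesis by (simp add: norm_divide field_simps)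
  qed
  then show "norm ((deriv ^^ n) g z0 / fact n) \<le> M / \<delta> ^ n" .
  assume z: "norm (z - z0) < \<delta>"
  show "((\<lambda>n. (deriv ^^ n) g z0 / fact n * (z - z0) ^ n) has_sum g z) UNIV"
  proof (rule norm_summable_imp_has_sum)
    show "(\<lambda>n. (deriv ^^ n) g z0 / fact n * (z - z0) ^ n) sums g z"
      using z \<delta> by (intro holomorphic_power_series[OF g]) (auto simp: dist_norm norm_minus_commute)
    have "summable (\<lambda>n. M * (norm (z - z0) / \<delta>) ^ n)"
      using z \<delta> by (intro summable_mult summable_geometric) auto
    then show "summable (\<lambda>n. norm ((deriv ^^ n) g z0 / fact n * (z - z0) ^ n))"
    proof (rule summable_comparison_test')
      fix n :: nat
      have "norm ((deriv ^^ n) g z0 / fact n * (z - z0) ^ n) \<le> M / \<delta> ^ n * norm (z - z0) ^ n"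
        unfolding norm_mult norm_power by (intro mult_right_mono b) auto
      then show "norm (norm ((deriv ^^ n) g z0 / fact n * (z - z0) ^ n)) \<le> M * (norm (z - z0) / \<delta>) ^ n"
        by (simp add: power_divide)
    qed
  qed
qed

lemma hol3_slice_holomorphic:
  assumes "hol3 E ((A \<times> B) \<times> C)"
  shows "b \<in> B \<Longrightarrow> c \<in> C \<Longrightarrow> (\<lambda>z. E ((z, b), c)) holomorphic_on A"
    "a \<in> A \<Longrightarrow> c \<in> C \<Longrightarrow> (\<lambda>z. E ((a, z), c)) holomorphic_on B"
    "a \<in> A \<Longrightarrow> b \<in> B \<Longrightarrow> (\<lambda>z. E ((a, b), z)) holomorphic_on C"
    apply (rule holomorphic_onI, rule field_differentiable_at_within, unfold field_differentiable_def,
        rule exI, rule hol3_has_derivatives(1)[OF assms], simp)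
   apply (rule holomorphic_onI, rule field_differentiable_at_within, unfold field_differentiable_def,
      rule exI, rule hol3_has_derivatives(2)[OF assms], simp)
  apply (rule holomorphic_onI, rule field_differentiable_at_within, unfold field_differentiable_def,
      rule exI, rule hol3_has_derivatives(3)[OF assms], simp)
  done

lemma deriv_pow_D1: "(deriv ^^ n) (\<lambda>z. E ((z, b), c)) = (\<lambda>z. (D1 ^^ n) E ((z, b), c))"
  by (induction n) (auto simp: D1_def)

lemma deriv_pow_D2: "(deriv ^^ n) (\<lambda>z. E ((a, z), c)) = (\<lambda>z. (D2 ^^ n) E ((a, z), c))"
  by (induction n) (auto simp: D2_def)

lemma hol3_D_pow: "open S \<Longrightarrow> hol3 f S \<Longrightarrow> hol3 ((D1 ^^ n) f) S \<and> hol3 ((D2 ^^ n) f) S"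
  by (induction n) (auto intro: hol3_D1 hol3_D2)

text \<open>Fubini for a triple series dominated by a product of three geometric series: the
  domination gives absolute summability, after which the iterated sums determine the unordered
  one.\<close>

lemma has_sum_triple_geometric:
  fixes g :: "nat \<times> nat \<times> nat \<Rightarrow> complex"
  assumes "\<And>i j k. norm (g (i, j, k)) \<le> M * (x ^ i * (y ^ j * z ^ k))" "0 \<le> x" "x < 1" "0 \<le> y" "y < 1" "0 \<le> z" "z < 1"
    and 1: "\<And>i j. ((\<lambda>k. g (i, j, k)) has_sum h i j) UNIV" and 2: "\<And>i. ((\<lambda>j. h i j) has_sum l i) UNIV" and 3: "(l has_sum s) UNIV"
  shows "(g has_sum s) UNIV"
proof -
  have geo: "((\<lambda>k. w ^ k) has_sum 1 / (1 - w)) UNIV" if "0 \<le> w" "w < 1" for w :: real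
    using that by (intro sums_nonneg_imp_has_sum geometric_sums) auto
  have "(\<lambda>(j, k). y ^ j * z ^ k) summable_on UNIV \<times> UNIV"
  proof (rule summable_on_SigmaI[where g = "\<lambda>j. y ^ j * (1 / (1 - z))"])
    show "((\<lambda>k. case (j, k) of (j, k) \<Rightarrow> y ^ j * z ^ k) has_sum y ^ j * (1 / (1 - z))) UNIV" for j
      using has_sum_cmult_right[OF geo[OF assms(6,7)], of "y ^ j"] by (simp only: prod.case)
    show "(\<lambda>j. y ^ j * (1 / (1 - z))) summable_on UNIV"
      by (intro summable_on_cmult_left has_sum_imp_summable[OF geo[OF assms(4,5)]])
  qed (use assms in auto)
  then obtain s2 where s2: "((\<lambda>(j, k). y ^ j * z ^ k) has_sum s2) UNIV" by (auto simp: summable_on_def)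
  have "(\<lambda>(i, j, k). x ^ i * (y ^ j * z ^ k)) summable_on UNIV \<times> UNIV"
  proof (rule summable_on_SigmaI[where g = "\<lambda>i. x ^ i * s2"])
    show "((\<lambda>p. case (i, p) of (i, j, k) \<Rightarrow> x ^ i * (y ^ j * z ^ k)) has_sum x ^ i * s2) UNIV" for i
      using has_sum_cmult_right[OF s2, of "x ^ i"] by (simp add: case_prod_unfold)
    show "(\<lambda>i. x ^ i * s2) summable_on UNIV"
      by (intro summable_on_cmult_left has_sum_imp_summable[OF geo[OF assms(2,3)]])
  qed (use assms in auto)
  then have "(\<lambda>p. M * (\<lambda>(i, j, k). x ^ i * (y ^ j * z ^ k)) p) summable_on UNIV" by (intro summable_on_cmult_right) simp
  then have "(\<lambda>p. norm (g p)) summable_on UNIV"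
    by (rule summable_on_comparison_test) (use assms(1) in auto)
  then have sg: "g summable_on UNIV" by (rule abs_summable_summable)
  have "((\<lambda>(j, k). g (i, j, k)) has_sum l i) (UNIV \<times> UNIV)" for i
  proof (rule has_sum_SigmaI[where g = "h i"])
    have "g summable_on (Pair i ` UNIV)" using sg by (rule summable_on_subset_banach) auto
    then show "(\<lambda>(j, k). g (i, j, k)) summable_on UNIV \<times> UNIV"
      by (subst (asm) summable_on_reindex) (auto simp: inj_on_def o_def case_prod_unfold)
  qed (use 1 2 in auto)
  then have "((\<lambda>(i, p). g (i, p)) has_sum s) (UNIV \<times> UNIV)"
    using sg 3 by (intro has_sum_SigmaI[where g = l]) (auto simp: case_prod_unfold)
  then show ?thesis by simp
qed

text \<open>Iterated Taylor expansion: the coefficients in the first variable are holomorphic in the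
  other two with bound \<open>M / \<delta> ^ i\<close>, so they can be expanded in turn, and the
  Cauchy factors multiply.\<close>

lemma hol3_power_series:
  assumes E: "hol3 E ((ball a \<epsilon> \<times> ball b \<epsilon>) \<times> ball c \<epsilon>)"
    and M: "\<And>p. p \<in> (ball a \<epsilon> \<times> ball b \<epsilon>) \<times> ball c \<epsilon> \<Longrightarrow> norm (E p) \<le> M" and \<delta>: "0 < \<delta>" "\<delta> < \<epsilon>"
  obtains C where "\<And>x y z. norm (x - a) < \<delta> \<Longrightarrow> norm (y - b) < \<delta> \<Longrightarrow> norm (z - c) < \<delta> \<Longrightarrow>
    ((\<lambda>(i, j, k). C i j k * ((x - a) ^ i * ((y - b) ^ j * (z - c) ^ k))) has_sum E ((x, y), z)) UNIV"
proof -
  let ?P = "(ball a \<epsilon> \<times> ball b \<epsilon>) \<times> ball c \<epsilon>"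
  have oP: "open ?P" by (intro open_Times open_ball)
  have ctr: "a \<in> ball a \<epsilon>" "b \<in> ball b \<epsilon>" "c \<in> ball c \<epsilon>" using \<delta> by auto
  define F where "F i p = (D1 ^^ i) E p / fact i" for i p
  have hF: "hol3 (F i) ?P" for i
    using hol3_mult[OF conjunct1[OF hol3_D_pow[OF oP E, of i]] hol3_coords(4)[of "1 / fact i"]] by (simp add: F_def[abs_def])
  have F: "norm (F i ((a, y), z)) \<le> M / \<delta> ^ i"
    "norm (x - a) < \<delta> \<Longrightarrow> ((\<lambda>i. F i ((a, y), z) * (x - a) ^ i) has_sum E ((x, y), z)) UNIV"
    if "y \<in> ball b \<epsilon>" "z \<in> ball c \<epsilon>" for i x y z
    using holomorphic_taylor_bound[OF hol3_slice_holomorphic(1)[OF E that] M \<delta>] that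
    by (auto simp: deriv_pow_D1 F_def)
  define G where "G i j p = (D2 ^^ j) (F i) p / fact j" for i j p
  have hG: "hol3 (G i j) ?P" for i j
    using hol3_mult[OF conjunct2[OF hol3_D_pow[OF oP hF, of j i]] hol3_coords(4)[of "1 / fact j"]] by (simp add: G_def[abs_def])
  have G: "norm (G i j ((a, b), z)) \<le> M / \<delta> ^ i / \<delta> ^ j"
    "norm (y - b) < \<delta> \<Longrightarrow> ((\<lambda>j. G i j ((a, b), z) * (y - b) ^ j) has_sum F i ((a, y), z)) UNIV"
    if "z \<in> ball c \<epsilon>" for i j y z
    using holomorphic_taylor_bound[OF hol3_slice_holomorphic(2)[OF hF ctr(1) that] F(1)[OF _ that] \<delta>]
    by (auto simp: deriv_pow_D2 G_def)
  define C where "C i j k = (deriv ^^ k) (\<lambda>z. G i j ((a, b), z)) c / fact k" for i j k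
  have C: "norm (C i j k) \<le> M / \<delta> ^ i / \<delta> ^ j / \<delta> ^ k"
    "norm (z - c) < \<delta> \<Longrightarrow> ((\<lambda>k. C i j k * (z - c) ^ k) has_sum G i j ((a, b), z)) UNIV" for i j k z
    using holomorphic_taylor_bound[OF hol3_slice_holomorphic(3)[OF hG ctr(1,2)] G(1) \<delta>] by (auto simp: C_def)
  show thesis
  proof (rule that)
    fix x y z assume x: "norm (x - a) < \<delta>" and y: "norm (y - b) < \<delta>" and z: "norm (z - c) < \<delta>"
    have yz: "y \<in> ball b \<epsilon>" "z \<in> ball c \<epsilon>" using y z \<delta> by (auto simp: dist_norm norm_minus_commute)
    show "((\<lambda>(i, j, k). C i j k * ((x - a) ^ i * ((y - b) ^ j * (z - c) ^ k))) has_sum E ((x, y), z)) UNIV"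
    proof (rule has_sum_triple_geometric[where M = M and x = "norm (x - a) / \<delta>" and y = "norm (y - b) / \<delta>" and z = "norm (z - c) / \<delta>"])
      fix i j k
      have "norm (C i j k * ((x - a) ^ i * ((y - b) ^ j * (z - c) ^ k))) \<le> M / \<delta> ^ i / \<delta> ^ j / \<delta> ^ k * (norm (x - a) ^ i * (norm (y - b) ^ j * norm (z - c) ^ k))"
        unfolding norm_mult norm_power by (intro mult_right_mono C) auto
      then show "norm (case (i, j, k) of (i, j, k) \<Rightarrow> C i j k * ((x - a) ^ i * ((y - b) ^ j * (z - c) ^ k)))
        \<le> M * ((norm (x - a) / \<delta>) ^ i * ((norm (y - b) / \<delta>) ^ j * (norm (z - c) / \<delta>) ^ k))"
        by (simp add: power_divide field_simps)
      show "((\<lambda>k. case (i, j, k) of (i, j, k) \<Rightarrow> C i j k * ((x - a) ^ i * ((y - b) ^ j * (z - c) ^ k))) has_sum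
         G i j ((a, b), z) * ((x - a) ^ i * (y - b) ^ j)) UNIV"
        using has_sum_cmult_left[OF C(2)[OF z], of i j "(x - a) ^ i * (y - b) ^ j"] by (simp add: mult_ac)
      show "((\<lambda>j. G i j ((a, b), z) * ((x - a) ^ i * (y - b) ^ j)) has_sum F i ((a, y), z) * (x - a) ^ i) UNIV"
        using has_sum_cmult_left[OF G(2)[OF yz(2) y], of i "(x - a) ^ i"] by (simp add: mult_ac)
    next
      show "((\<lambda>i. F i ((a, y), z) * (x - a) ^ i) has_sum E ((x, y), z)) UNIV" using F(2)[OF yz x] .
    qed (use x y z \<delta> in auto)
  qed
qed

text \<open>At real points all the monomials are real, so taking real parts merely replaces the
  coefficients by their real parts.\<close>

lemma hol3_imp_real_analytic_at:
  fixes f :: "(real \<times> real) \<times> real \<Rightarrow> real"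
  assumes S: "open S" "hol3 E S" "((of_real x0, of_real y0), of_real t0) \<in> S"
    and f: "\<And>x y t. ((of_real x, of_real y), of_real t) \<in> S \<Longrightarrow> f ((x, y), t) = Re (E ((of_real x, of_real y), of_real t))"
  shows "real_analytic_at f ((x0, y0), t0)"
proof -
  let ?p = "((complex_of_real x0, complex_of_real y0), complex_of_real t0)"
  have "isCont E ?p" using hol3_continuous_on[OF S(2)] S by (simp add: continuous_on_eq_continuous_at)
  then obtain d where d: "d > 0" "\<And>q. dist q ?p < d \<Longrightarrow> dist (E q) (E ?p) < 1"
    unfolding continuous_at_eps_delta by (meson zero_less_one)
  obtain e where e: "e > 0" "ball ?p e \<subseteq> S" using S by (meson open_contains_ball)
  \<comment> \<open>One third, so that three coordinates of size \<epsilon> stay within distance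
    \<open>min d e\<close> by the triangle inequality in the nested product.\<close>
  define \<epsilon> where "\<epsilon> = min d e / 3"
  have \<epsilon>: "\<epsilon> > 0" using d e by (simp add: \<epsilon>_def)
  let ?P = "(ball (complex_of_real x0) \<epsilon> \<times> ball (complex_of_real y0) \<epsilon>) \<times> ball (complex_of_real t0) \<epsilon>"
  have near: "dist q ?p < min d e" if "q \<in> ?P" for q
  proof -
    obtain u v w where q: "q = ((u, v), w)" by (metis prod.collapse)
    have "dist q ?p \<le> dist (u, v) (complex_of_real x0, complex_of_real y0) + dist w (of_real t0)"
      unfolding q dist_Pair_Pair[of "(u, v)"] by (rule sqrt_sum_squares_le_sum) auto
    also have "dist (u, v) (complex_of_real x0, complex_of_real y0) \<le> dist u (of_real x0) + dist v (of_real y0)"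
      unfolding dist_Pair_Pair by (rule sqrt_sum_squares_le_sum) auto
    also have "dist u (of_real x0) + dist v (of_real y0) + dist w (of_real t0) < \<epsilon> + \<epsilon> + \<epsilon>"
      using that unfolding q by (intro add_strict_mono) (auto simp: dist_commute)
    finally show ?thesis by (simp add: \<epsilon>_def)
  qed
  have PS: "?P \<subseteq> S" using near e(2) by (force simp: dist_commute)
  have bd: "norm (E q) \<le> norm (E ?p) + 1" if "q \<in> ?P" for q
    using d(2)[of q] near[OF that] norm_triangle_ineq2[of "E q" "E ?p"] by (auto simp: dist_norm)
  obtain C where C: "\<And>x y z. norm (x - of_real x0) < \<epsilon>/2 \<Longrightarrow> norm (y - of_real y0) < \<epsilon>/2 \<Longrightarrow> norm (z - of_real t0) < \<epsilon>/2 \<Longrightarrow>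
    ((\<lambda>(i, j, k). C i j k * ((x - of_real x0) ^ i * ((y - of_real y0) ^ j * (z - of_real t0) ^ k))) has_sum E ((x, y), z)) UNIV"
    using hol3_power_series[OF hol3_mono[OF S(2) PS] bd, of "\<epsilon>/2"] \<epsilon> by auto
  define e1 e2 e3 :: "(real \<times> real) \<times> real" where "e1 = ((1, 0), 0)" and "e2 = ((0, 1), 0)" and "e3 = ((0, 0), 1)"
  have B: "Basis = {e1, e2, e3}" "e1 \<noteq> e2" "e1 \<noteq> e3" "e2 \<noteq> e3"
    by (auto simp: Basis_prod_def e1_def e2_def e3_def zero_prod_def)
  define c where "c \<alpha> = Re (C (\<alpha> e1) (\<alpha> e2) (\<alpha> e3))" for \<alpha> :: "(real \<times> real) \<times> real \<Rightarrow> nat"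
  show ?thesis unfolding real_analytic_at_def
  proof (intro exI[of _ c] exI[of _ "\<epsilon>/2"] conjI ballI)
    show "\<epsilon>/2 > 0" using \<epsilon> by simp
    fix q :: "(real \<times> real) \<times> real" assume q: "q \<in> ball ((x0, y0), t0) (\<epsilon>/2)"
    obtain x y t where qe: "q = ((x, y), t)" by (metis prod.collapse)
    have "\<bar>x - x0\<bar> \<le> dist (x, y) (x0, y0)" "\<bar>y - y0\<bar> \<le> dist (x, y) (x0, y0)" "dist (x, y) (x0, y0) \<le> dist q ((x0, y0), t0)" "\<bar>t - t0\<bar> \<le> dist q ((x0, y0), t0)"
      using dist_fst_le[of "(x, y)" "(x0, y0)"] dist_snd_le[of "(x, y)" "(x0, y0)"] dist_fst_le[of q "((x0, y0), t0)"] dist_snd_le[of q "((x0, y0), t0)"]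
      by (auto simp: qe dist_real_def)
    then have r: "\<bar>x - x0\<bar> < \<epsilon>/2" "\<bar>y - y0\<bar> < \<epsilon>/2" "\<bar>t - t0\<bar> < \<epsilon>/2" using q by (auto simp: dist_commute)
    then have n: "norm (complex_of_real x - of_real x0) < \<epsilon>/2" "norm (complex_of_real y - of_real y0) < \<epsilon>/2" "norm (complex_of_real t - of_real t0) < \<epsilon>/2"
      by (simp_all flip: of_real_diff)
    then have inS: "((complex_of_real x, complex_of_real y), complex_of_real t) \<in> S"
      using \<epsilon> by (intro subsetD[OF PS]) (auto simp: dist_norm norm_minus_commute)
    have "((\<lambda>p. Re ((\<lambda>(i, j, k). C i j k * ((of_real x - of_real x0) ^ i * ((of_real y - of_real y0) ^ j * (of_real t - of_real t0) ^ k))) p)) has_sum Re (E ((of_real x, of_real y), of_real t))) UNIV"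
      by (rule has_sum_Re[OF C[OF n]])
    also have "(\<lambda>p. Re ((\<lambda>(i, j, k). C i j k * ((of_real x - of_real x0) ^ i * ((of_real y - of_real y0) ^ j * (of_real t - of_real t0) ^ k))) p))
      = (\<lambda>(i, j, k). Re (C i j k) * ((x - x0) ^ i * ((y - y0) ^ j * (t - t0) ^ k)))"
      by (auto simp: fun_eq_iff simp flip: of_real_diff of_real_power of_real_mult)
    finally have hs: "((\<lambda>(i, j, k). Re (C i j k) * ((x - x0) ^ i * ((y - y0) ^ j * (t - t0) ^ k))) has_sum f q) UNIV"
      using f[OF inS] by (simp add: qe)
    show "((\<lambda>\<alpha>. c \<alpha> * (\<Prod>i\<in>Basis. ((q - ((x0, y0), t0)) \<bullet> i) ^ \<alpha> i)) has_sum f q) {\<alpha>. \<forall>i. i \<notin> Basis \<longrightarrow> \<alpha> i = 0}"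
    proof (rule has_sum_reindex_bij_witness[THEN iffD2, OF _ _ _ _ _ _ hs])
      \<comment> \<open>Multi-indices are functions vanishing off \<open>Basis\<close>; evaluation
        at the three basis vectors identifies them with triples.\<close>
      let ?i = "\<lambda>(i, j, k) b. if b = e1 then i else if b = e2 then j else if b = e3 then k else (0::nat)"
      let ?j = "\<lambda>\<alpha>. (\<alpha> e1, \<alpha> e2, \<alpha> e3)"
      fix \<alpha> :: "(real \<times> real) \<times> real \<Rightarrow> nat" assume \<alpha>: "\<alpha> \<in> {\<alpha>. \<forall>i. i \<notin> Basis \<longrightarrow> \<alpha> i = 0}"
      show "?i (?j \<alpha>) = \<alpha>" using \<alpha> B by (auto simp: fun_eq_iff)
      show "?j \<alpha> \<in> UNIV" by simp
      have "(\<Prod>i\<in>Basis. ((q - ((x0, y0), t0)) \<bullet> i) ^ \<alpha> i) = (x - x0) ^ \<alpha> e1 * ((y - y0) ^ \<alpha> e2 * (t - t0) ^ \<alpha> e3)"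
      proof -
        have "(q - ((x0, y0), t0)) \<bullet> e1 = x - x0" "(q - ((x0, y0), t0)) \<bullet> e2 = y - y0" "(q - ((x0, y0), t0)) \<bullet> e3 = t - t0"
          by (simp_all add: qe e1_def e2_def e3_def)
        then show ?thesis unfolding B(1) using B(2-4) by simp
      qed
      then show "(case ?j \<alpha> of (i, j, k) \<Rightarrow> Re (C i j k) * ((x - x0) ^ i * ((y - y0) ^ j * (t - t0) ^ k))) = c \<alpha> * (\<Prod>i\<in>Basis. ((q - ((x0, y0), t0)) \<bullet> i) ^ \<alpha> i)"
        by (simp add: c_def)
    next
      let ?i = "\<lambda>(i, j, k) b. if b = e1 then i else if b = e2 then j else if b = e3 then k else (0::nat)"
      let ?j = "\<lambda>\<alpha>. (\<alpha> e1, \<alpha> e2, \<alpha> e3)"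
      fix p :: "nat \<times> nat \<times> nat" 
      show "?j (?i p) = p" using B by (auto simp: case_prod_unfold)
      show "?i p \<in> {\<alpha>. \<forall>i. i \<notin> Basis \<longrightarrow> \<alpha> i = 0}" using B by (auto simp: case_prod_unfold)
    qed simp
  qed
qed

text \<open>The real series converges at the point all of whose coordinates are \<delta>. For real
  numbers unconditional convergence is absolute, so this one point dominates the series on the
  closed complex polydisc of radius \<delta>. \<open>E\<close> takes the coordinates as a family,
  and the substitution \<open>L\<close> lets one statement serve for one, two and three real
  variables.\<close>

lemma real_analytic_at_complex_extension:
  fixes f :: "'a::euclidean_space \<Rightarrow> real"
  assumes "real_analytic_at f x"
  obtains \<delta> and E :: "('a \<Rightarrow> complex) \<Rightarrow> complex" where "\<delta> > 0"
    "\<And>L S. open S \<Longrightarrow> (\<And>i. i \<in> Basis \<Longrightarrow> hol3 (L i) S) \<Longrightarrow> (\<And>i p. i \<in> Basis \<Longrightarrow> p \<in> S \<Longrightarrow> norm (L i p) < \<delta>) \<Longrightarrow>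
       hol3 (\<lambda>p. E (\<lambda>i. L i p)) S"
    "\<And>h. (\<And>i. i \<in> Basis \<Longrightarrow> \<bar>h \<bullet> i\<bar> < \<delta>) \<Longrightarrow> E (\<lambda>i. of_real (h \<bullet> i)) = of_real (f (x + h))"
proof -
  let ?A = "{\<alpha>::'a \<Rightarrow> nat. \<forall>i. i \<notin> Basis \<longrightarrow> \<alpha> i = 0}"
  obtain c r where r: "r > 0" and c: "\<And>y. y \<in> ball x r \<Longrightarrow> ((\<lambda>\<alpha>. c \<alpha> * (\<Prod>i\<in>Basis. ((y - x) \<bullet> i) ^ \<alpha> i)) has_sum f y) ?A"
    using assms unfolding real_analytic_at_def by blast
  \<comment> \<open>The coordinates of a point of the cube sum to at most r/2 in absolute value,
    which puts the whole cube inside the ball.\<close>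
  define \<delta> where "\<delta> = r / (2 * real DIM('a))"
  have \<delta>: "\<delta> > 0" using r by (simp add: \<delta>_def)
  have small: "x + h \<in> ball x r" if "\<And>i. i \<in> Basis \<Longrightarrow> \<bar>h \<bullet> i\<bar> \<le> \<delta>" for h :: 'a
  proof -
    have "norm h \<le> (\<Sum>i\<in>(Basis::'a set). \<bar>h \<bullet> i\<bar>)" by (rule norm_le_l1)
    also have "\<dots> \<le> (\<Sum>i\<in>(Basis::'a set). \<delta>)" by (intro sum_mono that)
    also have "\<dots> = r / 2" by (simp add: \<delta>_def)
    finally show ?thesis using r by (simp add: dist_norm)
  qed
  define b where "b \<alpha> = \<bar>c \<alpha>\<bar> * (\<Prod>i\<in>(Basis::'a set). \<delta> ^ \<alpha> i)" for \<alpha>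
  have "b summable_on ?A"
  proof -
    let ?h = "\<Sum>i\<in>(Basis::'a set). \<delta> *\<^sub>R i"
    have hi: "?h \<bullet> i = \<delta>" if "i \<in> Basis" for i using that by (simp add: inner_sum_left inner_Basis if_distrib cong: if_cong)
    have "((\<lambda>\<alpha>. c \<alpha> * (\<Prod>i\<in>Basis. ((x + ?h - x) \<bullet> i) ^ \<alpha> i)) has_sum f (x + ?h)) ?A"
      using small[of ?h] hi \<delta> by (intro c) auto
    then have "(\<lambda>\<alpha>. c \<alpha> * (\<Prod>i\<in>(Basis::'a set). \<delta> ^ \<alpha> i)) summable_on ?A"
      using hi by (auto simp: summable_on_def cong: prod.cong)
    then have "(\<lambda>\<alpha>. norm (c \<alpha> * (\<Prod>i\<in>(Basis::'a set). \<delta> ^ \<alpha> i))) summable_on ?A"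
      by (rule summable_on_iff_abs_summable_on_real[THEN iffD1])
    then show ?thesis using \<delta> by (simp add: b_def[abs_def] abs_mult abs_prod power_abs)
  qed
  define E where "E w = (\<Sum>\<^sub>\<infinity>\<alpha>\<in>?A. of_real (c \<alpha>) * (\<Prod>i\<in>Basis. w i ^ \<alpha> i))" for w :: "'a \<Rightarrow> complex"
  have bound: "norm (of_real (c \<alpha>) * (\<Prod>i\<in>Basis. w i ^ \<alpha> i)) \<le> b \<alpha>"
    if "\<And>i. i \<in> Basis \<Longrightarrow> norm (w i) \<le> \<delta>" for w :: "'a \<Rightarrow> complex" and \<alpha>
    unfolding b_def norm_mult prod_norm[symmetric] norm_power norm_of_real
    using that by (intro mult_left_mono prod_mono) (auto intro: power_mono)
  have sm: "((\<lambda>\<alpha>. of_real (c \<alpha>) * (\<Prod>i\<in>Basis. w i ^ \<alpha> i)) has_sum E w) ?A"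
    if "\<And>i. i \<in> Basis \<Longrightarrow> norm (w i) \<le> \<delta>" for w :: "'a \<Rightarrow> complex"
  proof -
    have "(\<lambda>\<alpha>. norm (of_real (c \<alpha>) * (\<Prod>i\<in>Basis. w i ^ \<alpha> i))) summable_on ?A"
      by (rule summable_on_comparison_test[OF \<open>b summable_on ?A\<close> bound]) (use that in auto)
    then have "(\<lambda>\<alpha>. of_real (c \<alpha>) * (\<Prod>i\<in>Basis. w i ^ \<alpha> i)) summable_on ?A" by (rule abs_summable_summable)
    then show ?thesis unfolding E_def by (rule has_sum_infsum)
  qed
  show thesis
  proof (rule that[OF \<delta>])
    fix L :: "'a \<Rightarrow> (complex \<times> complex) \<times> complex \<Rightarrow> complex" and S
    assume S: "open S" and L: "\<And>i. i \<in> Basis \<Longrightarrow> hol3 (L i) S" "\<And>i p. i \<in> Basis \<Longrightarrow> p \<in> S \<Longrightarrow> norm (L i p) < \<delta>"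
    show "hol3 (\<lambda>p. E (\<lambda>i. L i p)) S"
    proof (rule hol3_has_sum[OF S, where I = ?A and M = b and f = "\<lambda>\<alpha> p. of_real (c \<alpha>) * (\<Prod>i\<in>Basis. L i p ^ \<alpha> i)"])
      show "hol3 (\<lambda>p. of_real (c \<alpha>) * (\<Prod>i\<in>Basis. L i p ^ \<alpha> i)) S" for \<alpha>
        by (intro hol3_mult hol3_coords hol3_prod hol3_power L)
      show "norm (of_real (c \<alpha>) * (\<Prod>i\<in>Basis. L i p ^ \<alpha> i)) \<le> b \<alpha>" if "p \<in> S" for \<alpha> p
        by (rule bound) (use L(2)[OF _ that] less_imp_le in blast)
      show "((\<lambda>\<alpha>. of_real (c \<alpha>) * (\<Prod>i\<in>Basis. L i p ^ \<alpha> i)) has_sum E (\<lambda>i. L i p)) ?A" if "p \<in> S" for p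
        by (rule sm) (use L(2)[OF _ that] less_imp_le in blast)
    qed fact
  next
    fix h :: 'a assume h: "\<And>i. i \<in> Basis \<Longrightarrow> \<bar>h \<bullet> i\<bar> < \<delta>"
    have "((\<lambda>\<alpha>. c \<alpha> * (\<Prod>i\<in>Basis. ((x + h - x) \<bullet> i) ^ \<alpha> i)) has_sum f (x + h)) ?A"
      using h by (intro c small) (auto simp: less_imp_le)
    then have "((\<lambda>\<alpha>. complex_of_real (c \<alpha> * (\<Prod>i\<in>Basis. ((x + h - x) \<bullet> i) ^ \<alpha> i))) has_sum of_real (f (x + h))) ?A"
      by (rule has_sum_of_real)
    then have "((\<lambda>\<alpha>. of_real (c \<alpha>) * (\<Prod>i\<in>Basis. complex_of_real (h \<bullet> i) ^ \<alpha> i)) has_sum of_real (f (x + h))) ?A"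
      by (simp add: of_real_prod)
    moreover have "((\<lambda>\<alpha>. of_real (c \<alpha>) * (\<Prod>i\<in>Basis. complex_of_real (h \<bullet> i) ^ \<alpha> i)) has_sum E (\<lambda>i. of_real (h \<bullet> i))) ?A"
      using h by (intro sm) (auto simp: less_imp_le)
    ultimately show "E (\<lambda>i. of_real (h \<bullet> i)) = of_real (f (x + h))" using has_sum_unique by blast
  qed
qed

section \<open>The problem on the disc\<close>

text \<open>The weight \<open>v\<close> of this locale decays exponentially with the distance from s
  = 1, which makes integration from 1 gain a factor. The bound
  \<open>c * r\<^sup>2 \<le> 1/2\<close> keeps this decay weaker than the growth of x along rays
  from 0, where the other integration takes place. The last assumption keeps \<open>v\<close> at
  least r on the disc of products \<zeta> \<eta>, so that powers of \<open>v\<close> dominate the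
  modes.\<close>

locale disc_weight =
  fixes r \<rho> c :: real
  assumes r_gt_1: "1 < r" and c_pos: "0 < c" and c_small: "c * r\<^sup>2 \<le> 1/2"
    and r_le: "r \<le> \<rho> * exp (- c * (1 + r\<^sup>2))"
begin

definition v :: "complex \<Rightarrow> real" where "v s = \<rho> * exp (- c * norm (1 - s))"

lemma rho_pos: "0 < \<rho>"
proof (rule ccontr)
  assume "\<not> 0 < \<rho>"
  then have "\<rho> * exp (- c * (1 + r\<^sup>2)) \<le> 0" by (simp add: mult_nonpos_nonneg)
  then show False using r_le r_gt_1 by linarith
qed

lemma v_pos: "0 < v s" using rho_pos by (simp add: v_def)
lemma v_le_rho: "v s \<le> \<rho>" using rho_pos c_pos by (simp add: v_def)

lemma r2_gt_1: "1 < r\<^sup>2" using r_gt_1 by (simp add: one_less_power)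

lemma r_pos: "0 < r" using r_gt_1 by linarith

lemma c_le_half: "c \<le> 1/2"
proof -
  have "c * 1 \<le> c * r\<^sup>2" using r2_gt_1 c_pos by (intro mult_left_mono) auto
  then show ?thesis using c_small by linarith
qed

lemma r_le_v: assumes "s \<in> ball 0 (r\<^sup>2)" shows "r \<le> v s"
proof -
  have "norm (1 - s) \<le> 1 + r\<^sup>2" using assms norm_triangle_ineq4[of 1 s] by simp
  then have "- c * (1 + r\<^sup>2) \<le> - c * norm (1 - s)" using c_pos by simp
  then have "\<rho> * exp (- c * (1 + r\<^sup>2)) \<le> v s" unfolding v_def using rho_pos by (intro mult_left_mono) auto
  then show ?thesis using r_le by linarith
qed

lemma v_ratio: "v s \<le> exp (c * norm (s - t)) * v t"
proof -
  have "norm (1 - t) \<le> norm (1 - s) + norm (s - t)" using norm_triangle_ineq[of "1-s" "s-t"] by simp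
  then have "c * norm (1 - t) \<le> c * norm (1 - s) + c * norm (s - t)"
    by (metis c_pos distrib_left less_imp_le mult_left_mono)
  then have "exp (- c * norm (1 - s)) \<le> exp (c * norm (s - t) + - c * norm (1 - t))" by simp
  then have "\<rho> * exp (- c * norm (1 - s)) \<le> \<rho> * exp (c * norm (s - t) + - c * norm (1 - t))"
    using rho_pos by (intro mult_left_mono) auto
  also have "\<dots> = exp (c * norm (s - t)) * (\<rho> * exp (- c * norm (1 - t)))" unfolding exp_add by simp
  finally show ?thesis unfolding v_def .
qed

text \<open>The factor x gains exp(- (1 - x)), while moving from s to s x changes \<open>v\<close>
  by at most exp((1 - x) / 2), because c |s| <= 1/2. Half of the gain survives.\<close>

lemma v_ray: assumes "s \<in> ball 0 (r\<^sup>2)" "0 \<le> x" "x \<le> 1"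
  shows "x * v s \<le> exp (- (1 - x) / 2) * v (s * of_real x)"
proof -
  have "norm (s - s * of_real x) = norm s * (1 - x)"
  proof -
    have "s - s * of_real x = s * of_real (1 - x)" by (simp add: algebra_simps)
    then show ?thesis using assms by (simp add: norm_mult del: of_real_diff)
  qed
  also have "c * \<dots> \<le> (1/2) * (1 - x)"
  proof -
    have "c * norm s \<le> c * r\<^sup>2" using assms c_pos by simp
    then have "c * norm s \<le> 1/2" using c_small by linarith
    then have "(c * norm s) * (1 - x) \<le> (1/2) * (1 - x)" using assms by (intro mult_right_mono) auto
    then show ?thesis by simp
  qed
  finally have 1: "c * norm (s - s * of_real x) \<le> (1 - x) / 2" by simp
  have 2: "x \<le> exp (- (1 - x))" using exp_ge_add_one_self[of "x - 1"] by simp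
  have "x * v s \<le> exp (- (1 - x)) * (exp (c * norm (s - s * of_real x)) * v (s * of_real x))"
    using 2 v_ratio v_pos assms(2) by (intro mult_mono) (auto simp: less_imp_le)
  also have "\<dots> \<le> exp (- (1 - x)) * (exp ((1 - x)/2) * v (s * of_real x))"
    using 1 v_pos by (intro mult_left_mono mult_right_mono) (auto simp: less_imp_le)
  also have "\<dots> = exp (- (1 - x) / 2) * v (s * of_real x)"
  proof -
    have "- (1 - x) + (1 - x) / 2 = - (1 - x) / 2" by (simp add: field_simps)
    then have "exp (- (1 - x)) * exp ((1 - x) / 2) = exp (- (1 - x) / 2)"
      by (simp only: exp_add[symmetric])
    then show ?thesis by (metis mult.assoc)
  qed
  finally show ?thesis .
qed

text \<open>Passing from k to k + 1 in the exponent costs exp((1 - x) / 2) <= 2 and makes the decay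
  available for k = 0 as well.\<close>

lemma v_ray_power:
  assumes "s \<in> ball 0 (r\<^sup>2)" "0 \<le> x" "x \<le> 1"
  shows "x ^ k * v s ^ k \<le> 2 * exp (- (real k + 1) * (1 - x) / 2) * v (s * of_real x) ^ k"
proof -
  have "x ^ k * v s ^ k \<le> (exp (- (1 - x) / 2) * v (s * of_real x)) ^ k"
    unfolding power_mult_distrib[symmetric] using v_ray[OF assms] assms v_pos
    by (intro power_mono) (auto simp: less_imp_le)
  also have "\<dots> = exp (- (real k) * (1 - x) / 2) * v (s * of_real x) ^ k"
    by (simp add: power_mult_distrib exp_of_nat_mult[symmetric] algebra_simps)
  also have "exp (- (real k) * (1 - x) / 2) = exp ((1-x)/2) * exp (- (real k + 1) * (1 - x) / 2)"
  proof -
    have "- (real k) * (1 - x) / 2 = (1 - x) / 2 + (- (real k + 1) * (1 - x) / 2)" by (simp add: field_simps)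
    then show ?thesis by (simp only: exp_add[symmetric])
  qed
  also have "\<dots> \<le> 2 * exp (- (real k + 1) * (1 - x) / 2)"
  proof -
    have "exp ((1-x)/2) \<le> exp (1/2)" using assms by simp
    also have "\<dots> \<le> 2"
    proof -
      have "exp (1/2::real)^2 \<le> 2^2" using exp_le by (simp add: power2_eq_square exp_add[symmetric])
      then show ?thesis by (rule power2_le_imp_le) simp
    qed
    finally show ?thesis by simp
  qed
  finally show ?thesis using v_pos by (simp add: mult_right_mono less_imp_le)
qed

lemma ray_in_ball: "s \<in> ball 0 (r\<^sup>2) \<Longrightarrow> 0 \<le> x \<Longrightarrow> x \<le> 1 \<Longrightarrow> s * of_real x \<in> ball (0::complex) (r\<^sup>2)"
  using mult_left_le[of x "norm s"] by (simp add: norm_mult)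

text \<open>The decay in the power estimate lives within distance of order 1/(k + 1) from x = 1: its
  integral is at most 2/(k + 1), and the prefactor 2 makes 4.\<close>

lemma integral_ray_bound:
  assumes s: "s \<in> ball 0 (r\<^sup>2)" and f: "continuous_on {0..1} f"
    and bound: "\<And>x. 0 \<le> x \<Longrightarrow> x \<le> 1 \<Longrightarrow> norm (f x) * v (s * of_real x) ^ k \<le> B * x ^ k" and "0 \<le> B"
  shows "norm (integral {0..1} f :: complex) * v s ^ k \<le> 4 * B / (real k + 1)"
proof -
  define g where "g x = B * (2 * exp (- (real k + 1) * (1 - x) / 2)) / v s ^ k" for x
  have "((\<lambda>x. B * (2 * exp (- (real k + 1) * (1 - x) / 2)) / v s ^ k) has_integral
      4 * B / (real k + 1) / v s ^ k * exp (- (real k + 1) * (1 - 1) / 2)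
    - 4 * B / (real k + 1) / v s ^ k * exp (- (real k + 1) * (1 - 0) / 2)) {0..1}"
  proof (rule fundamental_theorem_of_calculus)
    fix x :: real
    have "((\<lambda>x. C * exp (- q * (1 - x) / 2)) has_real_derivative C * (exp (- q * (1 - x) / 2) * (q / 2))) (at x within {0..1})"
      for C q :: real by (auto intro!: derivative_eq_intros)
    note this[of "4 * B / (real k + 1) / v s ^ k" "real k + 1"]
    moreover have "4 * B / (real k + 1) / v s ^ k * (exp (- (real k + 1) * (1 - x) / 2) * ((real k + 1) / 2))
      = B * (2 * exp (- (real k + 1) * (1 - x) / 2)) / v s ^ k"
    proof -
      have "4 * B / q / w * (e * (q / 2)) = B * (2 * e) / w" if "q \<noteq> 0" "w \<noteq> 0" for q w e :: real
        using that by (simp add: field_simps)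
      moreover have "real k + 1 \<noteq> 0" "v s ^ k \<noteq> 0" using v_pos[of s] by auto
      ultimately show ?thesis by blast
    qed
    ultimately show "((\<lambda>x. 4 * B / (real k + 1) / v s ^ k * exp (- (real k + 1) * (1 - x) / 2)) has_vector_derivative
      B * (2 * exp (- (real k + 1) * (1 - x) / 2)) / v s ^ k) (at x within {0..1})"
      by (simp only: has_real_derivative_iff_has_vector_derivative)
  qed simp
  then have gi: "(g has_integral 4 * B / (real k + 1) / v s ^ k * exp (- (real k + 1) * (1 - 1) / 2)
    - 4 * B / (real k + 1) / v s ^ k * exp (- (real k + 1) * (1 - 0) / 2)) {0..1}"
    unfolding g_def[abs_def] .
  have gv: "integral {0..1} g \<le> 4 * B / (real k + 1) / v s ^ k"
    unfolding integral_unique[OF gi] using \<open>0 \<le> B\<close> v_pos[of s] by (simp add: less_imp_le)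
  have "norm (integral {0..1} f) \<le> integral {0..1} g"
  proof (rule integral_norm_bound_integral)
    show "f integrable_on {0..1}" by (rule integrable_continuous_interval[OF f])
    fix x :: real assume "x \<in> {0..1}"
    then have x: "0 \<le> x" "x \<le> 1" by auto
    let ?w = "v (s * of_real x) ^ k"
    have w: "0 < ?w" "0 < v s ^ k" using v_pos by auto
    have "norm (f x) * ?w * v s ^ k \<le> B * (x ^ k * v s ^ k)"
      using mult_right_mono[OF bound[OF x], of "v s ^ k"] w by simp
    also have "\<dots> \<le> B * (2 * exp (- (real k + 1) * (1 - x) / 2) * ?w)"
      using v_ray_power[OF s x] \<open>0 \<le> B\<close> by (intro mult_left_mono)
    finally have "(norm (f x) * v s ^ k) * ?w \<le> (B * (2 * exp (- (real k + 1) * (1 - x) / 2))) * ?w"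
      by (simp add: mult_ac)
    then have "norm (f x) * v s ^ k \<le> B * (2 * exp (- (real k + 1) * (1 - x) / 2))"
      using w mult_le_cancel_right_pos by blast
    then show "norm (f x) \<le> g x" using w by (simp add: g_def pos_le_divide_eq)
  qed (use gi in blast)
  then have "norm (integral {0..1} f) \<le> 4 * B / (real k + 1) / v s ^ k" using gv by linarith
  then show ?thesis using v_pos[of s] by (simp add: pos_le_divide_eq mult_ac)
qed

text \<open>The solution of the Euler equation s A' + (k + 1) A = a that is regular at 0 is the
  integral of \<open>x ^ k * a (s * x)\<close> over the unit interval. Its derivative is controlled
  without loss: away from 0 by the equation itself, near 0 by a Cauchy estimate whose factor k + 1
  the integration gives back.\<close>

lemma radial_integral:
  assumes a: "a holomorphic_on ball 0 (r\<^sup>2)"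
    and M: "\<And>s. s \<in> ball 0 (r\<^sup>2) \<Longrightarrow> norm (a s) * v s ^ k \<le> M"
  obtains A A' where
    "\<And>s. s \<in> ball 0 (r\<^sup>2) \<Longrightarrow> (A has_field_derivative A' s) (at s)"
    "\<And>s. s \<in> ball 0 (r\<^sup>2) \<Longrightarrow> s * A' s + of_nat (k + 1) * A s = a s"
    "\<And>s. s \<in> ball 0 (r\<^sup>2) \<Longrightarrow> norm (A s) * v s ^ k \<le> 4 * M / (real k + 1)"
    "\<And>s. s \<in> ball 0 (r\<^sup>2) \<Longrightarrow> norm (A' s) * v s ^ k \<le> 16 * M"
proof
  let ?S = "ball (0::complex) (r\<^sup>2)"
  define A where "A s = integral {0..1} (\<lambda>x. of_real x ^ k * a (s * of_real x))" for s
  define A' where "A' s = integral {0..1} (\<lambda>x. of_real x ^ (k+1) * deriv a (s * of_real x))" for s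
  have M0: "0 \<le> M" using M[of 0] r2_gt_1 v_pos[of 0]
    by (smt (verit, best) centre_in_ball norm_ge_zero zero_le_mult_iff zero_le_power)
  have da: "(a has_field_derivative deriv a s) (at s)" if "s \<in> ?S" for s
    using a that holomorphic_derivI open_ball by blast
  have da_hol: "deriv a holomorphic_on ?S" using a by (simp add: holomorphic_deriv)
  have ca: "continuous_on ?S a" "continuous_on ?S (deriv a)"
    using a da_hol holomorphic_on_imp_continuous_on by auto
  have cr: "continuous_on {0..1} (\<lambda>x. of_real x ^ j * f (s * of_real x :: complex))"
    if "s \<in> ?S" "continuous_on ?S f" for s j and f :: "complex \<Rightarrow> complex"
    by (intro continuous_intros continuous_on_compose2[OF that(2)])
       (use ray_in_ball[OF that(1)] in auto)
  show dA: "(A has_field_derivative A' s) (at s)" if s: "s \<in> ?S" for s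
  proof -
    have "((\<lambda>s. integral (cbox 0 1) (\<lambda>x. of_real x ^ k * a (s * of_real x))) has_field_derivative
       integral (cbox 0 1) ((\<lambda>s x. of_real x ^ (k+1) * deriv a (s * of_real x)) s)) (at s within ?S)"
    proof (rule leibniz_rule_field_derivative)
      fix s :: complex and x :: real assume s: "s \<in> ?S" and "x \<in> cbox 0 1"
      then have x: "0 \<le> x" "x \<le> 1" by auto
      have "((\<lambda>s. a (s * of_real x)) has_field_derivative deriv a (s * of_real x) * of_real x) (at s within ?S)"
        by (rule DERIV_chain2[of a _ "\<lambda>s. s * of_real x", OF da[OF ray_in_ball[OF s x]]]) (auto intro!: derivative_eq_intros)
      then show "((\<lambda>s. of_real x ^ k * a (s * of_real x)) has_field_derivative of_real x ^ (k+1) * deriv a (s * of_real x)) (at s within ?S)"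
        by (auto intro!: derivative_eq_intros)
    next
      fix s :: complex assume "s \<in> ?S"
      then show "(\<lambda>x. of_real x ^ k * a (s * of_real x)) integrable_on cbox 0 1"
        using integrable_continuous_interval[OF cr[OF _ ca(1), of s k]] by simp
    next
      show "continuous_on (?S \<times> cbox 0 1) (\<lambda>(s, x). complex_of_real x ^ (k + 1) * deriv a (s * complex_of_real x))"
        unfolding case_prod_beta
        by (intro continuous_intros continuous_on_compose2[OF ca(2)])
          (use ray_in_ball in auto)
    qed (use s in auto)
    then show ?thesis
      unfolding at_within_open[OF s open_ball] A_def[abs_def] A'_def box_real .
  qed
  show eq: "s * A' s + of_nat (k + 1) * A s = a s" if s: "s \<in> ?S" for s
  proof -
    have i: "((\<lambda>x. of_nat (k+1) * (of_real x ^ k * a (s * of_real x)) + s * (of_real x ^ (k+1) * deriv a (s * of_real x)))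
       has_integral (of_real 1 ^ (k+1) * a (s * of_real 1) - of_real 0 ^ (k+1) * a (s * of_real 0))) {0..1}"
    proof (rule fundamental_theorem_of_calculus)
      fix x :: real assume "x \<in> {0..1}"
      then have x: "0 \<le> x" "x \<le> 1" by auto
      have "((\<lambda>z. z ^ (k+1) * a (s * z)) has_field_derivative
          of_nat (k+1) * (of_real x ^ k * a (s * of_real x)) + s * (of_real x ^ (k+1) * deriv a (s * of_real x))) (at (of_real x))"
      proof -
        have "((\<lambda>z. a (s * z)) has_field_derivative deriv a (s * of_real x) * s) (at (of_real x))"
          by (rule DERIV_chain2[of a _ "\<lambda>z. s * z", OF da[OF ray_in_ball[OF s x]]]) (auto intro!: derivative_eq_intros)
        from DERIV_mult[OF DERIV_power[OF DERIV_ident, of "k+1"] this]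
        show ?thesis by (simp add: algebra_simps)
      qed
      from has_vector_derivative_real_field[OF this]
      show "((\<lambda>x. of_real x ^ (k+1) * a (s * of_real x)) has_vector_derivative
        of_nat (k+1) * (of_real x ^ k * a (s * of_real x)) + s * (of_real x ^ (k+1) * deriv a (s * of_real x))) (at x within {0..1})"
        by (simp add: has_vector_derivative_at_within)
    qed simp
    have "((\<lambda>x. of_nat (k+1) * (of_real x ^ k * a (s * of_real x)) + s * (of_real x ^ (k+1) * deriv a (s * of_real x)))
       has_integral (of_nat (k+1) * A s + s * A' s)) {0..1}"
      unfolding A_def A'_def
      by (intro has_integral_add has_integral_mult_right integrable_integral integrable_continuous_interval cr s ca)
    from has_integral_unique[OF this i] show ?thesis by (simp add: add.commute)
  qed
  show A_le: "norm (A s) * v s ^ k \<le> 4 * M / (real k + 1)" if s: "s \<in> ?S" for s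
    unfolding A_def
  proof (rule integral_ray_bound[OF s cr[OF s ca(1)] _ M0])
    fix x :: real assume x: "0 \<le> x" "x \<le> 1"
    show "norm (of_real x ^ k * a (s * of_real x)) * v (s * of_real x) ^ k \<le> M * x ^ k"
      using mult_right_mono[OF M[OF ray_in_ball[OF s x]], of "x ^ k"] x
      by (simp add: norm_mult norm_power mult_ac)
  qed
  show "norm (A' s) * v s ^ k \<le> 16 * M" if s: "s \<in> ?S" for s
  proof (cases "norm s < 1/2")
    case True
    have "norm (A' s) * v s ^ k \<le> 4 * (4 * (real k + 1) * M) / (real k + 1)"
      unfolding A'_def
    proof (rule integral_ray_bound[OF s cr[OF s ca(2)]])
      fix x :: real assume x: "0 \<le> x" "x \<le> 1"
      define t where "t = s * complex_of_real x"
      have t: "norm t < 1/2" using True x unfolding t_def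
        by (simp add: norm_mult) (smt (verit, best) mult_left_le norm_ge_zero)
      \<comment> \<open>On this scale \<open>v ^ k\<close> varies by a factor of at most 2, and the
        Cauchy estimate costs 1/d = 2 (k + 1).\<close>
      define d where "d = 1 / (2 * (real k + 1))"
      have d: "0 < d" "d \<le> 1/2" by (auto simp: d_def field_simps)
      have sub: "cball t d \<subseteq> ?S"
      proof
        fix z assume "z \<in> cball t d"
        then have "norm z \<le> norm t + d" by (metis dist_norm mem_cball norm_triangle_sub norm_minus_commute add.commute add_left_mono order_trans)
        then show "z \<in> ?S" using t d r2_gt_1 by simp
      qed
      have "norm ((deriv ^^ 1) a t) \<le> fact 1 * (2 * M / v t ^ k) / d ^ 1"
      proof (rule Cauchy_inequality)
        show "a holomorphic_on ball t d" "continuous_on (cball t d) a"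
          using sub a ca(1) ball_subset_cball[of t d]
          by (meson holomorphic_on_subset continuous_on_subset subset_trans)+
        fix z assume z: "norm (t - z) = d"
        then have zS: "z \<in> ?S" using sub by (auto simp: dist_norm)
        have "v t ^ k \<le> (exp (c * d) * v z) ^ k"
          using v_ratio[of t z] z v_pos by (intro power_mono) (auto simp: less_imp_le)
        also have "\<dots> = exp (real k * (c * d)) * v z ^ k"
          by (simp add: power_mult_distrib exp_of_nat_mult)
        also have "exp (real k * (c * d)) \<le> 2"
        proof -
          have "real k * d \<le> 1/2" by (simp add: d_def field_simps)
          then have "c * (real k * d) \<le> c * (1/2)" using c_pos by (intro mult_left_mono) auto
          then have "real k * (c * d) \<le> 1/2" using c_le_half by (simp add: mult_ac)
          then have "exp (real k * (c * d)) \<le> exp (1/2)" by simp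
          also have "\<dots> \<le> 2"
          proof -
            have "exp (1/2::real)^2 \<le> 2^2" using exp_le by (simp add: power2_eq_square exp_add[symmetric])
            then show ?thesis by (rule power2_le_imp_le) simp
          qed
          finally show ?thesis .
        qed
        finally have "v t ^ k \<le> 2 * v z ^ k" using v_pos[of z] by (simp add: mult_right_mono less_imp_le)
        then have "norm (a z) * v t ^ k \<le> norm (a z) * (2 * v z ^ k)" by (intro mult_left_mono) auto
        also have "\<dots> \<le> 2 * M" using M[OF zS] by simp
        finally show "norm (a z) \<le> 2 * M / v t ^ k" using v_pos[of t] by (simp add: pos_le_divide_eq)
      qed (use d in auto)
      then have "norm (deriv a t) * v t ^ k \<le> 4 * (real k + 1) * M"
        using v_pos[of t] by (simp add: d_def field_simps)
      then have "norm (deriv a t) * v t ^ k * x^(k+1) \<le> 4 * (real k + 1) * M * x ^ k"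
        using x M0 power_decreasing[of k "k+1" x]
        by (intro mult_mono[of "norm (deriv a t) * v t ^ k"]) auto
      then show "norm (of_real x ^ (k+1) * deriv a (s * of_real x)) * v (s * of_real x) ^ k \<le> 4 * (real k + 1) * M * x ^ k"
        using x by (simp add: norm_mult norm_power t_def mult_ac)
    qed (use M0 in auto)
    also have "\<dots> = 16 * M"
    proof -
      have "4 * (4 * q * M) / q = 16 * M" if "q \<noteq> 0" for q :: real using that by simp
      moreover have "real k + 1 \<noteq> 0" by linarith
      ultimately show ?thesis by blast
    qed
    finally show ?thesis .
  next
    \<comment> \<open>For |s| >= 1/2 the equation s A' = a - (k + 1) A may be divided by s; its
      right side is at most M + 4 M after weighting.\<close>
    case False
    let ?w = "v s ^ k"
    have w: "0 < ?w" using v_pos by simp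
    have "norm s * norm (A' s) = norm (a s - of_nat (k+1) * A s)"
      using eq[OF s] by (metis add_diff_cancel_right' norm_mult)
    also have "\<dots> \<le> norm (a s) + (real k + 1) * norm (A s)"
    proof -
      have "norm (of_nat (k+1) * A s) = (real k + 1) * norm (A s)"
        by (metis norm_mult norm_of_nat of_nat_1 of_nat_add)
      then show ?thesis by (metis norm_triangle_ineq4)
    qed
    finally have "norm s * norm (A' s) * ?w \<le> (norm (a s) + (real k + 1) * norm (A s)) * ?w"
      using w by (intro mult_right_mono) auto
    also have "\<dots> = norm (a s) * ?w + (real k + 1) * (norm (A s) * ?w)" by (simp add: algebra_simps)
    also have "\<dots> \<le> M + (real k + 1) * (4 * M / (real k + 1))"
      using M[OF s] A_le[OF s] by (intro add_mono mult_left_mono) auto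
    also have "\<dots> = 5 * M" by simp
    finally have 1: "norm s * (norm (A' s) * ?w) \<le> 5 * M" by (simp add: mult_ac)
    have "(1/2) * (norm (A' s) * ?w) \<le> norm s * (norm (A' s) * ?w)"
      using False w by (intro mult_right_mono) auto
    then show ?thesis using 1 M0 by simp
  qed
qed

text \<open>On the segment from 1 to s the weight is an exact exponential of the arc length, so
  integrating the bound \<open>B / v ^ k\<close> gains 1/(c k). This is why \<open>v\<close> is
  centred at 1. For k = 0 there is no gain and the length of the segment enters, at most 1 + r^2.
  The constant covers both cases, since 1/k <= 2/(k + 1).\<close>

lemma radial_primitive:
  assumes A: "A holomorphic_on ball 0 (r\<^sup>2)"
    and B: "\<And>s. s \<in> ball 0 (r\<^sup>2) \<Longrightarrow> norm (A s) * v s ^ k \<le> B"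
  obtains u where "u 1 = 0"
    "\<And>s. s \<in> ball 0 (r\<^sup>2) \<Longrightarrow> (u has_field_derivative A s) (at s)"
    "\<And>s. s \<in> ball 0 (r\<^sup>2) \<Longrightarrow> norm (u s) * v s ^ k \<le> (2/c + 1 + r\<^sup>2) * B / (real k + 1)"
proof -
  let ?S = "ball (0::complex) (r\<^sup>2)"
  obtain g where g: "\<And>s. s \<in> ?S \<Longrightarrow> (g has_field_derivative A s) (at s within ?S)"
    using holomorphic_convex_primitive'[OF convex_ball open_ball A] by blast
  have one: "1 \<in> ?S" using r2_gt_1 by simp
  have B0: "0 \<le> B" using B[OF one] v_pos[of 1] by (smt (verit) norm_ge_zero mult_nonneg_nonneg zero_le_power)
  define u where "u = (\<lambda>s. g s - g 1)"
  have du: "(u has_field_derivative A s) (at s)" if "s \<in> ?S" for s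
  proof -
    have "(g has_field_derivative A s) (at s)" using g[OF that] unfolding at_within_open[OF that open_ball] .
    from DERIV_diff[OF this DERIV_const[of "g 1"]] show ?thesis unfolding u_def by simp
  qed
  have "norm (u s) * v s ^ k \<le> (2/c + 1 + r\<^sup>2) * B / (real k + 1)" if s: "s \<in> ?S" for s
  proof -
    define d where "d = norm (s - 1)"
    define p where "p x = 1 + of_real x * (s - 1)" for x
    have pS: "p x \<in> ?S" if "0 \<le> x" "x \<le> 1" for x
    proof -
      have "p x = (1 - x) *\<^sub>R 1 + x *\<^sub>R s" by (simp add: p_def algebra_simps scaleR_conv_of_real)
      then show ?thesis using convexD_alt[OF convex_ball one s, of x] that by simp
    qed
    have dp: "((\<lambda>x. u (p x)) has_vector_derivative (s - 1) * A (p x)) (at x)" if "0 \<le> x" "x \<le> 1" for x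
    proof -
      have "((\<lambda>z. u (1 + z * (s - 1))) has_field_derivative A (1 + of_real x * (s - 1)) * (s - 1)) (at (of_real x))"
        by (rule DERIV_chain2[of u _ "\<lambda>z. 1 + z * (s - 1)", OF du[OF pS[OF that, unfolded p_def]]]) (auto intro!: derivative_eq_intros)
      from has_vector_derivative_real_field[OF this] show ?thesis unfolding p_def by (simp add: mult.commute)
    qed
    have vp: "v (p x) ^ k = \<rho> ^ k * exp (- (c * real k * d * x))" if "0 \<le> x" for x
    proof -
      have "norm (1 - p x) = x * d" using that by (simp add: p_def d_def norm_mult)
      then have "v (p x) = \<rho> * exp (- c * (x * d))" by (simp add: v_def)
      then show ?thesis by (simp add: power_mult_distrib exp_of_nat_mult[symmetric] mult_ac)
    qed
    have nb: "norm ((s - 1) * A (p x)) \<le> d * B / \<rho> ^ k * exp (c * real k * d * x)" if x: "0 \<le> x" "x \<le> 1" for x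
    proof -
      have "norm (A (p x)) \<le> B / v (p x) ^ k" using B[OF pS[OF x]] v_pos by (simp add: pos_le_divide_eq)
      then have "d * norm (A (p x)) \<le> d * (B / v (p x) ^ k)" by (intro mult_left_mono) (auto simp: d_def)
      then show ?thesis unfolding vp[OF x(1)] norm_mult d_def[symmetric] by (simp add: exp_minus field_simps)
    qed
    have vs: "v s ^ k = \<rho> ^ k * exp (- (c * real k * d))" using vp[of 1] by (simp add: p_def)
    have cont: "continuous_on {0..1} (\<lambda>x. u (p x))"
      by (rule continuous_at_imp_continuous_on) (use has_vector_derivative_continuous[OF dp] in auto)
    show ?thesis
    proof (cases "k = 0")
      case True
      have "norm (u (p 1) - u (p 0)) \<le> d * B * 1 - d * B * 0"
      proof (rule differentiable_bound_general[OF _ cont, where f' = "\<lambda>x. (s - 1) * A (p x)"])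
        show "((\<lambda>x. d * B * x) has_vector_derivative d * B) (at x)" for x
          by (auto intro!: derivative_eq_intros simp: has_real_derivative_iff_has_vector_derivative[symmetric])
      qed (use dp nb True in \<open>auto intro!: continuous_intros\<close>)
      moreover have "d * B \<le> (2/c + 1 + r\<^sup>2) * B"
      proof (rule mult_right_mono[OF _ B0])
        have "d \<le> 1 + r\<^sup>2" using s norm_triangle_ineq4[of s 1] by (simp add: d_def)
        moreover have "0 < 2/c" using c_pos by simp
        ultimately show "d \<le> 2/c + 1 + r\<^sup>2" by linarith
      qed
      ultimately show ?thesis using True by (simp add: p_def u_def)
    next
      case False
      define K where "K = B / \<rho> ^ k / (c * real k)"
      have K0: "0 \<le> K" using B0 rho_pos c_pos by (simp add: K_def)
      have "norm (u (p 1) - u (p 0)) \<le> K * exp (c * real k * d * 1) - K * exp (c * real k * d * 0)"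
      proof (rule differentiable_bound_general[OF _ cont, where f' = "\<lambda>x. (s - 1) * A (p x)"])
        show "((\<lambda>x. K * exp (c * real k * d * x)) has_vector_derivative K * (exp (c * real k * d * x) * (c * real k * d))) (at x)" for x
          by (auto intro!: derivative_eq_intros simp: has_real_derivative_iff_has_vector_derivative[symmetric])
        show "norm ((s - 1) * A (p x)) \<le> K * (exp (c * real k * d * x) * (c * real k * d))" if "0 < x" "x < 1" for x
        proof -
          have "K * (exp (c * real k * d * x) * (c * real k * d)) = d * B / \<rho> ^ k * exp (c * real k * d * x)"
            using False c_pos by (simp add: K_def field_simps)
          then show ?thesis using nb[of x] that by simp
        qed
      qed (use dp in \<open>auto intro!: continuous_intros\<close>)
      then have "norm (u s) \<le> K * exp (c * real k * d)" using K0 by (simp add: p_def u_def)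
      then have "norm (u s) * v s ^ k \<le> K * exp (c * real k * d) * v s ^ k"
        using v_pos[of s] by (intro mult_right_mono) auto
      also have "\<dots> = B / (c * real k)"
        unfolding vs K_def using rho_pos by (simp add: exp_minus field_simps)
      also have "\<dots> \<le> (2/c) * B / (real k + 1)"
      proof -
        have "1 / real k \<le> 2 / (real k + 1)" using False by (simp add: field_simps)
        then have "(B / c) * (1 / real k) \<le> (B / c) * (2 / (real k + 1))" using B0 c_pos by (intro mult_left_mono) auto
        then show ?thesis by (simp add: field_simps)
      qed
      also have "\<dots> \<le> (2/c + 1 + r\<^sup>2) * B / (real k + 1)"
        using B0 by (intro divide_right_mono mult_right_mono) auto
      finally show ?thesis .
    qed
  qed
  then show thesis using that[of u] du by (auto simp: u_def)
qed

section \<open>Angular modes\<close>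

definition em :: "int \<Rightarrow> complex \<Rightarrow> complex \<Rightarrow> complex"
  where "em m \<zeta> \<eta> = (if 0 \<le> m then \<zeta> ^ nat m else \<eta> ^ nat (- m))"

text \<open>The profile a of one term \<open>em m \<zeta> \<eta> * a (\<zeta> * \<eta>)\<close>. On
  the real section \<eta> = cnj \<zeta> the factor \<open>em\<close> is a power of |\<zeta>| times
  the character of frequency m, and a is a function of |\<zeta>|^2. The power |m| of the weight
  makes M dominate the whole term.\<close>

definition atom :: "int \<Rightarrow> (complex \<Rightarrow> complex) \<Rightarrow> real \<Rightarrow> bool" where
  "atom m a M \<longleftrightarrow> a holomorphic_on ball 0 (r\<^sup>2) \<and>
     (\<forall>s\<in>ball 0 (r\<^sup>2). norm (a s) * v s ^ nat \<bar>m\<bar> \<le> M)"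

lemma mult_in_ball: "\<zeta> \<in> ball 0 r \<Longrightarrow> \<eta> \<in> ball 0 r \<Longrightarrow> \<zeta> * \<eta> \<in> ball (0::complex) (r\<^sup>2)"
  using r_pos by (simp add: norm_mult power2_eq_square mult_strict_mono)

lemma v_ge_1: "s \<in> ball 0 (r\<^sup>2) \<Longrightarrow> 1 \<le> v s" using r_le_v[of s] r_gt_1 by linarith

text \<open>Two derivatives change the mode, hence the exponent of the weight, by at most 2. Since 1
  <= v <= \<rho>, this costs \<rho>^2.\<close>

lemma v_power_shift:
  assumes "norm x * v s ^ k \<le> B" "s \<in> ball 0 (r\<^sup>2)" "j \<le> k + 2"
  shows "norm x * v s ^ j \<le> \<rho>\<^sup>2 * B"
proof -
  have "v s ^ j \<le> v s ^ (k + 2)" using v_ge_1[OF assms(2)] assms(3) by (rule power_increasing[rotated])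
  also have "\<dots> \<le> v s ^ k * \<rho>\<^sup>2" unfolding power_add
    using v_pos[of s] v_le_rho[of s] by (intro mult_left_mono power_mono) (auto simp: less_imp_le)
  finally have "norm x * v s ^ j \<le> norm x * (v s ^ k * \<rho>\<^sup>2)" by (intro mult_left_mono) auto
  also have "\<dots> = \<rho>\<^sup>2 * (norm x * v s ^ k)" by simp
  also have "\<dots> \<le> \<rho>\<^sup>2 * B" using assms(1) by (intro mult_left_mono) auto
  finally show ?thesis .
qed

text \<open>The worst constants over all modes added up: 4 (2/c + 1 + r^2) from u, 8 r^2 and 16 r^4
  from the terms s A and s^2 A' of the second derivative, and 32 as room for A, A' and a alone. The
  factor \<rho>^2 pays for the shift of mode.\<close>

definition gc :: real where "gc = \<rho>\<^sup>2 * (4 * (2/c + 1 + r\<^sup>2) + 8 * r\<^sup>2 + 16 * r ^ 4 + 32)"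

lemma gc_pos: "0 < gc"
  unfolding gc_def using rho_pos c_pos by (intro mult_pos_pos add_nonneg_pos) auto

text \<open>The mixed derivative of \<open>em m \<zeta> \<eta> * u (\<zeta> * \<eta>)\<close> is
  \<open>em m\<close> times (k + 1) u' + s u'' with k = |m|. So A = u' solves the Euler equation
  with right side a, and u 1 = 0 is the Dirichlet condition. For m <= 0 two derivatives in \<zeta>
  only produce powers of \<eta>; for m >= 2 they produce factors up to k (k - 1), which are absorbed
  by the gains 1/(k + 1)^2 on u and 1/(k + 1) on A.\<close>

lemma atom_green:
  assumes "atom m a M"
  obtains u m1 p m2 q where "atom m u (gc * M)" "atom m1 p (gc * M)" "atom m2 q (gc * M)" "u 1 = 0"
    "\<And>\<zeta> \<eta>. \<zeta> \<in> ball 0 r \<Longrightarrow> \<eta> \<in> ball 0 r \<Longrightarrow>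
       ((\<lambda>\<zeta>. em m \<zeta> \<eta> * u (\<zeta> * \<eta>)) has_field_derivative em m1 \<zeta> \<eta> * p (\<zeta> * \<eta>)) (at \<zeta>)"
    "\<And>\<zeta> \<eta>. \<zeta> \<in> ball 0 r \<Longrightarrow> \<eta> \<in> ball 0 r \<Longrightarrow>
       ((\<lambda>\<zeta>. em m1 \<zeta> \<eta> * p (\<zeta> * \<eta>)) has_field_derivative em m2 \<zeta> \<eta> * q (\<zeta> * \<eta>)) (at \<zeta>)"
    "\<And>\<zeta> \<eta>. \<zeta> \<in> ball 0 r \<Longrightarrow> \<eta> \<in> ball 0 r \<Longrightarrow>
       ((\<lambda>\<eta>. em m1 \<zeta> \<eta> * p (\<zeta> * \<eta>)) has_field_derivative em m \<zeta> \<eta> * a (\<zeta> * \<eta>)) (at \<eta>)"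
proof -
  let ?S = "ball (0::complex) (r\<^sup>2)"
  define k where "k = nat \<bar>m\<bar>"
  define C3 where "C3 = 2/c + 1 + r\<^sup>2"
  have a: "a holomorphic_on ?S" and aM: "\<And>s. s \<in> ?S \<Longrightarrow> norm (a s) * v s ^ k \<le> M"
    using assms by (auto simp: atom_def k_def)
  have S0: "0 \<in> ?S" using r_pos by simp
  have M0: "0 \<le> M" using aM[OF S0] v_pos[of 0] by (smt (verit) norm_ge_zero mult_nonneg_nonneg zero_le_power)
  obtain A A' where dA: "\<And>s. s \<in> ?S \<Longrightarrow> (A has_field_derivative A' s) (at s)"
    and eqA: "\<And>s. s \<in> ?S \<Longrightarrow> s * A' s + of_nat (k + 1) * A s = a s"
    and bA: "\<And>s. s \<in> ?S \<Longrightarrow> norm (A s) * v s ^ k \<le> 4 * M / (real k + 1)"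
    and bA': "\<And>s. s \<in> ?S \<Longrightarrow> norm (A' s) * v s ^ k \<le> 16 * M"
    using radial_integral[OF a aM] by metis
  have hA: "A holomorphic_on ?S" using dA by (meson holomorphic_onI field_differentiable_at_within field_differentiable_def)
  have hA': "A' holomorphic_on ?S"
    using holomorphic_deriv[OF hA open_ball] dA by (metis (no_types, lifting) DERIV_imp_deriv holomorphic_transform)
  obtain u where u1: "u 1 = 0" and du: "\<And>s. s \<in> ?S \<Longrightarrow> (u has_field_derivative A s) (at s)"
    and bu0: "\<And>s. s \<in> ?S \<Longrightarrow> norm (u s) * v s ^ k \<le> (2/c + 1 + r\<^sup>2) * (4 * M / (real k + 1)) / (real k + 1)"
    using radial_primitive[OF hA bA] by blast
  have hu: "u holomorphic_on ?S" using du by (meson holomorphic_onI field_differentiable_at_within field_differentiable_def)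
  have C30: "0 \<le> C3" using c_pos by (simp add: C3_def)
  have gcM: "\<rho>\<^sup>2 * x \<le> gc * M" if "x \<le> (4 * C3 + 8 * r\<^sup>2 + 16 * r ^ 4 + 32) * M" for x
    unfolding gc_def C3_def[symmetric] using that by (simp add: mult.assoc mult_left_mono)
  have bu: "(real k + 1)\<^sup>2 * (norm (u s) * v s ^ k) \<le> 4 * C3 * M" if "s \<in> ?S" for s
  proof -
    have "C3 * (4 * M / q) / q = 4 * C3 * M / q\<^sup>2" if "q \<noteq> 0" for q :: real
      using that by (simp add: power2_eq_square)
    from this[of "real k + 1"] bu0[OF that] have "norm (u s) * v s ^ k \<le> 4 * C3 * M / (real k + 1)\<^sup>2"
      by (simp add: C3_def)
    then show ?thesis by (simp add: pos_le_divide_eq mult.commute)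
  qed
  have bA2: "(real k + 1) * (norm (A s) * v s ^ k) \<le> 4 * M" if "s \<in> ?S" for s
    using bA[OF that] by (simp add: pos_le_divide_eq mult.commute)
  have sS: "norm s \<le> r\<^sup>2" if "s \<in> ?S" for s using that by auto
  have mono: "x * (norm (u s) * v s ^ k) \<le> 4 * C3 * M" if "s \<in> ?S" "x \<le> (real k + 1)\<^sup>2" for s x
    using bu[OF that(1)] mult_right_mono[OF that(2), of "norm (u s) * v s ^ k"] v_pos[of s] by auto
  have monoA: "x * (norm (A s) * v s ^ k) \<le> 4 * M * y" if "s \<in> ?S" "x \<le> (real k + 1) * y" "0 \<le> y" for s x y
  proof -
    have "x * (norm (A s) * v s ^ k) \<le> ((real k + 1) * y) * (norm (A s) * v s ^ k)"
      using that v_pos[of s] by (intro mult_right_mono) auto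
    also have "\<dots> = y * ((real k + 1) * (norm (A s) * v s ^ k))" by simp
    also have "\<dots> \<le> y * (4 * M)" using bA2[OF that(1)] that(3) by (intro mult_left_mono) auto
    finally show ?thesis by (simp add: mult_ac)
  qed
  have w0: "0 \<le> v s ^ k" for s using v_pos[of s] by simp
  have nonneg: "0 \<le> C3 * M" "0 \<le> r\<^sup>2 * M" "0 \<le> r ^ 4 * M" using C30 M0 by auto
  have bigM: "(4 * C3 + 8 * r\<^sup>2 + 16 * r ^ 4 + 32) * M = 4 * (C3 * M) + 8 * (r\<^sup>2 * M) + 16 * (r ^ 4 * M) + 32 * M"
    by (simp add: algebra_simps)
  have ksq: "1 \<le> (real k + 1)\<^sup>2" "real k \<le> (real k + 1)\<^sup>2" "real k * (real k - 1) \<le> (real k + 1)\<^sup>2"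
    by (auto simp: power2_eq_square algebra_simps)
  have atom_u: "atom m u (gc * M)"
    unfolding atom_def
  proof (intro conjI hu ballI)
    fix s assume s: "s \<in> ?S"
    have "norm (u s) * v s ^ k \<le> 4 * C3 * M" using mono[OF s, of 1] ksq by simp
    from v_power_shift[OF this s, of k] gcM[of "4 * C3 * M"] nonneg M0
    show "norm (u s) * v s ^ nat \<bar>m\<bar> \<le> gc * M" by (simp add: k_def algebra_simps)
  qed
  have atomI: "atom j f (gc * M)"
    if "f holomorphic_on ?S" "nat \<bar>j\<bar> \<le> k + 2"
      "\<And>s. s \<in> ?S \<Longrightarrow> norm (f s) * v s ^ k \<le> (4 * C3 + 8 * r\<^sup>2 + 16 * r ^ 4 + 32) * M" for f j
    unfolding atom_def using that(1) v_power_shift[OF that(3) _ that(2)] gcM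
    by (meson order_refl order_trans)
  have atom_A: "atom j A (gc * M)" if "nat \<bar>j\<bar> \<le> k + 2" for j
  proof (rule atomI[OF hA that])
    fix s assume s: "s \<in> ?S"
    show "norm (A s) * v s ^ k \<le> (4 * C3 + 8 * r\<^sup>2 + 16 * r ^ 4 + 32) * M"
    proof -
      have "norm (A s) * v s ^ k \<le> 4 * M" using monoA[OF s, of 1 1] by simp
      then show ?thesis using nonneg M0 unfolding bigM by linarith
    qed
  qed
  have atom_A': "atom j A' (gc * M)" if "nat \<bar>j\<bar> \<le> k + 2" for j
  proof (rule atomI[OF hA' that])
    fix s assume s: "s \<in> ?S"
    show "norm (A' s) * v s ^ k \<le> (4 * C3 + 8 * r\<^sup>2 + 16 * r ^ 4 + 32) * M"
      using bA'[OF s] nonneg M0 unfolding bigM by linarith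
  qed
  have dmul: "((\<lambda>z. f (z * \<eta>)) has_field_derivative f' (\<zeta> * \<eta>) * \<eta>) (at \<zeta>)"
    "((\<lambda>z. f (\<zeta> * z)) has_field_derivative f' (\<zeta> * \<eta>) * \<zeta>) (at \<eta>)"
    if "\<zeta> * \<eta> \<in> ?S" "\<And>s. s \<in> ?S \<Longrightarrow> (f has_field_derivative f' s) (at s)" for \<zeta> \<eta> f f'
  proof -
    show "((\<lambda>z. f (z * \<eta>)) has_field_derivative f' (\<zeta> * \<eta>) * \<eta>) (at \<zeta>)"
      by (rule DERIV_chain2[of f _ "\<lambda>z. z * \<eta>", OF that(2)[OF that(1)]]) (auto intro!: derivative_eq_intros)
    show "((\<lambda>z. f (\<zeta> * z)) has_field_derivative f' (\<zeta> * \<eta>) * \<zeta>) (at \<eta>)"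
      by (rule DERIV_chain2[of f _ "\<lambda>z. \<zeta> * z", OF that(2)[OF that(1)]]) (auto intro!: derivative_eq_intros)
  qed
  \<comment> \<open>Each derivative in \<zeta> lowers the mode by one. For m = 1 the first
    derivative reaches mode 0 and the second crosses over to powers of \<eta>, so this case has
    formulas of its own.\<close>
  consider "m < 0" | "m = 0" | "m = 1" | "2 \<le> m" by linarith
  then show thesis
  proof cases
    case 1
    then have em: "em m \<zeta> \<eta> = \<eta> ^ k" "em (m - 1) \<zeta> \<eta> = \<eta> ^ (k + 1)" "em (m - 2) \<zeta> \<eta> = \<eta> ^ (k + 2)" for \<zeta> \<eta>
      by (auto simp: em_def k_def nat_diff_distrib nat_add_distrib simp flip: power_Suc intro!: arg_cong[where f="power \<eta>"])
    show thesis
    proof (rule that[OF atom_u atom_A[of "m - 1"] atom_A'[of "m - 2"] u1]; (unfold em)?)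
      fix \<zeta> \<eta> :: complex assume b: "\<zeta> \<in> ball 0 r" "\<eta> \<in> ball 0 r"
      note s = mult_in_ball[OF b]
      show "((\<lambda>\<zeta>. \<eta> ^ k * u (\<zeta> * \<eta>)) has_field_derivative \<eta> ^ (k + 1) * A (\<zeta> * \<eta>)) (at \<zeta>)"
        using DERIV_cmult[OF dmul(1)[OF s du], of "\<eta> ^ k"] by (simp add: mult_ac)
      show "((\<lambda>\<zeta>. \<eta> ^ (k + 1) * A (\<zeta> * \<eta>)) has_field_derivative \<eta> ^ (k + 2) * A' (\<zeta> * \<eta>)) (at \<zeta>)"
        using DERIV_cmult[OF dmul(1)[OF s dA], of "\<eta> ^ (k+1)"] by (simp add: mult_ac)
      show "((\<lambda>\<eta>. \<eta> ^ (k + 1) * A (\<zeta> * \<eta>)) has_field_derivative \<eta> ^ k * a (\<zeta> * \<eta>)) (at \<eta>)"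
        unfolding eqA[OF s, symmetric]
        by (rule DERIV_cong[OF DERIV_mult[OF DERIV_power[OF DERIV_ident, of "k+1"] dmul(2)[OF s dA]]]) (simp_all add: algebra_simps)
    qed (use 1 in \<open>auto simp: k_def\<close>)
  next
    case 2
    then have k: "k = 0" by (simp add: k_def)
    have em: "em m \<zeta> \<eta> = 1" "em (-1) \<zeta> \<eta> = \<eta>" "em (-2) \<zeta> \<eta> = \<eta>\<^sup>2" for \<zeta> \<eta>
      using 2 by (auto simp: em_def)
    show thesis
    proof (rule that[OF atom_u atom_A[of "- 1"] atom_A'[of "- 2"] u1]; (unfold em)?)
      fix \<zeta> \<eta> :: complex assume b: "\<zeta> \<in> ball 0 r" "\<eta> \<in> ball 0 r"
      note s = mult_in_ball[OF b]
      show "((\<lambda>\<zeta>. 1 * u (\<zeta> * \<eta>)) has_field_derivative \<eta> * A (\<zeta> * \<eta>)) (at \<zeta>)"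
        using dmul(1)[OF s du] by (simp add: mult_ac)
      show "((\<lambda>\<zeta>. \<eta> * A (\<zeta> * \<eta>)) has_field_derivative \<eta>\<^sup>2 * A' (\<zeta> * \<eta>)) (at \<zeta>)"
        using DERIV_cmult[OF dmul(1)[OF s dA], of "\<eta>"] by (simp add: mult_ac power2_eq_square)
      show "((\<lambda>\<eta>. \<eta> * A (\<zeta> * \<eta>)) has_field_derivative 1 * a (\<zeta> * \<eta>)) (at \<eta>)"
        unfolding eqA[OF s, symmetric]
        by (rule DERIV_cong[OF DERIV_mult[OF DERIV_ident dmul(2)[OF s dA]]]) (simp_all add: k algebra_simps)
    qed (use 2 in \<open>auto simp: k_def\<close>)
  next
    case 3
    then have k: "k = 1" by (simp add: k_def)
    have em: "em m \<zeta> \<eta> = \<zeta>" "em 0 \<zeta> \<eta> = 1" "em (-1) \<zeta> \<eta> = \<eta>" for \<zeta> \<eta>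
      using 3 by (auto simp: em_def)
    have atp: "atom 0 (\<lambda>s. u s + s * A s) (gc * M)"
    proof (rule atomI)
      fix s assume s: "s \<in> ?S"
      have "norm (u s + s * A s) \<le> norm (u s) + r\<^sup>2 * norm (A s)"
        by (rule order_trans[OF norm_triangle_ineq]) (use sS[OF s] in \<open>auto simp: norm_mult intro!: mult_right_mono\<close>)
      then have "norm (u s + s * A s) * v s ^ k \<le> (norm (u s) + r\<^sup>2 * norm (A s)) * v s ^ k"
        by (intro mult_right_mono w0)
      also have "\<dots> \<le> 4 * C3 * M + 4 * M * r\<^sup>2"
        using mono[OF s, of 1] ksq monoA[OF s, of "r\<^sup>2" "r\<^sup>2"] by (simp add: algebra_simps)
      also have "\<dots> \<le> (4 * C3 + 8 * r\<^sup>2 + 16 * r ^ 4 + 32) * M"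
        unfolding bigM using nonneg M0 by (simp only: mult.assoc mult.commute[of M], linarith?)
      finally show "norm (u s + s * A s) * v s ^ k \<le> (4 * C3 + 8 * r\<^sup>2 + 16 * r ^ 4 + 32) * M" .
    qed (auto intro!: holomorphic_intros hu hA)
    have atq: "atom (-1) (\<lambda>s. 2 * A s + s * A' s) (gc * M)"
    proof (rule atomI)
      fix s assume s: "s \<in> ?S"
      \<comment> \<open>For k = 1 the profile of the second derivative is the left side of the Euler
        equation, hence a itself.\<close>
      have e: "2 * A s + s * A' s = a s" using eqA[OF s] k by (simp add: add.commute)
      show "norm (2 * A s + s * A' s) * v s ^ k \<le> (4 * C3 + 8 * r\<^sup>2 + 16 * r ^ 4 + 32) * M"
        unfolding e using aM[OF s] nonneg M0 unfolding bigM by linarith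
    qed (auto intro!: holomorphic_intros hA hA')
    show thesis
    proof (rule that[OF atom_u atp atq u1]; (unfold em)?)
      fix \<zeta> \<eta> :: complex assume b: "\<zeta> \<in> ball 0 r" "\<eta> \<in> ball 0 r"
      note s = mult_in_ball[OF b]
      note d = dmul[OF s du] dmul[OF s dA]
      show "((\<lambda>\<zeta>. \<zeta> * u (\<zeta> * \<eta>)) has_field_derivative 1 * (u (\<zeta> * \<eta>) + \<zeta> * \<eta> * A (\<zeta> * \<eta>))) (at \<zeta>)"
        using DERIV_mult[OF DERIV_ident d(1)] by (simp add: algebra_simps)
      show "((\<lambda>\<zeta>. 1 * (u (\<zeta> * \<eta>) + \<zeta> * \<eta> * A (\<zeta> * \<eta>))) has_field_derivative \<eta> * (2 * A (\<zeta> * \<eta>) + \<zeta> * \<eta> * A' (\<zeta> * \<eta>))) (at \<zeta>)"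
        by (rule d derivative_eq_intros refl | simp add: algebra_simps)+
      show "((\<lambda>\<eta>. 1 * (u (\<zeta> * \<eta>) + \<zeta> * \<eta> * A (\<zeta> * \<eta>))) has_field_derivative \<zeta> * a (\<zeta> * \<eta>)) (at \<eta>)"
        unfolding eqA[OF s, symmetric] by (rule d derivative_eq_intros refl | simp add: k algebra_simps)+
    qed
  next
    case 4
    define n where "n = nat (m - 2)"
    have kn: "k = n + 2" "m = int n + 2" using 4 by (auto simp: k_def n_def nat_diff_distrib)
    have em: "em m \<zeta> \<eta> = \<zeta> ^ (n+2)" "em (m - 1) \<zeta> \<eta> = \<zeta> ^ (n + 1)" "em (m - 2) \<zeta> \<eta> = \<zeta> ^ n" for \<zeta> \<eta>
      by (auto simp: em_def kn(2) nat_add_distrib simp flip: power_Suc)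
    let ?p = "\<lambda>s. of_nat k * u s + s * A s"
    let ?q = "\<lambda>s. of_nat (k * (k - 1)) * u s + of_nat (2 * k) * (s * A s) + s\<^sup>2 * A' s"
    have atp: "atom (m - 1) ?p (gc * M)"
    proof (rule atomI)
      fix s assume s: "s \<in> ?S"
      have "norm (?p s) \<le> real k * norm (u s) + r\<^sup>2 * norm (A s)"
        by (rule order_trans[OF norm_triangle_ineq]) (use sS[OF s] in \<open>auto simp: norm_mult intro!: mult_right_mono\<close>)
      then have "norm (?p s) * v s ^ k \<le> (real k * norm (u s) + r\<^sup>2 * norm (A s)) * v s ^ k"
        by (intro mult_right_mono w0)
      also have "\<dots> \<le> 4 * C3 * M + 4 * M * r\<^sup>2"
        using mono[OF s, of "real k"] ksq monoA[OF s, of "r\<^sup>2" "r\<^sup>2"] by (simp add: algebra_simps)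
      also have "\<dots> \<le> (4 * C3 + 8 * r\<^sup>2 + 16 * r ^ 4 + 32) * M"
        unfolding bigM using nonneg M0 by (simp only: mult.assoc mult.commute[of M], linarith?)
      finally show "norm (?p s) * v s ^ k \<le> (4 * C3 + 8 * r\<^sup>2 + 16 * r ^ 4 + 32) * M" .
    qed (use kn in \<open>auto intro!: holomorphic_intros hu hA\<close>)
    have atq: "atom (m - 2) ?q (gc * M)"
    proof (rule atomI)
      fix s assume s: "s \<in> ?S"
      have s2: "norm (s\<^sup>2) \<le> r ^ 4" using power_mono[OF sS[OF s], of 2] by (simp add: norm_power power_mult[symmetric])
      have k2: "real (k * (k - 1)) = real k * (real k - 1)" using kn by (simp add: of_nat_diff algebra_simps)
      have "norm (?q s) \<le> norm (of_nat (k * (k - 1)) * u s) + norm (of_nat (2 * k) * (s * A s)) + norm (s\<^sup>2 * A' s)"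
        by (meson norm_triangle_ineq norm_triangle_mono order_refl)
      also have "\<dots> \<le> (real k * (real k - 1)) * norm (u s) + (2 * real k * r\<^sup>2) * norm (A s) + r ^ 4 * norm (A' s)"
        unfolding norm_mult norm_of_nat k2 using sS[OF s] s2
        by (intro add_mono mult_right_mono order_refl) (auto intro!: mult_left_mono mult_right_mono simp: mult.assoc)
      finally have "norm (?q s) * v s ^ k \<le> ((real k * (real k - 1)) * norm (u s) + (2 * real k * r\<^sup>2) * norm (A s) + r ^ 4 * norm (A' s)) * v s ^ k"
        by (intro mult_right_mono w0)
      also have "\<dots> = (real k * (real k - 1)) * (norm (u s) * v s ^ k) + (2 * real k * r\<^sup>2) * (norm (A s) * v s ^ k) + r ^ 4 * (norm (A' s) * v s ^ k)"
        by (simp add: algebra_simps)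
      also have "\<dots> \<le> 4 * C3 * M + 4 * M * (2 * r\<^sup>2) + r ^ 4 * (16 * M)"
        using ksq bA'[OF s] by (intro add_mono mono monoA s mult_left_mono) (auto simp: algebra_simps)
      also have "\<dots> \<le> (4 * C3 + 8 * r\<^sup>2 + 16 * r ^ 4 + 32) * M"
        unfolding bigM using nonneg M0 by (simp only: mult.assoc mult.commute[of M], linarith?)
      finally show "norm (?q s) * v s ^ k \<le> (4 * C3 + 8 * r\<^sup>2 + 16 * r ^ 4 + 32) * M" .
    qed (use kn in \<open>auto intro!: holomorphic_intros hu hA hA'\<close>)
    have Suc_k: "of_nat k = (of_nat n + 2 :: complex)" "of_nat (k * (k - 1)) = ((of_nat n + 2) * (of_nat n + 1) :: complex)"
      "of_nat (2 * k) = (2 * of_nat n + 4 :: complex)" "of_nat (k + 1) = (of_nat n + 3 :: complex)"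
      by (auto simp: kn algebra_simps)
    show thesis
    proof (rule that[OF atom_u atp atq u1]; unfold em)
      fix \<zeta> \<eta> :: complex assume b: "\<zeta> \<in> ball 0 r" "\<eta> \<in> ball 0 r"
      note s = mult_in_ball[OF b]
      note d = dmul[OF s du] dmul[OF s dA]
      note pw = DERIV_power[OF DERIV_ident]
      show "((\<lambda>\<zeta>. \<zeta> ^ (n + 2) * u (\<zeta> * \<eta>)) has_field_derivative \<zeta> ^ (n+1) * ?p (\<zeta> * \<eta>)) (at \<zeta>)"
        by (rule DERIV_cong[OF DERIV_mult[OF pw[of "n+2"] d(1)]]) (unfold Suc_k, simp_all add: algebra_simps)
      have dp: "((\<lambda>\<zeta>. ?p (\<zeta> * \<eta>)) has_field_derivative ((of_nat n + 3) * A (\<zeta> * \<eta>) * \<eta> + \<zeta> * \<eta> * A' (\<zeta> * \<eta>) * \<eta>)) (at \<zeta>)"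
        unfolding Suc_k by (rule d derivative_eq_intros refl | simp add: algebra_simps)+
      show "((\<lambda>\<zeta>. \<zeta> ^ (n+1) * ?p (\<zeta> * \<eta>)) has_field_derivative \<zeta> ^ n * ?q (\<zeta> * \<eta>)) (at \<zeta>)"
        by (rule DERIV_cong[OF DERIV_mult[OF pw[of "n+1"] dp]]) (unfold Suc_k, simp_all add: algebra_simps power2_eq_square)
      have dp2: "((\<lambda>\<eta>. ?p (\<zeta> * \<eta>)) has_field_derivative ((of_nat n + 3) * A (\<zeta> * \<eta>) * \<zeta> + \<zeta> * \<eta> * A' (\<zeta> * \<eta>) * \<zeta>)) (at \<eta>)"
        unfolding Suc_k by (rule d derivative_eq_intros refl | simp add: algebra_simps)+
      show "((\<lambda>\<eta>. \<zeta> ^ (n+1) * ?p (\<zeta> * \<eta>)) has_field_derivative \<zeta> ^ (n+2) * a (\<zeta> * \<eta>)) (at \<eta>)"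
        unfolding eqA[OF s, symmetric]
        by (rule DERIV_cong[OF DERIV_cmult[OF dp2, of "\<zeta> ^ (n+1)"]]) (simp_all add: Suc_k algebra_simps)
    qed
  qed
qed

section \<open>The algebra of absolutely convergent sums of atoms\<close>

definition bdd :: "(complex \<Rightarrow> complex \<Rightarrow> complex) \<Rightarrow> real \<Rightarrow> bool" where
  "bdd f M \<longleftrightarrow> (\<exists>m a b B. (\<forall>i::nat. atom (m i) (a i) (b i)) \<and> (b has_sum B) UNIV \<and> B \<le> M \<and>
     (\<forall>\<zeta>\<in>ball 0 r. \<forall>\<eta>\<in>ball 0 r. ((\<lambda>i. em (m i) \<zeta> \<eta> * a i (\<zeta> * \<eta>)) has_sum f \<zeta> \<eta>) UNIV))"

lemma atom_nonneg: "atom m a M \<Longrightarrow> 0 \<le> M"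
proof -
  assume "atom m a M"
  then have "norm (a 0) * v 0 ^ nat \<bar>m\<bar> \<le> M" using r_pos by (auto simp: atom_def)
  moreover have "0 \<le> norm (a 0) * v 0 ^ nat \<bar>m\<bar>" using v_pos[of 0] by simp
  ultimately show ?thesis by linarith
qed

lemma atom_zero: "atom m (\<lambda>_. 0) 0" by (simp add: atom_def)

lemma norm_em_le: assumes "\<zeta> \<in> ball 0 r" "\<eta> \<in> ball 0 r" shows "norm (em m \<zeta> \<eta>) \<le> r ^ nat \<bar>m\<bar>"
  using assms by (auto simp: em_def norm_power intro!: power_mono)

text \<open>From |em| <= r^|m| and r <= v the weighted bound dominates the sup norm on the bidisc;
  convergence in the algebra is therefore uniform convergence there.\<close>

lemma atom_norm_le:
  assumes "atom m a M" "\<zeta> \<in> ball 0 r" "\<eta> \<in> ball 0 r"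
  shows "norm (em m \<zeta> \<eta> * a (\<zeta> * \<eta>)) \<le> M"
proof -
  note s = mult_in_ball[OF assms(2,3)]
  have "norm (em m \<zeta> \<eta> * a (\<zeta> * \<eta>)) \<le> r ^ nat \<bar>m\<bar> * norm (a (\<zeta> * \<eta>))"
    unfolding norm_mult by (intro mult_right_mono norm_em_le assms) auto
  also have "\<dots> \<le> v (\<zeta> * \<eta>) ^ nat \<bar>m\<bar> * norm (a (\<zeta> * \<eta>))"
    using r_le_v[OF s] r_pos by (intro mult_right_mono power_mono) auto
  also have "\<dots> \<le> M" using assms(1) s by (auto simp: atom_def mult.commute)
  finally show ?thesis .
qed

text \<open>In a product of modes of opposite sign, factors \<zeta> and \<eta> pair off, each pair
  contributing one factor s = \<zeta> \<eta>. The number of pairs is (|m| + |n| - |m + n|) / 2,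
  which is 0 for equal signs.\<close>

lemma em_mult:
  "em m \<zeta> \<eta> * em n \<zeta> \<eta> = em (m + n) \<zeta> \<eta> * (\<zeta> * \<eta>) ^ nat ((\<bar>m\<bar> + \<bar>n\<bar> - \<bar>m + n\<bar>) div 2)"
proof -
  have *: "x ^ j * y ^ k = x ^ (j - k) * (x * y) ^ k" if "k \<le> j" for x y :: complex and j k
    using that by (simp add: power_mult_distrib flip: power_add mult.assoc)
  consider "0 \<le> m" "0 \<le> n" | "m < 0" "n < 0" | "0 \<le> m" "n < 0" "0 \<le> m + n" | "0 \<le> m" "n < 0" "m + n < 0"
    | "m < 0" "0 \<le> n" "0 \<le> m + n" | "m < 0" "0 \<le> n" "m + n < 0" by linarith
  then show ?thesis
  proof cases
    case 1 then show ?thesis by (simp add: em_def nat_add_distrib power_add)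
  next
    case 2
    then have "nat (- m - n) = nat (- m) + nat (- n)" by linarith
    then show ?thesis using 2 by (simp add: em_def power_add)
  next
    case 3
    have "nat (m + n) = nat m - nat (- n)" "nat ((\<bar>m\<bar> + \<bar>n\<bar> - \<bar>m + n\<bar>) div 2) = nat (- n)" "nat (-n) \<le> nat m" using 3 by linarith+
    then show ?thesis using 3 *[of "nat (-n)" "nat m" \<zeta> \<eta>] by (simp add: em_def)
  next
    case 4
    have "nat (- m - n) = nat (-n) - nat m" "nat ((\<bar>m\<bar> + \<bar>n\<bar> - \<bar>m + n\<bar>) div 2) = nat m" "nat m \<le> nat (-n)" using 4 by linarith+
    then show ?thesis using 4 *[of "nat m" "nat (-n)" \<eta> \<zeta>] by (simp add: em_def mult.commute)
  next
    case 5
    have "nat (m + n) = nat n - nat (- m)" "nat ((\<bar>m\<bar> + \<bar>n\<bar> - \<bar>m + n\<bar>) div 2) = nat (- m)" "nat (-m) \<le> nat n" using 5 by linarith+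
    then show ?thesis using 5 *[of "nat (-m)" "nat n" \<zeta> \<eta>] by (simp add: em_def mult.commute)
  next
    case 6
    have "nat (- m - n) = nat (-m) - nat n" "nat ((\<bar>m\<bar> + \<bar>n\<bar> - \<bar>m + n\<bar>) div 2) = nat n" "nat n \<le> nat (-m)" using 6 by linarith+
    then show ?thesis using 6 *[of "nat n" "nat (-m)" \<eta> \<zeta>] by (simp add: em_def mult.commute)
  qed
qed

text \<open>Each pair that cancels lowers the exponent of the weight by 2 and brings a factor |s| <=
  r^2 <= v^2 in exchange, so the bounds multiply without a constant.\<close>

lemma atom_mult:
  assumes "atom m a M" "atom n b N"
  shows "atom (m + n) (\<lambda>s. s ^ nat ((\<bar>m\<bar> + \<bar>n\<bar> - \<bar>m + n\<bar>) div 2) * (a s * b s)) (M * N)"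
proof -
  define k where "k = nat ((\<bar>m\<bar> + \<bar>n\<bar> - \<bar>m + n\<bar>) div 2)"
  have k: "nat \<bar>m\<bar> + nat \<bar>n\<bar> = nat \<bar>m + n\<bar> + 2 * k"
  proof -
    have "even (\<bar>m\<bar> + \<bar>n\<bar> - \<bar>m + n\<bar>)" by simp
    then have "2 * ((\<bar>m\<bar> + \<bar>n\<bar> - \<bar>m + n\<bar>) div 2) = \<bar>m\<bar> + \<bar>n\<bar> - \<bar>m + n\<bar>" by simp
    moreover have "0 \<le> (\<bar>m\<bar> + \<bar>n\<bar> - \<bar>m + n\<bar>) div 2" by simp
    ultimately show ?thesis unfolding k_def by linarith
  qed
  have "norm (s ^ k * (a s * b s)) * v s ^ nat \<bar>m + n\<bar> \<le> M * N" if s: "s \<in> ball 0 (r\<^sup>2)" for s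
  proof -
    have "norm s \<le> r\<^sup>2" using s by simp
    also have "\<dots> \<le> (v s)\<^sup>2" using r_le_v[OF s] r_pos by (intro power_mono) auto
    finally have "norm s ^ k \<le> v s ^ (2 * k)" by (simp add: power_mult power_mono)
    then have "norm s ^ k * v s ^ nat \<bar>m + n\<bar> \<le> v s ^ (2 * k) * v s ^ nat \<bar>m + n\<bar>"
      using v_pos[of s] by (intro mult_right_mono) auto
    also have "\<dots> = v s ^ nat \<bar>m\<bar> * v s ^ nat \<bar>n\<bar>" using k by (simp add: mult.commute add.commute flip: power_add)
    finally have "(norm (a s) * norm (b s)) * (norm s ^ k * v s ^ nat \<bar>m + n\<bar>) \<le> (norm (a s) * norm (b s)) * (v s ^ nat \<bar>m\<bar> * v s ^ nat \<bar>n\<bar>)"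
      by (intro mult_left_mono) auto
    also have "\<dots> = (norm (a s) * v s ^ nat \<bar>m\<bar>) * (norm (b s) * v s ^ nat \<bar>n\<bar>)" by simp
    also have "\<dots> \<le> M * N" using assms s atom_nonneg[OF assms(1)] v_pos[of s]
      by (intro mult_mono) (auto simp: atom_def)
    finally show ?thesis by (simp add: norm_mult norm_power mult_ac)
  qed
  then show ?thesis using assms unfolding atom_def k_def[symmetric] by (auto intro!: holomorphic_intros)
qed

lemma has_sum_prod_nat:
  fixes f g :: "nat \<Rightarrow> 'a :: {real_normed_field, banach}"
  assumes f: "(f has_sum x) UNIV" "(\<lambda>i. norm (f i)) summable_on UNIV" and g: "(g has_sum y) UNIV" "(\<lambda>i. norm (g i)) summable_on UNIV"
  shows "((\<lambda>i. f (fst (prod_decode i)) * g (snd (prod_decode i))) has_sum x * y) UNIV"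
proof -
  have "(\<lambda>(i, j). norm (f i) * norm (g j)) summable_on UNIV \<times> UNIV"
    by (rule summable_on_SigmaI[where g = "\<lambda>i. norm (f i) * infsum (\<lambda>j. norm (g j)) UNIV"])
      (use f(2) g(2) in \<open>auto intro!: has_sum_cmult_right summable_on_cmult_left\<close>)
  then have "(\<lambda>x. norm ((\<lambda>(i, j). f i * g j) x)) summable_on UNIV \<times> UNIV"
    by (simp add: case_prod_unfold norm_mult)
  then have "(\<lambda>(i, j). f i * g j) summable_on UNIV \<times> UNIV" by (rule abs_summable_summable)
  then have "((\<lambda>(i, j). f i * g j) has_sum x * y) (UNIV \<times> UNIV)"
    by (intro has_sum_SigmaI[where g = "\<lambda>i. f i * y"])
      (use f g in \<open>auto intro!: has_sum_cmult_right has_sum_cmult_left\<close>)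
  then have "((\<lambda>i. (\<lambda>(i, j). f i * g j) (prod_decode i)) has_sum x * y) UNIV"
    by (subst has_sum_reindex_bij_betw[OF bij_prod_decode]) simp
  then show ?thesis by (simp add: case_prod_beta)
qed

lemma abs_summable_of_bound:
  fixes f :: "'i \<Rightarrow> complex"
  assumes "(b has_sum B) A" "\<And>i. i \<in> A \<Longrightarrow> norm (f i) \<le> b i"
  shows "(\<lambda>i. norm (f i)) summable_on A"
  by (rule summable_on_comparison_test[OF has_sum_imp_summable[OF assms(1)] assms(2)]) auto

text \<open>Products of atoms are atoms, and pairs of indices are enumerated by
  \<open>prod_decode\<close>. A representation may repeat a mode, so nothing is regrouped and the
  bounds sum to the product of the two sums.\<close>

lemma bdd_mult:
  assumes "bdd f M" "bdd g N" shows "bdd (\<lambda>\<zeta> \<eta>. f \<zeta> \<eta> * g \<zeta> \<eta>) (M * N)"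
proof -
  obtain m a b B where f: "\<And>i::nat. atom (m i) (a i) (b i)" "(b has_sum B) UNIV" "B \<le> M"
    "\<And>\<zeta> \<eta>. \<zeta>\<in>ball 0 r \<Longrightarrow> \<eta>\<in>ball 0 r \<Longrightarrow> ((\<lambda>i. em (m i) \<zeta> \<eta> * a i (\<zeta> * \<eta>)) has_sum f \<zeta> \<eta>) UNIV"
    using assms(1) unfolding bdd_def by blast
  obtain m' a' b' B' where g: "\<And>i::nat. atom (m' i) (a' i) (b' i)" "(b' has_sum B') UNIV" "B' \<le> N"
    "\<And>\<zeta> \<eta>. \<zeta>\<in>ball 0 r \<Longrightarrow> \<eta>\<in>ball 0 r \<Longrightarrow> ((\<lambda>i. em (m' i) \<zeta> \<eta> * a' i (\<zeta> * \<eta>)) has_sum g \<zeta> \<eta>) UNIV"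
    using assms(2) unfolding bdd_def by blast
  have pos: "0 \<le> b i" "0 \<le> b' i" for i using f(1) g(1) atom_nonneg by blast+
  have B0: "0 \<le> B" "0 \<le> B'" using has_sum_nonneg[OF f(2)] has_sum_nonneg[OF g(2)] pos by auto
  define p q where "p i = fst (prod_decode i)" and "q i = snd (prod_decode i)" for i
  define k where "k i = nat ((\<bar>m (p i)\<bar> + \<bar>m' (q i)\<bar> - \<bar>m (p i) + m' (q i)\<bar>) div 2)" for i
  show ?thesis unfolding bdd_def
  proof (intro exI conjI allI ballI)
    fix i show "atom (m (p i) + m' (q i)) (\<lambda>s. s ^ k i * (a (p i) s * a' (q i) s)) (b (p i) * b' (q i))"
      unfolding k_def by (rule atom_mult[OF f(1) g(1)])
  next
    show "((\<lambda>i. b (p i) * b' (q i)) has_sum (B * B')) UNIV"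
      unfolding p_def q_def
      by (rule has_sum_prod_nat) (use f(2) g(2) pos in \<open>auto dest: has_sum_imp_summable\<close>)
    show "B * B' \<le> M * N" using f(3) g(3) B0 by (intro mult_mono) auto
  next
    fix \<zeta> \<eta> :: complex assume z: "\<zeta> \<in> ball 0 r" "\<eta> \<in> ball 0 r"
    have "((\<lambda>i. (em (m (p i)) \<zeta> \<eta> * a (p i) (\<zeta> * \<eta>)) * (em (m' (q i)) \<zeta> \<eta> * a' (q i) (\<zeta> * \<eta>))) has_sum f \<zeta> \<eta> * g \<zeta> \<eta>) UNIV"
      unfolding p_def q_def
      by (rule has_sum_prod_nat[OF f(4)[OF z] _ g(4)[OF z]])
        (rule abs_summable_of_bound[OF f(2)] abs_summable_of_bound[OF g(2)], rule atom_norm_le[OF _ z], rule f g)+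
    moreover have "em (m (p i) + m' (q i)) \<zeta> \<eta> * ((\<zeta> * \<eta>) ^ k i * (a (p i) (\<zeta> * \<eta>) * a' (q i) (\<zeta> * \<eta>)))
       = (em (m (p i)) \<zeta> \<eta> * a (p i) (\<zeta> * \<eta>)) * (em (m' (q i)) \<zeta> \<eta> * a' (q i) (\<zeta> * \<eta>))" for i
    proof -
      have "(em (m (p i)) \<zeta> \<eta> * a (p i) (\<zeta> * \<eta>)) * (em (m' (q i)) \<zeta> \<eta> * a' (q i) (\<zeta> * \<eta>))
        = (em (m (p i)) \<zeta> \<eta> * em (m' (q i)) \<zeta> \<eta>) * (a (p i) (\<zeta> * \<eta>) * a' (q i) (\<zeta> * \<eta>))" by (simp only: mult_ac)
      then show ?thesis unfolding em_mult k_def by (simp only: mult.assoc)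
    qed
    ultimately show "((\<lambda>i. em (m (p i) + m' (q i)) \<zeta> \<eta> * ((\<zeta> * \<eta>) ^ k i * (a (p i) (\<zeta> * \<eta>) * a' (q i) (\<zeta> * \<eta>)))) has_sum f \<zeta> \<eta> * g \<zeta> \<eta>) UNIV"
      by (simp only:)
  qed
qed

lemma has_sum_interleave:
  fixes f g :: "nat \<Rightarrow> 'a :: {real_normed_vector}"
  assumes "(f has_sum x) UNIV" "(g has_sum y) UNIV"
  shows "((\<lambda>i. if even i then f (i div 2) else g (i div 2)) has_sum x + y) UNIV"
proof -
  let ?h = "\<lambda>i. if even i then f (i div 2) else g (i div 2)"
  have 1: "(?h has_sum x) (range (\<lambda>i. 2 * i))"
    by (subst has_sum_reindex) (use assms(1) in \<open>auto simp: inj_on_def o_def\<close>)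
  have 2: "(?h has_sum y) (range (\<lambda>i. 2 * i + 1))"
    by (subst has_sum_reindex) (use assms(2) in \<open>auto simp: inj_on_def o_def\<close>)
  have "(?h has_sum x + y) (range (\<lambda>i. 2 * i) \<union> range (\<lambda>i. 2 * i + 1))"
    by (rule has_sum_Un_disjoint[OF 1 2]) (auto, presburger)
  moreover have "range (\<lambda>i. 2 * i) \<union> range (\<lambda>i. 2 * i + 1) = (UNIV :: nat set)"
    by (auto simp: image_iff) presburger
  ultimately show ?thesis by simp
qed

lemma bdd_add:
  assumes "bdd f M" "bdd g N" shows "bdd (\<lambda>\<zeta> \<eta>. f \<zeta> \<eta> + g \<zeta> \<eta>) (M + N)"
proof -
  obtain m a b B where f: "\<And>i::nat. atom (m i) (a i) (b i)" "(b has_sum B) UNIV" "B \<le> M"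
    "\<And>\<zeta> \<eta>. \<zeta>\<in>ball 0 r \<Longrightarrow> \<eta>\<in>ball 0 r \<Longrightarrow> ((\<lambda>i. em (m i) \<zeta> \<eta> * a i (\<zeta> * \<eta>)) has_sum f \<zeta> \<eta>) UNIV"
    using assms(1) unfolding bdd_def by blast
  obtain m' a' b' B' where g: "\<And>i::nat. atom (m' i) (a' i) (b' i)" "(b' has_sum B') UNIV" "B' \<le> N"
    "\<And>\<zeta> \<eta>. \<zeta>\<in>ball 0 r \<Longrightarrow> \<eta>\<in>ball 0 r \<Longrightarrow> ((\<lambda>i. em (m' i) \<zeta> \<eta> * a' i (\<zeta> * \<eta>)) has_sum g \<zeta> \<eta>) UNIV"
    using assms(2) unfolding bdd_def by blast
  let ?J = "\<lambda>i x y. if even (i::nat) then x (i div 2) else y (i div 2)"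
  show ?thesis unfolding bdd_def
  proof (intro exI conjI allI ballI)
    fix i show "atom (?J i m m') (?J i a a') (?J i b b')" using f(1) g(1) by simp
  next
    show "((\<lambda>i. ?J i b b') has_sum (B + B')) UNIV" by (rule has_sum_interleave[OF f(2) g(2)])
    show "B + B' \<le> M + N" using f(3) g(3) by simp
  next
    fix \<zeta> \<eta> :: complex assume z: "\<zeta> \<in> ball 0 r" "\<eta> \<in> ball 0 r"
    show "((\<lambda>i. em (?J i m m') \<zeta> \<eta> * (?J i a a') (\<zeta> * \<eta>)) has_sum f \<zeta> \<eta> + g \<zeta> \<eta>) UNIV"
      using has_sum_interleave[OF f(4)[OF z] g(4)[OF z]] by (rule has_sum_cong[THEN iffD1, rotated]) simp
  qed
qed

lemma bdd_atom:
  assumes "atom m a M" shows "bdd (\<lambda>\<zeta> \<eta>. em m \<zeta> \<eta> * a (\<zeta> * \<eta>)) M"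
  unfolding bdd_def
proof (intro exI conjI allI ballI)
  let ?J = "\<lambda>i x y. if (i::nat) = 0 then x else y"
  show "atom m (?J i a (\<lambda>_. 0)) (?J i M 0)" for i using assms atom_zero by simp
  show "((\<lambda>i. ?J i M 0) has_sum M) UNIV"
    by (rule has_sum_finite_neutralI[where B = "{0}"]) auto
  show "M \<le> M" by simp
  fix \<zeta> \<eta> :: complex
  show "((\<lambda>i. em m \<zeta> \<eta> * ?J i a (\<lambda>_. 0) (\<zeta> * \<eta>)) has_sum em m \<zeta> \<eta> * a (\<zeta> * \<eta>)) UNIV"
    by (rule has_sum_finite_neutralI[where B = "{0}"]) auto
qed

lemma bdd_const: "bdd (\<lambda>_ _. w) (norm w)"
proof -
  have "atom 0 (\<lambda>_. w) (norm w)" by (simp add: atom_def)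
  from bdd_atom[OF this] show ?thesis by (simp add: em_def)
qed

lemma bdd_cmult: "bdd f M \<Longrightarrow> bdd (\<lambda>\<zeta> \<eta>. w * f \<zeta> \<eta>) (norm w * M)"
  by (rule bdd_mult[OF bdd_const])

lemma bdd_sum:
  assumes "finite I" "\<And>i. i \<in> I \<Longrightarrow> bdd (f i) (M i)"
  shows "bdd (\<lambda>\<zeta> \<eta>. \<Sum>i\<in>I. f i \<zeta> \<eta>) (\<Sum>i\<in>I. M i)"
  using assms
proof (induction I rule: finite_induct)
  case empty
  then show ?case using bdd_const[of 0] by simp
next
  case (insert x F)
  then show ?case using bdd_add[of "f x" "M x"] by simp
qed

lemma bdd_norm_le:
  assumes "bdd f M" "\<zeta> \<in> ball 0 r" "\<eta> \<in> ball 0 r" shows "norm (f \<zeta> \<eta>) \<le> M"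
proof -
  obtain m a b B where f: "\<And>i::nat. atom (m i) (a i) (b i)" "(b has_sum B) UNIV" "B \<le> M"
    "((\<lambda>i. em (m i) \<zeta> \<eta> * a i (\<zeta> * \<eta>)) has_sum f \<zeta> \<eta>) UNIV"
    using assms unfolding bdd_def by blast
  have "norm (f \<zeta> \<eta>) \<le> B"
    by (rule norm_infsum_le[OF f(4,2)]) (rule atom_norm_le[OF f(1) assms(2,3)])
  then show ?thesis using f(3) by simp
qed

text \<open>The reflection F' of the overview: holomorphic in both variables again, and equal to the
  complex conjugate of f on the real section \<eta> = cnj \<zeta>.\<close>

definition star :: "(complex \<Rightarrow> complex \<Rightarrow> complex) \<Rightarrow> complex \<Rightarrow> complex \<Rightarrow> complex" where
  "star f \<zeta> \<eta> = cnj (f (cnj \<eta>) (cnj \<zeta>))"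

lemma atom_star:
  assumes "atom m a M" shows "atom (- m) (\<lambda>s. cnj (a (cnj s))) M"
proof -
  have "cnj ` ball 0 (r\<^sup>2) = ball 0 (r\<^sup>2)"
    by (auto simp: image_iff intro!: bexI[of _ "cnj x" for x])
  then have "(\<lambda>s. cnj (a (cnj s))) holomorphic_on ball 0 (r\<^sup>2)"
    using holomorphic_on_compose_cnj_cnj[of a "ball 0 (r\<^sup>2)"] assms by (simp add: atom_def o_def)
  moreover have "v (cnj s) = v s" for s
    unfolding v_def by (metis complex_cnj_diff complex_cnj_one complex_mod_cnj)
  ultimately show ?thesis using assms unfolding atom_def
    by (metis abs_minus_cancel complex_mod_cnj mem_ball_0)
qed

lemma bdd_star: assumes "bdd f M" shows "bdd (star f) M"
proof -
  obtain m a b B where f: "\<And>i::nat. atom (m i) (a i) (b i)" "(b has_sum B) UNIV" "B \<le> M"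
    "\<And>\<zeta> \<eta>. \<zeta>\<in>ball 0 r \<Longrightarrow> \<eta>\<in>ball 0 r \<Longrightarrow> ((\<lambda>i. em (m i) \<zeta> \<eta> * a i (\<zeta> * \<eta>)) has_sum f \<zeta> \<eta>) UNIV"
    using assms(1) unfolding bdd_def by blast
  show ?thesis unfolding bdd_def
  proof (intro exI conjI allI ballI)
    show "atom (- m i) (\<lambda>s. cnj (a i (cnj s))) (b i)" for i by (rule atom_star[OF f(1)])
    fix \<zeta> \<eta> :: complex assume z: "\<zeta> \<in> ball 0 r" "\<eta> \<in> ball 0 r"
    have "((\<lambda>i. em (m i) (cnj \<eta>) (cnj \<zeta>) * a i (cnj \<eta> * cnj \<zeta>)) has_sum f (cnj \<eta>) (cnj \<zeta>)) UNIV"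
      by (rule f(4)) (use z in auto)
    then have "((\<lambda>i. cnj (em (m i) (cnj \<eta>) (cnj \<zeta>) * a i (cnj \<eta> * cnj \<zeta>))) has_sum star f \<zeta> \<eta>) UNIV"
      unfolding star_def by (simp only: has_sum_cnj_iff)
    moreover have "cnj (em j (cnj \<eta>) (cnj \<zeta>)) = em (- j) \<zeta> \<eta>" for j
      by (auto simp: em_def)
    ultimately show "((\<lambda>i. em (- m i) \<zeta> \<eta> * cnj (a i (cnj (\<zeta> * \<eta>)))) has_sum star f \<zeta> \<eta>) UNIV"
      by (simp add: mult.commute)
  qed (use f in auto)
qed

text \<open>The monomials are atoms of mode n with constant profile. Since v <= \<rho>, their bounds
  are the terms of the absolute Taylor series at \<rho>, which converges because \<rho> < R.\<close>

lemma bdd_holomorphic: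
  assumes "h holomorphic_on ball 0 R" "\<rho> < R"
  obtains M where "bdd (\<lambda>\<zeta> \<eta>. h \<zeta>) M"
proof -
  define co where "co n = (deriv ^^ n) h 0 / fact n" for n
  have hs: "(\<lambda>n. co n * z ^ n) sums h z" if "z \<in> ball 0 R" for z
    using holomorphic_power_series[OF assms(1) that] by (simp add: co_def)
  define b where "b n = norm (co n) * \<rho> ^ n" for n
  obtain R' where R': "\<rho> < R'" "R' < R" using dense assms(2) by blast
  have "summable (\<lambda>n. norm (co n * of_real \<rho> ^ n))"
  proof (rule powser_insidea)
    show "summable (\<lambda>n. co n * of_real R' ^ n)" using hs[of "of_real R'"] R' rho_pos by (auto simp: sums_iff)
  qed (use R' rho_pos in auto)
  then have sb: "summable b" using rho_pos by (simp add: b_def[abs_def] norm_mult norm_power)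
  have b0: "0 \<le> b n" for n using rho_pos by (simp add: b_def)
  have hb: "(b has_sum suminf b) UNIV" using sums_nonneg_imp_has_sum[OF summable_sums[OF sb]] b0 by auto
  have "r < \<rho>"
  proof -
    have "exp (- c * (1 + r\<^sup>2)) < 1" using c_pos by (simp add: add_pos_nonneg)
    then have "\<rho> * exp (- c * (1 + r\<^sup>2)) < \<rho> * 1" using rho_pos by (intro mult_strict_left_mono)
    then show ?thesis using r_le by linarith
  qed
  have "bdd (\<lambda>\<zeta> \<eta>. h \<zeta>) (suminf b)" unfolding bdd_def
  proof (intro exI conjI allI ballI)
    show "atom (int n) (\<lambda>_. co n) (b n)" for n
      unfolding atom_def b_def using v_pos v_le_rho by (auto intro!: mult_left_mono power_mono simp: less_imp_le)
    show "(b has_sum suminf b) UNIV" by fact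
    fix \<zeta> \<eta> :: complex assume z: "\<zeta> \<in> ball 0 r" "\<eta> \<in> ball 0 r"
    have zR: "\<zeta> \<in> ball 0 R" using z \<open>r < \<rho>\<close> R' by auto
    have "((\<lambda>n. co n * \<zeta> ^ n) has_sum h \<zeta>) UNIV"
    proof (rule norm_summable_imp_has_sum[OF _ hs[OF zR]])
      have "norm (co n * \<zeta> ^ n) \<le> b n" for n
        unfolding b_def norm_mult norm_power using z \<open>r < \<rho>\<close> by (intro mult_left_mono power_mono) auto
      then show "summable (\<lambda>n. norm (co n * \<zeta> ^ n))" using summable_comparison_test'[OF sb, of 0 "\<lambda>n. norm (co n * \<zeta> ^ n)"] by simp
    qed
    then show "((\<lambda>n. em (int n) \<zeta> \<eta> * co n) has_sum h \<zeta>) UNIV" by (simp add: em_def mult.commute)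
  qed simp
  then show thesis by (rule that)
qed

end

lemma suminf_has_field_derivative:
  fixes f :: "nat \<Rightarrow> complex \<Rightarrow> complex"
  assumes d: "\<And>n z. z \<in> ball 0 r \<Longrightarrow> (f n has_field_derivative f' n z) (at z)"
    and b: "\<And>n z. z \<in> ball 0 r \<Longrightarrow> norm (f n z) \<le> b n" "summable b"
    and b': "\<And>n z. z \<in> ball 0 r \<Longrightarrow> norm (f' n z) \<le> b' n" "summable b'"
    and z: "z \<in> ball 0 r"
  shows "((\<lambda>z. \<Sum>n. f n z) has_field_derivative (\<Sum>n. f' n z)) (at z)"
proof (rule has_field_derivative_series'(2)[where S = "ball 0 r" and x0 = z])
  show "uniformly_convergent_on (ball 0 r) (\<lambda>n z. \<Sum>i<n. f' i z)"
    using b' by (rule Weierstrass_m_test')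
  show "summable (\<lambda>n. f n z)" by (rule summable_comparison_test'[OF b(2), of 0]) (use b(1)[OF z] in auto)
qed (use z d in \<open>auto intro: has_field_derivative_at_within\<close>)

lemma summable_imp_has_sum:
  fixes f :: "nat \<Rightarrow> complex"
  assumes "\<And>n. norm (f n) \<le> b n" "summable b" shows "(f has_sum suminf f) UNIV" "f sums suminf f" "summable (\<lambda>n. norm (f n))"
proof -
  show s: "summable (\<lambda>n. norm (f n))" by (rule summable_comparison_test'[OF assms(2), of 0]) (use assms(1) in auto)
  show "f sums suminf f" using s by (simp add: summable_norm_cancel summable_sums)
  then show "(f has_sum suminf f) UNIV" by (rule norm_summable_imp_has_sum[OF s])
qed

context disc_weight
begin

lemma bdd_atoms_series:
  assumes "\<And>i::nat. atom (m i) (a i) (b i)" "summable b" "suminf b \<le> M"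
  shows "bdd (\<lambda>\<zeta> \<eta>. \<Sum>i. em (m i) \<zeta> \<eta> * a i (\<zeta> * \<eta>)) M"
  unfolding bdd_def
proof (intro exI conjI allI ballI)
  show "(b has_sum suminf b) UNIV"
    using assms(2) atom_nonneg[OF assms(1)] by (intro sums_nonneg_imp_has_sum summable_sums) auto
  fix \<zeta> \<eta> :: complex assume z: "\<zeta> \<in> ball 0 r" "\<eta> \<in> ball 0 r"
  show "((\<lambda>i. em (m i) \<zeta> \<eta> * a i (\<zeta> * \<eta>)) has_sum (\<Sum>i. em (m i) \<zeta> \<eta> * a i (\<zeta> * \<eta>))) UNIV"
    by (rule summable_imp_has_sum(1)[OF atom_norm_le[OF assms(1) z] assms(2)])
qed (use assms in auto)

text \<open>The solutions are chosen atom by atom and summed. Because \<open>gc\<close> is the same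
  for all modes, the differentiated series converge with the same constant and the relations hold
  termwise.\<close>

lemma bdd_green:
  assumes "bdd f M"
  obtains U P Q where "bdd U (gc * M)" "bdd P (gc * M)" "bdd Q (gc * M)"
    "\<And>\<zeta> \<eta>. \<zeta> \<in> ball 0 r \<Longrightarrow> \<eta> \<in> ball 0 r \<Longrightarrow> ((\<lambda>\<zeta>. U \<zeta> \<eta>) has_field_derivative P \<zeta> \<eta>) (at \<zeta>)"
    "\<And>\<zeta> \<eta>. \<zeta> \<in> ball 0 r \<Longrightarrow> \<eta> \<in> ball 0 r \<Longrightarrow> ((\<lambda>\<zeta>. P \<zeta> \<eta>) has_field_derivative Q \<zeta> \<eta>) (at \<zeta>)"
    "\<And>\<zeta> \<eta>. \<zeta> \<in> ball 0 r \<Longrightarrow> \<eta> \<in> ball 0 r \<Longrightarrow> ((\<lambda>\<eta>. P \<zeta> \<eta>) has_field_derivative f \<zeta> \<eta>) (at \<eta>)"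
    "\<And>\<zeta> \<eta>. \<zeta> * \<eta> = 1 \<Longrightarrow> U \<zeta> \<eta> = 0"
proof -
  obtain m a b B where f: "\<And>i::nat. atom (m i) (a i) (b i)" "(b has_sum B) UNIV" "B \<le> M"
    "\<And>\<zeta> \<eta>. \<zeta>\<in>ball 0 r \<Longrightarrow> \<eta>\<in>ball 0 r \<Longrightarrow> ((\<lambda>i. em (m i) \<zeta> \<eta> * a i (\<zeta> * \<eta>)) has_sum f \<zeta> \<eta>) UNIV"
    using assms(1) unfolding bdd_def by blast
  define X where "X i u m1 p m2 q \<longleftrightarrow> atom (m i) u (gc * b i) \<and> atom m1 p (gc * b i) \<and> atom m2 q (gc * b i) \<and> u 1 = 0 \<and>
    (\<forall>\<zeta> \<in> ball 0 r. \<forall>\<eta> \<in> ball 0 r.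
       ((\<lambda>\<zeta>. em (m i) \<zeta> \<eta> * u (\<zeta> * \<eta>)) has_field_derivative em m1 \<zeta> \<eta> * p (\<zeta> * \<eta>)) (at \<zeta>) \<and>
       ((\<lambda>\<zeta>. em m1 \<zeta> \<eta> * p (\<zeta> * \<eta>)) has_field_derivative em m2 \<zeta> \<eta> * q (\<zeta> * \<eta>)) (at \<zeta>) \<and>
       ((\<lambda>\<eta>. em m1 \<zeta> \<eta> * p (\<zeta> * \<eta>)) has_field_derivative em (m i) \<zeta> \<eta> * a i (\<zeta> * \<eta>)) (at \<eta>))"
    for i u m1 p m2 q
  have "\<exists>u m1 p m2 q. X i u m1 p m2 q" for i
    unfolding X_def by (rule atom_green[OF f(1)[of i]]) blast
  then obtain u m1 p m2 q where "\<And>i. X i (u i) (m1 i) (p i) (m2 i) (q i)" by metis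
  note X = this[unfolded X_def]
  have b0: "0 \<le> b i" for i using atom_nonneg[OF f(1)] .
  have sb: "summable b" "suminf b = B" using has_sum_imp_sums[OF f(2)] by (auto simp: sums_iff)
  have sgb: "summable (\<lambda>i. gc * b i)" "(\<Sum>i. gc * b i) \<le> gc * M"
    using sb f(3) gc_pos by (auto simp: suminf_mult intro: summable_mult)
  define U where "U \<zeta> \<eta> = (\<Sum>i. em (m i) \<zeta> \<eta> * u i (\<zeta> * \<eta>))" for \<zeta> \<eta>
  define P where "P \<zeta> \<eta> = (\<Sum>i. em (m1 i) \<zeta> \<eta> * p i (\<zeta> * \<eta>))" for \<zeta> \<eta>
  define Q where "Q \<zeta> \<eta> = (\<Sum>i. em (m2 i) \<zeta> \<eta> * q i (\<zeta> * \<eta>))" for \<zeta> \<eta>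
  have at: "atom (m i) (u i) (gc * b i)" "atom (m1 i) (p i) (gc * b i)" "atom (m2 i) (q i) (gc * b i)" for i using X by auto
  show thesis
  proof (rule that[of U P Q])
    show "bdd U (gc * M)" "bdd P (gc * M)" "bdd Q (gc * M)"
      unfolding U_def[abs_def] P_def[abs_def] Q_def[abs_def] by (rule bdd_atoms_series[OF _ sgb], rule at)+
    show "U \<zeta> \<eta> = 0" if "\<zeta> * \<eta> = 1" for \<zeta> \<eta> using X by (simp add: U_def that)
    fix \<zeta> \<eta> :: complex assume z: "\<zeta> \<in> ball 0 r" "\<eta> \<in> ball 0 r"
    show "((\<lambda>\<zeta>. U \<zeta> \<eta>) has_field_derivative P \<zeta> \<eta>) (at \<zeta>)"
      unfolding U_def P_def
      by (rule suminf_has_field_derivative[OF _ atom_norm_le[OF at(1) _ z(2)] sgb(1) atom_norm_le[OF at(2) _ z(2)] sgb(1) z(1)])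
        (use X z in blast)
    show "((\<lambda>\<zeta>. P \<zeta> \<eta>) has_field_derivative Q \<zeta> \<eta>) (at \<zeta>)"
      unfolding P_def Q_def
      by (rule suminf_has_field_derivative[OF _ atom_norm_le[OF at(2) _ z(2)] sgb(1) atom_norm_le[OF at(3) _ z(2)] sgb(1) z(1)])
        (use X z in blast)
    have "f \<zeta> \<eta> = (\<Sum>i. em (m i) \<zeta> \<eta> * a i (\<zeta> * \<eta>))"
      using has_sum_imp_sums[OF f(4)[OF z]] by (simp add: sums_iff)
    then show "((\<lambda>\<eta>. P \<zeta> \<eta>) has_field_derivative f \<zeta> \<eta>) (at \<eta>)"
      unfolding P_def
      by (simp only:, intro suminf_has_field_derivative[OF _ atom_norm_le[OF at(2) z(1)] sgb(1) atom_norm_le[OF f(1) z(1)] sb(1) z(2)])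
        (use X z in blast)
  qed
qed

lemma bdd_hol3:
  assumes "bdd f M" shows "hol3 (\<lambda>p. f (fst (fst p)) (snd (fst p))) ((ball 0 r \<times> ball 0 r) \<times> UNIV)"
proof -
  obtain m a b B where f: "\<And>i::nat. atom (m i) (a i) (b i)" "(b has_sum B) UNIV" "B \<le> M"
    "\<And>\<zeta> \<eta>. \<zeta>\<in>ball 0 r \<Longrightarrow> \<eta>\<in>ball 0 r \<Longrightarrow> ((\<lambda>i. em (m i) \<zeta> \<eta> * a i (\<zeta> * \<eta>)) has_sum f \<zeta> \<eta>) UNIV"
    using assms(1) unfolding bdd_def by blast
  let ?S = "((ball (0::complex) r \<times> ball (0::complex) r) \<times> (UNIV :: complex set))"
  show ?thesis
  proof (rule hol3_has_sum[where I = UNIV and M = b and f = "\<lambda>i p. em (m i) (fst (fst p)) (snd (fst p)) * a i (fst (fst p) * snd (fst p))"])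
    show "open ?S" by (intro open_Times) auto
    show "b summable_on UNIV" using f(2) has_sum_imp_summable by blast
    fix i
    show "hol3 (\<lambda>p. em (m i) (fst (fst p)) (snd (fst p)) * a i (fst (fst p) * snd (fst p))) ?S"
    proof (rule hol3_mult)
      show "hol3 (\<lambda>p. em (m i) (fst (fst p)) (snd (fst p))) ?S"
        unfolding em_def by (cases "0 \<le> m i") (auto intro!: hol3_power hol3_coords)
      show "hol3 (\<lambda>p. a i (fst (fst p) * snd (fst p))) ?S"
        by (rule hol3_holomorphic[where T = "ball 0 (r\<^sup>2)"])
          (use f(1)[of i] mult_in_ball in \<open>auto simp: atom_def intro!: hol3_mult hol3_coords\<close>)
    qed
  qed (use f atom_norm_le in auto)
qed

end

section \<open>The majorant series\<close>

fun maj :: "real \<Rightarrow> nat \<Rightarrow> real" where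
  "maj L 0 = 1"
| "maj L (Suc n) = (L * (\<Sum>i\<le>n. maj L i * maj L (n - i)) + (\<Sum>i<n. maj L (Suc i) * maj L (n - i))) / 2"

declare maj.simps(2) [simp del]

lemma maj_nonneg: "0 \<le> L \<Longrightarrow> 0 \<le> maj L n"
proof (induction n rule: less_induct)
  case (less n)
  show ?case
  proof (cases n)
    case (Suc m)
    show ?thesis unfolding Suc maj.simps(2)[of L m]
      using less Suc by (intro divide_nonneg_nonneg add_nonneg_nonneg mult_nonneg_nonneg sum_nonneg) auto
  qed simp
qed

lemma sum_triangle_le_square:
  fixes f :: "nat \<Rightarrow> real" assumes "\<And>i. 0 \<le> f i"
  shows "(\<Sum>m<N. \<Sum>i\<le>m. f i * f (m - i)) \<le> (\<Sum>i<N. f i)\<^sup>2"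
proof -
  have "(\<Sum>m<N. \<Sum>i\<le>m. f i * f (m - i)) = (\<Sum>(i, j)\<in>{(i, j). i + j < N}. f i * f j)"
    by (rule sum.triangle_reindex[symmetric])
  also have "\<dots> \<le> (\<Sum>(i, j)\<in>{..<N} \<times> {..<N}. f i * f j)"
    using assms by (intro sum_mono2) auto
  also have "\<dots> = (\<Sum>i<N. f i)\<^sup>2"
    by (simp add: power2_eq_square sum_product sum.cartesian_product)
  finally show ?thesis .
qed

text \<open>If T is the generating function without its constant term 1, the recursion reads 2 T = L
  t (1 + T)^2 + T^2: the quadratic equation for y with all signs made positive. The choice of t
  gives L t <= 1/10, and the partial sums stay below 1/4 by induction, as half of (1/10) (5/4)^2 +
  (1/4)^2 is again below 1/4.\<close>

lemma maj_summable:
  assumes "0 \<le> L" obtains t where "0 < t" "summable (\<lambda>n. maj L n * t ^ n)"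
proof
  define t where "t = 1 / (10 * (L + 1))"
  show t: "0 < t" using assms by (simp add: t_def)
  have Lt: "L * t \<le> 1/10" using assms by (simp add: t_def field_simps)
  define a where "a n = maj L n * t ^ n" for n
  have a0: "0 \<le> a n" for n using maj_nonneg[OF assms] t by (simp add: a_def)
  have rec: "a (Suc m) = (L * t * (\<Sum>i\<le>m. a i * a (m - i)) + (\<Sum>i<m. a (Suc i) * a (m - i))) / 2" for m
  proof -
    have 1: "a i * a (m - i) * t = maj L i * maj L (m - i) * t ^ Suc m" if "i \<le> m" for i
    proof -
      have "t ^ i * t ^ (m - i) = t ^ m" using that by (simp flip: power_add)
      then show ?thesis by (simp add: a_def mult_ac)
    qed
    have 2: "a (Suc i) * a (m - i) = maj L (Suc i) * maj L (m - i) * t ^ Suc m" if "i < m" for i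
    proof -
      have "t ^ Suc i * t ^ (m - i) = t ^ Suc m" using that by (simp flip: power_add power_Suc)
      then show ?thesis unfolding a_def by (metis mult.assoc mult.commute)
    qed
    have e1: "L * t * (\<Sum>i\<le>m. a i * a (m - i)) = L * (\<Sum>i\<le>m. maj L i * maj L (m - i)) * t ^ Suc m"
      using 1 by (simp add: sum_distrib_left sum_distrib_right mult_ac del: power_Suc)
    have e2: "(\<Sum>i<m. a (Suc i) * a (m - i)) = (\<Sum>i<m. maj L (Suc i) * maj L (m - i)) * t ^ Suc m"
      unfolding sum_distrib_right by (intro sum.cong refl 2) auto
    show ?thesis
      unfolding e1 e2 unfolding a_def maj.simps(2)[of L m] by (simp add: algebra_simps add_divide_distrib del: power_Suc)
  qed
  have T: "(\<Sum>n<N. a (Suc n)) \<le> 1/4" for N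
  proof (induction N)
    case (Suc N)
    let ?T = "\<Sum>n<N. a (Suc n)"
    have T0: "0 \<le> ?T" by (intro sum_nonneg a0)
    have "(\<Sum>n<Suc N. a (Suc n)) = (\<Sum>m<Suc N. (L * t * (\<Sum>i\<le>m. a i * a (m - i)) + (\<Sum>i<m. a (Suc i) * a (m - i))) / 2)"
      by (intro sum.cong refl rec)
    also have "\<dots> = (L * t * (\<Sum>m<Suc N. \<Sum>i\<le>m. a i * a (m - i)) + (\<Sum>m<Suc N. \<Sum>i<m. a (Suc i) * a (m - i))) / 2"
      by (simp add: sum_divide_distrib[symmetric] sum.distrib sum_distrib_left del: sum.lessThan_Suc)
    \<comment> \<open>The term m = 0 is empty and both indices are at least 1, so only the tail
      after a 0 = 1 enters, and with one order less than on the left: this closes the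
      induction.\<close>
    also have "(\<Sum>m<Suc N. \<Sum>i<m. a (Suc i) * a (m - i)) = (\<Sum>m<N. \<Sum>i\<le>m. a (Suc i) * a (Suc (m - i)))"
      by (subst sum.lessThan_Suc_shift) (simp add: lessThan_Suc_atMost del: sum.lessThan_Suc, intro sum.cong refl, simp add: Suc_diff_le)
    also have "\<dots> \<le> ?T\<^sup>2" using sum_triangle_le_square[of "\<lambda>i. a (Suc i)" N] a0 by simp
    also have "(\<Sum>m<Suc N. \<Sum>i\<le>m. a i * a (m - i)) \<le> (\<Sum>i<Suc N. a i)\<^sup>2" by (rule sum_triangle_le_square[OF a0])
    also have "(\<Sum>i<Suc N. a i) = 1 + ?T" by (subst sum.lessThan_Suc_shift) (simp add: a_def)
    finally have "(\<Sum>n<Suc N. a (Suc n)) \<le> (L * t * (1 + ?T)\<^sup>2 + ?T\<^sup>2) / 2" using t assms by (simp add: mult_left_mono)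
    also have "\<dots> \<le> (1/10 * (5/4)\<^sup>2 + (1/4)\<^sup>2) / 2"
      using Suc.IH T0 Lt t assms by (intro divide_right_mono add_mono mult_mono power_mono) auto
    also have "\<dots> \<le> 1/4" by (simp add: power2_eq_square)
    finally show ?case .
  qed simp
  have "summable (\<lambda>n. a (Suc n))" by (rule summableI_nonneg_bounded[OF _ T]) (rule a0)
  then have "summable a" by (simp only: summable_Suc_iff)
  then show "summable (\<lambda>n. maj L n * t ^ n)" by (simp add: a_def[abs_def])
qed

text \<open>The coefficient of order n in \<tau> times the square of the majorant; the shift by one
  is the explicit factor \<tau> of the equation.\<close>

definition cv :: "real \<Rightarrow> nat \<Rightarrow> real" where
  "cv L n = (case n of 0 \<Rightarrow> 0 | Suc m \<Rightarrow> \<Sum>i\<le>m. maj L i * maj L (m - i))"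

lemma cv_summable:
  assumes "0 \<le> L" "0 < t" "summable (\<lambda>n. maj L n * t ^ n)"
  shows "summable (\<lambda>n. cv L n * t ^ n)" "0 \<le> cv L n"
proof -
  show "0 \<le> cv L n" using maj_nonneg[OF assms(1)] by (auto simp: cv_def split: nat.splits intro!: sum_nonneg)
  have e: "cv L (Suc m) * t ^ Suc m = t * (\<Sum>i\<le>m. (maj L i * t ^ i) * (maj L (m - i) * t ^ (m - i)))" for m
  proof -
    have key: "(maj L i * t ^ i) * (maj L (m - i) * t ^ (m - i)) = maj L i * maj L (m - i) * t ^ m" if "i \<le> m" for i
    proof -
      have "t ^ i * t ^ (m - i) = t ^ m" using that by (simp flip: power_add)
      then show ?thesis by (simp add: mult_ac)
    qed
    have "(\<Sum>i\<le>m. (maj L i * t ^ i) * (maj L (m - i) * t ^ (m - i))) = (\<Sum>i\<le>m. maj L i * maj L (m - i)) * t ^ m"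
      unfolding sum_distrib_right by (intro sum.cong refl key) auto
    then show ?thesis by (simp add: cv_def)
  qed
  have "summable (\<lambda>n. norm (maj L n * t ^ n))"
    using assms maj_nonneg[OF assms(1)] by simp
  from Cauchy_product_sums[OF this this] have "summable (\<lambda>m. \<Sum>i\<le>m. (maj L i * t ^ i) * (maj L (m - i) * t ^ (m - i)))"
    by (simp add: sums_iff)
  then have "summable (\<lambda>m. cv L (Suc m) * t ^ Suc m)" unfolding e by (rule summable_mult)
  then show "summable (\<lambda>n. cv L n * t ^ n)" by (subst (asm) summable_Suc_iff)
qed

section \<open>The recursion in powers of the parameter\<close>

type_synonym fn2 = "complex \<Rightarrow> complex \<Rightarrow> complex"

context disc_weight
begin

text \<open>The coefficient of \<open>\<tau> ^ n\<close> in \<tau> K y \<open>star y\<close>, where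
  the factor \<tau> leaves only \<open>y j\<close> with j < n. With K = g \<open>star g\<close> and
  H = g^2 this is the right side of the equation after the substitution F = H y^2.\<close>

definition rhs :: "fn2 \<Rightarrow> (nat \<Rightarrow> fn2) \<Rightarrow> nat \<Rightarrow> fn2" where
  "rhs K y n \<zeta> \<eta> = (case n of 0 \<Rightarrow> 0 | Suc m \<Rightarrow> K \<zeta> \<eta> * (\<Sum>i\<le>m. y i \<zeta> \<eta> * star (y (m - i)) \<zeta> \<eta>))"

definition green_of :: "fn2 \<Rightarrow> real \<Rightarrow> fn2 \<times> fn2 \<times> fn2 \<Rightarrow> bool" where
  "green_of f M = (\<lambda>(U, P, Q). bdd U (gc * M) \<and> bdd P (gc * M) \<and> bdd Q (gc * M) \<and>
    (\<forall>\<zeta>\<in>ball 0 r. \<forall>\<eta>\<in>ball 0 r. ((\<lambda>\<zeta>. U \<zeta> \<eta>) has_field_derivative P \<zeta> \<eta>) (at \<zeta>) \<and>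
      ((\<lambda>\<zeta>. P \<zeta> \<eta>) has_field_derivative Q \<zeta> \<eta>) (at \<zeta>) \<and>
      ((\<lambda>\<eta>. P \<zeta> \<eta>) has_field_derivative f \<zeta> \<eta>) (at \<eta>)) \<and>
    (\<forall>\<zeta> \<eta>. \<zeta> * \<eta> = 1 \<longrightarrow> U \<zeta> \<eta> = 0))"

lemma green_of_exists: "bdd f M \<Longrightarrow> \<exists>T. green_of f M T"
proof -
  assume "bdd f M"
  then obtain U P Q where "green_of f M (U, P, Q)"
    unfolding green_of_def prod.case by (rule bdd_green) blast
  then show ?thesis by blast
qed

lemma rhs_bdd:
  assumes "bdd K \<kappa>" "\<And>j. j < n \<Longrightarrow> bdd (y j) (maj L j)"
  shows "bdd (rhs K y n) (\<kappa> * cv L n)"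
proof (cases n)
  case 0
  then show ?thesis using bdd_const[of 0] by (simp add: rhs_def[abs_def] cv_def)
next
  case (Suc m)
  have "bdd (\<lambda>\<zeta> \<eta>. K \<zeta> \<eta> * (\<Sum>i\<le>m. y i \<zeta> \<eta> * star (y (m - i)) \<zeta> \<eta>)) (\<kappa> * (\<Sum>i\<le>m. maj L i * maj L (m - i)))"
    by (intro bdd_mult bdd_sum assms bdd_star) (auto simp: Suc)
  then show ?thesis by (simp add: rhs_def[abs_def] cv_def Suc)
qed

text \<open>The coefficient of \<open>\<tau> ^ n\<close> in \<open>y\<^sup>2 = 1 + q (Q - \<alpha> P)\<close> determines \<open>y n\<close> from the
  previous ones, since \<open>P n\<close> and \<open>Q n\<close> only involve \<open>y j\<close> with \<open>j < n\<close>.\<close>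
definition step :: "fn2 \<Rightarrow> fn2 \<Rightarrow> fn2 \<Rightarrow> real \<Rightarrow> real \<Rightarrow> (nat \<Rightarrow> fn2) \<Rightarrow> nat \<Rightarrow> fn2 \<Rightarrow> fn2 \<times> fn2 \<times> fn2 \<Rightarrow> bool" where
  "step K q \<alpha> \<kappa> L Y n y T \<longleftrightarrow> bdd y (maj L n) \<and> green_of (rhs K Y n) (\<kappa> * cv L n) T \<and>
    (case n of 0 \<Rightarrow> y = (\<lambda>_ _. 1) | Suc m \<Rightarrow>
      (\<forall>\<zeta> \<eta>. 2 * y \<zeta> \<eta> + (\<Sum>i<m. Y (Suc i) \<zeta> \<eta> * Y (m - i) \<zeta> \<eta>) = q \<zeta> \<eta> * (snd (snd T) \<zeta> \<eta> - \<alpha> \<zeta> \<eta> * fst (snd T) \<zeta> \<eta>)))"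

lemma step_cong:
  assumes "\<And>j. j < n \<Longrightarrow> Y j = Y' j" shows "step K q \<alpha> \<kappa> L Y n y T = step K q \<alpha> \<kappa> L Y' n y T"
proof -
  have "rhs K Y n = rhs K Y' n" 
  proof (intro ext)
    show "rhs K Y n \<zeta> \<eta> = rhs K Y' n \<zeta> \<eta>" for \<zeta> \<eta>
      by (cases n) (auto simp: rhs_def assms)
  qed
  moreover have "(\<Sum>i<m. Y (Suc i) \<zeta> \<eta> * Y (m - i) \<zeta> \<eta>) = (\<Sum>i<m. Y' (Suc i) \<zeta> \<eta> * Y' (m - i) \<zeta> \<eta>)" if "n = Suc m" for m \<zeta> \<eta>
    using assms that by (intro sum.cong) auto
  ultimately show ?thesis by (auto simp: step_def split: nat.splits)
qed

text \<open>With y 0 = 1 the unknown occurs as 2 \<open>y n\<close>, and all other products are of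
  lower order. \<open>L\<close> multiplies the constants met between the products of the
  \<open>y j\<close> and q (Q - \<alpha> P): \<kappa> for K, \<open>gc\<close> for the Green
  operator, \<open>1 + Na\<close> for the two terms, \<open>Nq\<close> for q. With this value the
  bounds satisfy the recursion of \<open>maj\<close> with equality.\<close>

lemma step_exists:
  assumes K: "bdd K \<kappa>" and q: "bdd q Nq" and \<alpha>: "bdd \<alpha> Na" and pos: "0 \<le> \<kappa>" "0 \<le> Nq" "0 \<le> Na"
    and L: "L = Nq * (1 + Na) * gc * \<kappa>"
    and Y: "\<And>j. j < n \<Longrightarrow> bdd (Y j) (maj L j)"
  shows "\<exists>y T. step K q \<alpha> \<kappa> L Y n y T"
proof -
  obtain U P Q where T: "green_of (rhs K Y n) (\<kappa> * cv L n) (U, P, Q)"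
    using green_of_exists[OF rhs_bdd[OF K Y]] by (metis prod.collapse)
  show ?thesis
  proof (cases n)
    case 0
    have "bdd (\<lambda>_ _. 1) (maj L 0)" using bdd_const[of 1] by simp
    then have "step K q \<alpha> \<kappa> L Y n (\<lambda>_ _. 1) (U, P, Q)" using T 0 by (simp add: step_def)
    then show ?thesis by blast
  next
    case (Suc m)
    define y where "y \<zeta> \<eta> = (1/2) * (q \<zeta> \<eta> * (Q \<zeta> \<eta> + (-1) * (\<alpha> \<zeta> \<eta> * P \<zeta> \<eta>)) + (-1) * (\<Sum>i<m. Y (Suc i) \<zeta> \<eta> * Y (m - i) \<zeta> \<eta>))" for \<zeta> \<eta>
    let ?G = "gc * (\<kappa> * cv L n)"
    have PQ: "bdd P ?G" "bdd Q ?G" using T by (auto simp: green_of_def)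
    have "bdd y (norm (1/2::complex) * (Nq * (?G + norm (-1::complex) * (Na * ?G)) + norm (-1::complex) * (\<Sum>i<m. maj L (Suc i) * maj L (m - i))))"
      unfolding y_def[abs_def]
      by (intro bdd_cmult bdd_mult bdd_add bdd_sum q \<alpha> PQ Y) (auto simp: Suc)
    also have "norm (1/2::complex) * (Nq * (?G + norm (-1::complex) * (Na * ?G)) + norm (-1::complex) * (\<Sum>i<m. maj L (Suc i) * maj L (m - i))) = maj L n"
      unfolding Suc maj.simps(2)[of L m] by (simp add: cv_def L algebra_simps)
    finally have "bdd y (maj L n)" .
    then have "step K q \<alpha> \<kappa> L Y n y (U, P, Q)" using T Suc by (auto simp: step_def y_def algebra_simps)
    then show ?thesis by blast
  qed
qed

text \<open>Each step is a relation between the earlier data and the new data, so the sequence comes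
  from dependent choice along the well-founded order of the naturals; \<open>step_cong\<close> shows
  that only earlier values matter.\<close>

lemma recursion_solution:
  assumes K: "bdd K \<kappa>" and q: "bdd q Nq" and \<alpha>: "bdd \<alpha> Na" and pos: "0 \<le> \<kappa>" "0 \<le> Nq" "0 \<le> Na"
    and L: "L = Nq * (1 + Na) * gc * \<kappa>"
  obtains y T where "\<And>n. step K q \<alpha> \<kappa> L y n (y n) (T n)"
proof -
  have "\<exists>f. \<forall>n. (\<lambda>f n z. step K q \<alpha> \<kappa> L (\<lambda>j. fst (f j)) n (fst z) (snd z)) f n (f n)"
  proof (rule dependent_wf_choice[OF wf_less_than])
    fix f g :: "nat \<Rightarrow> fn2 \<times> (fn2 \<times> fn2 \<times> fn2)" and n z assume "\<And>j. (j, n) \<in> less_than \<Longrightarrow> f j = g j"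
    then show "step K q \<alpha> \<kappa> L (\<lambda>j. fst (f j)) n (fst z) (snd z) = step K q \<alpha> \<kappa> L (\<lambda>j. fst (g j)) n (fst z) (snd z)"
      by (intro step_cong) simp
  next
    fix n and f :: "nat \<Rightarrow> fn2 \<times> (fn2 \<times> fn2 \<times> fn2)" assume "\<And>j. (j, n) \<in> less_than \<Longrightarrow> step K q \<alpha> \<kappa> L (\<lambda>j. fst (f j)) j (fst (f j)) (snd (f j))"
    then have "\<And>j. j < n \<Longrightarrow> bdd (fst (f j)) (maj L j)" by (auto simp: step_def)
    from step_exists[OF assms this] show "\<exists>z. step K q \<alpha> \<kappa> L (\<lambda>j. fst (f j)) n (fst z) (snd z)" by (metis fst_conv snd_conv)
  qed
  then obtain f where "\<And>n. step K q \<alpha> \<kappa> L (\<lambda>j. fst (f j)) n (fst (f n)) (snd (f n))" by blast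
  then show thesis by (rule that)
qed

end

text \<open>The ansatz is H + Q - \<alpha> P = H y^2 with y = 1 at \<tau> = 0. Then sqrt(F F')
  becomes K y \<open>star y\<close>. On \<eta> = cnj \<zeta> a product with its reflection is an
  absolute square, so K is |H| and the right side is \<tau> |H y^2|, which is the equation in the
  last clause.\<close>

theorem disc_solution:
  assumes R: "1 < R" and H: "H holomorphic_on ball 0 R" "\<And>z. z \<in> ball 0 R \<Longrightarrow> H z \<noteq> 0"
    and \<alpha>: "\<alpha> holomorphic_on ball 0 R"
  obtains r t U P Q \<Phi> where "1 < r" "r < R" "0 < t"
    "hol3 U ((ball 0 r \<times> ball 0 r) \<times> ball 0 t)"
    "\<And>\<zeta> \<eta> \<tau>. \<zeta> \<in> ball 0 r \<Longrightarrow> \<eta> \<in> ball 0 r \<Longrightarrow> \<tau> \<in> ball 0 t \<Longrightarrow>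
       ((\<lambda>\<zeta>. U ((\<zeta>, \<eta>), \<tau>)) has_field_derivative P ((\<zeta>, \<eta>), \<tau>)) (at \<zeta>)"
    "\<And>\<zeta> \<eta> \<tau>. \<zeta> \<in> ball 0 r \<Longrightarrow> \<eta> \<in> ball 0 r \<Longrightarrow> \<tau> \<in> ball 0 t \<Longrightarrow>
       ((\<lambda>\<zeta>. P ((\<zeta>, \<eta>), \<tau>)) has_field_derivative Q ((\<zeta>, \<eta>), \<tau>)) (at \<zeta>)"
    "\<And>\<zeta> \<eta> \<tau>. \<zeta> \<in> ball 0 r \<Longrightarrow> \<eta> \<in> ball 0 r \<Longrightarrow> \<tau> \<in> ball 0 t \<Longrightarrow>
       ((\<lambda>\<eta>. P ((\<zeta>, \<eta>), \<tau>)) has_field_derivative \<Phi> ((\<zeta>, \<eta>), \<tau>)) (at \<eta>)"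
    "\<And>\<zeta> \<eta> \<tau>. \<zeta> * \<eta> = 1 \<Longrightarrow> U ((\<zeta>, \<eta>), \<tau>) = 0"
    "\<And>\<zeta> \<eta>. \<zeta> \<in> ball 0 r \<Longrightarrow> \<eta> \<in> ball 0 r \<Longrightarrow> U ((\<zeta>, \<eta>), 0) = 0"
    "\<And>\<zeta> \<tau>. \<zeta> \<in> ball 0 r \<Longrightarrow> \<bar>\<tau>\<bar> < t \<Longrightarrow> \<Phi> ((\<zeta>, cnj \<zeta>), of_real \<tau>) =
       of_real (\<tau> * norm (H \<zeta> + Q ((\<zeta>, cnj \<zeta>), of_real \<tau>) - \<alpha> \<zeta> * P ((\<zeta>, cnj \<zeta>), of_real \<tau>)))"
proof -
  define \<rho> where "\<rho> = (1 + R) / 2"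
  define r where "r = (1 + \<rho>) / 2"
  have r: "1 < r" "r < \<rho>" "\<rho> < R" using R by (auto simp: r_def \<rho>_def)
  \<comment> \<open>The first entry of the minimum gives r <= \<rho> exp(- c (1 + r^2)), the second
    c r^2 <= 1/2. The first is positive because r < \<rho>.\<close>
  define c where "c = min (ln (\<rho> / r) / (1 + r\<^sup>2)) (1 / (2 * r\<^sup>2))"
  interpret disc_weight r \<rho> c
  proof
    show "1 < r" by fact
    have p: "0 < 1 + r\<^sup>2" by (simp add: add_pos_nonneg)
    show "0 < c" using r p by (auto simp: c_def ln_gt_zero)
    have "c * r\<^sup>2 \<le> 1 / (2 * r\<^sup>2) * r\<^sup>2" by (intro mult_right_mono) (auto simp: c_def)
    then show "c * r\<^sup>2 \<le> 1/2" using r by simp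
    have "c * (1 + r\<^sup>2) \<le> ln (\<rho> / r) / (1 + r\<^sup>2) * (1 + r\<^sup>2)" using p by (intro mult_right_mono) (auto simp: c_def)
    then have "c * (1 + r\<^sup>2) \<le> ln (\<rho> / r)" using p by simp
    then have "exp (- ln (\<rho> / r)) \<le> exp (- c * (1 + r\<^sup>2))" by simp
    moreover have "exp (- ln (\<rho> / r)) = r / \<rho>" using r by (simp add: exp_minus)
    ultimately have "r / \<rho> \<le> exp (- c * (1 + r\<^sup>2))" by simp
    then show "r \<le> \<rho> * exp (- c * (1 + r\<^sup>2))" using r by (simp add: field_simps)
  qed
  obtain g where g: "g holomorphic_on ball 0 R" "\<And>z. z \<in> ball 0 R \<Longrightarrow> H z = g z ^ 2"
    using contractible_imp_holomorphic_sqrt[OF H(1) convex_imp_contractible[OF convex_ball] H(2)] by blast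
  obtain Mg where Mg: "bdd (\<lambda>\<zeta> \<eta>. g \<zeta>) Mg" using bdd_holomorphic[OF g(1) r(3)] .
  define K where "K \<zeta> \<eta> = g \<zeta> * star (\<lambda>\<zeta> \<eta>. g \<zeta>) \<zeta> \<eta>" for \<zeta> \<eta>
  have K: "bdd K (Mg * Mg)" unfolding K_def[abs_def] by (rule bdd_mult[OF Mg bdd_star[OF Mg]])
  have "(\<lambda>z. 1 / H z) holomorphic_on ball 0 R" using H by (intro holomorphic_intros)
  then obtain Nq where q: "bdd (\<lambda>\<zeta> \<eta>. 1 / H \<zeta>) Nq" using bdd_holomorphic[OF _ r(3)] by blast
  obtain Na where a: "bdd (\<lambda>\<zeta> \<eta>. \<alpha> \<zeta>) Na" using bdd_holomorphic[OF \<alpha> r(3)] .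
  have zero: "0 \<in> ball (0::complex) r" using r by simp
  have pos: "0 \<le> Mg * Mg" "0 \<le> Nq" "0 \<le> Na"
    using bdd_norm_le[OF q zero zero] bdd_norm_le[OF a zero zero] norm_ge_zero order_trans by (auto, blast+)
  define \<kappa> where "\<kappa> = Mg * Mg"
  define L where "L = Nq * (1 + Na) * gc * \<kappa>"
  have L0: "0 \<le> L" using pos gc_pos by (simp add: L_def \<kappa>_def)
  obtain y T where st: "\<And>n. step K (\<lambda>\<zeta> \<eta>. 1 / H \<zeta>) (\<lambda>\<zeta> \<eta>. \<alpha> \<zeta>) \<kappa> L y n (y n) (T n)"
    using recursion_solution[OF K q a pos, folded \<kappa>_def, OF L_def] by blast
  define u p w f where "u n = fst (T n)" and "p n = fst (snd (T n))" and "w n = snd (snd (T n))" and "f n = rhs K y n" for n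
  have gr: "green_of (f n) (\<kappa> * cv L n) (u n, p n, w n)" for n using st[of n] by (simp add: step_def u_def p_def w_def f_def)
  have yb: "bdd (y n) (maj L n)" for n using st[of n] by (simp add: step_def)
  obtain t where t: "0 < t" "summable (\<lambda>n. maj L n * t ^ n)" using maj_summable[OF L0] .
  define b where "b n = gc * (\<kappa> * cv L n) * t ^ n" for n
  have sb: "summable b"
    using summable_mult[OF cv_summable(1)[OF L0 t], of "gc * \<kappa>"] by (simp add: b_def[abs_def] mult_ac)
  define b' where "b' n = \<kappa> * cv L n * t ^ n" for n
  have sb': "summable b'"
    using summable_mult[OF cv_summable(1)[OF L0 t], of "\<kappa>"] by (simp add: b'_def[abs_def] mult_ac)
  have bu: "bdd (u n) (gc * (\<kappa> * cv L n))" "bdd (p n) (gc * (\<kappa> * cv L n))" "bdd (w n) (gc * (\<kappa> * cv L n))" for n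
    using gr[of n] by (auto simp: green_of_def)
  have bf: "bdd (f n) (\<kappa> * cv L n)" for n unfolding f_def by (rule rhs_bdd[OF K[folded \<kappa>_def] yb])
  have pw: "norm (\<tau> ^ n * h \<zeta> \<eta>) \<le> M * t ^ n" if "bdd h M" "\<zeta> \<in> ball 0 r" "\<eta> \<in> ball 0 r" "\<tau> \<in> ball 0 t" for h M \<zeta> \<eta> \<tau> n
  proof -
    have "norm (\<tau> ^ n * h \<zeta> \<eta>) \<le> t ^ n * M"
      unfolding norm_mult norm_power using that bdd_norm_le[OF that(1-3)] t by (intro mult_mono power_mono) auto
    then show ?thesis by (simp add: mult.commute)
  qed
  define ser where "ser h x = (\<Sum>n. snd x ^ n * h n (fst (fst x)) (snd (fst x)))" for h :: "nat \<Rightarrow> fn2" and x :: "(complex \<times> complex) \<times> complex"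
  have ser: "ser h ((\<zeta>, \<eta>), \<tau>) = (\<Sum>n. \<tau> ^ n * h n \<zeta> \<eta>)" for h \<zeta> \<eta> \<tau> by (simp add: ser_def)
  have ny: "norm (\<tau> ^ n * y n \<zeta> \<eta>) \<le> maj L n * t ^ n" if "\<zeta> \<in> ball 0 r" "\<eta> \<in> ball 0 r" "\<tau> \<in> ball 0 t" for \<zeta> \<eta> \<tau> n
    by (rule pw[OF yb that])
  have der: "((\<lambda>\<zeta>. u n \<zeta> \<eta>) has_field_derivative p n \<zeta> \<eta>) (at \<zeta>)" "((\<lambda>\<zeta>. p n \<zeta> \<eta>) has_field_derivative w n \<zeta> \<eta>) (at \<zeta>)"
    "((\<lambda>\<eta>. p n \<zeta> \<eta>) has_field_derivative f n \<zeta> \<eta>) (at \<eta>)" if "\<zeta> \<in> ball 0 r" "\<eta> \<in> ball 0 r" for \<zeta> \<eta> n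
    using gr[of n] that by (auto simp: green_of_def)
  show thesis
  proof (rule that[of r t "ser u" "ser p" "ser w" "ser f"])
    show "1 < r" "r < R" "0 < t" using r t by auto
    let ?S = "(ball (0::complex) r \<times> ball (0::complex) r) \<times> ball (0::complex) t"
    show "hol3 (ser u) ?S"
    proof (rule hol3_has_sum[where I = UNIV and M = b and f = "\<lambda>n x. snd x ^ n * u n (fst (fst x)) (snd (fst x))"])
      show "open ?S" by (intro open_Times open_ball)
      show "hol3 (\<lambda>x. snd x ^ n * u n (fst (fst x)) (snd (fst x))) ?S" for n
        by (intro hol3_mult hol3_power hol3_coords hol3_mono[OF bdd_hol3[OF bu(1)]]) auto
      show nb: "norm (snd x ^ n * u n (fst (fst x)) (snd (fst x))) \<le> b n" if "x \<in> ?S" for n x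
        unfolding b_def using that by (intro pw[OF bu(1)]) auto
      have "0 \<le> b n" for n
        by (rule order_trans[OF norm_ge_zero nb[of "((0,0),0)"]]) (use r t in auto)
      then show "b summable_on UNIV" using sb by (intro summable_nonneg_imp_summable_on) auto
      show "((\<lambda>n. snd x ^ n * u n (fst (fst x)) (snd (fst x))) has_sum ser u x) UNIV" if "x \<in> ?S" for x
        unfolding ser_def by (rule summable_imp_has_sum(1)[OF nb[OF that] sb])
    qed
    show "ser u ((\<zeta>, \<eta>), \<tau>) = 0" if "\<zeta> * \<eta> = 1" for \<zeta> \<eta> \<tau>
    proof -
      have "u n \<zeta> \<eta> = 0" for n using gr[of n] that by (auto simp: green_of_def)
      then show ?thesis by (simp add: ser)
    qed
    fix \<zeta> \<eta> :: complex assume z: "\<zeta> \<in> ball 0 r" "\<eta> \<in> ball 0 r"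
    have u0: "u 0 \<zeta> \<eta> = 0" using bdd_norm_le[OF bu(1)[of 0] z] by (simp add: cv_def)
    have p0: "p 0 \<zeta> \<eta> = 0" "w 0 \<zeta> \<eta> = 0" using bdd_norm_le[OF bu(2)[of 0] z] bdd_norm_le[OF bu(3)[of 0] z] by (simp_all add: cv_def)
    show "ser u ((\<zeta>, \<eta>), 0) = 0" unfolding ser by (subst suminf_finite[of "{0}"]) (auto simp: u0)
    {
      fix \<tau> :: complex assume \<tau>: "\<tau> \<in> ball 0 t"
      show "((\<lambda>\<zeta>. ser u ((\<zeta>, \<eta>), \<tau>)) has_field_derivative ser p ((\<zeta>, \<eta>), \<tau>)) (at \<zeta>)"
        unfolding ser
        by (rule suminf_has_field_derivative[OF DERIV_cmult[OF der(1)[OF _ z(2)]] _ sb _ sb z(1)])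
          (auto simp: b_def intro!: pw[OF bu(1) _ _ \<tau>] pw[OF bu(2) _ _ \<tau>] z[simplified])
      show "((\<lambda>\<zeta>. ser p ((\<zeta>, \<eta>), \<tau>)) has_field_derivative ser w ((\<zeta>, \<eta>), \<tau>)) (at \<zeta>)"
        unfolding ser
        by (rule suminf_has_field_derivative[OF DERIV_cmult[OF der(2)[OF _ z(2)]] _ sb _ sb z(1)])
          (auto simp: b_def intro!: pw[OF bu(2) _ _ \<tau>] pw[OF bu(3) _ _ \<tau>] z[simplified])
      show "((\<lambda>\<eta>. ser p ((\<zeta>, \<eta>), \<tau>)) has_field_derivative ser f ((\<zeta>, \<eta>), \<tau>)) (at \<eta>)"
        unfolding ser
        by (rule suminf_has_field_derivative[OF DERIV_cmult[OF der(3)[OF z(1)]] _ sb _ sb' z(2)])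
          (auto simp: b_def b'_def intro!: pw[OF bu(2) _ _ \<tau>] pw[OF bf _ _ \<tau>] z[simplified])
    }
  next
    fix \<zeta> :: complex and \<tau> :: real assume \<zeta>: "\<zeta> \<in> ball 0 r" and \<tau>: "\<bar>\<tau>\<bar> < t"
    have z: "\<zeta> \<in> ball 0 r" "cnj \<zeta> \<in> ball 0 r" "complex_of_real \<tau> \<in> ball 0 t" using \<zeta> \<tau> by auto
    have zR: "\<zeta> \<in> ball 0 R" using \<zeta> r by auto
    define Yn where "Yn n = of_real \<tau> ^ n * y n \<zeta> (cnj \<zeta>)" for n
    define Yv where "Yv = suminf Yn"
    have nY: "norm (Yn n) \<le> maj L n * t ^ n" for n unfolding Yn_def by (rule ny[OF z])
    have sY: "summable (\<lambda>n. norm (Yn n))" "Yn sums Yv" using summable_imp_has_sum[OF nY t(2)] by (auto simp: Yv_def)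
    have sm: "(\<lambda>n. of_real \<tau> ^ n * h n \<zeta> (cnj \<zeta>)) sums ser h ((\<zeta>, cnj \<zeta>), of_real \<tau>)"
      if "\<And>n. bdd (h n) (M n)" "summable (\<lambda>n. M n * t ^ n)" for h M
      unfolding ser by (rule summable_imp_has_sum(2)[OF _ that(2)], rule pw[OF that(1) z])
    have sums: "(\<lambda>n. of_real \<tau> ^ n * p n \<zeta> (cnj \<zeta>)) sums ser p ((\<zeta>, cnj \<zeta>), of_real \<tau>)"
      "(\<lambda>n. of_real \<tau> ^ n * w n \<zeta> (cnj \<zeta>)) sums ser w ((\<zeta>, cnj \<zeta>), of_real \<tau>)"
      "(\<lambda>n. of_real \<tau> ^ n * f n \<zeta> (cnj \<zeta>)) sums ser f ((\<zeta>, cnj \<zeta>), of_real \<tau>)"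
      by (rule sm[OF bu(2) sb[unfolded b_def[abs_def]]] sm[OF bu(3) sb[unfolded b_def[abs_def]]] sm[OF bf sb'[unfolded b'_def[abs_def]]])+
    let ?V = "1 / H \<zeta> * (ser w ((\<zeta>, cnj \<zeta>), of_real \<tau>) - \<alpha> \<zeta> * ser p ((\<zeta>, cnj \<zeta>), of_real \<tau>))"
    have "(\<lambda>n. (if n = 0 then 1 else 0) + 1 / H \<zeta> * (of_real \<tau> ^ n * w n \<zeta> (cnj \<zeta>) - \<alpha> \<zeta> * (of_real \<tau> ^ n * p n \<zeta> (cnj \<zeta>)))) sums (1 + ?V)"
      by (intro sums_add sums_mult sums_diff sums) (use sums_single[of 0 "\<lambda>_. 1::complex"] in simp)
    \<comment> \<open>Comparison of coefficients in 1 + q (Q - \<alpha> P) = y^2. For n >= 1 the two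
      extreme terms of the Cauchy product give 2 \<open>y n\<close>, because y 0 = 1.\<close>
    moreover have "(if n = 0 then 1 else 0) + 1 / H \<zeta> * (of_real \<tau> ^ n * w n \<zeta> (cnj \<zeta>) - \<alpha> \<zeta> * (of_real \<tau> ^ n * p n \<zeta> (cnj \<zeta>)))
      = (\<Sum>i\<le>n. Yn i * Yn (n - i))" for n
    proof -
      let ?y = "\<lambda>n. y n \<zeta> (cnj \<zeta>)"
      have y0: "?y 0 = 1" using st[of 0] by (simp add: step_def)
      have conv: "(\<Sum>i\<le>n. Yn i * Yn (n - i)) = of_real \<tau> ^ n * (\<Sum>i\<le>n. ?y i * ?y (n - i))"
        unfolding sum_distrib_left Yn_def by (intro sum.cong) (auto simp: mult_ac simp flip: power_add)
      show ?thesis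
      proof (cases n)
        case 0
        have "p 0 \<zeta> (cnj \<zeta>) = 0" "w 0 \<zeta> (cnj \<zeta>) = 0" using bdd_norm_le[OF bu(2)[of 0] z(1,2)] bdd_norm_le[OF bu(3)[of 0] z(1,2)] by (simp_all add: cv_def)
        then show ?thesis using 0 y0 by (simp add: Yn_def)
      next
        case (Suc m)
        have "(\<Sum>i\<le>n. ?y i * ?y (n - i)) = ?y 0 * ?y n + ((\<Sum>i<m. ?y (Suc i) * ?y (m - i)) + ?y n * ?y 0)"
        proof -
          have "(\<Sum>i\<le>Suc m. ?y i * ?y (Suc m - i)) = ?y 0 * ?y (Suc m) + (\<Sum>i\<le>m. ?y (Suc i) * ?y (m - i))"
            by (subst sum.atMost_Suc_shift) simp
          also have "(\<Sum>i\<le>m. ?y (Suc i) * ?y (m - i)) = (\<Sum>i<m. ?y (Suc i) * ?y (m - i)) + ?y (Suc m) * ?y 0"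
            by (simp flip: lessThan_Suc_atMost)
          finally show ?thesis using Suc by simp
        qed
        also have "\<dots> = 2 * ?y n + (\<Sum>i<m. ?y (Suc i) * ?y (m - i))" by (simp add: y0)
        also have "\<dots> = 1 / H \<zeta> * (w n \<zeta> (cnj \<zeta>) - \<alpha> \<zeta> * p n \<zeta> (cnj \<zeta>))"
          using st[of n] Suc by (simp add: step_def w_def p_def)
        finally have fin: "(\<Sum>i\<le>n. ?y i * ?y (n - i)) = 1 / H \<zeta> * (w n \<zeta> (cnj \<zeta>) - \<alpha> \<zeta> * p n \<zeta> (cnj \<zeta>))" .
        show ?thesis unfolding conv fin using Suc by (simp add: algebra_simps)
      qed
    qed
    ultimately have "1 + ?V = Yv * Yv"
      using Cauchy_product_sums[OF sY(1) sY(1)] sums_unique2 unfolding Yv_def by (simp only:) blast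
    moreover have "ser f ((\<zeta>, cnj \<zeta>), of_real \<tau>) = of_real \<tau> * K \<zeta> (cnj \<zeta>) * (Yv * cnj Yv)"
    proof -
      have sc: "summable (\<lambda>n. norm (cnj (Yn n)))" using sY(1) by simp
      have cs: "(\<Sum>n. cnj (Yn n)) = cnj Yv" using sY(2) sums_cnj sums_iff by blast
      have "(\<lambda>m. of_real \<tau> * K \<zeta> (cnj \<zeta>) * (\<Sum>i\<le>m. Yn i * cnj (Yn (m - i)))) sums (of_real \<tau> * K \<zeta> (cnj \<zeta>) * (Yv * cnj Yv))"
        using Cauchy_product_sums[OF sY(1) sc] unfolding cs Yv_def[symmetric] by (rule sums_mult)
      \<comment> \<open>Since \<tau> is real, conjugating \<open>Yn\<close> only conjugates y, and
        on the real section that is \<open>star y\<close>.\<close>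
      moreover have "of_real \<tau> * K \<zeta> (cnj \<zeta>) * (\<Sum>i\<le>m. Yn i * cnj (Yn (m - i))) = of_real \<tau> ^ Suc m * f (Suc m) \<zeta> (cnj \<zeta>)" for m
      proof -
        have "(\<Sum>i\<le>m. Yn i * cnj (Yn (m - i))) = of_real \<tau> ^ m * (\<Sum>i\<le>m. y i \<zeta> (cnj \<zeta>) * star (y (m - i)) \<zeta> (cnj \<zeta>))"
          unfolding sum_distrib_left Yn_def star_def by (intro sum.cong) (auto simp: mult_ac simp flip: power_add)
        then show ?thesis by (simp add: f_def rhs_def mult_ac)
      qed
      ultimately have "(\<lambda>m. of_real \<tau> ^ Suc m * f (Suc m) \<zeta> (cnj \<zeta>)) sums (of_real \<tau> * K \<zeta> (cnj \<zeta>) * (Yv * cnj Yv))"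
        by (simp only:)
      then have "(\<lambda>m. of_real \<tau> ^ m * f m \<zeta> (cnj \<zeta>)) sums (of_real \<tau> * K \<zeta> (cnj \<zeta>) * (Yv * cnj Yv) + of_real \<tau> ^ 0 * f 0 \<zeta> (cnj \<zeta>))"
        by (subst (asm) sums_Suc_iff) simp
      then show ?thesis using sums(3) sums_unique2 by (fastforce simp: f_def rhs_def)
    qed
    moreover have "K \<zeta> (cnj \<zeta>) = of_real (norm (H \<zeta>))"
    proof -
      have "norm (H \<zeta>) = (norm (g \<zeta>))\<^sup>2" using g(2)[OF zR] by (simp add: norm_power)
      then show ?thesis by (simp only: K_def star_def complex_norm_square complex_cnj_cnj)
    qed
    moreover have "Yv * cnj Yv = of_real (norm (Yv * Yv))" 
    proof -
      have "norm (Yv * Yv) = (norm Yv)\<^sup>2" by (simp add: norm_mult power2_eq_square)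
      then show ?thesis by (simp only: complex_norm_square)
    qed
    ultimately have "ser f ((\<zeta>, cnj \<zeta>), of_real \<tau>) = of_real (\<tau> * norm (H \<zeta> * (1 + ?V)))"
      by (simp add: norm_mult)
    also have "H \<zeta> * (1 + ?V) = H \<zeta> + ser w ((\<zeta>, cnj \<zeta>), of_real \<tau>) - \<alpha> \<zeta> * ser p ((\<zeta>, cnj \<zeta>), of_real \<tau>)"
      using H(2)[OF zR] by (simp add: field_simps)
    finally show "ser f ((\<zeta>, cnj \<zeta>), of_real \<tau>) = of_real (\<tau> * norm (H \<zeta> + ser w ((\<zeta>, cnj \<zeta>), of_real \<tau>) - \<alpha> \<zeta> * ser p ((\<zeta>, cnj \<zeta>), of_real \<tau>)))" .
  qed
qed

section \<open>The maximum principle and uniqueness\<close>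

lemma real_slice_derivatives:
  assumes S: "open S" "hol3 E S" and f: "\<And>x y. ((of_real x, of_real y), c) \<in> S \<Longrightarrow> f (x, y) = Re (E ((of_real x, of_real y), c))"
    and p: "((of_real x, of_real y), c) \<in> S"
  shows "((\<lambda>s. f (s, y)) has_real_derivative Re (D1 E ((of_real x, of_real y), c))) (at x)"
    "((\<lambda>s. f (x, s)) has_real_derivative Re (D2 E ((of_real x, of_real y), c))) (at y)"
proof -
  have Re: "((\<lambda>s. Re (g (of_real s))) has_real_derivative Re D) (at t)" if "(g has_field_derivative D) (at (of_real t))" for g D t
    using has_vector_derivative_real_field[OF that] bounded_linear.has_vector_derivative[OF bounded_linear_Re]
    by (simp add: has_real_derivative_iff_has_vector_derivative)
  have o1: "open ((\<lambda>s::real. ((of_real s, of_real y), c)) -` S)" "open ((\<lambda>s::real. ((of_real x, of_real s), c)) -` S)"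
    by (intro open_vimage S continuous_intros)+
  have 1: "((\<lambda>s. Re (E ((of_real s, of_real y), c))) has_real_derivative Re (D1 E ((of_real x, of_real y), c))) (at x)"
    by (rule Re[OF hol3_has_derivatives(1)[OF S(2) p]])
  have 2: "((\<lambda>s. Re (E ((of_real x, of_real s), c))) has_real_derivative Re (D2 E ((of_real x, of_real y), c))) (at y)"
    by (rule Re[OF hol3_has_derivatives(2)[OF S(2) p]])
  show "((\<lambda>s. f (s, y)) has_real_derivative Re (D1 E ((of_real x, of_real y), c))) (at x)"
    by (rule has_field_derivative_transform_within_open[OF 1 o1(1)]) (use p f in auto)
  show "((\<lambda>s. f (x, s)) has_real_derivative Re (D2 E ((of_real x, of_real y), c))) (at y)"
    by (rule has_field_derivative_transform_within_open[OF 2 o1(2)]) (use p f in auto)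
qed

lemma pd_real_slice:
  assumes S: "open S" "hol3 E S" and f: "\<And>x y. ((of_real x, of_real y), c) \<in> S \<Longrightarrow> f (x, y) = Re (E ((of_real x, of_real y), c))"
    and p: "((of_real x, of_real y), c) \<in> S"
  shows "pdx f (x, y) = Re (D1 E ((of_real x, of_real y), c))" "pdy f (x, y) = Re (D2 E ((of_real x, of_real y), c))"
  using real_slice_derivatives[OF assms] by (auto simp: pdx_def pdy_def DERIV_imp_deriv)

lemma pd2_real_slice:
  assumes S: "open S" "hol3 E S" and f: "\<And>x y. ((of_real x, of_real y), c) \<in> S \<Longrightarrow> f (x, y) = Re (E ((of_real x, of_real y), c))"
    and p: "((of_real x, of_real y), c) \<in> S"
  shows "pdx (pdx f) (x, y) = Re (D1 (D1 E) ((of_real x, of_real y), c))"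
    "pdy (pdy f) (x, y) = Re (D2 (D2 E) ((of_real x, of_real y), c))"
    "pdx (pdy f) (x, y) = Re (D1 (D2 E) ((of_real x, of_real y), c))"
  using pd_real_slice[OF S(1) hol3_D1[OF S] pd_real_slice(1)[OF S f] p] pd_real_slice[OF S(1) hol3_D2[OF S] pd_real_slice(2)[OF S f] p]
  by auto

text \<open>Near p the function is the restriction to real points of the real part of a holomorphic
  function; all rules for derivatives are inherited from that extension. The slot c can hold a
  frozen parameter of a family.\<close>

definition smooth_slice :: "(real \<times> real \<Rightarrow> real) \<Rightarrow> real \<times> real \<Rightarrow> bool" where
  "smooth_slice f p \<longleftrightarrow> (\<exists>S E c. open S \<and> hol3 E S \<and> ((of_real (fst p), of_real (snd p)), c) \<in> S \<and>
     (\<forall>x y. ((of_real x, of_real y), c) \<in> S \<longrightarrow> f (x, y) = Re (E ((of_real x, of_real y), c))))"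

text \<open>Restricting the extension to the complex line through p in direction (a, b) leaves a
  function of one variable; the two cross terms of its second derivative merge by symmetry of mixed
  derivatives.\<close>

lemma smooth_slice_taylor:
  assumes "smooth_slice f p"
  shows "\<exists>g'. (\<forall>\<^sub>F s in nhds 0. ((\<lambda>s. f (p + s *\<^sub>R (a, b))) has_real_derivative g' s) (at s)) \<and>
    (g' has_real_derivative (a\<^sup>2 * pdx (pdx f) p + 2 * a * b * pdx (pdy f) p + b\<^sup>2 * pdy (pdy f) p)) (at 0)"
proof -
  obtain S E c where S: "open S" "hol3 E S" "((of_real (fst p), of_real (snd p)), c) \<in> S"
    and f: "\<And>x y. ((of_real x, of_real y), c) \<in> S \<Longrightarrow> f (x, y) = Re (E ((of_real x, of_real y), c))"
    using assms unfolding smooth_slice_def by blast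
  define x y where "x = fst p" and "y = snd p"
  define l where "l z = ((of_real x + z * of_real a, of_real y + z * of_real b), c)" for z :: complex
  have lS: "open (l -` S)" unfolding l_def by (intro open_vimage S continuous_intros)
  have l0: "l 0 = ((of_real x, of_real y), c)" by (simp add: l_def)
  have 0: "0 \<in> l -` S" using S(3) by (simp add: l0 x_def y_def)
  have ch: "((\<lambda>z. F (l z)) has_field_derivative (of_real a * D1 F (l z) + of_real b * D2 F (l z))) (at z)" if "hol3 F S" "l z \<in> S" for F z
  proof -
    have dl: "(l has_derivative (\<lambda>h. ((h * of_real a, h * of_real b), 0))) (at z)"
      unfolding l_def by (auto intro!: derivative_eq_intros has_derivative_Pair)
    have "(F has_derivative (\<lambda>((u, v), w). D1 F (l z) * u + D2 F (l z) * v + D3 F (l z) * w)) (at (l z))"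
      using hol3_has_derivatives(4)[OF that(1)] that(2) unfolding l_def by blast
    from has_derivative_compose[OF dl this]
    have "((\<lambda>z. F (l z)) has_derivative (\<lambda>h. D1 F (l z) * (h * of_real a) + D2 F (l z) * (h * of_real b))) (at z)" by simp
    also have "(\<lambda>h. D1 F (l z) * (h * of_real a) + D2 F (l z) * (h * of_real b)) = (*) (of_real a * D1 F (l z) + of_real b * D2 F (l z))"
      by (auto simp: fun_eq_iff algebra_simps)
    finally show ?thesis unfolding has_field_derivative_def .
  qed
  define h where "h z = of_real a * D1 E (l z) + of_real b * D2 E (l z)" for z
  have Re: "((\<lambda>s. Re (g (of_real s))) has_real_derivative Re D) (at t)" if "(g has_field_derivative D) (at (of_real t))" for g D t
    using has_vector_derivative_real_field[OF that] bounded_linear.has_vector_derivative[OF bounded_linear_Re]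
    by (simp add: has_real_derivative_iff_has_vector_derivative)
  have oT: "open ((\<lambda>s. l (of_real s)) -` S)" unfolding l_def by (intro open_vimage S continuous_intros)
  have fl: "f (p + s *\<^sub>R (a, b)) = Re (E (l (of_real s)))" if "l (of_real s) \<in> S" for s
    using f[of "x + s * a" "y + s * b"] that by (simp add: l_def x_def y_def plus_prod_def)
  have d1: "((\<lambda>s. f (p + s *\<^sub>R (a, b))) has_real_derivative Re (h (of_real s))) (at s)" if "l (of_real s) \<in> S" for s
  proof -
    have "((\<lambda>s. Re (E (l (of_real s)))) has_real_derivative Re (h (of_real s))) (at s)"
      unfolding h_def by (rule Re[OF ch[OF S(2) that]])
    then show ?thesis by (rule has_field_derivative_transform_within_open[OF _ oT]) (use that fl in auto)
  qed
  have "0 \<in> (\<lambda>s. l (of_real s)) -` S" using 0 by simp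
  from eventually_nhds_in_open[OF oT this]
  have ev: "\<forall>\<^sub>F s in nhds 0. ((\<lambda>s. f (p + s *\<^sub>R (a, b))) has_real_derivative Re (h (of_real s))) (at s)"
    by (rule eventually_mono) (rule d1, simp)
  have l0S: "l 0 \<in> S" using 0 by simp
  have "(h has_field_derivative (of_real a * (of_real a * D1 (D1 E) (l 0) + of_real b * D2 (D1 E) (l 0)) + of_real b * (of_real a * D1 (D2 E) (l 0) + of_real b * D2 (D2 E) (l 0)))) (at 0)"
    unfolding h_def[abs_def] by (intro DERIV_add DERIV_cmult ch hol3_D1 hol3_D2 S l0S)
  then have "(h has_field_derivative (of_real a * (of_real a * D1 (D1 E) (l 0) + of_real b * D2 (D1 E) (l 0)) + of_real b * (of_real a * D1 (D2 E) (l 0) + of_real b * D2 (D2 E) (l 0)))) (at (of_real 0))" by simp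
  from Re[OF this] have "((\<lambda>s. Re (h (of_real s))) has_real_derivative Re (of_real a * (of_real a * D1 (D1 E) (l 0) + of_real b * D2 (D1 E) (l 0)) + of_real b * (of_real a * D1 (D2 E) (l 0) + of_real b * D2 (D2 E) (l 0)))) (at 0)" .
  moreover have "Re (of_real a * (of_real a * D1 (D1 E) (l 0) + of_real b * D2 (D1 E) (l 0)) + of_real b * (of_real a * D1 (D2 E) (l 0) + of_real b * D2 (D2 E) (l 0)))
    = a\<^sup>2 * pdx (pdx f) p + 2 * a * b * pdx (pdy f) p + b\<^sup>2 * pdy (pdy f) p"
  proof -
    have "p = (x, y)" by (simp add: x_def y_def)
    then show ?thesis
      using pd2_real_slice[OF S(1,2) f, of x y] S(3) D2_D1[OF S(1,2) l0S]
      by (simp add: l0 x_def y_def power2_eq_square algebra_simps)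
  qed
  ultimately show ?thesis using ev by (intro exI[of _ "\<lambda>s. Re (h (of_real s))"]) simp
qed

lemma second_derivative_at_max:
  fixes g g' :: "real \<Rightarrow> real"
  assumes ev: "\<forall>\<^sub>F s in nhds 0. (g has_real_derivative g' s) (at s)" and g'': "(g' has_real_derivative D) (at 0)"
    and max: "\<forall>\<^sub>F s in nhds 0. g s \<le> g 0"
  shows "D \<le> 0"
proof (rule ccontr)
  assume "\<not> D \<le> 0"
  then have D: "D > 0" by simp
  obtain e where e: "e > 0" "\<And>s. \<bar>s\<bar> < e \<Longrightarrow> (g has_real_derivative g' s) (at s) \<and> g s \<le> g 0"
    using eventually_conj[OF ev max] unfolding eventually_nhds_metric by (auto simp: dist_real_def)
  have g0: "g' 0 = 0" using DERIV_local_max[of g "g' 0" 0 e] e by auto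
  obtain d where d: "d > 0" "\<And>h. 0 < h \<Longrightarrow> h < d \<Longrightarrow> g' 0 < g' (0 + h)" using DERIV_pos_inc_right[OF g'' D] by blast
  define s where "s = min d e / 2"
  have s: "0 < s" "s < d" "s < e" using d e by (auto simp: s_def)
  obtain z where z: "0 < z" "z < s" "g s - g 0 = (s - 0) * g' z"
    using MVT2[of 0 s g g'] e s by auto
  have "g' z > 0" using d(2)[of z] z s g0 by simp
  then have "g s > g 0" using z s by (smt (verit) mult_pos_pos)
  then show False using e(2)[of s] s by simp
qed

text \<open>The Hessian of \<open>D + \<epsilon> |z|\<^sup>2\<close> is negative semidefinite at an interior maximum, which bounds the
  trace-free part of the Hessian of \<open>D\<close> strictly by its trace.\<close>
lemma maximum_principle:
  assumes \<Omega>: "open \<Omega>" "bounded \<Omega>" and D: "\<And>p. p \<in> \<Omega> \<Longrightarrow> smooth_slice D p" "continuous_on (closure \<Omega>) D"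
    and eq: "\<And>p. p \<in> \<Omega> \<Longrightarrow> (pdx (pdx D) p + pdy (pdy D) p)\<^sup>2 \<le> (pdx (pdx D) p - pdy (pdy D) p)\<^sup>2 + 4 * (pdx (pdy D) p)\<^sup>2"
    and bd: "\<And>p. p \<in> frontier \<Omega> \<Longrightarrow> D p \<le> 0" and p: "p \<in> closure \<Omega>"
  shows "D p \<le> 0"
proof (rule ccontr)
  assume "\<not> D p \<le> 0"
  have cpt: "compact (closure \<Omega>)" using \<Omega> by simp
  have "bounded (closure \<Omega>)" using \<Omega>(2) by (rule bounded_closure)
  then obtain B where B: "B > 0" "\<And>q. q \<in> closure \<Omega> \<Longrightarrow> norm q \<le> B" unfolding bounded_pos by blast
  \<comment> \<open>The perturbation is then at most D p / 2 on the closure, so it cannot move the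
    maximum to the frontier, where D <= 0.\<close>
  define \<epsilon> where "\<epsilon> = D p / (2 * B\<^sup>2)"
  have \<epsilon>: "\<epsilon> > 0" using \<open>\<not> D p \<le> 0\<close> B by (simp add: \<epsilon>_def)
  define w where "w q = D q + \<epsilon> * (norm q)\<^sup>2" for q
  have "continuous_on (closure \<Omega>) w" unfolding w_def by (intro continuous_intros D)
  then have "\<exists>m\<in>closure \<Omega>. \<forall>q\<in>closure \<Omega>. w q \<le> w m" using p by (intro continuous_attains_sup[OF cpt]) auto
  then obtain m where m: "m \<in> closure \<Omega>" "\<And>q. q \<in> closure \<Omega> \<Longrightarrow> w q \<le> w m" by blast
  have "m \<notin> frontier \<Omega>"
  proof
    assume "m \<in> frontier \<Omega>"
    then have "D m \<le> 0" by (rule bd)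
    moreover have "\<epsilon> * (norm m)\<^sup>2 \<le> \<epsilon> * B\<^sup>2" using B(2)[OF m(1)] \<epsilon> by (intro mult_left_mono power_mono) auto
    ultimately have "w m \<le> \<epsilon> * B\<^sup>2" unfolding w_def by linarith
    also have "\<dots> = D p / 2" using B by (simp add: \<epsilon>_def)
    also have "\<dots> < w p" using \<open>\<not> D p \<le> 0\<close> \<epsilon> by (simp add: w_def add_pos_nonneg)
    finally show False using m(2)[OF p] by simp
  qed
  then have mO: "m \<in> \<Omega>" using m(1) \<Omega>(1) by (simp add: frontier_def interior_open)
  let ?A = "pdx (pdx D) m" and ?B = "pdx (pdy D) m" and ?C = "pdy (pdy D) m"
  have quad: "a\<^sup>2 * ?A + 2 * a * b * ?B + b\<^sup>2 * ?C + 2 * \<epsilon> * (a\<^sup>2 + b\<^sup>2) \<le> 0" for a b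
  proof -
    obtain g' where g': "\<forall>\<^sub>F s in nhds 0. ((\<lambda>s. D (m + s *\<^sub>R (a, b))) has_real_derivative g' s) (at s)"
      "(g' has_real_derivative (a\<^sup>2 * ?A + 2 * a * b * ?B + b\<^sup>2 * ?C)) (at 0)"
      using smooth_slice_taylor[OF D(1)[OF mO]] by blast
    have nsq: "(norm (m + s *\<^sub>R (a, b)))\<^sup>2 = (fst m + s * a)\<^sup>2 + (snd m + s * b)\<^sup>2" for s
      by (cases m) (simp add: norm_Pair)
    have "\<forall>\<^sub>F s in nhds 0. ((\<lambda>s. w (m + s *\<^sub>R (a, b))) has_real_derivative g' s + \<epsilon> * (2 * (fst m + s * a) * a + 2 * (snd m + s * b) * b)) (at s)"
      using g'(1)
    proof eventually_elim
      case (elim s)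
      then show ?case unfolding w_def nsq by (auto intro!: derivative_eq_intros simp: algebra_simps)
    qed
    moreover have "((\<lambda>s. g' s + \<epsilon> * (2 * (fst m + s * a) * a + 2 * (snd m + s * b) * b)) has_real_derivative
        (a\<^sup>2 * ?A + 2 * a * b * ?B + b\<^sup>2 * ?C) + \<epsilon> * (2 * (a * a) + 2 * (b * b))) (at 0)"
      by (intro DERIV_add g'(2)) (auto intro!: derivative_eq_intros simp: algebra_simps)
    moreover have "\<forall>\<^sub>F s in nhds 0. w (m + s *\<^sub>R (a, b)) \<le> w (m + 0 *\<^sub>R (a, b))"
    proof -
      have "open ((\<lambda>s::real. m + s *\<^sub>R (a, b)) -` \<Omega>)" by (intro open_vimage \<Omega> continuous_intros)
      moreover have m0: "m + 0 *\<^sub>R (a, b) = m" by (simp only: scaleR_zero_left add_0_right)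
      moreover have "0 \<in> (\<lambda>s::real. m + s *\<^sub>R (a, b)) -` \<Omega>" using mO by (simp only: vimage_eq m0)
      ultimately have "\<forall>\<^sub>F s in nhds 0. s \<in> (\<lambda>s::real. m + s *\<^sub>R (a, b)) -` \<Omega>" using eventually_nhds_in_open by blast
      then show ?thesis unfolding m0 by (rule eventually_mono) (rule m(2), use closure_subset in blast)
    qed
    ultimately have "(a\<^sup>2 * ?A + 2 * a * b * ?B + b\<^sup>2 * ?C) + \<epsilon> * (2 * (a * a) + 2 * (b * b)) \<le> 0"
      by (rule second_derivative_at_max)
    then show ?thesis by (simp add: power2_eq_square algebra_simps)
  qed
  define A' C' where "A' = ?A + 2 * \<epsilon>" and "C' = ?C + 2 * \<epsilon>"
  have q: "a\<^sup>2 * A' + 2 * a * b * ?B + b\<^sup>2 * C' \<le> 0" for a b using quad[of a b] by (simp add: A'_def C'_def algebra_simps)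
  have A: "A' \<le> 0" "C' \<le> 0" using q[of 1 0] q[of 0 1] by auto
  have det: "?B\<^sup>2 \<le> A' * C'"
  proof (cases "A' = 0")
    case True
    have "?B = 0"
    proof (rule ccontr)
      assume nz: "?B \<noteq> 0"
      \<comment> \<open>With A' = 0 this direction gives the form the value 2 (1 - C') + C' = 2 -
        C', which is positive since C' <= 0.\<close>
      have "2 * ((1 - C') / ?B) * 1 * ?B + 1 * C' \<le> 0" using q[of "(1 - C') / ?B" 1] True by simp
      then show False using nz A by simp
    qed
    then show ?thesis using True by simp
  next
    case False
    then have "A' < 0" using A by simp
    have "?B\<^sup>2 * A' + 2 * ?B * (- A') * ?B + A'\<^sup>2 * C' \<le> 0" using q[of "?B" "- A'"] by simp
    then have "A' * (A' * C' - ?B\<^sup>2) \<le> 0" by (simp add: power2_eq_square algebra_simps)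
    then show ?thesis using \<open>A' < 0\<close> by (simp add: mult_le_0_iff)
  qed
  \<comment> \<open>The trace A' + C' of the perturbed Hessian is at most 0 and dominates the
    trace-free part. The trace of D itself is lower by 4 \<epsilon>, hence strictly larger in
    modulus, although by assumption it is dominated by the same trace-free part.\<close>
  have "(A' - C')\<^sup>2 + 4 * ?B\<^sup>2 \<le> (A' + C')\<^sup>2" using det by (simp add: power2_eq_square algebra_simps)
  moreover have "(A' + C' - 4 * \<epsilon>)\<^sup>2 \<le> (A' - C')\<^sup>2 + 4 * ?B\<^sup>2"
    using eq[OF mO] by (simp add: A'_def C'_def)
  ultimately have "(A' + C' - 4 * \<epsilon>)\<^sup>2 \<le> (A' + C')\<^sup>2" by linarith
  moreover have "\<bar>A' + C'\<bar> < \<bar>A' + C' - 4 * \<epsilon>\<bar>" using A \<epsilon> by linarith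
  ultimately show False by (metis abs_le_square_iff not_le)
qed

lemma smooth_sliceD:
  assumes "smooth_slice f (x, y)"
  shows "((\<lambda>s. f (s, y)) has_real_derivative pdx f (x, y)) (at x)" "((\<lambda>s. f (x, s)) has_real_derivative pdy f (x, y)) (at y)"
    "smooth_slice (pdx f) (x, y)" "smooth_slice (pdy f) (x, y)" "isCont f (x, y)" "\<exists>W. open W \<and> (x, y) \<in> W \<and> (\<forall>q\<in>W. smooth_slice f q)"
proof -
  obtain S E c where S: "open S" "hol3 E S" "((of_real x, of_real y), c) \<in> S"
    and f: "\<And>x y. ((of_real x, of_real y), c) \<in> S \<Longrightarrow> f (x, y) = Re (E ((of_real x, of_real y), c))"
    using assms unfolding smooth_slice_def by auto
  show "((\<lambda>s. f (s, y)) has_real_derivative pdx f (x, y)) (at x)" "((\<lambda>s. f (x, s)) has_real_derivative pdy f (x, y)) (at y)"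
    using real_slice_derivatives[OF S(1,2) f S(3)] pd_real_slice[OF S(1,2) f S(3)] by simp_all
  show "smooth_slice (pdx f) (x, y)" unfolding smooth_slice_def
    by (rule exI[of _ S], rule exI[of _ "D1 E"], rule exI[of _ c])
      (use S hol3_D1[OF S(1,2)] pd_real_slice(1)[OF S(1,2) f] in auto)
  show "smooth_slice (pdy f) (x, y)" unfolding smooth_slice_def
    by (rule exI[of _ S], rule exI[of _ "D2 E"], rule exI[of _ c])
      (use S hol3_D2[OF S(1,2)] pd_real_slice(2)[OF S(1,2) f] in auto)
  define W where "W = (\<lambda>q::real \<times> real. ((complex_of_real (fst q), complex_of_real (snd q)), c)) -` S"
  have oW: "open W" unfolding W_def by (intro open_vimage S continuous_intros)
  have xW: "(x, y) \<in> W" using S by (simp add: W_def)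
  have "continuous_on W (\<lambda>q. Re (E ((of_real (fst q), of_real (snd q)), c)))"
    by (intro continuous_intros continuous_on_compose2[OF hol3_continuous_on[OF S(2)]]) (auto simp: W_def)
  then have "continuous_on W f" by (rule continuous_on_cong[THEN iffD1, rotated -1]) (use f in \<open>auto simp: W_def\<close>)
  then show "isCont f (x, y)" using oW xW by (simp add: continuous_on_eq_continuous_at)
  have "smooth_slice f q" if "q \<in> W" for q
    unfolding smooth_slice_def by (rule exI[of _ S], rule exI[of _ E], rule exI[of _ c]) (use S f that in \<open>auto simp: W_def\<close>)
  then show "\<exists>W. open W \<and> (x, y) \<in> W \<and> (\<forall>q\<in>W. smooth_slice f q)" using oW xW by blast
qed

text \<open>The two extensions may be frozen at different parameters c and c', so both are first
  made constant in the third slot, on a common domain.\<close>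

lemma smooth_slice_combine:
  assumes "smooth_slice f p" "smooth_slice g p" shows "smooth_slice (\<lambda>q. f q + k * g q) p"
proof -
  obtain S E c where S: "open S" "hol3 E S" "((of_real (fst p), of_real (snd p)), c) \<in> S"
    and f: "\<And>x y. ((of_real x, of_real y), c) \<in> S \<Longrightarrow> f (x, y) = Re (E ((of_real x, of_real y), c))"
    using assms(1) unfolding smooth_slice_def by auto
  obtain S' E' c' where S': "open S'" "hol3 E' S'" "((of_real (fst p), of_real (snd p)), c') \<in> S'"
    and g: "\<And>x y. ((of_real x, of_real y), c') \<in> S' \<Longrightarrow> g (x, y) = Re (E' ((of_real x, of_real y), c'))"
    using assms(2) unfolding smooth_slice_def by auto
  let ?T = "(\<lambda>q. (fst q, c)) -` S \<inter> (\<lambda>q. (fst q, c')) -` S' :: ((complex \<times> complex) \<times> complex) set"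
  have oT: "open ?T" by (intro open_Int open_vimage S S' continuous_intros)
  have h1: "hol3 (\<lambda>q. E ((fst (fst q), snd (fst q)), c)) ?T"
    by (rule hol3_compose[OF S(2) hol3_coords(1,2,4)]) auto
  have h2: "hol3 (\<lambda>q. E' ((fst (fst q), snd (fst q)), c')) ?T"
    by (rule hol3_compose[OF S'(2) hol3_coords(1,2,4)]) auto
  show ?thesis unfolding smooth_slice_def
  proof (intro exI conjI allI impI)
    show "open ?T" by fact
    show "hol3 (\<lambda>q. E ((fst (fst q), snd (fst q)), c) + of_real k * E' ((fst (fst q), snd (fst q)), c')) ?T"
      by (intro hol3_add hol3_mult h1 h2 hol3_coords)
    show "((of_real (fst p), of_real (snd p)), 0) \<in> ?T" using S(3) S'(3) by simp
    fix x y assume "((complex_of_real x, complex_of_real y), 0) \<in> ?T"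
    then show "f (x, y) + k * g (x, y) = Re (E ((fst (fst ((complex_of_real x, complex_of_real y), 0::complex)), snd (fst ((complex_of_real x, complex_of_real y), 0::complex))), c) + of_real k * E' ((fst (fst ((complex_of_real x, complex_of_real y), 0::complex)), snd (fst ((complex_of_real x, complex_of_real y), 0::complex))), c'))"
      using f g by simp
  qed
qed

lemma pd_combine:
  assumes "smooth_slice f p" "smooth_slice g p"
  shows "pdx (\<lambda>q. f q + k * g q) p = pdx f p + k * pdx g p" "pdy (\<lambda>q. f q + k * g q) p = pdy f p + k * pdy g p"
proof -
  obtain x y where p: "p = (x, y)" by (cases p)
  have "((\<lambda>s. f (s, y) + k * g (s, y)) has_real_derivative pdx f (x, y) + k * pdx g (x, y)) (at x)"
    using assms smooth_sliceD(1) unfolding p by (intro DERIV_add DERIV_cmult) auto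
  then show "pdx (\<lambda>q. f q + k * g q) p = pdx f p + k * pdx g p" unfolding p by (simp add: pdx_def[of "\<lambda>q. f q + k * g q"] DERIV_imp_deriv)
  have "((\<lambda>s. f (x, s) + k * g (x, s)) has_real_derivative pdy f (x, y) + k * pdy g (x, y)) (at y)"
    using assms smooth_sliceD(2) unfolding p by (intro DERIV_add DERIV_cmult) auto
  then show "pdy (\<lambda>q. f q + k * g q) p = pdy f p + k * pdy g p" unfolding p by (simp add: pdy_def[of "\<lambda>q. f q + k * g q"] DERIV_imp_deriv)
qed

lemma pd_local_cong:
  assumes "open W" "p \<in> W" "\<And>q. q \<in> W \<Longrightarrow> f q = g q" shows "pdx f p = pdx g p" "pdy f p = pdy g p"
proof -
  obtain x y where p: "p = (x, y)" by (cases p)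
  have "open ((\<lambda>s. (s, y)) -` W)" by (intro open_vimage assms continuous_intros)
  then have "\<forall>\<^sub>F s in nhds x. s \<in> (\<lambda>s. (s, y)) -` W" using assms(2) by (intro eventually_nhds_in_open) (auto simp: p)
  then have "\<forall>\<^sub>F s in nhds x. f (s, y) = g (s, y)" by (rule eventually_mono) (use assms(3) in auto)
  then show "pdx f p = pdx g p" unfolding p pdx_def by (intro deriv_cong_ev) auto
  have "open ((\<lambda>s. (x, s)) -` W)" by (intro open_vimage assms continuous_intros)
  then have "\<forall>\<^sub>F s in nhds y. s \<in> (\<lambda>s. (x, s)) -` W" using assms(2) by (intro eventually_nhds_in_open) (auto simp: p)
  then have "\<forall>\<^sub>F s in nhds y. f (x, s) = g (x, s)" by (rule eventually_mono) (use assms(3) in auto)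
  then show "pdy f p = pdy g p" unfolding p pdy_def by (intro deriv_cong_ev) auto
qed

lemma pd2_combine:
  assumes f: "smooth_slice f p" and g: "smooth_slice g p"
  shows "pdx (pdx (\<lambda>q. f q + k * g q)) p = pdx (pdx f) p + k * pdx (pdx g) p"
    "pdy (pdy (\<lambda>q. f q + k * g q)) p = pdy (pdy f) p + k * pdy (pdy g) p"
    "pdx (pdy (\<lambda>q. f q + k * g q)) p = pdx (pdy f) p + k * pdx (pdy g) p"
proof -
  have fe: "\<exists>W. open W \<and> p \<in> W \<and> (\<forall>q\<in>W. smooth_slice h q)" if "smooth_slice h p" for h
    using that smooth_sliceD(6)[of h "fst p" "snd p"] by simp
  obtain W1 where W1: "open W1" "p \<in> W1" "\<And>q. q \<in> W1 \<Longrightarrow> smooth_slice f q" using fe[OF f] by blast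
  obtain W2 where W2: "open W2" "p \<in> W2" "\<And>q. q \<in> W2 \<Longrightarrow> smooth_slice g q" using fe[OF g] by blast
  have W: "open (W1 \<inter> W2)" "p \<in> W1 \<inter> W2" using W1 W2 by auto
  have ex: "pdx (\<lambda>q. f q + k * g q) q = pdx f q + k * pdx g q" "pdy (\<lambda>q. f q + k * g q) q = pdy f q + k * pdy g q" if "q \<in> W1 \<inter> W2" for q
    using pd_combine[of f q g k] W1(3) W2(3) that by auto
  have sm: "smooth_slice (pdx h) p" "smooth_slice (pdy h) p" if "smooth_slice h p" for h
    using smooth_sliceD(3,4)[of h "fst p" "snd p"] that by auto
  show "pdx (pdx (\<lambda>q. f q + k * g q)) p = pdx (pdx f) p + k * pdx (pdx g) p"
    using pd_local_cong(1)[OF W ex(1)] pd_combine(1)[OF sm(1)[OF f] sm(1)[OF g]] by simp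
  show "pdy (pdy (\<lambda>q. f q + k * g q)) p = pdy (pdy f) p + k * pdy (pdy g) p"
    using pd_local_cong(2)[OF W ex(2)] pd_combine(2)[OF sm(2)[OF f] sm(2)[OF g]] by simp
  show "pdx (pdy (\<lambda>q. f q + k * g q)) p = pdx (pdy f) p + k * pdx (pdy g) p"
    using pd_local_cong(1)[OF W ex(2)] pd_combine(1)[OF sm(2)[OF f] sm(2)[OF g]] by simp
qed

section \<open>Complexification of real analytic functions\<close>

lemma real_analytic_ext1:
  fixes f :: "real \<Rightarrow> real"
  assumes "real_analytic_at f s0"
  obtains \<delta> G where "\<delta> > 0" "G holomorphic_on ball (of_real s0) \<delta>" "\<And>s. \<bar>s - s0\<bar> < \<delta> \<Longrightarrow> G (of_real s) = of_real (f s)"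
proof -
  obtain \<delta> E where E: "\<delta> > 0" "\<And>L S. open S \<Longrightarrow> (\<And>i. i \<in> Basis \<Longrightarrow> hol3 (L i) S) \<Longrightarrow> (\<And>i p. i \<in> Basis \<Longrightarrow> p \<in> S \<Longrightarrow> norm (L i p) < \<delta>) \<Longrightarrow>
       hol3 (\<lambda>p. E (\<lambda>i. L i p)) S" "\<And>h::real. (\<And>i. i \<in> Basis \<Longrightarrow> \<bar>h \<bullet> i\<bar> < \<delta>) \<Longrightarrow> E (\<lambda>i. of_real (h \<bullet> i)) = of_real (f (s0 + h))"
    using real_analytic_at_complex_extension[OF assms] by blast
  \<comment> \<open>The complexified inner product of the increment with i, given for every i and
    not only for basis vectors, because the value of \<open>E\<close> at real increments is stated
    for the whole family.\<close>
  define L where "L i p = (fst (fst p) - of_real s0) * of_real i" for i and p :: "(complex \<times> complex) \<times> complex"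
  let ?S = "(ball (of_real s0) \<delta> \<times> UNIV) \<times> UNIV :: ((complex \<times> complex) \<times> complex) set"
  have "hol3 (\<lambda>p. E (\<lambda>i. L i p)) ?S"
  proof (rule E(2))
    show "open ?S" by (intro open_Times) auto
    show "hol3 (L i) ?S" for i unfolding L_def by (intro hol3_mult hol3_diff hol3_coords)
    show "norm (L i p) < \<delta>" if "i \<in> Basis" "p \<in> ?S" for i p using that by (auto simp: L_def dist_norm norm_minus_commute)
  qed
  from hol3_slice_holomorphic(1)[OF this, of 0 0]
  have 1: "(\<lambda>z. E (\<lambda>i. L i ((z, 0), 0))) holomorphic_on ball (of_real s0) \<delta>" by simp
  show thesis
  proof (rule that[OF E(1) 1])
    fix s :: real assume s: "\<bar>s - s0\<bar> < \<delta>"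
    have "(\<lambda>i. L i ((of_real s, 0), 0)) = (\<lambda>i. of_real ((s - s0) \<bullet> i))" by (auto simp: L_def)
    then show "E (\<lambda>i. L i ((of_real s, 0), 0)) = of_real (f s)" using E(3)[of "s - s0"] s by simp
  qed
qed

lemma real_analytic_ext2:
  fixes f :: "real \<times> real \<Rightarrow> real"
  assumes "real_analytic_at f (x0, y0)"
  obtains \<delta> G where "\<delta> > 0" "hol3 G ((ball (of_real x0) \<delta> \<times> ball (of_real y0) \<delta>) \<times> UNIV)"
    "\<And>x y c. \<bar>x - x0\<bar> < \<delta> \<Longrightarrow> \<bar>y - y0\<bar> < \<delta> \<Longrightarrow> G ((of_real x, of_real y), c) = of_real (f (x, y))"
proof -
  obtain \<delta> E where E: "\<delta> > 0" "\<And>L S. open S \<Longrightarrow> (\<And>i. i \<in> Basis \<Longrightarrow> hol3 (L i) S) \<Longrightarrow> (\<And>i p. i \<in> Basis \<Longrightarrow> p \<in> S \<Longrightarrow> norm (L i p) < \<delta>) \<Longrightarrow>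
       hol3 (\<lambda>p. E (\<lambda>i. L i p)) S" "\<And>h::real \<times> real. (\<And>i. i \<in> Basis \<Longrightarrow> \<bar>h \<bullet> i\<bar> < \<delta>) \<Longrightarrow> E (\<lambda>i. of_real (h \<bullet> i)) = of_real (f ((x0, y0) + h))"
    using real_analytic_at_complex_extension[OF assms] by blast
  define L where "L i p = (fst (fst p) - of_real x0) * of_real (fst i) + (snd (fst p) - of_real y0) * of_real (snd i)"
    for i :: "real \<times> real" and p :: "(complex \<times> complex) \<times> complex"
  let ?S = "(ball (of_real x0) \<delta> \<times> ball (of_real y0) \<delta>) \<times> UNIV :: ((complex \<times> complex) \<times> complex) set"
  have 1: "hol3 (\<lambda>p. E (\<lambda>i. L i p)) ?S"
  proof (rule E(2))
    show "open ?S" by (intro open_Times) auto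
    show "hol3 (L i) ?S" for i unfolding L_def by (intro hol3_add hol3_mult hol3_diff hol3_coords)
    show "norm (L i p) < \<delta>" if "i \<in> Basis" "p \<in> ?S" for i p using that by (auto simp: L_def Basis_prod_def dist_norm norm_minus_commute)
  qed
  show thesis
  proof (rule that[OF E(1) 1])
    fix x y :: real and c assume xy: "\<bar>x - x0\<bar> < \<delta>" "\<bar>y - y0\<bar> < \<delta>"
    have "(\<lambda>i. L i ((of_real x, of_real y), c)) = (\<lambda>i. of_real ((x - x0, y - y0) \<bullet> i))" by (auto simp: L_def inner_prod_def)
    moreover have "E (\<lambda>i. of_real ((x - x0, y - y0) \<bullet> i)) = of_real (f ((x0, y0) + (x - x0, y - y0)))"
      by (rule E(3)) (use xy E(1) in \<open>auto simp: Basis_prod_def\<close>)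
    ultimately show "E (\<lambda>i. L i ((of_real x, of_real y), c)) = of_real (f (x, y))" by simp
  qed
qed

text \<open>Freezing t at t0 is the substitution of the increment 0 for the third coordinate in the
  series.\<close>

lemma real_analytic_at3_smooth_slice:
  fixes f :: "(real \<times> real) \<times> real \<Rightarrow> real"
  assumes "real_analytic_at f ((x0, y0), t0)" shows "smooth_slice (\<lambda>q. f (q, t0)) (x0, y0)"
proof -
  obtain \<delta> E where E: "\<delta> > 0" "\<And>L S. open S \<Longrightarrow> (\<And>i. i \<in> Basis \<Longrightarrow> hol3 (L i) S) \<Longrightarrow> (\<And>i p. i \<in> Basis \<Longrightarrow> p \<in> S \<Longrightarrow> norm (L i p) < \<delta>) \<Longrightarrow>
       hol3 (\<lambda>p. E (\<lambda>i. L i p)) S" "\<And>h::(real \<times> real) \<times> real. (\<And>i. i \<in> Basis \<Longrightarrow> \<bar>h \<bullet> i\<bar> < \<delta>) \<Longrightarrow> E (\<lambda>i. of_real (h \<bullet> i)) = of_real (f (((x0, y0), t0) + h))"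
    using real_analytic_at_complex_extension[OF assms] by blast
  define L where "L i p = (fst (fst p) - of_real x0) * of_real (fst (fst i)) + (snd (fst p) - of_real y0) * of_real (snd (fst i))"
    for i :: "(real \<times> real) \<times> real" and p :: "(complex \<times> complex) \<times> complex"
  let ?S = "(ball (of_real x0) \<delta> \<times> ball (of_real y0) \<delta>) \<times> UNIV :: ((complex \<times> complex) \<times> complex) set"
  have oS: "open ?S" by (intro open_Times) auto
  have 1: "hol3 (\<lambda>p. E (\<lambda>i. L i p)) ?S"
  proof (rule E(2)[OF oS])
    show "hol3 (L i) ?S" for i unfolding L_def by (intro hol3_add hol3_mult hol3_diff hol3_coords)
    show "norm (L i p) < \<delta>" if "i \<in> Basis" "p \<in> ?S" for i p
      using that E(1) by (auto simp: L_def Basis_prod_def dist_norm norm_minus_commute)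
  qed
  show ?thesis unfolding smooth_slice_def
  proof (rule exI[of _ ?S], rule exI[of _ "\<lambda>p. E (\<lambda>i. L i p)"], rule exI[of _ 0], intro conjI oS 1 allI impI)
    show "((complex_of_real (fst (x0, y0)), complex_of_real (snd (x0, y0))), 0) \<in> ?S" using E(1) by simp
    fix x y :: real assume "((complex_of_real x, complex_of_real y), 0) \<in> ?S"
    then have xy: "\<bar>x - x0\<bar> < \<delta>" "\<bar>y - y0\<bar> < \<delta>" by (auto simp: dist_norm abs_minus_commute simp flip: of_real_diff)
    have "(\<lambda>i. L i ((of_real x, of_real y), 0)) = (\<lambda>i. of_real (((x - x0, y - y0), 0) \<bullet> i))" by (auto simp: L_def inner_prod_def)
    moreover have "E (\<lambda>i. of_real (((x - x0, y - y0), 0) \<bullet> i)) = of_real (f (((x0, y0), t0) + ((x - x0, y - y0), 0)))"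
      by (rule E(3)) (use xy E(1) in \<open>auto simp: Basis_prod_def\<close>)
    ultimately have "E (\<lambda>i. L i ((of_real x, of_real y), 0)) = of_real (f ((x, y), t0))" by simp
    then show "f ((x, y), t0) = Re (E (\<lambda>i. L i ((of_real x, of_real y), 0)))" by simp
  qed
qed

text \<open>With q the discriminant and N the norm, N^2 = (A + C)^2 + 4 q. The function
  \<open>sqrt\<close> is odd, so q < 0 would give (A + C)^2 = - s^2 q and N^2 = (4 - s^2) q < 0;
  this is where |s| < 2 enters. For q >= 0 one gets N^2 = (4 + s^2) q.\<close>

lemma trace_eq_tracefree_norm:
  fixes A B C s :: real
  assumes eq: "A + C = s * sqrt (B\<^sup>2 - A * C)" and s: "\<bar>s\<bar> < 2"
  shows "A + C = s / sqrt (4 + s\<^sup>2) * norm (Complex (A - C) (2 * B))"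
proof -
  define q where "q = B\<^sup>2 - A * C"
  have N: "(norm (Complex (A - C) (2 * B)))\<^sup>2 = (A + C)\<^sup>2 + 4 * q"
  proof -
    have "(norm (Complex (A - C) (2 * B)))\<^sup>2 = (A - C)\<^sup>2 + (2 * B)\<^sup>2" by (simp add: cmod_power2)
    also have "\<dots> = (A + C)\<^sup>2 + 4 * q" unfolding q_def power2_eq_square by algebra
    finally show ?thesis .
  qed
  have s2: "s\<^sup>2 < 4" using abs_square_less_1[of "s / 2"] s by (simp add: power_divide)
  have q0: "q \<ge> 0"
  proof (rule ccontr)
    assume "\<not> q \<ge> 0"
    then have q: "q < 0" by simp
    have "(sqrt q)\<^sup>2 = - q" using q real_sqrt_minus[of "- q"] by (simp add: power2_eq_square)
    then have "(A + C)\<^sup>2 = s\<^sup>2 * (- q)" using eq by (simp add: q_def power_mult_distrib)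
    then have "(norm (Complex (A - C) (2 * B)))\<^sup>2 = (4 - s\<^sup>2) * q" using N by (simp add: algebra_simps)
    moreover have "(4 - s\<^sup>2) * q < 0" using s2 q by (simp add: mult_pos_neg)
    ultimately show False by (metis not_less zero_le_power2)
  qed
  have "(A + C)\<^sup>2 = s\<^sup>2 * q" using eq q0 by (simp add: q_def power_mult_distrib)
  then have "(norm (Complex (A - C) (2 * B)))\<^sup>2 = (4 + s\<^sup>2) * q" using N by (simp add: algebra_simps)
  then have "norm (Complex (A - C) (2 * B)) = sqrt (4 + s\<^sup>2) * sqrt q"
    by (metis norm_ge_zero real_sqrt_abs abs_of_nonneg real_sqrt_mult)
  moreover have "sqrt (4 + s\<^sup>2) > 0" by (simp add: add_pos_nonneg)
  ultimately show ?thesis using eq by (simp add: q_def)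
qed

text \<open>Both traces are \<tau> times the norm of the respective trace-free part, with the same
  \<tau> and |\<tau>| <= 1. The reverse triangle inequality bounds the trace of the difference by
  the trace-free part of the difference. One inequality is stated, as f and g may be
  exchanged.\<close>

lemma uniqueness_le:
  assumes \<Omega>: "open \<Omega>" "bounded \<Omega>" and s: "\<bar>s\<bar> < 2"
    and f: "\<And>p. p \<in> closure \<Omega> \<Longrightarrow> smooth_slice f p" "\<And>p. p \<in> \<Omega> \<Longrightarrow> pdx (pdx f) p + pdy (pdy f) p = s * sqrt ((pdx (pdy f) p)\<^sup>2 - pdx (pdx f) p * pdy (pdy f) p)"
    and g: "\<And>p. p \<in> closure \<Omega> \<Longrightarrow> smooth_slice g p" "\<And>p. p \<in> \<Omega> \<Longrightarrow> pdx (pdx g) p + pdy (pdy g) p = s * sqrt ((pdx (pdy g) p)\<^sup>2 - pdx (pdx g) p * pdy (pdy g) p)"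
    and bd: "\<And>p. p \<in> frontier \<Omega> \<Longrightarrow> f p = g p" and p: "p \<in> closure \<Omega>"
  shows "f p \<le> g p"
proof -
  define D where "D q = f q + (-1) * g q" for q
  have sm: "smooth_slice D q" if "q \<in> closure \<Omega>" for q unfolding D_def by (intro smooth_slice_combine f g that)
  have "D p \<le> 0"
  proof (rule maximum_principle[OF \<Omega>])
    show "smooth_slice D q" if "q \<in> \<Omega>" for q using sm that closure_subset by blast
    show "continuous_on (closure \<Omega>) D"
      using smooth_sliceD(5)[of D] sm by (intro continuous_at_imp_continuous_on) (metis prod.collapse)
    show "D q \<le> 0" if "q \<in> frontier \<Omega>" for q using bd[OF that] by (simp add: D_def)
    show "p \<in> closure \<Omega>" by fact
    fix q assume q: "q \<in> \<Omega>"
    then have qc: "q \<in> closure \<Omega>" using closure_subset by blast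
    note e = pd2_combine[OF f(1)[OF qc] g(1)[OF qc], of "-1", folded D_def]
    define \<tau> where "\<tau> = s / sqrt (4 + s\<^sup>2)"
    define zf where "zf = Complex (pdx (pdx f) q - pdy (pdy f) q) (2 * pdx (pdy f) q)"
    define zg where "zg = Complex (pdx (pdx g) q - pdy (pdy g) q) (2 * pdx (pdy g) q)"
    have tf: "pdx (pdx f) q + pdy (pdy f) q = \<tau> * norm zf" unfolding \<tau>_def zf_def by (rule trace_eq_tracefree_norm[OF f(2)[OF q] s])
    have tg: "pdx (pdx g) q + pdy (pdy g) q = \<tau> * norm zg" unfolding \<tau>_def zg_def by (rule trace_eq_tracefree_norm[OF g(2)[OF q] s])
    have \<tau>1: "\<bar>\<tau>\<bar> \<le> 1"
    proof -
      have "\<bar>s\<bar> \<le> sqrt (4 + s\<^sup>2)" by (rule real_le_rsqrt) simp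
      moreover have "sqrt (4 + s\<^sup>2) > 0" by (simp add: add_pos_nonneg)
      ultimately show ?thesis by (simp add: \<tau>_def abs_divide divide_le_eq)
    qed
    have "pdx (pdx D) q + pdy (pdy D) q = \<tau> * (norm zf - norm zg)" using tf tg unfolding e by (simp add: algebra_simps)
    then have "(pdx (pdx D) q + pdy (pdy D) q)\<^sup>2 = \<bar>\<tau>\<bar>\<^sup>2 * (norm zf - norm zg)\<^sup>2" by (simp add: power_mult_distrib)
    also have "\<dots> \<le> 1\<^sup>2 * (norm (zf - zg))\<^sup>2"
    proof (rule mult_mono)
      have "\<bar>norm zf - norm zg\<bar> \<le> norm (zf - zg)" by (rule norm_triangle_ineq3)
      then show "(norm zf - norm zg)\<^sup>2 \<le> (norm (zf - zg))\<^sup>2" by (metis abs_ge_zero power2_abs power_mono)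
    qed (use \<tau>1 power_mono[OF \<tau>1, of 2] in auto)
    also have "zf - zg = Complex (pdx (pdx D) q - pdy (pdy D) q) (2 * pdx (pdy D) q)"
      unfolding zf_def zg_def e by (simp add: complex_eq_iff)
    also have "1\<^sup>2 * (norm (Complex (pdx (pdx D) q - pdy (pdy D) q) (2 * pdx (pdy D) q)))\<^sup>2
      = (pdx (pdx D) q - pdy (pdy D) q)\<^sup>2 + 4 * (pdx (pdy D) q)\<^sup>2" by (simp add: cmod_power2 power_mult_distrib)
    finally show "(pdx (pdx D) q + pdy (pdy D) q)\<^sup>2 \<le> (pdx (pdx D) q - pdy (pdy D) q)\<^sup>2 + 4 * (pdx (pdy D) q)\<^sup>2" .
  qed
  then show ?thesis by (simp add: D_def)
qed

section \<open>Harmonic functions with nondegenerate Hessian\<close>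

lemma D_cong:
  assumes "open S" "p \<in> S" "\<And>q. q \<in> S \<Longrightarrow> f q = g q" shows "D1 f p = D1 g p" "D2 f p = D2 g p"
proof -
  obtain a b c where p: "p = ((a, b), c)" by (metis prod.collapse)
  have "open ((\<lambda>z. ((z, b), c)) -` S)" by (intro open_vimage assms continuous_intros)
  then have "\<forall>\<^sub>F z in nhds a. z \<in> (\<lambda>z. ((z, b), c)) -` S" using assms(2) by (intro eventually_nhds_in_open) (auto simp: p)
  then have "\<forall>\<^sub>F z in nhds a. f ((z, b), c) = g ((z, b), c)" by (rule eventually_mono) (use assms(3) in auto)
  then show "D1 f p = D1 g p" unfolding p D1_def by (intro deriv_cong_ev) auto
  have "open ((\<lambda>z. ((a, z), c)) -` S)" by (intro open_vimage assms continuous_intros)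
  then have "\<forall>\<^sub>F z in nhds b. z \<in> (\<lambda>z. ((a, z), c)) -` S" using assms(2) by (intro eventually_nhds_in_open) (auto simp: p)
  then have "\<forall>\<^sub>F z in nhds b. f ((a, z), c) = g ((a, z), c)" by (rule eventually_mono) (use assms(3) in auto)
  then show "D2 f p = D2 g p" unfolding p D2_def by (intro deriv_cong_ev) auto
qed

lemma D_linear:
  assumes "hol3 f S" "hol3 g S" "p \<in> S"
  shows "D1 (\<lambda>q. k * f q + l * g q) p = k * D1 f p + l * D1 g p" "D2 (\<lambda>q. k * f q + l * g q) p = k * D2 f p + l * D2 g p"
proof -
  obtain a b c where p: "p = ((a, b), c)" by (metis prod.collapse)
  note p' = assms(3)[unfolded p]
  have "((\<lambda>z. k * f ((z, b), c) + l * g ((z, b), c)) has_field_derivative k * D1 f p + l * D1 g p) (at a)"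
    unfolding p by (intro DERIV_add DERIV_cmult hol3_has_derivatives(1)[OF assms(1) p'] hol3_has_derivatives(1)[OF assms(2) p'])
  then show "D1 (\<lambda>q. k * f q + l * g q) p = k * D1 f p + l * D1 g p"
    by (simp add: D1_def[of "\<lambda>q. k * f q + l * g q"] p DERIV_imp_deriv)
  have "((\<lambda>z. k * f ((a, z), c) + l * g ((a, z), c)) has_field_derivative k * D2 f p + l * D2 g p) (at b)"
    unfolding p by (intro DERIV_add DERIV_cmult hol3_has_derivatives(2)[OF assms(1) p'] hol3_has_derivatives(2)[OF assms(2) p'])
  then show "D2 (\<lambda>q. k * f q + l * g q) p = k * D2 f p + l * D2 g p"
    by (simp add: D2_def[of "\<lambda>q. k * f q + l * g q"] p DERIV_imp_deriv)
qed

lemma pd_imag_slice: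
  assumes S: "open S" "hol3 E S" and f: "\<And>x y. ((of_real x, of_real y), c) \<in> S \<Longrightarrow> f (x, y) = Im (E ((of_real x, of_real y), c))"
    and p: "((of_real x, of_real y), c) \<in> S"
  shows "pdx f (x, y) = Im (D1 E ((of_real x, of_real y), c))" "pdy f (x, y) = Im (D2 E ((of_real x, of_real y), c))"
proof -
  let ?E = "\<lambda>q. (-\<i>) * E q + 0 * E q"
  have h: "hol3 ?E S" by (intro hol3_add hol3_mult hol3_coords S)
  have f': "f (x, y) = Re (?E ((of_real x, of_real y), c))" if "((of_real x, of_real y), c) \<in> S" for x y
    using f[OF that] by simp
  show "pdx f (x, y) = Im (D1 E ((of_real x, of_real y), c))"
    using pd_real_slice(1)[OF S(1) h f' p] D_linear(1)[OF S(2) S(2) p, of "-\<i>" 0] by simp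
  show "pdy f (x, y) = Im (D2 E ((of_real x, of_real y), c))"
    using pd_real_slice(2)[OF S(1) h f' p] D_linear(2)[OF S(2) S(2) p, of "-\<i>" 0] by simp
qed

lemma pd2_imag_slice:
  assumes S: "open S" "hol3 E S" and f: "\<And>x y. ((of_real x, of_real y), c) \<in> S \<Longrightarrow> f (x, y) = Im (E ((of_real x, of_real y), c))"
    and p: "((of_real x, of_real y), c) \<in> S"
  shows "pdx (pdx f) (x, y) = Im (D1 (D1 E) ((of_real x, of_real y), c))"
    "pdy (pdy f) (x, y) = Im (D2 (D2 E) ((of_real x, of_real y), c))"
    "pdx (pdy f) (x, y) = Im (D1 (D2 E) ((of_real x, of_real y), c))"
  using pd_imag_slice[OF S(1) hol3_D1[OF S] pd_imag_slice(1)[OF S f] p] pd_imag_slice[OF S(1) hol3_D2[OF S] pd_imag_slice(2)[OF S f] p]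
  by auto

lemma pd_zero: "pdx (\<lambda>_. 0) = (\<lambda>_. 0)" "pdy (\<lambda>_. 0) = (\<lambda>_. 0)"
  by (auto simp: pdx_def pdy_def)

lemma smooth_slice_zero: "smooth_slice (\<lambda>_. 0) p"
  unfolding smooth_slice_def
  by (rule exI[of _ UNIV], rule exI[of _ "\<lambda>_. 0"], rule exI[of _ 0]) (auto intro: hol3_coords(4))

lemma pd2_zero_on_open:
  assumes "open W" "p \<in> W" "\<And>q. q \<in> W \<Longrightarrow> v q = 0"
  shows "pdx (pdx v) p = 0" "pdy (pdy v) p = 0" "pdx (pdy v) p = 0"
proof -
  have x: "pdx v q = 0" and y: "pdy v q = 0" if "q \<in> W" for q
    using pd_local_cong[OF assms(1) that, of v "\<lambda>_. 0"] assms(3) pd_zero by auto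
  show "pdx (pdx v) p = 0" "pdy (pdy v) p = 0" "pdx (pdy v) p = 0"
    using pd_local_cong(1)[OF assms(1,2), of "pdx v" "\<lambda>_. 0"] pd_local_cong(2)[OF assms(1,2), of "pdy v" "\<lambda>_. 0"]
      pd_local_cong(1)[OF assms(1,2), of "pdy v" "\<lambda>_. 0"] x y pd_zero by auto
qed

lemma holomorphic_zero_of_real:
  assumes h: "h holomorphic_on ball a \<delta>" and x: "of_real x \<in> ball a \<delta>" and \<epsilon>: "0 < \<epsilon>"
    and z: "\<And>s. \<bar>s - x\<bar> < \<epsilon> \<Longrightarrow> of_real s \<in> ball a \<delta> \<Longrightarrow> h (of_real s) = 0" and w: "w \<in> ball a \<delta>"
  shows "h w = 0"
proof (rule analytic_continuation[OF h open_ball _ _ x _ _ w])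
  let ?U = "{complex_of_real s |s. \<bar>s - x\<bar> < \<epsilon> \<and> of_real s \<in> ball a \<delta>}"
  show "?U \<subseteq> ball a \<delta>" by auto
  show "connected (ball a \<delta>)" by simp
  show "h u = 0" if "u \<in> ?U" for u using that z by auto
  obtain d where d: "d > 0" "ball (of_real x) d \<subseteq> ball a \<delta>" using x open_ball[of a \<delta>] unfolding open_contains_ball by blast
  show "of_real x islimpt ?U" unfolding islimpt_approachable
  proof (intro allI impI)
    fix e :: real assume e: "e > 0"
    define h where "h = min e (min d \<epsilon>) / 2"
    have h: "h > 0" "h < e" "h < d" "h < \<epsilon>" using e d \<epsilon> by (auto simp: h_def)
    have dd: "dist (complex_of_real (x + h)) (of_real x) = h" using h by (simp add: dist_norm)
    have "complex_of_real (x + h) \<in> ball a \<delta>"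
      by (rule subsetD[OF d(2)]) (use dd h in \<open>simp only: mem_ball dist_commute[of "of_real x"]\<close>)
    then have 1: "complex_of_real (x + h) \<in> ?U" using h by (intro CollectI exI[of _ "x + h"]) simp
    have 2: "complex_of_real (x + h) \<noteq> of_real x" using h by simp
    have 3: "dist (complex_of_real (x + h)) (of_real x) < e" by (simp only: dd h)
    show "\<exists>x'\<in>?U. x' \<noteq> of_real x \<and> dist x' (of_real x) < e" by (rule bexI[OF _ 1], rule conjI[OF 2 3])
  qed
qed

text \<open>The identity theorem twice: real zeros near (x, y) give zeros for complex first and real
  second coordinate, and then for both complex. The starting point (x, y) may be anywhere in the
  polydisc.\<close>

lemma hol3_zero_of_real:
  assumes L: "hol3 L ((ball a \<delta> \<times> ball b \<delta>) \<times> UNIV)" and W: "open W" "(x, y) \<in> W" "of_real x \<in> ball a \<delta>" "of_real y \<in> ball b \<delta>"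
    and z: "\<And>x y. (x, y) \<in> W \<Longrightarrow> of_real x \<in> ball a \<delta> \<Longrightarrow> of_real y \<in> ball b \<delta> \<Longrightarrow> L ((of_real x, of_real y), c) = 0"
    and uv: "u \<in> ball a \<delta>" "v \<in> ball b \<delta>"
  shows "L ((u, v), c) = 0"
proof -
  obtain \<epsilon> where \<epsilon>: "\<epsilon> > 0" "ball (x, y) \<epsilon> \<subseteq> W" using W unfolding open_contains_ball by blast
  have box: "(s, t) \<in> W" if "\<bar>s - x\<bar> < \<epsilon> / 2" "\<bar>t - y\<bar> < \<epsilon> / 2" for s t
  proof -
    have "dist (x, y) (s, t) \<le> \<bar>x - s\<bar> + \<bar>y - t\<bar>"
      using norm_Pair_le[of "x - s" "y - t"] by (simp add: dist_norm)
    then have "dist (x, y) (s, t) < \<epsilon>" using that by linarith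
    then show ?thesis using \<epsilon>(2) by auto
  qed
  have 1: "L ((u, of_real t), c) = 0" if t: "\<bar>t - y\<bar> < \<epsilon> / 2" "of_real t \<in> ball b \<delta>" for t
  proof (rule holomorphic_zero_of_real[OF _ W(3) _ _ uv(1), of _ "\<epsilon> / 2"])
    show "(\<lambda>z. L ((z, of_real t), c)) holomorphic_on ball a \<delta>" by (rule hol3_slice_holomorphic(1)[OF L t(2)]) simp
    show "0 < \<epsilon> / 2" using \<epsilon> by simp
    show "L ((of_real s, of_real t), c) = 0" if "\<bar>s - x\<bar> < \<epsilon> / 2" "of_real s \<in> ball a \<delta>" for s
      by (rule z[OF box[OF that(1) t(1)] that(2) t(2)])
  qed
  show ?thesis
  proof (rule holomorphic_zero_of_real[OF _ W(4) _ _ uv(2), of _ "\<epsilon> / 2"])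
    show "(\<lambda>z. L ((u, z), c)) holomorphic_on ball b \<delta>" by (rule hol3_slice_holomorphic(2)[OF L uv(1)]) simp
    show "0 < \<epsilon> / 2" using \<epsilon> by simp
    show "L ((u, of_real t), c) = 0" if "\<bar>t - y\<bar> < \<epsilon> / 2" "of_real t \<in> ball b \<delta>" for t by (rule 1[OF that])
  qed
qed

text \<open>The second Wirtinger derivative \<open>f\<^sub>z\<^sub>z\<close>, that is a quarter of
  \<open>f\<^sub>x\<^sub>x - f\<^sub>y\<^sub>y - 2 i f\<^sub>x\<^sub>y\<close>.\<close>

definition tracefree_hessian :: "(real \<times> real \<Rightarrow> real) \<Rightarrow> complex \<Rightarrow> complex" where
  "tracefree_hessian f z = Complex (pdx (pdx f) (Re z, Im z) - pdy (pdy f) (Re z, Im z)) (- 2 * pdx (pdy f) (Re z, Im z)) / 4"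

text \<open>At a boundary point the Laplace equation is given on one side only. The complexified
  Laplacian vanishes on real points of \<Omega>, hence on the whole polydisc by the identity
  theorem, and so f is harmonic across the boundary; the Cauchy-Riemann equations for
  \<open>f\<^sub>z\<^sub>z\<close> follow.\<close>

lemma harmonic_hessian_holomorphic:
  assumes f: "real_analytic_at f (x0, y0)" and \<Omega>: "open \<Omega>" "(x0, y0) \<in> closure \<Omega>"
    and lap: "\<And>p. p \<in> \<Omega> \<Longrightarrow> pdx (pdx f) p + pdy (pdy f) p = 0"
  shows "\<exists>\<delta>>0. tracefree_hessian f holomorphic_on ball (Complex x0 y0) \<delta> \<and>
    (\<forall>z\<in>ball (Complex x0 y0) \<delta>. smooth_slice f (Re z, Im z) \<and> pdx (pdx f) (Re z, Im z) + pdy (pdy f) (Re z, Im z) = 0)"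
proof -
  obtain \<delta> G where \<delta>: "\<delta> > 0" and G: "hol3 G ((ball (of_real x0) \<delta> \<times> ball (of_real y0) \<delta>) \<times> UNIV)"
    and fG: "\<And>x y c. \<bar>x - x0\<bar> < \<delta> \<Longrightarrow> \<bar>y - y0\<bar> < \<delta> \<Longrightarrow> G ((of_real x, of_real y), c) = of_real (f (x, y))"
    using real_analytic_ext2[OF f] by blast
  define S where "S = (ball (complex_of_real x0) \<delta> \<times> ball (complex_of_real y0) \<delta>) \<times> (UNIV :: complex set)"
  have S: "open S" "hol3 G S" using G by (auto simp: S_def intro!: open_Times)
  have rS: "((of_real x, of_real y), c) \<in> S \<longleftrightarrow> \<bar>x - x0\<bar> < \<delta> \<and> \<bar>y - y0\<bar> < \<delta>" for x y c
    by (auto simp: S_def dist_norm abs_minus_commute simp flip: of_real_diff)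
  have re: "f (x, y) = Re (G ((of_real x, of_real y), 0))" and im: "0 = Im (G ((of_real x, of_real y), 0))"
    if "((of_real x, of_real y), 0) \<in> S" for x y
    using fG[of x y 0] that by (auto simp: rS)
  have E: "D1 (D1 G) ((of_real x, of_real y), 0) = of_real (pdx (pdx f) (x, y))"
    "D2 (D2 G) ((of_real x, of_real y), 0) = of_real (pdy (pdy f) (x, y))"
    "D1 (D2 G) ((of_real x, of_real y), 0) = of_real (pdx (pdy f) (x, y))" if "((of_real x, of_real y), 0) \<in> S" for x y
    using pd2_real_slice[OF S re that] pd2_imag_slice[of S G 0 "\<lambda>_. 0", OF S im that]
    by (auto simp: complex_eq_iff pd_zero)
  have h: "hol3 (D1 G) S" "hol3 (D2 G) S" "hol3 (D1 (D1 G)) S" "hol3 (D2 (D2 G)) S" "hol3 (D1 (D2 G)) S"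
    by (intro hol3_D1 hol3_D2 S)+
  have L0: "D1 (D1 G) ((u, v), 0) + D2 (D2 G) ((u, v), 0) = 0" if uv: "u \<in> ball (of_real x0) \<delta>" "v \<in> ball (of_real y0) \<delta>" for u v
  proof -
    \<comment> \<open>The centre may be a boundary point, so the identity theorem is started at a
      nearby point of \<Omega>.\<close>
    obtain q where q: "q \<in> \<Omega>" "dist q (x0, y0) < \<delta>" using \<Omega>(2) \<delta> unfolding closure_approachable by blast
    obtain x y where xy: "q = (x, y)" by (cases q)
    have "\<bar>x - x0\<bar> < \<delta>" "\<bar>y - y0\<bar> < \<delta>"
      using dist_fst_le[of q "(x0, y0)"] dist_snd_le[of q "(x0, y0)"] q(2) xy by (auto simp: dist_real_def)
    then have xyS: "((of_real x, of_real y), 0) \<in> S" by (simp add: rS)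
    show ?thesis
    proof (rule hol3_zero_of_real[of "\<lambda>q. D1 (D1 G) q + D2 (D2 G) q", OF _ \<Omega>(1) q(1)[unfolded xy] _ _ _ uv])
      show "hol3 (\<lambda>q. D1 (D1 G) q + D2 (D2 G) q) ((ball (of_real x0) \<delta> \<times> ball (of_real y0) \<delta>) \<times> UNIV)"
        using hol3_add[OF h(3,4)] by (simp add: S_def)
      show "of_real x \<in> ball (complex_of_real x0) \<delta>" "of_real y \<in> ball (complex_of_real y0) \<delta>" using xyS by (auto simp: S_def)
      fix x y assume a: "(x, y) \<in> \<Omega>" "complex_of_real x \<in> ball (of_real x0) \<delta>" "complex_of_real y \<in> ball (of_real y0) \<delta>"
      then have "((of_real x, of_real y), 0) \<in> S" by (simp add: S_def)
      from E(1,2)[OF this] lap[OF a(1)] show "D1 (D1 G) ((of_real x, of_real y), 0) + D2 (D2 G) ((of_real x, of_real y), 0) = 0"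
        by (simp flip: of_real_add)
    qed
  qed
  define B where "B q = (1/2) * D1 (D1 G) q + (- \<i>/2) * D1 (D2 G) q" for q
  have hB: "hol3 B S" unfolding B_def by (intro hol3_add hol3_mult hol3_coords h)
  \<comment> \<open>The Cauchy-Riemann equations as y-derivative = i times x-derivative. Third
    derivatives commute, and the Laplace equation differentiated in x replaces
    \<open>D1 (D2 (D2 G))\<close> by minus the third x-derivative.\<close>
  have CR: "D2 B ((u, v), 0) = \<i> * D1 B ((u, v), 0)" if uv: "((u, v), 0) \<in> S" for u v
  proof -
    have a: "D2 (D1 (D1 G)) ((u, v), 0) = D1 (D1 (D2 G)) ((u, v), 0)"
      using D2_D1[OF S(1) h(1) uv] D_cong(1)[OF S(1) uv D2_D1[OF S]] by simp
    have b: "D2 (D1 (D2 G)) ((u, v), 0) = D1 (D2 (D2 G)) ((u, v), 0)"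
      by (rule D2_D1[OF S(1) h(2) uv])
    have s1: "((\<lambda>z. D1 (D1 G) ((z, v), 0) + D2 (D2 G) ((z, v), 0)) has_field_derivative D1 (D1 (D1 G)) ((u, v), 0) + D1 (D2 (D2 G)) ((u, v), 0)) (at u)"
      by (intro DERIV_add hol3_has_derivatives(1)[OF h(3) uv] hol3_has_derivatives(1)[OF h(4) uv])
    have s2: "((\<lambda>z. D1 (D1 G) ((z, v), 0) + D2 (D2 G) ((z, v), 0)) has_field_derivative 0) (at u)"
    proof (rule has_field_derivative_transform_within_open[of "\<lambda>_. 0" _ _ "ball (of_real x0) \<delta>"])
      show "u \<in> ball (of_real x0) \<delta>" using uv by (simp add: S_def)
      show "0 = D1 (D1 G) ((z, v), 0) + D2 (D2 G) ((z, v), 0)" if "z \<in> ball (of_real x0) \<delta>" for z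
        using L0[OF that, of v] uv by (simp add: S_def)
    qed auto
    have c: "D1 (D2 (D2 G)) ((u, v), 0) = - D1 (D1 (D1 G)) ((u, v), 0)"
      using DERIV_unique[OF s1 s2] by (simp only: add_eq_0_iff)
    show ?thesis
      unfolding B_def D_linear[OF h(3,5) uv] a b c by (simp add: algebra_simps)
  qed
  have PB: "tracefree_hessian f z = B ((of_real (Re z), of_real (Im z)), 0)"
    "smooth_slice f (Re z, Im z) \<and> pdx (pdx f) (Re z, Im z) + pdy (pdy f) (Re z, Im z) = 0"
    "((of_real (Re z), of_real (Im z)), 0) \<in> S" if z: "z \<in> ball (Complex x0 y0) \<delta>" for z
  proof -
    have n: "norm (z - Complex x0 y0) < \<delta>" using z by (simp add: dist_norm norm_minus_commute)
    have zS: "((of_real (Re z), of_real (Im z)), 0) \<in> S"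
      using abs_Re_le_cmod[of "z - Complex x0 y0"] abs_Im_le_cmod[of "z - Complex x0 y0"] n by (simp add: rS)
    then show "((of_real (Re z), of_real (Im z)), 0) \<in> S" .
    have e: "complex_of_real (pdx (pdx f) (Re z, Im z)) + of_real (pdy (pdy f) (Re z, Im z)) = 0"
      using L0[of "of_real (Re z)" "of_real (Im z)"] zS unfolding E(1,2)[OF zS, symmetric] by (simp add: S_def)
    then have l: "pdx (pdx f) (Re z, Im z) + pdy (pdy f) (Re z, Im z) = 0" by (simp flip: of_real_add)
    have "smooth_slice f (Re z, Im z)" unfolding smooth_slice_def
      by (rule exI[of _ S], rule exI[of _ G], rule exI[of _ 0]) (use S zS re in auto)
    with l show "smooth_slice f (Re z, Im z) \<and> pdx (pdx f) (Re z, Im z) + pdy (pdy f) (Re z, Im z) = 0" by simp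
    have l': "pdy (pdy f) (Re z, Im z) = - pdx (pdx f) (Re z, Im z)" using l by simp
    show "tracefree_hessian f z = B ((of_real (Re z), of_real (Im z)), 0)"
      unfolding tracefree_hessian_def B_def E(1,3)[OF zS] l' by (simp add: complex_eq_iff)
  qed
  have "tracefree_hessian f holomorphic_on ball (Complex x0 y0) \<delta>"
  proof (subst holomorphic_on_open[OF open_ball], intro ballI exI)
    fix z assume z: "z \<in> ball (Complex x0 y0) \<delta>"
    note zS = PB(3)[OF z]
    let ?p = "((complex_of_real (Re z), complex_of_real (Im z)), 0::complex)"
    have i: "((\<lambda>z. ((complex_of_real (Re z), complex_of_real (Im z)), 0::complex)) has_derivative (\<lambda>h. ((of_real (Re h), of_real (Im h)), 0))) (at z)"
      by (intro has_derivative_Pair has_derivative_of_real has_derivative_const bounded_linear.has_derivative[OF bounded_linear_Re] bounded_linear.has_derivative[OF bounded_linear_Im] has_derivative_ident)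
    have "((\<lambda>z. B ((of_real (Re z), of_real (Im z)), 0)) has_derivative
      (\<lambda>h. case ((complex_of_real (Re h), complex_of_real (Im h)), 0::complex) of ((x, y), w) \<Rightarrow> D1 B ?p * x + D2 B ?p * y + D3 B ?p * w)) (at z)"
      using has_derivative_compose[OF i hol3_has_derivatives(4)[OF hB zS]] by simp
    moreover have "(\<lambda>h. case ((complex_of_real (Re h), complex_of_real (Im h)), 0::complex) of ((x, y), w) \<Rightarrow> D1 B ?p * x + D2 B ?p * y + D3 B ?p * w) = (*) (D1 B ?p)"
    proof
      fix h
      have "D1 B ?p * of_real (Re h) + D2 B ?p * of_real (Im h) = D1 B ?p * (of_real (Re h) + \<i> * of_real (Im h))"
        unfolding CR[OF zS] by (simp add: algebra_simps)
      then show "(case ((complex_of_real (Re h), complex_of_real (Im h)), 0::complex) of ((x, y), w) \<Rightarrow> D1 B ?p * x + D2 B ?p * y + D3 B ?p * w) = D1 B ?p * h"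
        by (simp add: complex_eq[symmetric])
    qed
    ultimately have "((\<lambda>z. B ((of_real (Re z), of_real (Im z)), 0)) has_field_derivative D1 B ?p) (at z)"
      by (simp add: has_field_derivative_def)
    then show "(tracefree_hessian f has_field_derivative D1 B ?p) (at z)"
      by (rule has_field_derivative_transform_within_open[OF _ open_ball z]) (simp add: PB(1))
  qed
  with \<delta> PB(2) show ?thesis by blast
qed

section \<open>The coordinates z and its conjugate as independent variables\<close>

definition lc :: "(complex \<times> complex) \<times> complex \<Rightarrow> (complex \<times> complex) \<times> complex" where
  "lc p = ((fst (fst p) + \<i> * snd (fst p), fst (fst p) - \<i> * snd (fst p)), snd p)"

lemma hol3_lc: assumes "open S" "hol3 T S" shows "open (lc -` S)" "hol3 (\<lambda>p. T (lc p)) (lc -` S)"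
proof -
  show "open (lc -` S)" unfolding lc_def by (intro open_vimage assms continuous_intros)
  show "hol3 (\<lambda>p. T (lc p)) (lc -` S)" unfolding lc_def
    by (rule hol3_compose[OF assms(2)]; (intro hol3_add hol3_diff hol3_mult hol3_coords)?) (auto simp: lc_def)
qed

lemma D_lc:
  assumes T: "hol3 T S" and p: "lc p \<in> S"
  shows "D1 (\<lambda>p. T (lc p)) p = D1 T (lc p) + D2 T (lc p)" "D2 (\<lambda>p. T (lc p)) p = \<i> * D1 T (lc p) + (- \<i>) * D2 T (lc p)"
proof -
  obtain a b c where pe: "p = ((a, b), c)" by (metis prod.collapse)
  define q where "q = lc p"
  have q: "q = ((a + \<i> * b, a - \<i> * b), c)" by (simp add: q_def lc_def pe)
  note qS = p[folded q_def, unfolded q]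
  have i1: "((\<lambda>z. ((z + \<i> * b, z - \<i> * b), c)) has_derivative (\<lambda>h. ((h, h), 0))) (at a)"
    by (auto intro!: derivative_eq_intros)
  have i2: "((\<lambda>z. ((a + \<i> * z, a - \<i> * z), c)) has_derivative (\<lambda>h. ((\<i> * h, - (\<i> * h)), 0))) (at b)"
    by (auto intro!: derivative_eq_intros)
  have "((\<lambda>z. T ((z + \<i> * b, z - \<i> * b), c)) has_derivative (\<lambda>h. case ((h, h), 0::complex) of ((x, y), w) \<Rightarrow> D1 T q * x + D2 T q * y + D3 T q * w)) (at a)"
    using has_derivative_compose[OF i1 hol3_has_derivatives(4)[OF T qS]] by (simp add: q)
  then have "((\<lambda>z. T ((z + \<i> * b, z - \<i> * b), c)) has_field_derivative D1 T q + D2 T q) (at a)"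
    unfolding has_field_derivative_def by (rule has_derivative_eq_rhs) (auto simp: algebra_simps)
  then show "D1 (\<lambda>p. T (lc p)) p = D1 T (lc p) + D2 T (lc p)"
    unfolding D1_def[of "\<lambda>p. T (lc p)"] q_def[symmetric] by (simp add: pe lc_def DERIV_imp_deriv)
  have "((\<lambda>z. T ((a + \<i> * z, a - \<i> * z), c)) has_derivative (\<lambda>h. case ((\<i> * h, - (\<i> * h)), 0::complex) of ((x, y), w) \<Rightarrow> D1 T q * x + D2 T q * y + D3 T q * w)) (at b)"
    using has_derivative_compose[OF i2 hol3_has_derivatives(4)[OF T qS]] by (simp add: q)
  then have "((\<lambda>z. T ((a + \<i> * z, a - \<i> * z), c)) has_field_derivative \<i> * D1 T q + (- \<i>) * D2 T q) (at b)"
    unfolding has_field_derivative_def by (rule has_derivative_eq_rhs) (auto simp: algebra_simps)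
  then show "D2 (\<lambda>p. T (lc p)) p = \<i> * D1 T (lc p) + (- \<i>) * D2 T (lc p)"
    unfolding D2_def[of "\<lambda>p. T (lc p)"] q_def[symmetric] by (simp add: pe lc_def DERIV_imp_deriv)
qed

text \<open>The Wirtinger identities for complexified functions; they turn the Laplacian and the
  trace-free Hessian into pure second derivatives in the independent variables.\<close>

lemma D2_lc:
  assumes S: "open S" "hol3 T S" and p: "lc p \<in> S"
  defines "E \<equiv> \<lambda>p. T (lc p)"
  shows "D1 (D1 E) p + D2 (D2 E) p = 4 * D2 (D1 T) (lc p)"
    "D1 (D1 E) p - D2 (D2 E) p - 2 * \<i> * D1 (D2 E) p = 4 * D1 (D1 T) (lc p)"
proof -
  note o = hol3_lc(1)[OF S]
  have pS: "p \<in> lc -` S" using p by simp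
  note h1 = hol3_D1[OF S] and h2 = hol3_D2[OF S]
  note e1 = hol3_lc(2)[OF S(1) h1] and e2 = hol3_lc(2)[OF S(1) h2]
  have d1: "D1 E q = 1 * D1 T (lc q) + 1 * D2 T (lc q)" if "q \<in> lc -` S" for q
    unfolding E_def using D_lc(1)[OF S(2), of q] that by simp
  have d2: "D2 E q = \<i> * D1 T (lc q) + (- \<i>) * D2 T (lc q)" if "q \<in> lc -` S" for q
    unfolding E_def using D_lc(2)[OF S(2), of q] that by simp
  have x: "D2 (D1 T) (lc p) = D1 (D2 T) (lc p)" by (rule D2_D1[OF S p])
  have "D1 (D1 E) p = 1 * D1 (\<lambda>q. D1 T (lc q)) p + 1 * D1 (\<lambda>q. D2 T (lc q)) p"
    using D_cong(1)[OF o pS d1] D_linear(1)[OF e1 e2 pS, of 1 1] by simp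
  then have a: "D1 (D1 E) p = D1 (D1 T) (lc p) + 2 * D1 (D2 T) (lc p) + D2 (D2 T) (lc p)"
    unfolding D_lc(1)[OF h1 p] D_lc(1)[OF h2 p] x by simp
  have "D2 (D2 E) p = \<i> * D2 (\<lambda>q. D1 T (lc q)) p + (- \<i>) * D2 (\<lambda>q. D2 T (lc q)) p"
    using D_cong(2)[OF o pS d2] D_linear(2)[OF e1 e2 pS, of \<i> "- \<i>"] by simp
  then have b: "D2 (D2 E) p = - D1 (D1 T) (lc p) + 2 * D1 (D2 T) (lc p) - D2 (D2 T) (lc p)"
    unfolding D_lc(2)[OF h1 p] D_lc(2)[OF h2 p] x by (simp add: algebra_simps)
  have "D1 (D2 E) p = \<i> * D1 (\<lambda>q. D1 T (lc q)) p + (- \<i>) * D1 (\<lambda>q. D2 T (lc q)) p"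
    using D_cong(1)[OF o pS d2] D_linear(1)[OF e1 e2 pS, of \<i> "- \<i>"] by simp
  then have c: "D1 (D2 E) p = \<i> * D1 (D1 T) (lc p) - \<i> * D2 (D2 T) (lc p)"
    unfolding D_lc(1)[OF h1 p] D_lc(1)[OF h2 p] x by (simp add: algebra_simps)
  show "D1 (D1 E) p + D2 (D2 E) p = 4 * D2 (D1 T) (lc p)" unfolding a b x by simp
  show "D1 (D1 E) p - D2 (D2 E) p - 2 * \<i> * D1 (D2 E) p = 4 * D1 (D1 T) (lc p)" unfolding a b c by (simp add: algebra_simps)
qed

text \<open>Converse of the trace identity: with N the norm, the assumption forces the discriminant
  to be N^2 / (4 + s^2), which is nonnegative, so its root can be taken.\<close>

lemma tracefree_norm_imp_trace_eq:
  fixes A B C s :: real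
  assumes "A + C = s / sqrt (4 + s\<^sup>2) * norm (Complex (A - C) (2 * B))"
  shows "A + C = s * sqrt (B\<^sup>2 - A * C)"
proof -
  define N where "N = norm (Complex (A - C) (2 * B))"
  have pos: "4 + s\<^sup>2 > 0" by (simp add: add_pos_nonneg)
  have "N\<^sup>2 = (A - C)\<^sup>2 + (2 * B)\<^sup>2" by (simp add: N_def cmod_power2)
  then have N: "N\<^sup>2 = (A + C)\<^sup>2 + 4 * (B\<^sup>2 - A * C)" unfolding power2_eq_square by algebra
  have "(A + C)\<^sup>2 = s\<^sup>2 / (4 + s\<^sup>2) * N\<^sup>2" using assms pos by (simp add: N_def power_mult_distrib power_divide)
  then have "4 * (B\<^sup>2 - A * C) = (1 - s\<^sup>2 / (4 + s\<^sup>2)) * N\<^sup>2" unfolding left_diff_distrib using N by linarith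
  also have "1 - s\<^sup>2 / (4 + s\<^sup>2) = 4 / (4 + s\<^sup>2)" using pos by (simp add: field_simps)
  finally have "B\<^sup>2 - A * C = N\<^sup>2 / (4 + s\<^sup>2)" by simp
  then have "sqrt (B\<^sup>2 - A * C) = N / sqrt (4 + s\<^sup>2)" by (simp add: real_sqrt_divide N_def)
  then show ?thesis using assms by (simp add: N_def)
qed

text \<open>\<open>T\<close> need not be real on the real section, so the solution adds only its
  real part. The equation makes the mixed derivative of \<open>T\<close> real there, so the
  imaginary part v is harmonic; it vanishes on the frontier, hence throughout, by comparison with 0
  at s = 0. Thus the second derivatives of \<open>T\<close> are those of its real part.\<close>

lemma solution_from_bicomplex:
  assumes \<Omega>: "open \<Omega>" "bounded \<Omega>" and S: "open S" "hol3 T S"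
    and cl: "\<And>x y. (x, y) \<in> closure \<Omega> \<Longrightarrow> ((Complex x y, cnj (Complex x y)), c) \<in> S"
    and bd: "\<And>x y. (x, y) \<in> frontier \<Omega> \<Longrightarrow> T ((Complex x y, cnj (Complex x y)), c) = 0"
    and f: "\<And>p. p \<in> \<Omega> \<Longrightarrow> smooth_slice f p" "\<And>p. p \<in> \<Omega> \<Longrightarrow> pdx (pdx f) p + pdy (pdy f) p = 0"
    and eq: "\<And>x y. (x, y) \<in> \<Omega> \<Longrightarrow> D2 (D1 T) ((Complex x y, cnj (Complex x y)), c) =
      of_real (s / sqrt (4 + s\<^sup>2) * norm (tracefree_hessian f (Complex x y) + D1 (D1 T) ((Complex x y, cnj (Complex x y)), c)))"
    and F: "\<And>x y. ((Complex x y, cnj (Complex x y)), c) \<in> S \<Longrightarrow> F (x, y) = f (x, y) + Re (T ((Complex x y, cnj (Complex x y)), c))"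
    and p: "p \<in> \<Omega>"
  shows "pdx (pdx F) p + pdy (pdy F) p = s * sqrt ((pdx (pdy F) p)\<^sup>2 - pdx (pdx F) p * pdy (pdy F) p)"
proof -
  define E where "E q = T (lc q)" for q
  define v where "v q = Im (E ((of_real (fst q), of_real (snd q)), c))" for q :: "real \<times> real"
  define u where "u q = Re (E ((of_real (fst q), of_real (snd q)), c))" for q :: "real \<times> real"
  have lc: "lc ((of_real x, of_real y), c) = ((Complex x y, cnj (Complex x y)), c)" for x y
    by (simp add: lc_def complex_eq_iff)
  have S': "open (lc -` S)" "hol3 E (lc -` S)" unfolding E_def using hol3_lc[OF S] by auto
  have sub: "((of_real x, of_real y), c) \<in> lc -` S" if "(x, y) \<in> closure \<Omega>" for x y using cl[OF that] by (simp add: lc)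
  have subc: "p \<in> closure \<Omega>" if "p \<in> \<Omega>" for p using that closure_subset by blast
  have smu: "smooth_slice u q" and smv: "smooth_slice v q" if "q \<in> closure \<Omega>" for q
  proof -
    obtain x y where q: "q = (x, y)" by (cases q)
    show "smooth_slice u q" unfolding smooth_slice_def
      by (rule exI[of _ "lc -` S"], rule exI[of _ E], rule exI[of _ c]) (use S' sub that q in \<open>auto simp: u_def\<close>)
    have h: "hol3 (\<lambda>q. (- \<i>) * E q) (lc -` S)" by (intro hol3_mult hol3_coords S')
    show "smooth_slice v q" unfolding smooth_slice_def
      by (rule exI[of _ "lc -` S"], rule exI[of _ "\<lambda>q. (- \<i>) * E q"], rule exI[of _ c]) (use S' h sub that q in \<open>auto simp: v_def\<close>)
  qed
  note ru = pd2_real_slice[OF S', of c u] and rv = pd2_imag_slice[OF S', of c v]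
  have sumE: "D1 (D1 E) ((of_real x, of_real y), c) + D2 (D2 E) ((of_real x, of_real y), c)
      = of_real (4 * (s / sqrt (4 + s\<^sup>2)) * norm (tracefree_hessian f (Complex x y) + D1 (D1 T) ((Complex x y, cnj (Complex x y)), c)))"
    if "(x, y) \<in> \<Omega>" for x y
    using D2_lc(1)[OF S, of "((of_real x, of_real y), c)", folded E_def] sub[OF subc[OF that]] eq[OF that] by (simp add: lc)
  have lapv: "pdx (pdx v) q + pdy (pdy v) q = 0" if q: "q \<in> \<Omega>" for q
  proof -
    obtain x y where xy: "q = (x, y)" by (cases q)
    note qS = sub[OF subc[OF q[unfolded xy]]]
    have "pdx (pdx v) q + pdy (pdy v) q = Im (D1 (D1 E) ((of_real x, of_real y), c) + D2 (D2 E) ((of_real x, of_real y), c))"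
      unfolding xy using rv(1,2)[OF _ qS] by (simp add: v_def)
    also have "\<dots> = 0" unfolding sumE[OF q[unfolded xy]] by (rule Im_complex_of_real)
    finally show ?thesis .
  qed
  have vb: "v q = 0" if "q \<in> frontier \<Omega>" for q
    using bd[of "fst q" "snd q"] that by (simp add: v_def E_def lc)
  have v0: "v q = 0" if q: "q \<in> closure \<Omega>" for q
  proof (rule antisym)
    show "v q \<le> 0"
      by (rule uniqueness_le[of \<Omega> 0 v "\<lambda>_. 0", OF \<Omega> _ smv _ smooth_slice_zero _ vb q]) (auto simp: lapv pd_zero)
    show "0 \<le> v q"
      by (rule uniqueness_le[of \<Omega> 0 "\<lambda>_. 0" v, OF \<Omega> _ smooth_slice_zero _ smv _ vb[symmetric] q]) (auto simp: lapv pd_zero)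
  qed
  obtain x y where xy: "p = (x, y)" by (cases p)
  note pS = sub[OF subc[OF p[unfolded xy]]]
  let ?q = "((complex_of_real x, complex_of_real y), c)"
  have v2: "pdx (pdx v) p = 0" "pdy (pdy v) p = 0" "pdx (pdy v) p = 0"
    using pd2_zero_on_open[OF \<Omega>(1) p, of v] v0 subc by auto
  define a where "a = pdx (pdx u) p"
  define b where "b = pdx (pdy u) p"
  define d where "d = pdy (pdy u) p"
  have E: "D1 (D1 E) ?q = of_real a" "D2 (D2 E) ?q = of_real d" "D1 (D2 E) ?q = of_real b"
    using ru[OF _ pS] rv[OF _ pS] v2 unfolding a_def b_def d_def xy by (auto simp: complex_eq_iff u_def v_def)
  define M where "M = tracefree_hessian f (Complex x y) + D1 (D1 T) ((Complex x y, cnj (Complex x y)), c)"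
  have tr: "a + d = 4 * (s / sqrt (4 + s\<^sup>2)) * norm M"
  proof -
    have "complex_of_real (a + d) = of_real (4 * (s / sqrt (4 + s\<^sup>2)) * norm M)"
      using sumE[OF p[unfolded xy]] unfolding E M_def of_real_add .
    then show ?thesis by (simp only: of_real_eq_iff)
  qed
  have tf: "of_real a - of_real d - 2 * \<i> * of_real b = 4 * D1 (D1 T) ((Complex x y, cnj (Complex x y)), c)"
    using D2_lc(2)[OF S, of ?q, folded E_def] pS unfolding E lc by (simp add: lc)
  define A where "A = pdx (pdx f) p + a"
  define B where "B = pdx (pdy f) p + b"
  define C where "C = pdy (pdy f) p + d"
  have M: "4 * M = Complex (A - C) (- 2 * B)"
  proof -
    have "4 * M = 4 * tracefree_hessian f (Complex x y) + (of_real a - of_real d - 2 * \<i> * of_real b)"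
      unfolding M_def tf by (simp add: algebra_simps)
    also have "4 * tracefree_hessian f (Complex x y) = Complex (pdx (pdx f) p - pdy (pdy f) p) (- 2 * pdx (pdy f) p)"
      by (simp add: tracefree_hessian_def xy)
    finally show ?thesis by (simp add: complex_eq_iff A_def B_def C_def)
  qed
  have "norm (4 * M) = norm (Complex (A - C) (2 * B))" unfolding M by (simp add: cmod_def)
  then have nM: "4 * norm M = norm (Complex (A - C) (2 * B))" by (simp add: norm_mult)
  have "A + C = s / sqrt (4 + s\<^sup>2) * norm (Complex (A - C) (2 * B))"
    using tr f(2)[OF p] unfolding A_def C_def nM[unfolded A_def C_def, symmetric] by (simp add: algebra_simps)
  then have main: "A + C = s * sqrt (B\<^sup>2 - A * C)" by (rule tracefree_norm_imp_trace_eq)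
  have Fu: "F q = f q + 1 * u q" if "q \<in> \<Omega>" for q
    using F[of "fst q" "snd q"] cl[of "fst q" "snd q"] subc[OF that] by (simp add: u_def E_def lc)
  have Fc: "pdx F q = pdx (\<lambda>q. f q + 1 * u q) q" "pdy F q = pdy (\<lambda>q. f q + 1 * u q) q" if "q \<in> \<Omega>" for q
    using pd_local_cong[OF \<Omega>(1) that Fu] by auto
  have e: "pdx (pdx F) p = A" "pdy (pdy F) p = C" "pdx (pdy F) p = B"
    using pd_local_cong(1)[OF \<Omega>(1) p Fc(1)] pd_local_cong(2)[OF \<Omega>(1) p Fc(2)] pd_local_cong(1)[OF \<Omega>(1) p Fc(2)]
      pd2_combine[OF f(1)[OF p] smu[OF subc[OF p]], of 1] by (auto simp: A_def B_def C_def a_def b_def d_def)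
  show ?thesis unfolding e by (rule main)
qed

section \<open>Transfer to the Jordan domain\<close>

definition cplx :: "real \<times> real \<Rightarrow> complex" where "cplx p = Complex (fst p) (snd p)"

lemma cplx_simps [simp]: "Re (cplx p) = fst p" "Im (cplx p) = snd p" "cplx (Re z, Im z) = z" "norm (cplx p) = norm p"
  by (simp_all add: cplx_def norm_prod_def cmod_def)

lemma cplx_linear: "linear cplx" "bounded_linear cplx" "inj cplx" "surj cplx"
proof -
  show l: "linear cplx" by (rule linearI) (auto simp: complex_eq_iff)
  then show "bounded_linear cplx" by (simp add: linear_linear)
  show "inj cplx" by (rule injI) (metis cplx_simps(1,2) prod.collapse)
  show "surj cplx" by (rule surjI[of _ "\<lambda>z. (Re z, Im z)"]) simp
qed

lemma open_cplx_image: "open (cplx ` S) \<longleftrightarrow> open S"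
proof
  have c: "continuous_on UNIV cplx" "continuous_on UNIV (\<lambda>z. (Re z, Im z))"
    using linear_continuous_on[OF cplx_linear(2)] by (auto intro!: continuous_intros)
  show "open S" if "open (cplx ` S)"
    using open_vimage[OF that c(1)] inj_vimage_image_eq[OF cplx_linear(3)] by simp
  have "cplx ` S = (\<lambda>z. (Re z, Im z)) -` S"
    by (auto simp: image_iff) (metis cplx_simps(3))
  then show "open (cplx ` S)" if "open S" using open_vimage[OF that c(2)] by simp
qed

lemma bounded_cplx_image: "bounded (cplx ` S) \<longleftrightarrow> bounded S"
  by (simp add: bounded_iff)

lemma closure_cplx: "closure (cplx ` S) = cplx ` closure S"
  using closure_injective_linear_image[OF cplx_linear(1,3)] by simp

lemma frontier_cplx: "open S \<Longrightarrow> frontier (cplx ` S) = cplx ` frontier S"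
  by (simp add: frontier_def interior_open open_cplx_image closure_cplx image_set_diff[OF cplx_linear(3)])

lemma inside_cplx: "inside (cplx ` S) = cplx ` inside S"
proof -
  have cc: "connected_component (- (cplx ` S)) (cplx x) (cplx y) \<longleftrightarrow> connected_component (- S) x y" for x y
  proof
    assume "connected_component (- (cplx ` S)) (cplx x) (cplx y)"
    then obtain T where T: "connected T" "T \<subseteq> - (cplx ` S)" "cplx x \<in> T" "cplx y \<in> T" unfolding connected_component_def by blast
    have "connected ((\<lambda>z. (Re z, Im z)) ` T)" by (intro connected_continuous_image T continuous_intros)
    moreover have "(\<lambda>z. (Re z, Im z)) ` T \<subseteq> - S"
    proof (intro image_subsetI)
      fix z assume "z \<in> T"
      then have "z \<notin> cplx ` S" using T(2) by blast
      then show "(Re z, Im z) \<in> - S" using imageI[of "(Re z, Im z)" S cplx] by auto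
    qed
    moreover have "x \<in> (\<lambda>z. (Re z, Im z)) ` T" "y \<in> (\<lambda>z. (Re z, Im z)) ` T"
      by (rule image_eqI[OF _ T(3)], simp) (rule image_eqI[OF _ T(4)], simp)
    ultimately show "connected_component (- S) x y" unfolding connected_component_def by blast
  next
    assume "connected_component (- S) x y"
    then obtain T where T: "connected T" "T \<subseteq> - S" "x \<in> T" "y \<in> T" unfolding connected_component_def by blast
    have "connected (cplx ` T)" by (intro connected_continuous_image T linear_continuous_on cplx_linear)
    moreover have "cplx ` T \<subseteq> - (cplx ` S)"
    proof (intro image_subsetI)
      fix q assume "q \<in> T"
      then have "q \<notin> S" using T(2) by blast
      then show "cplx q \<in> - (cplx ` S)" using inj_image_mem_iff[OF cplx_linear(3), of q S] by simp
    qed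
    ultimately show "connected_component (- (cplx ` S)) (cplx x) (cplx y)" unfolding connected_component_def using T by blast
  qed
  have "Collect (connected_component (- (cplx ` S)) (cplx x)) = cplx ` Collect (connected_component (- S) x)" for x
  proof (intro equalityI subsetI)
    fix z assume "z \<in> Collect (connected_component (- (cplx ` S)) (cplx x))"
    then have "connected_component (- S) x (Re z, Im z)" using cc[of x "(Re z, Im z)"] by simp
    then show "z \<in> cplx ` Collect (connected_component (- S) x)"
      by (intro image_eqI[of _ _ "(Re z, Im z)"]) auto
  qed (auto simp: cc)
  then have in_iff: "cplx x \<in> inside (cplx ` S) \<longleftrightarrow> x \<in> inside S" for x
    unfolding inside_def using inj_image_mem_iff[OF cplx_linear(3)] by (simp add: bounded_cplx_image)
  show ?thesis
  proof (intro equalityI subsetI)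
    fix z assume z: "z \<in> inside (cplx ` S)"
    then have "(Re z, Im z) \<in> inside S" using in_iff[of "(Re z, Im z)"] by simp
    then show "z \<in> cplx ` inside S" by (intro image_eqI[of _ _ "(Re z, Im z)"]) auto
  qed (use in_iff in auto)
qed

text \<open>The extension is G1 + i G2 with the complexified coordinate functions. Its derivative at
  a real point is the velocity of the curve, which regularity makes nonzero.\<close>

lemma analytic_jordan_curve_extension:
  assumes "analytic_jordan_curve \<gamma> T"
  shows "\<exists>d \<Gamma>. d > 0 \<and> \<Gamma> holomorphic_on ball (of_real s0) d \<and> (\<forall>s. \<bar>s - s0\<bar> < d \<longrightarrow> \<Gamma> (of_real s) = cplx (\<gamma> s)) \<and> deriv \<Gamma> (of_real s0) \<noteq> 0"
proof -
  have ra: "real_analytic_at (\<lambda>s. fst (\<gamma> s)) s0" "real_analytic_at (\<lambda>s. snd (\<gamma> s)) s0"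
    using assms by (auto simp: analytic_jordan_curve_def real_analytic_on_def)
  obtain v where v: "v \<noteq> 0" "(\<gamma> has_vector_derivative v) (at s0)" using assms unfolding analytic_jordan_curve_def by blast
  obtain d1 G1 where G1: "d1 > 0" "G1 holomorphic_on ball (of_real s0) d1" "\<And>s. \<bar>s - s0\<bar> < d1 \<Longrightarrow> G1 (of_real s) = of_real (fst (\<gamma> s))"
    using real_analytic_ext1[OF ra(1)] by blast
  obtain d2 G2 where G2: "d2 > 0" "G2 holomorphic_on ball (of_real s0) d2" "\<And>s. \<bar>s - s0\<bar> < d2 \<Longrightarrow> G2 (of_real s) = of_real (snd (\<gamma> s))"
    using real_analytic_ext1[OF ra(2)] by blast
  define d where "d = min d1 d2"
  define \<Gamma> where "\<Gamma> z = G1 z + \<i> * G2 z" for z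
  have d: "d > 0" using G1 G2 by (simp add: d_def)
  have hol: "\<Gamma> holomorphic_on ball (of_real s0) d" unfolding \<Gamma>_def
    by (intro holomorphic_intros holomorphic_on_subset[OF G1(2)] holomorphic_on_subset[OF G2(2)]) (auto simp: d_def)
  have eq: "\<Gamma> (of_real s) = cplx (\<gamma> s)" if "\<bar>s - s0\<bar> < d" for s
    using G1(3)[of s] G2(3)[of s] that by (simp add: \<Gamma>_def d_def complex_eq_iff)
  have "(\<Gamma> has_field_derivative deriv \<Gamma> (of_real s0)) (at (of_real s0))"
    using hol d by (intro holomorphic_derivI[of _ "ball (of_real s0) d"]) auto
  then have "((\<lambda>s. \<Gamma> (of_real s)) has_vector_derivative deriv \<Gamma> (of_real s0)) (at s0)"
    by (rule has_vector_derivative_real_field)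
  then have "((\<lambda>s. cplx (\<gamma> s)) has_vector_derivative deriv \<Gamma> (of_real s0)) (at s0)"
    by (rule has_vector_derivative_transform_within_open[OF _ open_ball[of s0 d]]) (use d eq in \<open>auto simp: dist_real_def abs_minus_commute\<close>)
  moreover have "((\<lambda>s. cplx (\<gamma> s)) has_vector_derivative cplx v) (at s0)"
    by (rule bounded_linear.has_vector_derivative[OF cplx_linear(2) v(2)])
  ultimately have "deriv \<Gamma> (of_real s0) = cplx v" by (rule vector_derivative_unique_at)
  moreover have "cplx v \<noteq> 0" using v(1) by (metis cplx_simps(4) norm_eq_zero)
  ultimately show ?thesis using d hol eq by (intro exI[of _ d] exI[of _ \<Gamma>]) auto
qed

section \<open>The parameter and the pulled-back potential\<close>

definition trace_param :: "complex \<Rightarrow> complex" where "trace_param s = s / csqrt (4 + s\<^sup>2)"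

lemma trace_param_domain: "norm s < 1 \<Longrightarrow> Re (4 + s\<^sup>2) > 0"
proof -
  assume s: "norm s < 1"
  have "\<bar>Re (s\<^sup>2)\<bar> \<le> norm (s\<^sup>2)" by (rule abs_Re_le_cmod)
  also have "norm (s\<^sup>2) \<le> 1" using s by (simp add: norm_power power_le_one)
  finally show ?thesis by simp
qed

text \<open>For |s| < 1 the number 4 + s^2 has positive real part and so avoids the cut of the
  principal square root.\<close>

lemma trace_param_holomorphic: "trace_param holomorphic_on ball 0 1"
  unfolding trace_param_def
proof (intro holomorphic_intros)
  fix z :: complex assume "z \<in> ball 0 1"
  then have *: "Re (4 + z\<^sup>2) > 0" using trace_param_domain[of z] by simp
  then show "4 + z\<^sup>2 \<notin> \<real>\<^sub>\<le>\<^sub>0" by (auto simp: complex_nonpos_Reals_iff simp del: plus_complex.sel)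
  show "csqrt (4 + z\<^sup>2) \<noteq> 0" using * by (metis csqrt_eq_0 less_irrefl zero_complex.sel(1))
qed

text \<open>Keeps \<tau> inside the disc on which the disc problem is solved when the family
  parameter is in that disc.\<close>

lemma trace_param_norm: assumes s: "norm s < 1" shows "norm (trace_param s) \<le> norm s"
proof -
  have "norm (s\<^sup>2) \<le> 1" using s by (simp add: norm_power power_le_one)
  then have "norm (4 + s\<^sup>2) \<ge> 1" using norm_triangle_ineq2[of 4 "- s\<^sup>2"] by simp
  then have "norm (csqrt (4 + s\<^sup>2)) \<ge> 1" by simp
  then have "norm s / norm (csqrt (4 + s\<^sup>2)) \<le> norm s / 1" by (intro divide_left_mono) auto
  then show ?thesis by (simp add: trace_param_def norm_divide)
qed

lemma trace_param_of_real: "trace_param (of_real s) = of_real (s / sqrt (4 + s\<^sup>2))"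
proof -
  have "csqrt (4 + (complex_of_real s)\<^sup>2) = csqrt (of_real (4 + s\<^sup>2))" by simp
  also have "\<dots> = of_real (sqrt (4 + s\<^sup>2))" by (rule csqrt_of_real) simp
  finally show ?thesis by (simp add: trace_param_def)
qed

text \<open>The disc solution is pulled back by \<kappa> in z and by its reflection in the conjugate
  variable. The mixed derivative only acquires the factor |\<kappa>'|^2, but the second derivative
  in z also acquires the term P \<kappa>''; this is the origin of the first-order term with \<alpha>
  in the disc problem.\<close>

lemma bicomplex_potential:
  assumes V: "open V" "\<kappa> holomorphic_on V" "\<And>z. z \<in> V \<Longrightarrow> \<kappa> z \<in> ball 0 r" and t: "0 < t"
    and U: "hol3 U ((ball 0 r \<times> ball 0 r) \<times> ball 0 t)"
    and P: "\<And>\<zeta> \<eta> \<tau>. \<zeta> \<in> ball 0 r \<Longrightarrow> \<eta> \<in> ball 0 r \<Longrightarrow> \<tau> \<in> ball 0 t \<Longrightarrow> ((\<lambda>\<zeta>. U ((\<zeta>, \<eta>), \<tau>)) has_field_derivative P ((\<zeta>, \<eta>), \<tau>)) (at \<zeta>)"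
    and Q: "\<And>\<zeta> \<eta> \<tau>. \<zeta> \<in> ball 0 r \<Longrightarrow> \<eta> \<in> ball 0 r \<Longrightarrow> \<tau> \<in> ball 0 t \<Longrightarrow> ((\<lambda>\<zeta>. P ((\<zeta>, \<eta>), \<tau>)) has_field_derivative Q ((\<zeta>, \<eta>), \<tau>)) (at \<zeta>)"
    and \<Phi>: "\<And>\<zeta> \<eta> \<tau>. \<zeta> \<in> ball 0 r \<Longrightarrow> \<eta> \<in> ball 0 r \<Longrightarrow> \<tau> \<in> ball 0 t \<Longrightarrow> ((\<lambda>\<eta>. P ((\<zeta>, \<eta>), \<tau>)) has_field_derivative \<Phi> ((\<zeta>, \<eta>), \<tau>)) (at \<eta>)"
  defines "S \<equiv> (V \<times> cnj -` V) \<times> ball 0 (min 1 t)"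
    and "T \<equiv> \<lambda>p. U ((\<kappa> (fst (fst p)), cnj (\<kappa> (cnj (snd (fst p))))), trace_param (snd p))"
  shows "open S" "hol3 T S"
    "\<And>z s. z \<in> V \<Longrightarrow> norm s < min 1 t \<Longrightarrow> D1 (D1 T) ((z, cnj z), s) =
       Q ((\<kappa> z, cnj (\<kappa> z)), trace_param s) * (deriv \<kappa> z)\<^sup>2 + P ((\<kappa> z, cnj (\<kappa> z)), trace_param s) * deriv (deriv \<kappa>) z"
    "\<And>z s. z \<in> V \<Longrightarrow> norm s < min 1 t \<Longrightarrow> D2 (D1 T) ((z, cnj z), s) =
       \<Phi> ((\<kappa> z, cnj (\<kappa> z)), trace_param s) * (deriv \<kappa> z * cnj (deriv \<kappa> z))"
proof -
  have oc: "open (cnj -` V)" by (intro open_vimage V continuous_intros)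
  show oS: "open S" unfolding S_def by (intro open_Times V oc open_ball)
  have tp: "trace_param s \<in> ball 0 t" if "norm s < min 1 t" for s using trace_param_norm[of s] that by simp
  have cc: "cnj (\<kappa> (cnj w)) \<in> ball 0 r" if "cnj w \<in> V" for w using V(3)[OF that] by simp
  have ch: "(\<lambda>w. cnj (\<kappa> (cnj w))) holomorphic_on cnj -` V"
    using holomorphic_on_compose_cnj_cnj[of \<kappa> "cnj -` V"] V(2) oc
    unfolding surj_image_vimage_eq[OF surjI[of cnj cnj, OF complex_cnj_cnj]] by (simp add: o_def)
  show "hol3 T S" unfolding T_def
  proof (rule hol3_compose[OF U])
    show "hol3 (\<lambda>p. \<kappa> (fst (fst p))) S" by (rule hol3_holomorphic[OF V(2,1) hol3_coords(1)]) (auto simp: S_def)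
    show "hol3 (\<lambda>p. cnj (\<kappa> (cnj (snd (fst p))))) S" by (rule hol3_holomorphic[OF ch oc hol3_coords(2)]) (auto simp: S_def)
    show "hol3 (\<lambda>p. trace_param (snd p)) S" by (rule hol3_holomorphic[OF trace_param_holomorphic open_ball hol3_coords(3)]) (auto simp: S_def)
    show "((\<kappa> (fst (fst p)), cnj (\<kappa> (cnj (snd (fst p))))), trace_param (snd p)) \<in> (ball 0 r \<times> ball 0 r) \<times> ball 0 t" if "p \<in> S" for p
    proof -
      have "\<kappa> (fst (fst p)) \<in> ball 0 r" "cnj (\<kappa> (cnj (snd (fst p)))) \<in> ball 0 r" "trace_param (snd p) \<in> ball 0 t"
        using that by (auto simp only: S_def mem_Times_iff vimage_eq mem_ball_0 intro!: V(3)[unfolded mem_ball_0] cc[unfolded mem_ball_0] tp[unfolded mem_ball_0])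
      then show ?thesis by (simp only: mem_Times_iff fst_conv snd_conv simp_thms)
    qed
  qed
  define W where "W p = ((\<kappa> (fst (fst p)), cnj (\<kappa> (cnj (snd (fst p))))), trace_param (snd p))" for p
  have d\<kappa>: "(\<kappa> has_field_derivative deriv \<kappa> z) (at z)" "(deriv \<kappa> has_field_derivative deriv (deriv \<kappa>) z) (at z)" if "z \<in> V" for z
    using that by (auto intro!: holomorphic_derivI[OF V(2,1)] holomorphic_derivI[OF holomorphic_deriv[OF V(2,1)] V(1)])
  have one: "D1 T p = P (W p) * deriv \<kappa> (fst (fst p))" if p: "p \<in> S" for p
  proof -
    obtain z w s where pe: "p = ((z, w), s)" by (metis prod.collapse)
    have m: "z \<in> V" "cnj w \<in> V" "norm s < min 1 t" using p by (auto simp: S_def pe)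
    have "((\<lambda>z. U ((\<kappa> z, cnj (\<kappa> (cnj w))), trace_param s)) has_field_derivative P ((\<kappa> z, cnj (\<kappa> (cnj w))), trace_param s) * deriv \<kappa> z) (at z)"
      by (rule DERIV_chain2[where f = "\<lambda>\<zeta>. U ((\<zeta>, cnj (\<kappa> (cnj w))), trace_param s)", OF P[OF V(3)[OF m(1)] cc[OF m(2)] tp[OF m(3)]] d\<kappa>(1)[OF m(1)]])
    then show ?thesis by (simp add: D1_def T_def W_def pe DERIV_imp_deriv)
  qed
  fix z s :: complex assume z: "z \<in> V" and s: "norm s < min 1 t"
  have pS: "((z, cnj z), s) \<in> S" using z s by (simp add: S_def)
  have cz: "cnj (\<kappa> z) \<in> ball 0 r" using cc[of "cnj z"] z by simp
  let ?w = "((\<kappa> z, cnj (\<kappa> z)), trace_param s)"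
  have "((\<lambda>z'. P ((\<kappa> z', cnj (\<kappa> z)), trace_param s) * deriv \<kappa> z') has_field_derivative
      (Q ?w * deriv \<kappa> z) * deriv \<kappa> z + deriv (deriv \<kappa>) z * P ?w) (at z)"
    by (rule DERIV_mult[OF DERIV_chain2[where f = "\<lambda>\<zeta>. P ((\<zeta>, cnj (\<kappa> z)), trace_param s)", OF Q[OF V(3)[OF z] cz tp[OF s]] d\<kappa>(1)[OF z]] d\<kappa>(2)[OF z]])
  then have "D1 (\<lambda>p. P (W p) * deriv \<kappa> (fst (fst p))) ((z, cnj z), s) = (Q ?w * deriv \<kappa> z) * deriv \<kappa> z + deriv (deriv \<kappa>) z * P ?w"
    by (simp add: D1_def W_def DERIV_imp_deriv)
  then show "D1 (D1 T) ((z, cnj z), s) = Q ?w * (deriv \<kappa> z)\<^sup>2 + P ?w * deriv (deriv \<kappa>) z"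
    using D_cong(1)[OF oS pS one] by (simp add: power2_eq_square mult_ac)
  have "((cnj \<circ> \<kappa> \<circ> cnj) has_field_derivative cnj (deriv \<kappa> z)) (at (cnj z))"
    using has_field_derivative_cnj_cnj[of \<kappa> "deriv \<kappa> z" "cnj z"] d\<kappa>(1)[OF z] by simp
  then have c': "((\<lambda>w. cnj (\<kappa> (cnj w))) has_field_derivative cnj (deriv \<kappa> z)) (at (cnj z))" by (simp add: o_def)
  have \<Phi>': "((\<lambda>\<eta>. P ((\<kappa> z, \<eta>), trace_param s)) has_field_derivative \<Phi> ?w) (at (cnj (\<kappa> (cnj (cnj z)))))"
    using \<Phi>[OF V(3)[OF z] cz tp[OF s]] by simp
  have "((\<lambda>w. P ((\<kappa> z, cnj (\<kappa> (cnj w))), trace_param s) * deriv \<kappa> z) has_field_derivative (\<Phi> ?w * cnj (deriv \<kappa> z)) * deriv \<kappa> z) (at (cnj z))"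
    by (rule DERIV_cmult_right[OF DERIV_chain2[where f = "\<lambda>\<eta>. P ((\<kappa> z, \<eta>), trace_param s)", OF \<Phi>' c']])
  then have "D2 (\<lambda>p. P (W p) * deriv \<kappa> (fst (fst p))) ((z, cnj z), s) = (\<Phi> ?w * cnj (deriv \<kappa> z)) * deriv \<kappa> z"
    by (simp add: D2_def W_def DERIV_imp_deriv)
  then show "D2 (D1 T) ((z, cnj z), s) = \<Phi> ?w * (deriv \<kappa> z * cnj (deriv \<kappa> z))"
    using D_cong(2)[OF oS pS one] by (simp add: mult_ac)
qed

lemma real_analytic_at_bicomplex:
  assumes f: "real_analytic_at f (x0, y0)" and S: "open S" "hol3 T S" "((Complex x0 y0, cnj (Complex x0 y0)), of_real t0) \<in> S"
  shows "real_analytic_at (\<lambda>(p, t). f p + Re (T ((cplx p, cnj (cplx p)), of_real t))) ((x0, y0), t0)"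
proof -
  obtain \<delta> G where \<delta>: "\<delta> > 0" and G: "hol3 G ((ball (of_real x0) \<delta> \<times> ball (of_real y0) \<delta>) \<times> UNIV)"
    and fG: "\<And>x y c. \<bar>x - x0\<bar> < \<delta> \<Longrightarrow> \<bar>y - y0\<bar> < \<delta> \<Longrightarrow> G ((of_real x, of_real y), c) = of_real (f (x, y))"
    using real_analytic_ext2[OF f] by blast
  let ?B = "(ball (complex_of_real x0) \<delta> \<times> ball (complex_of_real y0) \<delta>) \<times> (UNIV :: complex set)"
  note l = hol3_lc[OF S(1,2)]
  have lc: "lc ((of_real x, of_real y), c) = ((Complex x y, cnj (Complex x y)), c)" for x y c
    by (simp add: lc_def complex_eq_iff)
  show ?thesis
  proof (rule hol3_imp_real_analytic_at[of "?B \<inter> lc -` S" "\<lambda>p. G p + T (lc p)"])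
    show "open (?B \<inter> lc -` S)" by (intro open_Int open_Times l) auto
    show "hol3 (\<lambda>p. G p + T (lc p)) (?B \<inter> lc -` S)" by (intro hol3_add hol3_mono[OF G] hol3_mono[OF l(2)]) auto
    show "((complex_of_real x0, complex_of_real y0), complex_of_real t0) \<in> ?B \<inter> lc -` S" using \<delta> S(3) by (simp add: lc)
    fix x y t assume a: "((complex_of_real x, complex_of_real y), complex_of_real t) \<in> ?B \<inter> lc -` S"
    then have "\<bar>x - x0\<bar> < \<delta>" "\<bar>y - y0\<bar> < \<delta>" by (auto simp: dist_norm abs_minus_commute simp flip: of_real_diff)
    then show "(case ((x, y), t) of (p, t) \<Rightarrow> f p + Re (T ((cplx p, cnj (cplx p)), of_real t)))
      = Re (G ((of_real x, of_real y), of_real t) + T (lc ((of_real x, of_real y), of_real t)))"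
      using fG by (simp add: lc cplx_def)
  qed
qed

section \<open>Uniqueness and existence of the family\<close>

lemma solution_family_unique:
  assumes \<Omega>: "open \<Omega>" "bounded \<Omega>" and F: "solution_family \<Omega> f0 F a b" and G: "solution_family \<Omega> f0 G c d"
    and t: "t \<in> {a..b}" "t \<in> {c..d}" "\<bar>t\<bar> < 2" and p: "p \<in> closure \<Omega>"
  shows "F p t \<le> G p t"
proof (rule uniqueness_le[OF \<Omega> t(3), of "\<lambda>q. F q t" "\<lambda>q. G q t", OF _ _ _ _ _ p])
  have sm: "smooth_slice (\<lambda>q. H q t) q" if H: "solution_family \<Omega> f0 H a' b'" "t \<in> {a'..b'}" and q: "q \<in> closure \<Omega>" for H a' b' q
  proof -
    obtain x y where xy: "q = (x, y)" by (cases q)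
    obtain U where U: "closure \<Omega> \<times> {a'..b'} \<subseteq> U" "\<forall>x\<in>U. real_analytic_at (\<lambda>(p, t). H p t) x"
      using H(1) unfolding solution_family_def real_analytic_on_def by blast
    have "((x, y), t) \<in> U" using U(1) H(2) q unfolding xy by blast
    then have "real_analytic_at (\<lambda>(p, t). H p t) ((x, y), t)" by (rule bspec[OF U(2)])
    from real_analytic_at3_smooth_slice[OF this] show ?thesis by (simp add: xy)
  qed
  show "smooth_slice (\<lambda>q. F q t) q" "smooth_slice (\<lambda>q. G q t) q" if "q \<in> closure \<Omega>" for q
    using sm[OF F t(1) that] sm[OF G t(2) that] by auto
qed (use F G t in \<open>auto simp: solution_family_def\<close>)

lemma analytic_jordan_domain_parametrization:
  assumes jc: "analytic_jordan_curve \<gamma> T" and \<Omega>: "\<Omega> = inside (range \<gamma>)"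
  shows "open \<Omega>" "bounded \<Omega>"
    "open V \<Longrightarrow> cplx ` closure \<Omega> \<subseteq> V \<Longrightarrow> \<exists>\<Psi> R. 1 < R \<and> \<Psi> holomorphic_on ball 0 R \<and> inj_on \<Psi> (ball 0 R) \<and> \<Psi> ` ball 0 1 = cplx ` \<Omega> \<and>
      \<Psi> ` sphere 0 1 = cplx ` frontier \<Omega> \<and> \<Psi> ` ball 0 R \<subseteq> V"
proof -
  define g where "g s = cplx (\<gamma> s)" for s
  have rg: "range g = cplx ` range \<gamma>" by (auto simp: g_def)
  have ins: "inside (range g) = cplx ` \<Omega>" unfolding rg inside_cplx \<Omega> ..
  have T: "T > 0" using jc by (simp add: analytic_jordan_curve_def)
  have per: "g (s + T) = g s" for s using jc by (simp add: analytic_jordan_curve_def g_def)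
  have inj: "\<exists>k::int. s - t = of_int k * T" if "g s = g t" for s t
  proof -
    have "\<gamma> s = \<gamma> t" using injD[OF cplx_linear(3)] that by (simp add: g_def)
    then show ?thesis using jc by (simp add: analytic_jordan_curve_def)
  qed
  have \<Gamma>: "\<exists>d \<Gamma>. d > 0 \<and> \<Gamma> holomorphic_on ball (of_real s0) d \<and> (\<forall>s. \<bar>s - s0\<bar> < d \<longrightarrow> \<Gamma> (of_real s) = g s) \<and> deriv \<Gamma> (of_real s0) \<noteq> 0" for s0
    using analytic_jordan_curve_extension[OF jc] by (simp add: g_def)
  have "isCont \<gamma> s" for s
  proof -
    obtain v where "(\<gamma> has_vector_derivative v) (at s)" using jc unfolding analytic_jordan_curve_def by blast
    then show ?thesis by (rule has_vector_derivative_continuous)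
  qed
  then have "continuous_on UNIV \<gamma>" by (simp add: continuous_at_imp_continuous_on)
  then have ct: "continuous_on UNIV g" unfolding g_def
    by (rule continuous_on_compose2[OF linear_continuous_on[OF cplx_linear(2)]]) auto
  note cp = conformal_parametrization[OF T per inj \<Gamma> ct]
  show o: "open \<Omega>" using cp(1)[of UNIV] unfolding ins open_cplx_image by simp
  show "bounded \<Omega>" using cp(2)[of UNIV] unfolding ins bounded_cplx_image by simp
  assume V: "open V" "cplx ` closure \<Omega> \<subseteq> V"
  then show "\<exists>\<Psi> R. 1 < R \<and> \<Psi> holomorphic_on ball 0 R \<and> inj_on \<Psi> (ball 0 R) \<and> \<Psi> ` ball 0 1 = cplx ` \<Omega> \<and>
      \<Psi> ` sphere 0 1 = cplx ` frontier \<Omega> \<and> \<Psi> ` ball 0 R \<subseteq> V"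
    using cp(4)[of V] unfolding ins closure_cplx frontier_cplx[OF o] by simp
qed

text \<open>The set V assembles the local statements at the points of the closure; it is the set in
  which the extended conformal map has to stay, so that \<open>f\<^sub>z\<^sub>z\<close> pulls back
  to a zero-free holomorphic function.\<close>

lemma harmonic_hessian_neighborhood:
  assumes \<Omega>: "open \<Omega>" and f: "real_analytic_on f (closure \<Omega>)"
    and lap: "\<And>p. p \<in> \<Omega> \<Longrightarrow> pdx (pdx f) p + pdy (pdy f) p = 0"
    and hess: "\<And>p. p \<in> closure \<Omega> \<Longrightarrow> pdx (pdx f) p * pdy (pdy f) p - (pdx (pdy f) p)\<^sup>2 \<noteq> 0"
  obtains V where "open V" "cplx ` closure \<Omega> \<subseteq> V" "tracefree_hessian f holomorphic_on V" "\<And>z. z \<in> V \<Longrightarrow> tracefree_hessian f z \<noteq> 0"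
    "\<And>z. z \<in> V \<Longrightarrow> real_analytic_at f (Re z, Im z)" "\<And>p. p \<in> closure \<Omega> \<Longrightarrow> smooth_slice f p"
proof -
  obtain N where N: "open N" "closure \<Omega> \<subseteq> N" "\<And>p. p \<in> N \<Longrightarrow> real_analytic_at f p" using f unfolding real_analytic_on_def by blast
  define K where "K p \<delta> \<longleftrightarrow> \<delta> > 0 \<and> tracefree_hessian f holomorphic_on ball (cplx p) \<delta> \<and>
    (\<forall>z\<in>ball (cplx p) \<delta>. smooth_slice f (Re z, Im z) \<and> pdx (pdx f) (Re z, Im z) + pdy (pdy f) (Re z, Im z) = 0)" for p \<delta>
  have "\<forall>p\<in>closure \<Omega>. \<exists>\<delta>. K p \<delta>"
  proof
    fix p assume p: "p \<in> closure \<Omega>"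
    have "real_analytic_at f (fst p, snd p)" "(fst p, snd p) \<in> closure \<Omega>" using N(3)[OF subsetD[OF N(2) p]] p by simp_all
    from harmonic_hessian_holomorphic[OF this(1) \<Omega> this(2) lap] show "\<exists>\<delta>. K p \<delta>" unfolding K_def cplx_def .
  qed
  from bchoice[OF this] obtain \<delta> where K: "\<forall>p\<in>closure \<Omega>. K p (\<delta> p)" by blast
  have \<delta>: "\<delta> p > 0" "tracefree_hessian f holomorphic_on ball (cplx p) (\<delta> p)"
    "\<And>z. z \<in> ball (cplx p) (\<delta> p) \<Longrightarrow> smooth_slice f (Re z, Im z) \<and> pdx (pdx f) (Re z, Im z) + pdy (pdy f) (Re z, Im z) = 0"
    if "p \<in> closure \<Omega>" for p using bspec[OF K that] unfolding K_def by blast+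
  define B where "B = (\<Union>p\<in>closure \<Omega>. ball (cplx p) (\<delta> p))"
  have oB: "open B" unfolding B_def by auto
  have hB: "tracefree_hessian f holomorphic_on B" unfolding B_def by (rule holomorphic_on_UN_open) (use \<delta>(2) in auto)
  have o1: "open (B \<inter> tracefree_hessian f -` (- {0}))"
    by (rule continuous_open_preimage[OF holomorphic_on_imp_continuous_on[OF hB] oB]) auto
  have o2: "open ((\<lambda>z. (Re z, Im z)) -` N)" by (intro open_vimage N continuous_intros)
  have cl: "smooth_slice f p" "pdx (pdx f) p + pdy (pdy f) p = 0" "cplx p \<in> B" if "p \<in> closure \<Omega>" for p
    using \<delta>(3)[OF that, of "cplx p"] \<delta>(1)[OF that] that by (auto simp: B_def intro!: bexI[of _ p])
  show thesis
  proof (rule that[of "(B \<inter> tracefree_hessian f -` (- {0})) \<inter> (\<lambda>z. (Re z, Im z)) -` N"])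
    show "open ((B \<inter> tracefree_hessian f -` (- {0})) \<inter> (\<lambda>z. (Re z, Im z)) -` N)" by (intro open_Int o1 o2)
    show "cplx ` closure \<Omega> \<subseteq> (B \<inter> tracefree_hessian f -` (- {0})) \<inter> (\<lambda>z. (Re z, Im z)) -` N"
    proof (intro image_subsetI)
      fix p assume p: "p \<in> closure \<Omega>"
      \<comment> \<open>For a harmonic function a zero of \<open>f\<^sub>z\<^sub>z\<close> makes all
        second derivatives vanish, and with them the Hessian determinant.\<close>
      have "tracefree_hessian f (cplx p) \<noteq> 0"
      proof
        assume "tracefree_hessian f (cplx p) = 0"
        then have "pdx (pdx f) p = pdy (pdy f) p" "pdx (pdy f) p = 0" by (auto simp: tracefree_hessian_def complex_eq_iff)
        then show False using cl(2)[OF p] hess[OF p] by simp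
      qed
      then show "cplx p \<in> (B \<inter> tracefree_hessian f -` (- {0})) \<inter> (\<lambda>z. (Re z, Im z)) -` N"
        using cl(3)[OF p] p N(2) by auto
    qed
    show "tracefree_hessian f holomorphic_on (B \<inter> tracefree_hessian f -` (- {0})) \<inter> (\<lambda>z. (Re z, Im z)) -` N"
      by (rule holomorphic_on_subset[OF hB]) auto
  qed (use N(3) cl(1) in auto)
qed

lemma solution_family_exists:
  assumes jc: "analytic_jordan_curve \<gamma> T" and \<Omega>: "\<Omega> = inside (range \<gamma>)" and f: "real_analytic_on f (closure \<Omega>)"
    and lap: "\<And>p. p \<in> \<Omega> \<Longrightarrow> pdx (pdx f) p + pdy (pdy f) p = 0"
    and hess: "\<And>p. p \<in> closure \<Omega> \<Longrightarrow> pdx (pdx f) p * pdy (pdy f) p - (pdx (pdy f) p)\<^sup>2 \<noteq> 0"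
  shows "\<exists>F. \<exists>e>0. solution_family \<Omega> f F (- e) e"
proof -
  note \<Omega>' = analytic_jordan_domain_parametrization(1,2)[OF jc \<Omega>]
  obtain V where V: "open V" "cplx ` closure \<Omega> \<subseteq> V" "tracefree_hessian f holomorphic_on V" "\<And>z. z \<in> V \<Longrightarrow> tracefree_hessian f z \<noteq> 0"
    "\<And>z. z \<in> V \<Longrightarrow> real_analytic_at f (Re z, Im z)" and sm: "\<And>p. p \<in> closure \<Omega> \<Longrightarrow> smooth_slice f p"
    by (rule harmonic_hessian_neighborhood[OF \<Omega>'(1) f lap hess]; (assumption | (rule that; assumption)))
  obtain \<Psi> R where \<Psi>: "1 < R" "\<Psi> holomorphic_on ball 0 R" "inj_on \<Psi> (ball 0 R)" "\<Psi> ` ball 0 1 = cplx ` \<Omega>"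
    "\<Psi> ` sphere 0 1 = cplx ` frontier \<Omega>" "\<Psi> ` ball 0 R \<subseteq> V"
    using analytic_jordan_domain_parametrization(3)[OF jc \<Omega> V(1,2)] by (elim exE conjE) (rule that; assumption)
  obtain \<kappa> where \<kappa>: "\<kappa> holomorphic_on \<Psi> ` ball 0 R" "\<And>z. z \<in> ball 0 R \<Longrightarrow> deriv \<Psi> z * deriv \<kappa> (\<Psi> z) = 1" "\<And>z. z \<in> ball 0 R \<Longrightarrow> \<kappa> (\<Psi> z) = z"
    by (rule holomorphic_has_inverse[OF \<Psi>(2) open_ball \<Psi>(3)]) (rule that; assumption)
  have oR: "open (\<Psi> ` ball 0 R)" by (rule open_mapping_thm3[OF \<Psi>(2) open_ball \<Psi>(3)])
  have \<kappa>'0: "deriv \<kappa> (\<Psi> z) \<noteq> 0" if "z \<in> ball 0 R" for z using \<kappa>(2)[OF that] by auto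
  \<comment> \<open>Dividing \<open>f\<^sub>z\<^sub>z\<close> + Q \<kappa>'^2 + P \<kappa>'' by
    \<kappa>'^2 must give H + Q - \<alpha> P, which dictates both H and \<alpha>. All derivatives of
    \<kappa> are taken at the image point under \<Psi>.\<close>
  define H where "H \<zeta> = tracefree_hessian f (\<Psi> \<zeta>) / (deriv \<kappa> (\<Psi> \<zeta>))\<^sup>2" for \<zeta>
  define \<alpha> where "\<alpha> \<zeta> = - deriv (deriv \<kappa>) (\<Psi> \<zeta>) / (deriv \<kappa> (\<Psi> \<zeta>))\<^sup>2" for \<zeta>
  have co: "(\<lambda>\<zeta>. h (\<Psi> \<zeta>)) holomorphic_on ball 0 R" if "h holomorphic_on \<Psi> ` ball 0 R" for h
    using holomorphic_on_compose[OF \<Psi>(2) that] by (simp add: o_def)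
  note d1 = holomorphic_deriv[OF \<kappa>(1) oR]
  note d2 = holomorphic_deriv[OF d1 oR]
  have H: "H holomorphic_on ball 0 R" unfolding H_def
    by (intro holomorphic_intros co holomorphic_on_subset[OF V(3)] \<Psi>(6) d1) (use \<kappa>'0 in auto)
  have \<alpha>: "\<alpha> holomorphic_on ball 0 R" unfolding \<alpha>_def
    by (intro holomorphic_intros co d1 d2) (use \<kappa>'0 in auto)
  have H0: "H z \<noteq> 0" if "z \<in> ball 0 R" for z
    using V(4)[OF subsetD[OF \<Psi>(6) imageI[OF that]]] \<kappa>'0[OF that] by (simp add: H_def)
  obtain r t U P Q \<Phi> where r: "1 < r" "r < R" "0 < t"
    and U: "hol3 U ((ball 0 r \<times> ball 0 r) \<times> ball 0 t)"
    and P: "\<And>\<zeta> \<eta> \<tau>. \<zeta> \<in> ball 0 r \<Longrightarrow> \<eta> \<in> ball 0 r \<Longrightarrow> \<tau> \<in> ball 0 t \<Longrightarrow> ((\<lambda>\<zeta>. U ((\<zeta>, \<eta>), \<tau>)) has_field_derivative P ((\<zeta>, \<eta>), \<tau>)) (at \<zeta>)"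
    and Q: "\<And>\<zeta> \<eta> \<tau>. \<zeta> \<in> ball 0 r \<Longrightarrow> \<eta> \<in> ball 0 r \<Longrightarrow> \<tau> \<in> ball 0 t \<Longrightarrow> ((\<lambda>\<zeta>. P ((\<zeta>, \<eta>), \<tau>)) has_field_derivative Q ((\<zeta>, \<eta>), \<tau>)) (at \<zeta>)"
    and \<Phi>: "\<And>\<zeta> \<eta> \<tau>. \<zeta> \<in> ball 0 r \<Longrightarrow> \<eta> \<in> ball 0 r \<Longrightarrow> \<tau> \<in> ball 0 t \<Longrightarrow> ((\<lambda>\<eta>. P ((\<zeta>, \<eta>), \<tau>)) has_field_derivative \<Phi> ((\<zeta>, \<eta>), \<tau>)) (at \<eta>)"
    and U0: "\<And>\<zeta> \<eta> \<tau>. \<zeta> * \<eta> = 1 \<Longrightarrow> U ((\<zeta>, \<eta>), \<tau>) = 0" "\<And>\<zeta> \<eta>. \<zeta> \<in> ball 0 r \<Longrightarrow> \<eta> \<in> ball 0 r \<Longrightarrow> U ((\<zeta>, \<eta>), 0) = 0"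
    and eq: "\<And>\<zeta> \<tau>. \<zeta> \<in> ball 0 r \<Longrightarrow> \<bar>\<tau>\<bar> < t \<Longrightarrow> \<Phi> ((\<zeta>, cnj \<zeta>), of_real \<tau>) =
       of_real (\<tau> * norm (H \<zeta> + Q ((\<zeta>, cnj \<zeta>), of_real \<tau>) - \<alpha> \<zeta> * P ((\<zeta>, cnj \<zeta>), of_real \<tau>)))"
    by (rule disc_solution[OF \<Psi>(1) H H0 \<alpha>]; (assumption | (rule that; assumption)))
  define Vr where "Vr = \<Psi> ` ball 0 r"
  have sub: "ball 0 r \<subseteq> ball (0::complex) R" using r by auto
  have VrR: "Vr \<subseteq> \<Psi> ` ball 0 R" using sub by (auto simp: Vr_def)
  have oV: "open Vr" unfolding Vr_def
    by (rule open_mapping_thm3[OF holomorphic_on_subset[OF \<Psi>(2) sub] open_ball inj_on_subset[OF \<Psi>(3) sub]])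
  have \<kappa>V: "\<kappa> holomorphic_on Vr" by (rule holomorphic_on_subset[OF \<kappa>(1) VrR])
  have \<kappa>r: "\<kappa> z \<in> ball 0 r" if "z \<in> Vr" for z
  proof -
    obtain w where w: "w \<in> ball 0 r" "z = \<Psi> w" using \<open>z \<in> Vr\<close> unfolding Vr_def by blast
    then show ?thesis using \<kappa>(3)[OF subsetD[OF sub w(1)]] by simp
  qed
  have \<Psi>\<kappa>: "\<Psi> (\<kappa> z) = z" if "z \<in> Vr" for z
  proof -
    obtain w where w: "w \<in> ball 0 r" "z = \<Psi> w" using \<open>z \<in> Vr\<close> unfolding Vr_def by blast
    then show ?thesis using \<kappa>(3)[OF subsetD[OF sub w(1)]] by simp
  qed
  \<comment> \<open>The bound 1 keeps the family parameter in the disc on which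
    \<open>trace_param\<close> is holomorphic.\<close>
  define t' where "t' = min 1 t"
  define S where "S = (Vr \<times> cnj -` Vr) \<times> ball (0::complex) t'"
  define W where "W = (\<lambda>p. U ((\<kappa> (fst (fst p)), cnj (\<kappa> (cnj (snd (fst p))))), trace_param (snd p)))"
  have bp: "open S" "hol3 W S"
    unfolding S_def W_def t'_def
    by (rule bicomplex_potential(1)[OF oV \<kappa>V \<kappa>r r(3) U P Q \<Phi>]; assumption) (rule bicomplex_potential(2)[OF oV \<kappa>V \<kappa>r r(3) U P Q \<Phi>]; assumption)
  have W11: "D1 (D1 W) ((z, cnj z), s) = Q ((\<kappa> z, cnj (\<kappa> z)), trace_param s) * (deriv \<kappa> z)\<^sup>2 + P ((\<kappa> z, cnj (\<kappa> z)), trace_param s) * deriv (deriv \<kappa>) z"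
    if "z \<in> Vr" "norm s < t'" for z s
    unfolding W_def by (rule bicomplex_potential(3)[OF oV \<kappa>V \<kappa>r r(3) U P Q \<Phi>]; (assumption | rule that(1) | rule that(2)[unfolded t'_def]))
  have W12: "D2 (D1 W) ((z, cnj z), s) = \<Phi> ((\<kappa> z, cnj (\<kappa> z)), trace_param s) * (deriv \<kappa> z * cnj (deriv \<kappa> z))"
    if "z \<in> Vr" "norm s < t'" for z s
    unfolding W_def by (rule bicomplex_potential(4)[OF oV \<kappa>V \<kappa>r r(3) U P Q \<Phi>]; (assumption | rule that(1) | rule that(2)[unfolded t'_def]))
  have t': "0 < t'" using r by (simp add: t'_def)
  have frV: "z \<in> Vr" "z \<in> V" if z: "z \<in> cplx ` closure \<Omega>" for z
  proof -
    have "cplx ` closure \<Omega> = cplx ` \<Omega> \<union> cplx ` frontier \<Omega>" unfolding closure_Un_frontier image_Un ..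
    also have "\<dots> = \<Psi> ` (ball 0 1 \<union> sphere 0 1)" unfolding \<Psi>(4,5)[symmetric] image_Un ..
    also have "\<dots> \<subseteq> Vr" unfolding Vr_def using r(1) by (intro image_mono) auto
    finally show "z \<in> Vr" using z by blast
    show "z \<in> V" using V(2) z by blast
  qed
  define F where "F = (\<lambda>p s. f p + Re (W ((cplx p, cnj (cplx p)), of_real s)))"
  have cpl: "cplx (x, y) = Complex x y" for x y by (simp add: cplx_def)
  have sm': "smooth_slice f p" if "p \<in> \<Omega>" for p using sm that closure_subset by blast
  have inS: "((z, cnj z), of_real s) \<in> S" if "z \<in> Vr" "\<bar>s\<bar> < t'" for z s using that by (simp add: S_def)
  have pde: "pdx (pdx (\<lambda>q. F q s)) p + pdy (pdy (\<lambda>q. F q s)) p =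
        s * sqrt ((pdx (pdy (\<lambda>q. F q s)) p)\<^sup>2 - pdx (pdx (\<lambda>q. F q s)) p * pdy (pdy (\<lambda>q. F q s)) p)"
    if s: "\<bar>s\<bar> < t'" and p: "p \<in> \<Omega>" for s p
  proof (rule solution_from_bicomplex[OF \<Omega>' bp(1,2), of "of_real s", OF _ _ sm' lap _ _ p])
    fix x y assume xy: "(x, y) \<in> closure \<Omega>"
    then have "Complex x y \<in> Vr" using frV(1)[OF imageI[OF xy, of cplx]] by (simp only: cpl)
    then show "((Complex x y, cnj (Complex x y)), of_real s) \<in> S" using inS s by blast
  next
    fix x y assume xy: "(x, y) \<in> frontier \<Omega>"
    have "Complex x y \<in> cplx ` frontier \<Omega>" using imageI[OF xy, of cplx] by (simp only: cpl)
    then obtain w where w: "w \<in> sphere 0 1" "Complex x y = \<Psi> w" unfolding \<Psi>(5)[symmetric] by blast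
    have wR: "w \<in> ball 0 R" using w(1) \<Psi>(1) by simp
    have "\<kappa> (Complex x y) = w" unfolding w(2) by (rule \<kappa>(3)[OF wR])
    moreover have "w * cnj w = 1" using w(1) by (simp add: complex_norm_square[symmetric])
    ultimately show "W ((Complex x y, cnj (Complex x y)), of_real s) = 0" unfolding W_def by (intro U0(1)) simp
  next
    fix x y assume xy: "(x, y) \<in> \<Omega>"
    define z where "z = Complex x y"
    have "z \<in> cplx ` closure \<Omega>"
      using imageI[OF subsetD[OF closure_subset xy], of cplx] by (simp only: cpl z_def)
    then have z: "z \<in> Vr" by (rule frV(1))
    define \<tau> where "\<tau> = s / sqrt (4 + s\<^sup>2)"
    have ns: "norm (complex_of_real s) < t'" using s by simp
    have tp: "trace_param (of_real s) = of_real \<tau>" by (simp only: trace_param_of_real \<tau>_def)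
    have "norm (trace_param (of_real s)) \<le> norm (complex_of_real s)" by (rule trace_param_norm) (use s in \<open>simp add: t'_def\<close>)
    then have "\<bar>\<tau>\<bar> \<le> \<bar>s\<bar>" unfolding tp norm_of_real .
    then have \<tau>: "\<bar>\<tau>\<bar> < t" using s by (simp add: t'_def)
    let ?w = "((\<kappa> z, cnj (\<kappa> z)), complex_of_real \<tau>)"
    have d0: "deriv \<kappa> z \<noteq> 0" using \<kappa>'0[of "\<kappa> z"] \<kappa>r[OF z] sub \<Psi>\<kappa>[OF z] by auto
    have "tracefree_hessian f z + D1 (D1 W) ((z, cnj z), of_real s) = (H (\<kappa> z) + Q ?w - \<alpha> (\<kappa> z) * P ?w) * (deriv \<kappa> z)\<^sup>2"
      unfolding W11[OF z ns] tp H_def \<alpha>_def \<Psi>\<kappa>[OF z] using d0 by (simp add: field_simps)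
    then have n: "norm (tracefree_hessian f z + D1 (D1 W) ((z, cnj z), of_real s)) = norm (H (\<kappa> z) + Q ?w - \<alpha> (\<kappa> z) * P ?w) * (norm (deriv \<kappa> z))\<^sup>2"
      by (simp add: norm_mult norm_power)
    \<comment> \<open>The mixed derivative carries \<kappa>' times its conjugate and the norm
      carries |\<kappa>'^2|; these agree, so the conformal factor cancels and the equation is
      transported to \<Omega>.\<close>
    have "D2 (D1 W) ((z, cnj z), of_real s) = of_real (\<tau> * norm (H (\<kappa> z) + Q ?w - \<alpha> (\<kappa> z) * P ?w)) * of_real ((norm (deriv \<kappa> z))\<^sup>2)"
      unfolding W12[OF z ns] tp eq[OF \<kappa>r[OF z] \<tau>] by (simp only: complex_norm_square)
    also have "\<dots> = of_real (\<tau> * norm (tracefree_hessian f z + D1 (D1 W) ((z, cnj z), of_real s)))"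
      unfolding n of_real_mult by (simp only: mult.assoc)
    finally show "D2 (D1 W) ((Complex x y, cnj (Complex x y)), of_real s) =
      of_real (s / sqrt (4 + s\<^sup>2) * norm (tracefree_hessian f (Complex x y) + D1 (D1 W) ((Complex x y, cnj (Complex x y)), of_real s)))"
      unfolding z_def \<tau>_def .
  next
    show "F (x, y) s = f (x, y) + Re (W ((Complex x y, cnj (Complex x y)), of_real s))" for x y by (simp add: F_def cplx_def)
  qed
  \<comment> \<open>Half of \<open>t'\<close> places the closed parameter interval inside the open
    range where the equation and analyticity are known.\<close>
  have "solution_family \<Omega> f F (- (t' / 2)) (t' / 2)" unfolding solution_family_def
  proof (intro conjI ballI)
    show "real_analytic_on (\<lambda>(p, t). F p t) (closure \<Omega> \<times> {- (t' / 2)..t' / 2})" unfolding real_analytic_on_def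
    proof (intro exI conjI ballI)
      let ?N = "(cplx -` (Vr \<inter> V)) \<times> ball (0::real) t'"
      show "open ?N" by (intro open_Times open_vimage open_Int oV V(1) open_ball linear_continuous_on cplx_linear)
      show "closure \<Omega> \<times> {- (t' / 2)..t' / 2} \<subseteq> ?N" using frV[OF imageI] t' by (auto simp: dist_real_def)
      fix q assume q: "q \<in> ?N"
      obtain x y s where qe: "q = ((x, y), s)" by (metis prod.collapse)
      have m: "Complex x y \<in> Vr" "Complex x y \<in> V" "\<bar>s\<bar> < t'" using q by (auto simp: qe cplx_def)
      have "real_analytic_at (\<lambda>(p, t). f p + Re (W ((cplx p, cnj (cplx p)), of_real t))) ((x, y), s)"
        by (rule real_analytic_at_bicomplex[OF _ bp(1,2) inS[OF m(1,3)]]) (use V(5)[OF m(2)] in simp)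
      then show "real_analytic_at (\<lambda>(p, t). F p t) q" by (simp add: F_def qe)
    qed
  next
    fix p s assume p: "p \<in> frontier \<Omega>"
    then have "cplx p \<in> \<Psi> ` sphere 0 1" unfolding \<Psi>(5) by blast
    then obtain w where w: "w \<in> sphere 0 1" "cplx p = \<Psi> w" by blast
    have wR: "w \<in> ball 0 R" using w(1) \<Psi>(1) by simp
    have "\<kappa> (cplx p) = w" unfolding w(2) by (rule \<kappa>(3)[OF wR])
    moreover have "w * cnj w = 1" using w(1) by (simp add: complex_norm_square[symmetric])
    ultimately have "W ((cplx p, cnj (cplx p)), of_real s) = 0" unfolding W_def by (intro U0(1)) simp
    then show "F p s = f p" by (simp add: F_def)
  next
    fix p assume "p \<in> closure \<Omega>"
    then have z: "cplx p \<in> Vr" using frV(1) by blast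
    have "cnj (\<kappa> (cplx p)) \<in> ball 0 r" using \<kappa>r[OF z] by simp
    then have "W ((cplx p, cnj (cplx p)), of_real 0) = 0" using U0(2)[OF \<kappa>r[OF z]] by (simp add: W_def trace_param_def)
    then show "F p 0 = f p" by (simp add: F_def)
  next
    fix p s assume "p \<in> \<Omega>" "s \<in> {- (t' / 2)..t' / 2}"
    then show "pdx (pdx (\<lambda>q. F q s)) p + pdy (pdy (\<lambda>q. F q s)) p =
        s * sqrt ((pdx (pdy (\<lambda>q. F q s)) p)\<^sup>2 - pdx (pdx (\<lambda>q. F q s)) p * pdy (pdy (\<lambda>q. F q s)) p)"
      using t' by (intro pde) auto
  qed
  then show ?thesis using t' by (intro exI[of _ F] exI[of _ "t' / 2"]) auto
qed

theorem theorem2: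
  fixes \<Omega> :: "(real \<times> real) set" and f0 :: "real \<times> real \<Rightarrow> real"
  assumes "analytic_jordan_domain \<Omega>"
    and "real_analytic_on f0 (closure \<Omega>)"
    and "\<forall>p\<in>\<Omega>. pdx (pdx f0) p + pdy (pdy f0) p = 0"
    and "\<forall>p\<in>closure \<Omega>. pdx (pdx f0) p * pdy (pdy f0) p - (pdx (pdy f0) p)\<^sup>2 \<noteq> 0"
  shows "\<exists>a b F. a < 0 \<and> 0 < b \<and> solution_family \<Omega> f0 F a b \<and>
           (\<forall>c d G. c < 0 \<and> 0 < d \<and> solution_family \<Omega> f0 G c d \<longrightarrow>
              (\<exists>e>0. \<forall>p\<in>closure \<Omega>. \<forall>t\<in>{-e..e}. G p t = F p t))"
proof -
  obtain \<gamma> T where jc: "analytic_jordan_curve \<gamma> T" "\<Omega> = inside (range \<gamma>)"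
    using assms(1) unfolding analytic_jordan_domain_def by blast
  note \<Omega> = analytic_jordan_domain_parametrization(1,2)[OF jc]
  have "\<exists>F. \<exists>e>0. solution_family \<Omega> f0 F (- e) e"
    by (rule solution_family_exists[OF jc assms(2)]) (use assms(3,4) in blast)+
  then obtain F \<epsilon> where \<epsilon>: "\<epsilon> > 0" and F: "solution_family \<Omega> f0 F (- \<epsilon>) \<epsilon>"
    by (elim exE conjE) (rule that; assumption)
  show ?thesis
  proof (intro exI conjI allI impI)
    show "- \<epsilon> < 0" "0 < \<epsilon>" using \<epsilon> by auto
    show "solution_family \<Omega> f0 F (- \<epsilon>) \<epsilon>" by fact
    fix c d G assume "c < 0 \<and> 0 < d \<and> solution_family \<Omega> f0 G c d"
    then have cd: "c < 0" "0 < d" and G: "solution_family \<Omega> f0 G c d" by auto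
    \<comment> \<open>The entry 1 ensures |t| < 2, the range of the comparison; the others put t in
      both parameter intervals.\<close>
    define e where "e = min (min \<epsilon> 1) (min (- c) d)"
    show "0 < e" using cd \<epsilon> by (simp add: e_def)
    show "\<forall>p\<in>closure \<Omega>. \<forall>t\<in>{-e..e}. G p t = F p t"
    proof (intro ballI)
      fix p t assume p: "p \<in> closure \<Omega>" and "t \<in> {-e..e}"
      then have t: "t \<in> {- \<epsilon>..\<epsilon>}" "t \<in> {c..d}" "\<bar>t\<bar> < 2" by (auto simp: e_def)
      show "G p t = F p t"
        by (rule antisym[OF solution_family_unique[OF \<Omega> G F t(2,1,3) p] solution_family_unique[OF \<Omega> F G t p]])
    qed
  qed
qed

end
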